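(* Let $X$ be an infinite dimensional complex Banach space, let $T\in B(X)$, and suppose that $T$ or its adjoint $T^{*}\in B(X^{*})$ has the single valued extension property (SVEP). Then $$\sigma_{ea}(f(T))=f(\sigma_{ea}(T))\quad\text{for every } f\in H(\sigma(T)).$$
   Context: $B(X)$ is the algebra of bounded linear operators on $X$; $X^*$ is the dual space of $X$; $N(T)$ and $R(T)$ denote the null space and range of $T$; $\alpha(T):=\dim N(T)$, $\beta(T):=\dim X/R(T)$; $\sigma(T)$ is the spectrum of $T$. Let $\Phi_{+}(X)$ be the set of $T\in B(X)$ with $R(T)$ closed and $\alpha(T)<\infty$; for such $T$ the index is $i(T)=\alpha(T)-\beta(T)\in\mathbb{Z}\cup\{-\infty\}$. Let $\Phi_{+}^{-}(X):=\{T\in\Phi_+(X): i(T)\le 0\}$. The essential approximate point spectrum is $\sigma_{ea}(T):=\{\lambda\in\mathbb{C}:T-\lambda\notin\Phi_{+}^{-}(X)\}$. An operator $T$ on a Banach space $X$ has SVEP if for every open set $U\subseteq\mathbb{C}$ the only analytic function $f:U\to X$ with $(T-\lambda)f(\lambda)=0$ for all $\lambda\in U$ is the zero function. $H(\sigma(T))$ is the space of functions analytic in an open neighborhood of $\sigma(T)$, and $f(T)$ is defined by the holomorphic functional calculus. *)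

theory Defs
  imports "HOL-Complex_Analysis.Complex_Analysis"
begin

class complex_normed_vector = real_normed_vector +
  fixes scaleC :: "complex \<Rightarrow> 'a \<Rightarrow> 'a" (infixr \<open>*\<^sub>C\<close> 75)
  assumes scaleC_add_right: "a *\<^sub>C (x + y) = a *\<^sub>C x + a *\<^sub>C y"
    and scaleC_add_left: "(a + b) *\<^sub>C x = a *\<^sub>C x + b *\<^sub>C x"
    and scaleC_scaleC: "a *\<^sub>C b *\<^sub>C x = (a * b) *\<^sub>C x"
    and scaleC_of_real: "complex_of_real r *\<^sub>C x = r *\<^sub>R x"
    and norm_scaleC: "norm (a *\<^sub>C x) = cmod a * norm x"

class complex_banach = complex_normed_vector + complete_space
begin
subclass banach ..
end

lemma scaleC_one [simp]: "1 *\<^sub>C x = (x :: 'a::complex_normed_vector)"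
  using scaleC_of_real[of 1 x] by simp

interpretation complex_vector:
  vector_space "scaleC :: complex \<Rightarrow> 'a \<Rightarrow> 'a::complex_normed_vector"
  by unfold_locales (simp_all add: scaleC_add_right scaleC_add_left scaleC_scaleC)

lemma bounded_linear_scaleC_right:
  "bounded_linear (\<lambda>x :: 'a::complex_normed_vector. c *\<^sub>C x)"
proof (rule bounded_linear_intro[where K = "cmod c"])
  fix r and x :: 'a
  show "c *\<^sub>C (r *\<^sub>R x) = r *\<^sub>R (c *\<^sub>C x)"
    by (simp add: scaleC_of_real[symmetric] scaleC_scaleC mult.commute)
qed (simp_all add: scaleC_add_right norm_scaleC mult.commute)

instantiation complex :: complex_banach
begin

definition scaleC_complex :: "complex \<Rightarrow> complex \<Rightarrow> complex"
  where "scaleC_complex a x = a * x"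

instance
  by standard (simp_all add: scaleC_complex_def algebra_simps norm_mult scaleR_conv_of_real)

end

typedef (overloaded) ('a, 'b) cblinfun (\<open>(_ \<Rightarrow>\<^sub>C\<^sub>L /_)\<close> [22, 21] 21) =
  "{f :: 'a::complex_normed_vector \<Rightarrow> 'b::complex_normed_vector.
      bounded_linear f \<and> (\<forall>c x. f (c *\<^sub>C x) = c *\<^sub>C f x)}"
  morphisms cblinfun_apply Cblinfun
  by (rule exI[of _ "\<lambda>_. 0"]) (simp add: bounded_linear_zero)

declare [[coercion "cblinfun_apply :: ('a::complex_normed_vector \<Rightarrow>\<^sub>C\<^sub>L 'b::complex_normed_vector) \<Rightarrow> 'a \<Rightarrow> 'b"]]

setup_lifting type_definition_cblinfun

lemma cblinfun_eqI: "(\<And>x. cblinfun_apply f x = cblinfun_apply g x) \<Longrightarrow> f = g"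
  by transfer auto

instantiation cblinfun :: (complex_normed_vector, complex_normed_vector) complex_normed_vector
begin

lift_definition norm_cblinfun :: "('a \<Rightarrow>\<^sub>C\<^sub>L 'b) \<Rightarrow> real" is onorm .

lift_definition uminus_cblinfun :: "('a \<Rightarrow>\<^sub>C\<^sub>L 'b) \<Rightarrow> ('a \<Rightarrow>\<^sub>C\<^sub>L 'b)" is "\<lambda>f x. - f x"
  by (simp add: bounded_linear_minus)

lift_definition zero_cblinfun :: "'a \<Rightarrow>\<^sub>C\<^sub>L 'b" is "\<lambda>x. 0"
  by (simp add: bounded_linear_zero)

lift_definition plus_cblinfun :: "('a \<Rightarrow>\<^sub>C\<^sub>L 'b) \<Rightarrow> ('a \<Rightarrow>\<^sub>C\<^sub>L 'b) \<Rightarrow> ('a \<Rightarrow>\<^sub>C\<^sub>L 'b)"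
  is "\<lambda>f g x. f x + g x"
  by (simp add: bounded_linear_add scaleC_add_right)

lift_definition minus_cblinfun :: "('a \<Rightarrow>\<^sub>C\<^sub>L 'b) \<Rightarrow> ('a \<Rightarrow>\<^sub>C\<^sub>L 'b) \<Rightarrow> ('a \<Rightarrow>\<^sub>C\<^sub>L 'b)"
  is "\<lambda>f g x. f x - g x"
  by (simp add: bounded_linear_sub complex_vector.scale_right_diff_distrib)

lift_definition scaleC_cblinfun :: "complex \<Rightarrow> ('a \<Rightarrow>\<^sub>C\<^sub>L 'b) \<Rightarrow> ('a \<Rightarrow>\<^sub>C\<^sub>L 'b)"
  is "\<lambda>c f x. c *\<^sub>C f x"
  by (auto simp: scaleC_scaleC mult.commute
      intro: bounded_linear_compose[OF bounded_linear_scaleC_right])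

definition scaleR_cblinfun :: "real \<Rightarrow> ('a \<Rightarrow>\<^sub>C\<^sub>L 'b) \<Rightarrow> ('a \<Rightarrow>\<^sub>C\<^sub>L 'b)"
  where "scaleR_cblinfun r f = complex_of_real r *\<^sub>C f"

definition dist_cblinfun :: "('a \<Rightarrow>\<^sub>C\<^sub>L 'b) \<Rightarrow> ('a \<Rightarrow>\<^sub>C\<^sub>L 'b) \<Rightarrow> real"
  where "dist_cblinfun a b = norm (a - b)"

definition [code del]:
  "(uniformity :: (('a \<Rightarrow>\<^sub>C\<^sub>L 'b) \<times> ('a \<Rightarrow>\<^sub>C\<^sub>L 'b)) filter) =
    (INF e\<in>{0 <..}. principal {(x, y). dist x y < e})"

definition open_cblinfun :: "('a \<Rightarrow>\<^sub>C\<^sub>L 'b) set \<Rightarrow> bool"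
  where [code del]: "open_cblinfun S = (\<forall>x\<in>S. \<forall>\<^sub>F (x', y) in uniformity. x' = x \<longrightarrow> y \<in> S)"

definition sgn_cblinfun :: "('a \<Rightarrow>\<^sub>C\<^sub>L 'b) \<Rightarrow> ('a \<Rightarrow>\<^sub>C\<^sub>L 'b)"
  where "sgn_cblinfun x = scaleR (inverse (norm x)) x"

instance
proof
  have onorm_scaleC: "onorm (\<lambda>x. c *\<^sub>C f x) = cmod c * onorm f"
    if f: "bounded_linear f" for c and f :: "'a \<Rightarrow> 'b"
  proof (rule antisym)
    have *: "onorm (\<lambda>x. c *\<^sub>C g x) \<le> cmod c * onorm g"
      if "bounded_linear g" for c and g :: "'a \<Rightarrow> 'b"
      using onorm[OF that] onorm_pos_le[OF that]
      by (intro onorm_bound) (auto simp: norm_scaleC mult.assoc intro!: mult_left_mono)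
    show "onorm (\<lambda>x. c *\<^sub>C f x) \<le> cmod c * onorm f"
      by (rule *[OF f])
    show "cmod c * onorm f \<le> onorm (\<lambda>x. c *\<^sub>C f x)"
    proof (cases "c = 0")
      case True
      then show ?thesis
        by (simp add: onorm_zero)
    next
      case False
      have "onorm f = onorm (\<lambda>x. inverse c *\<^sub>C c *\<^sub>C f x)"
        using False by (simp add: scaleC_scaleC)
      also have "\<dots> \<le> cmod (inverse c) * onorm (\<lambda>x. c *\<^sub>C f x)"
        by (rule *) (rule bounded_linear_compose[OF bounded_linear_scaleC_right f])
      finally show ?thesis
        using False by (simp add: norm_inverse inverse_eq_divide norm_divide pos_le_divide_eq mult.commute)
    qed
  qed
  fix f g h :: "'a \<Rightarrow>\<^sub>C\<^sub>L 'b" and r s :: real and a b :: complex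
  show "f + g + h = f + (g + h)" "f + g = g + f" "0 + f = f" "- f + f = 0" "f - g = f + - g"
    by (transfer; simp add: fun_eq_iff algebra_simps)+
  show "a *\<^sub>C (f + g) = a *\<^sub>C f + a *\<^sub>C g" "(a + b) *\<^sub>C f = a *\<^sub>C f + b *\<^sub>C f"
    "a *\<^sub>C b *\<^sub>C f = (a * b) *\<^sub>C f"
    by (transfer; simp add: fun_eq_iff scaleC_add_right scaleC_add_left scaleC_scaleC)+
  then show "r *\<^sub>R (f + g) = r *\<^sub>R f + r *\<^sub>R g" "(r + s) *\<^sub>R f = r *\<^sub>R f + s *\<^sub>R f"
    "r *\<^sub>R s *\<^sub>R f = (r * s) *\<^sub>R f"
    unfolding scaleR_cblinfun_def
    by (transfer; simp add: fun_eq_iff scaleC_add_right scaleC_add_left scaleC_scaleC)+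
  show "1 *\<^sub>R f = f"
    unfolding scaleR_cblinfun_def by transfer simp
  show "complex_of_real r *\<^sub>C f = r *\<^sub>R f"
    by (simp add: scaleR_cblinfun_def)
  show "norm (a *\<^sub>C f) = cmod a * norm f"
    by transfer (simp add: onorm_scaleC)
  then show "norm (r *\<^sub>R f) = \<bar>r\<bar> * norm f"
    unfolding scaleR_cblinfun_def by transfer (simp add: onorm_scaleC)
  show "norm f = 0 \<longleftrightarrow> f = 0"
    by transfer (auto simp: onorm_eq_0 fun_eq_iff)
  show "norm (f + g) \<le> norm f + norm g"
    by transfer (simp add: onorm_triangle)
qed (simp_all only: dist_cblinfun_def sgn_cblinfun_def uniformity_cblinfun_def open_cblinfun_def)

end

instance cblinfun :: (complex_normed_vector, complex_banach) complex_banach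
proof
  fix X :: "nat \<Rightarrow> ('a \<Rightarrow>\<^sub>C\<^sub>L 'b)"
  assume X: "Cauchy X"
  define Y where "Y n = Blinfun (cblinfun_apply (X n))" for n
  have Y: "blinfun_apply (Y n) = cblinfun_apply (X n)" for n
    unfolding Y_def by (rule bounded_linear_Blinfun_apply) (use cblinfun_apply in blast)
  have dist_Y: "dist (Y m) (Y n) = dist (X m) (X n)" for m n
    unfolding dist_norm norm_blinfun.rep_eq norm_cblinfun.rep_eq
    by (simp add: minus_blinfun.rep_eq minus_cblinfun.rep_eq Y)
  have "Cauchy Y"
    using X by (simp add: Cauchy_def dist_Y)
  then obtain L where L: "Y \<longlonglongrightarrow> L"
    by (auto simp: Cauchy_convergent_iff convergent_def)
  have pt: "(\<lambda>n. blinfun_apply (Y n) x) \<longlonglongrightarrow> blinfun_apply L x" for x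
    by (intro tendsto_intros L)
  have "blinfun_apply L (c *\<^sub>C x) = c *\<^sub>C blinfun_apply L x" for c x
  proof (rule LIMSEQ_unique[OF pt])
    have "blinfun_apply (Y n) (c *\<^sub>C x) = c *\<^sub>C blinfun_apply (Y n) x" for n
      using cblinfun_apply[of "X n"] by (simp add: Y)
    then show "(\<lambda>n. blinfun_apply (Y n) (c *\<^sub>C x)) \<longlonglongrightarrow> c *\<^sub>C blinfun_apply L x"
      using bounded_linear.tendsto[OF bounded_linear_scaleC_right pt] by simp
  qed
  then have L_apply: "cblinfun_apply (Cblinfun (blinfun_apply L)) = blinfun_apply L"
    by (intro Cblinfun_inverse) (simp add: blinfun.bounded_linear_right)
  have "dist (X n) (Cblinfun (blinfun_apply L)) = dist (Y n) L" for n
    unfolding dist_norm norm_blinfun.rep_eq norm_cblinfun.rep_eq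
    by (simp add: minus_blinfun.rep_eq minus_cblinfun.rep_eq Y L_apply)
  then have "X \<longlonglongrightarrow> Cblinfun (blinfun_apply L)"
    using L by (simp add: tendsto_dist_iff[of X] tendsto_dist_iff[of Y])
  then show "convergent X"
    by (rule convergentI)
qed

lift_definition id_cblinfun :: "'a::complex_normed_vector \<Rightarrow>\<^sub>C\<^sub>L 'a" is "\<lambda>x. x"
  by (simp add: bounded_linear_ident)

lift_definition cblinfun_compose ::
  "('b::complex_normed_vector \<Rightarrow>\<^sub>C\<^sub>L 'c::complex_normed_vector) \<Rightarrow>
   ('a::complex_normed_vector \<Rightarrow>\<^sub>C\<^sub>L 'b) \<Rightarrow> ('a \<Rightarrow>\<^sub>C\<^sub>L 'c)" (infixl \<open>o\<^sub>C\<^sub>L\<close> 55) is "(\<circ>)"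
  by (simp add: bounded_linear_compose comp_def)

text \<open>The Banach-space adjoint (no conjugation) on the dual \<^typ>\<open>'a \<Rightarrow>\<^sub>C\<^sub>L complex\<close>.\<close>

lift_definition cadjoint ::
  "('a::complex_normed_vector \<Rightarrow>\<^sub>C\<^sub>L 'a) \<Rightarrow> (('a \<Rightarrow>\<^sub>C\<^sub>L complex) \<Rightarrow>\<^sub>C\<^sub>L ('a \<Rightarrow>\<^sub>C\<^sub>L complex))"
  is "\<lambda>T \<phi>. \<phi> o\<^sub>C\<^sub>L T"
proof (intro conjI allI)
  fix T :: "'a \<Rightarrow>\<^sub>C\<^sub>L 'a"
  show "bounded_linear (\<lambda>\<phi> :: 'a \<Rightarrow>\<^sub>C\<^sub>L complex. \<phi> o\<^sub>C\<^sub>L T)"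
  proof (rule bounded_linear_intro[where K = "norm T"])
    fix \<phi> \<psi> :: "'a \<Rightarrow>\<^sub>C\<^sub>L complex" and r
    show "(\<phi> + \<psi>) o\<^sub>C\<^sub>L T = (\<phi> o\<^sub>C\<^sub>L T) + (\<psi> o\<^sub>C\<^sub>L T)"
      by transfer auto
    show "(r *\<^sub>R \<phi>) o\<^sub>C\<^sub>L T = r *\<^sub>R (\<phi> o\<^sub>C\<^sub>L T)"
      unfolding scaleR_cblinfun_def by transfer auto
    show "norm (\<phi> o\<^sub>C\<^sub>L T) \<le> norm \<phi> * norm T"
      by transfer (auto intro!: onorm_compose)
  qed
  show "(c *\<^sub>C \<phi>) o\<^sub>C\<^sub>L T = c *\<^sub>C (\<phi> o\<^sub>C\<^sub>L T)" for c and \<phi> :: "'a \<Rightarrow>\<^sub>C\<^sub>L complex"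
    by transfer auto
qed

definition cfinite_dim :: "'a::complex_normed_vector set \<Rightarrow> bool" where
  "cfinite_dim V \<longleftrightarrow> (\<exists>B. finite B \<and> V \<subseteq> complex_vector.span B)"

definition ecdim :: "'a::complex_normed_vector set \<Rightarrow> enat" where
  "ecdim V = (if cfinite_dim V then enat (complex_vector.dim V) else \<infinity>)"

text \<open>
  The vectors of \<open>B\<close> have linearly independent (in particular, distinct) cosets in the
  quotient of the whole space by the subspace \<open>W\<close>: a finite combination of these cosets
  vanishes iff the combination of the representatives lies in \<open>W\<close>.
\<close>

definition cindependent_mod ::
  "'a::complex_normed_vector set \<Rightarrow> 'a set \<Rightarrow> bool" where
  "cindependent_mod W B \<longleftrightarrow>
     (\<forall>S a. finite S \<and> S \<subseteq> B \<and> (\<Sum>x\<in>S. a x *\<^sub>C x) \<in> W \<longrightarrow> (\<forall>x\<in>S. a x = 0))"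

text \<open>\<open>ecodim W\<close> is the dimension of the quotient space \<open>X / W\<close>.\<close>

definition ecodim :: "'a::complex_normed_vector set \<Rightarrow> enat" where
  "ecodim W = (SUP B \<in> {B. finite B \<and> cindependent_mod W B}. enat (card B))"

definition null_space ::
  "('a::complex_normed_vector \<Rightarrow>\<^sub>C\<^sub>L 'b::complex_normed_vector) \<Rightarrow> 'a set" where
  "null_space T = {x. T x = 0}"

definition nullity :: "('a::complex_normed_vector \<Rightarrow>\<^sub>C\<^sub>L 'a) \<Rightarrow> enat" where
  "nullity T = ecdim (null_space T)"

definition defect :: "('a::complex_normed_vector \<Rightarrow>\<^sub>C\<^sub>L 'a) \<Rightarrow> enat" where
  "defect T = ecodim (range (cblinfun_apply T))"

definition upper_semi_Fredholm :: "('a::complex_normed_vector \<Rightarrow>\<^sub>C\<^sub>L 'a) set" where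
  "upper_semi_Fredholm = {T. closed (range (cblinfun_apply T)) \<and> nullity T < \<infinity>}"

text \<open>Only meaningful if \<open>nullity T\<close> is finite; it equals \<open>-\<infinity>\<close> if moreover \<open>defect T = \<infinity>\<close>.\<close>

definition Fredholm_index :: "('a::complex_normed_vector \<Rightarrow>\<^sub>C\<^sub>L 'a) \<Rightarrow> ereal" where
  "Fredholm_index T = ereal_of_enat (nullity T) - ereal_of_enat (defect T)"

definition upper_semi_Weyl :: "('a::complex_normed_vector \<Rightarrow>\<^sub>C\<^sub>L 'a) set" where
  "upper_semi_Weyl = {T \<in> upper_semi_Fredholm. Fredholm_index T \<le> 0}"

definition ea_spectrum :: "('a::complex_normed_vector \<Rightarrow>\<^sub>C\<^sub>L 'a) \<Rightarrow> complex set" where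
  "ea_spectrum T = {z. T - z *\<^sub>C id_cblinfun \<notin> upper_semi_Weyl}"

definition vec_analytic_on ::
  "(complex \<Rightarrow> 'a::complex_normed_vector) \<Rightarrow> complex set \<Rightarrow> bool" where
  "vec_analytic_on f U \<longleftrightarrow> (\<forall>z\<in>U. \<exists>D. (f has_derivative (\<lambda>h. h *\<^sub>C D)) (at z))"

definition SVEP :: "('a::complex_normed_vector \<Rightarrow>\<^sub>C\<^sub>L 'a) \<Rightarrow> bool" where
  "SVEP T \<longleftrightarrow>
     (\<forall>U f. open U \<and> vec_analytic_on f U \<and> (\<forall>z\<in>U. (T - z *\<^sub>C id_cblinfun) (f z) = 0)
        \<longrightarrow> (\<forall>z\<in>U. f z = 0))"

definition is_inverse_of ::
  "('a::complex_normed_vector \<Rightarrow>\<^sub>C\<^sub>L 'a) \<Rightarrow> ('a \<Rightarrow>\<^sub>C\<^sub>L 'a) \<Rightarrow> bool" where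
  "is_inverse_of S A \<longleftrightarrow> S o\<^sub>C\<^sub>L A = id_cblinfun \<and> A o\<^sub>C\<^sub>L S = id_cblinfun"

definition cspectrum :: "('a::complex_normed_vector \<Rightarrow>\<^sub>C\<^sub>L 'a) \<Rightarrow> complex set" where
  "cspectrum T = {z. \<nexists>S. is_inverse_of S (T - z *\<^sub>C id_cblinfun)}"

text \<open>The resolvent \<open>(z - T)\<^sup>-\<^sup>1\<close>, for \<open>z\<close> outside the spectrum.\<close>

definition resolvent ::
  "('a::complex_normed_vector \<Rightarrow>\<^sub>C\<^sub>L 'a) \<Rightarrow> complex \<Rightarrow> ('a \<Rightarrow>\<^sub>C\<^sub>L 'a)" where
  "resolvent T z = (THE S. is_inverse_of S (z *\<^sub>C id_cblinfun - T))"

text \<open>The vector-valued analogue of \<^const>\<open>contour_integral\<close>.\<close>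

definition vec_contour_integral ::
  "(real \<Rightarrow> complex) \<Rightarrow> (complex \<Rightarrow> 'a::complex_banach) \<Rightarrow> 'a" where
  "vec_contour_integral \<gamma> F =
     integral {0..1} (\<lambda>t. vector_derivative \<gamma> (at t within {0..1}) *\<^sub>C F (\<gamma> t))"

text \<open>A finite family of closed piecewise smooth curves in \<open>U - K\<close> that winds once around
  every point of \<open>K\<close> and not at all around the points outside \<open>U\<close>.\<close>

definition surrounds_within ::
  "(real \<Rightarrow> complex) list \<Rightarrow> complex set \<Rightarrow> complex set \<Rightarrow> bool" where
  "surrounds_within \<Gamma> K U \<longleftrightarrow>
     (\<forall>\<gamma>\<in>set \<Gamma>. valid_path \<gamma> \<and> pathfinish \<gamma> = pathstart \<gamma> \<and> path_image \<gamma> \<subseteq> U - K) \<and>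
     (\<forall>z\<in>K. (\<Sum>\<gamma>\<leftarrow>\<Gamma>. winding_number \<gamma> z) = 1) \<and>
     (\<forall>z. z \<notin> U \<longrightarrow> (\<Sum>\<gamma>\<leftarrow>\<Gamma>. winding_number \<gamma> z) = 0)"

definition hol_near :: "complex set \<Rightarrow> (complex \<Rightarrow> complex) set" where
  "hol_near K = {f. \<exists>U. open U \<and> K \<subseteq> U \<and> f holomorphic_on U}"

text \<open>
  \<open>f(T)\<close> is the integral of \<open>f(z) (z - T)\<^sup>-\<^sup>1\<close> over \<open>\<Gamma>\<close>, divided by \<open>2 \<pi> \<i>\<close>, where \<open>\<Gamma>\<close>
  surrounds the spectrum of \<open>T\<close> inside an open set \<open>U\<close> on which \<open>f\<close> is holomorphic.
  By Cauchy's theorem such \<open>U\<close> and \<open>\<Gamma>\<close> exist and the value does not depend on them, so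
  \<open>SOME\<close> selects from a singleton whenever \<open>f \<in> hol_near (cspectrum T)\<close>.
\<close>

definition hol_calc ::
  "(complex \<Rightarrow> complex) \<Rightarrow> ('a::complex_banach \<Rightarrow>\<^sub>C\<^sub>L 'a) \<Rightarrow> ('a \<Rightarrow>\<^sub>C\<^sub>L 'a)" where
  "hol_calc f T = (SOME S. \<exists>U \<Gamma>.
     open U \<and> cspectrum T \<subseteq> U \<and> f holomorphic_on U \<and> surrounds_within \<Gamma> (cspectrum T) U \<and>
     S = (1 / (2 * of_real pi * \<i>)) *\<^sub>C
           (\<Sum>\<gamma>\<leftarrow>\<Gamma>. vec_contour_integral \<gamma> (\<lambda>z. f z *\<^sub>C resolvent T z)))"

end

theory Submission
  imports Defs
begin

text \<open>
  For given \<open>\<mu>\<close> let \<open>Z\<close> be the open set on which \<open>f\<close> is locally constant with value \<open>\<mu>\<close>, and let \<open>P\<close> be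
  the spectral projection of \<open>T\<close> for \<open>Z\<close>. Off \<open>Z\<close>, \<open>f - \<mu>\<close> has finitely many zeros on the spectrum, so
  \<open>f(T) - \<mu> = (T - l\<^sub>1) \<dots> (T - l\<^sub>n) h(T) (1 - P)\<close> with commuting factors and \<open>h(T)\<close> invertible.
  Products of upper semi-Fredholm operators of index \<open>\<le> 0\<close> are of the same kind, and if the product is
  upper semi-Fredholm, then so are the factors. As for the index, if \<open>\<alpha>(T - l) > \<beta>(T - l)\<close>, then an
  underdetermined holomorphic linear system yields an analytic family of eigenvectors of \<open>T\<close> near \<open>l\<close>,
  so that SVEP of \<open>T\<close> gives \<open>i(T - l) \<le> 0\<close>; dually, SVEP of \<open>T\<^sup>*\<close> gives \<open>i(T - l) \<ge> 0\<close> for each factor,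
  and then all indices vanish if that of the product is \<open>\<le> 0\<close>.

  It remains to see that \<open>P\<close> has finite rank when every \<open>T - l\<close> with \<open>l \<in> Z\<close> is upper semi-Fredholm. Boundary
  points of the spectrum at which \<open>T - l\<close> is upper semi-Fredholm are isolated, so the spectrum is finite
  in \<open>Z\<close>. The product of the corresponding \<open>T - l\<close> is upper semi-Fredholm and quasinilpotent on the range
  of \<open>P\<close>, which forces that range to be finite-dimensional.
\<close>

section \<open>Bounded complex-linear operators\<close>

text \<open>The obstacle is that a product determines only the sum of the indices of its factors: a
  factor of positive index may be compensated by one of negative index. SVEP on either side puts all
  indices on one side of 0, which rules out the cancellation. Since an index may be -\<infinity>,
  nullities and defects are compared and added, never subtracted. Perturbation theory of the index
  is replaced by a construction: modulo a finite-dimensional space of errors,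
  \<open>(A - z) x = y\<close> has solutions analytic in \<open>z\<close>, and cancelling the errors
  is a linear system with holomorphic coefficients. More unknowns than equations yield eigenvectors;
  one additional unknown yields surjectivity. The functional calculus chooses an arbitrary cycle, so
  its use rests on the existence of a cycle around a compact set (a grid polygon) and on Cauchy's
  theorem for null-homologous cycles. Operator-valued integrals are compared by applying
  functionals, which is where the Hahn-Banach theorem enters.\<close>

lemma bounded_linear_cblinfun: "bounded_linear (cblinfun_apply T)"
  using cblinfun_apply by blast

lemma cblinfun_scaleC_right [simp]: "T (c *\<^sub>C x) = c *\<^sub>C T x"
  for T :: "'a::complex_normed_vector \<Rightarrow>\<^sub>C\<^sub>L 'b::complex_normed_vector"
  using cblinfun_apply by blast

lemma cblinfun_add_right: "T (x + y) = T x + T y"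
  and cblinfun_diff_right: "T (x - y) = T x - T y"
  and cblinfun_minus_right: "T (- x) = - T x"
  and cblinfun_zero_right [simp]: "T 0 = 0"
  and cblinfun_sum_right: "T (\<Sum>i\<in>I. f i) = (\<Sum>i\<in>I. T (f i))"
  for T :: "'a::complex_normed_vector \<Rightarrow>\<^sub>C\<^sub>L 'b::complex_normed_vector"
  using bounded_linear_cblinfun[of T]
  by (auto simp: linear_simps bounded_linear.linear linear_sum)

lemmas cblinfun_right_simps =
  cblinfun_add_right cblinfun_diff_right cblinfun_minus_right cblinfun_sum_right

lemma cblinfun_add_left [simp]: "(S + T) x = S x + T x"
  and cblinfun_diff_left [simp]: "(S - T) x = S x - T x"
  and cblinfun_minus_left [simp]: "(- T) x = - T x"
  and cblinfun_zero_left [simp]: "(0 :: 'a::complex_normed_vector \<Rightarrow>\<^sub>C\<^sub>L 'b::complex_normed_vector) x = 0"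
  and cblinfun_scaleC_left [simp]: "(c *\<^sub>C T) x = c *\<^sub>C T x"
  for S T :: "'a::complex_normed_vector \<Rightarrow>\<^sub>C\<^sub>L 'b::complex_normed_vector"
  by (transfer; simp)+

lemma id_cblinfun_apply [simp]: "id_cblinfun x = x"
  by transfer simp

lemma cblinfun_compose_apply [simp]: "(S o\<^sub>C\<^sub>L T) x = S (T x)"
  by transfer simp

lemma cadjoint_apply [simp]: "cadjoint T \<phi> = \<phi> o\<^sub>C\<^sub>L T"
  by (simp add: cadjoint.rep_eq)

lemma norm_cblinfun_apply: "norm (T x) \<le> norm T * norm x"
  for T :: "'a::complex_normed_vector \<Rightarrow>\<^sub>C\<^sub>L 'b::complex_normed_vector"
  by transfer (simp add: onorm)

lemma cblinfun_sum_left: "(\<Sum>i\<in>I. f i) x = (\<Sum>i\<in>I. f i x)"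
  for f :: "'i \<Rightarrow> 'a::complex_normed_vector \<Rightarrow>\<^sub>C\<^sub>L 'b::complex_normed_vector"
  by (induction I rule: infinite_finite_induct) auto

lemma norm_cblinfun_le:
  fixes T :: "'a::complex_normed_vector \<Rightarrow>\<^sub>C\<^sub>L 'b::complex_normed_vector"
  assumes "\<And>x. norm (T x) \<le> K * norm x" "K \<ge> 0"
  shows "norm T \<le> K"
  using assms by transfer (simp add: onorm_bound)

lemma norm_cblinfun_compose: "norm (S o\<^sub>C\<^sub>L T) \<le> norm S * norm T"
  by transfer (auto intro!: onorm_compose)

lemma cblinfun_compose_assoc: "(S o\<^sub>C\<^sub>L T) o\<^sub>C\<^sub>L R = S o\<^sub>C\<^sub>L (T o\<^sub>C\<^sub>L R)"
  by (rule cblinfun_eqI) simp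

lemma cblinfun_compose_id_left [simp]: "id_cblinfun o\<^sub>C\<^sub>L T = T"
  and cblinfun_compose_id_right [simp]: "T o\<^sub>C\<^sub>L id_cblinfun = T"
  by (rule cblinfun_eqI; simp)+

lemma scaleC_real_commute: "c *\<^sub>C (r *\<^sub>R x) = r *\<^sub>R (c *\<^sub>C x)"
  for x :: "'a::complex_normed_vector"
  by (simp add: scaleC_of_real[symmetric] scaleC_scaleC mult.commute)

lemma ex_cblinfun:
  fixes f :: "'a::complex_normed_vector \<Rightarrow> 'b::complex_normed_vector"
  assumes "\<And>x y. f (x + y) = f x + f y" "\<And>c x. f (c *\<^sub>C x) = c *\<^sub>C f x"
    "\<And>x. norm (f x) \<le> K * norm x"
  obtains T where "cblinfun_apply T = f"
proof -
  have "bounded_linear f"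
    using assms by (intro bounded_linear_intro[where K=K])
      (auto simp: scaleC_of_real[symmetric] mult.commute)
  then show ?thesis
    using assms that[of "Cblinfun f"] by (simp add: Cblinfun_inverse)
qed

lemma bounded_bilinear_scaleC:
  "bounded_bilinear (\<lambda>c x. c *\<^sub>C (x :: 'a::complex_normed_vector))"
proof (rule bounded_bilinear.intro)
  show "(r *\<^sub>R c) *\<^sub>C x = r *\<^sub>R c *\<^sub>C x" for r c and x :: 'a
    by (simp add: scaleR_conv_of_real scaleC_of_real[symmetric] scaleC_scaleC)
  show "\<exists>K. \<forall>c (x :: 'a). norm (c *\<^sub>C x) \<le> cmod c * norm x * K"
    by (auto simp: norm_scaleC intro!: exI[of _ 1])
qed (simp_all add: scaleC_add_left scaleC_add_right scaleC_real_commute)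

lemmas tendsto_scaleC [tendsto_intros] = bounded_bilinear.tendsto[OF bounded_bilinear_scaleC]
lemmas continuous_on_scaleC [continuous_intros] =
  bounded_bilinear.continuous_on[OF bounded_bilinear_scaleC]
lemmas tendsto_cblinfun [tendsto_intros] = bounded_linear.tendsto[OF bounded_linear_cblinfun]

lemma subspace_null_space: "complex_vector.subspace (null_space T)"
  by (auto simp: complex_vector.subspace_def null_space_def cblinfun_right_simps)

lemma subspace_range_cblinfun: "complex_vector.subspace (range (cblinfun_apply T))"
  unfolding complex_vector.subspace_def
  by (auto simp flip: cblinfun_right_simps cblinfun_scaleC_right intro: range_eqI[where x=0])

lemma closed_null_space: "closed (null_space T)"
proof -
  have "null_space T = cblinfun_apply T -` {0}"
    by (auto simp: null_space_def)
  then show ?thesis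
    by (auto intro!: continuous_closed_vimage
        linear_continuous_at bounded_linear_cblinfun)
qed

section \<open>The Hahn--Banach theorem\<close>

definition sublinear :: "('a::real_vector \<Rightarrow> real) \<Rightarrow> bool" where
  "sublinear p \<longleftrightarrow> (\<forall>x y. p (x + y) \<le> p x + p y) \<and> (\<forall>r x. r \<ge> 0 \<longrightarrow> p (r *\<^sub>R x) = r * p x)"

lemma sublinear_zero: "sublinear p \<Longrightarrow> p 0 = 0"
  unfolding sublinear_def using mult_zero_left by (metis order_refl scaleR_zero_right)

lemma sublinear_minus: "sublinear p \<Longrightarrow> - p (- x) \<le> p x"
  using sublinear_zero[of p] unfolding sublinear_def
  by (metis add.right_inverse add_le_cancel_left add_0_right diff_0 diff_add_cancel le_diff_eq
      minus_le_iff uminus_add_conv_diff)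

text \<open>The infimum \<open>p\<close> along the ray through \<open>y\<close> is again sublinear
  and lies below \<open>q\<close>; minimality forces \<open>p = q\<close>, and the term
  \<open>t = 1\<close> of the infimum gives \<open>q x + q y \<le> q (x + y)\<close>.\<close>

lemma minimal_sublinear_additive:
  assumes q: "sublinear q" and min: "\<And>p. sublinear p \<Longrightarrow> p \<le> q \<Longrightarrow> p = q"
  shows "q (x + y) = q x + q y"
proof -
  have add: "q (x + y) \<le> q x + q y" and sc: "r \<ge> 0 \<Longrightarrow> q (r *\<^sub>R x) = r * q x" for x y r
    using q by (auto simp: sublinear_def)
  define p where "p x = (INF t\<in>{0..}. q (x + t *\<^sub>R y) - t * q y)" for x
  have lower: "- q (- x) \<le> q (x + t *\<^sub>R y) - t * q y" if "t \<ge> 0" for t x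
    using add[of "x + t *\<^sub>R y" "-x"] sc[OF that, of y] by simp
  have bdd: "bdd_below ((\<lambda>t. q (x + t *\<^sub>R y) - t * q y) ` {0..})" for x
    using lower by (intro bdd_belowI2[where m="- q (- x)"]) auto
  have p_le: "p x \<le> q (x + t *\<^sub>R y) - t * q y" if "t \<ge> 0" for x t
    unfolding p_def using that by (intro cINF_lower bdd) auto
  have p_ge: "c \<le> p x" if "\<And>t. t \<ge> 0 \<Longrightarrow> c \<le> q (x + t *\<^sub>R y) - t * q y" for c x
    unfolding p_def using that by (intro cINF_greatest) auto
  have "sublinear p"
    unfolding sublinear_def
  proof (intro conjI allI impI)
    fix x z
    have "p (x + z) - (q (x + t *\<^sub>R y) - t * q y) \<le> q (z + s *\<^sub>R y) - s * q y"
      if "t \<ge> 0" "s \<ge> 0" for t s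
      using p_le[of "t + s" "x + z"] add[of "x + t *\<^sub>R y" "z + s *\<^sub>R y"] that
      by (simp add: algebra_simps)
    then have "p (x + z) - (q (x + t *\<^sub>R y) - t * q y) \<le> p z" if "t \<ge> 0" for t
      using that by (intro p_ge) auto
    then have "p (x + z) - p z \<le> p x"
      by (intro p_ge) (simp add: algebra_simps)
    then show "p (x + z) \<le> p x + p z" by simp
  next
    fix r :: real and x assume r: "r \<ge> 0"
    show "p (r *\<^sub>R x) = r * p x"
    proof (cases "r = 0")
      case True
      have "p 0 \<le> 0" using p_le[of 0 0] sublinear_zero[OF q] by simp
      moreover have "0 \<le> p 0" by (rule p_ge) (simp add: sc)
      ultimately show ?thesis using True by simp
    next
      case False
      with r have r: "r > 0" by simp
      have 1: "p (r *\<^sub>R x) \<le> r * p x" if "r > 0" for r x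
      proof -
        have "p (r *\<^sub>R x) / r \<le> p x"
        proof (rule p_ge)
          fix t :: real assume "t \<ge> 0"
          then have "p (r *\<^sub>R x) \<le> q (r *\<^sub>R x + (r * t) *\<^sub>R y) - (r * t) * q y"
            using that by (intro p_le) auto
          also have "r *\<^sub>R x + (r * t) *\<^sub>R y = r *\<^sub>R (x + t *\<^sub>R y)"
            by (simp add: algebra_simps)
          also have "q \<dots> - (r * t) * q y = r * (q (x + t *\<^sub>R y) - t * q y)"
            using that by (simp add: sc right_diff_distrib del: scaleR_add_right scaleR_right_distrib)
          finally show "p (r *\<^sub>R x) / r \<le> q (x + t *\<^sub>R y) - t * q y"
            using that by (simp add: field_simps)
        qed
        then show ?thesis using that by (simp add: field_simps)
      qed
      have "p x = p (inverse r *\<^sub>R (r *\<^sub>R x))" using r by simp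
      also have "\<dots> \<le> inverse r * p (r *\<^sub>R x)" using r by (intro 1) auto
      finally have "r * p x \<le> p (r *\<^sub>R x)" using r by (simp add: field_simps)
      with 1[OF r, of x] show ?thesis by simp
    qed
  qed
  moreover have "p \<le> q"
    using p_le[of 0] by (auto simp: le_fun_def)
  ultimately have "p = q" by (rule min)
  with p_le[of 1 x] have "q x \<le> q (x + y) - q y" by simp
  with add[of x y] show ?thesis by simp
qed

text \<open>Zorn's lemma for the reversed pointwise order: a chain is bounded below by its pointwise
  infimum, which is finite because \<open>- p (- x) \<le> a x\<close> for every sublinear
  \<open>a \<le> p\<close>.\<close>

lemma ex_minimal_sublinear:
  assumes p: "sublinear p"
  obtains q where "sublinear q" "q \<le> p" "\<And>r. sublinear r \<Longrightarrow> r \<le> q \<Longrightarrow> r = q"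
proof -
  let ?A = "{q. sublinear q \<and> q \<le> p}"
  have "\<exists>m\<in>?A. \<forall>a\<in>?A. a \<le> m \<longrightarrow> a = m"
  proof (rule predicate_Zorn)
    show "partial_order_on ?A (relation_of (\<lambda>a b. b \<le> a) ?A)"
      by (rule partial_order_on_relation_ofI) auto
  next
    fix C assume C: "C \<in> Chains (relation_of (\<lambda>a b. b \<le> a) ?A)"
    then have CA: "C \<subseteq> ?A" and tot: "\<And>a b. a \<in> C \<Longrightarrow> b \<in> C \<Longrightarrow> a \<le> b \<or> b \<le> a"
      by (auto simp: Chains_def relation_of_def)
    show "\<exists>u\<in>?A. \<forall>a\<in>C. u \<le> a"
    proof (cases "C = {}")
      case True
      then show ?thesis using p by auto
    next
      case False
      define u where "u x = (INF a\<in>C. a x)" for x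
      have low: "- p (- x) \<le> a x" if "a \<in> C" for a x
        using that CA sublinear_minus[of a x] le_funD[of a p "-x"] by auto
      have bdd: "bdd_below ((\<lambda>a. a x) ` C)" for x
        using low by (intro bdd_belowI2[where m="- p (- x)"]) auto
      have u_le: "u x \<le> a x" if "a \<in> C" for a x
        unfolding u_def using that bdd by (intro cINF_lower) auto
      have u_ge: "c \<le> u x" if "\<And>a. a \<in> C \<Longrightarrow> c \<le> a x" for c x
        unfolding u_def using that False by (intro cINF_greatest) auto
      have "sublinear u"
        unfolding sublinear_def
      proof (intro conjI allI impI)
        fix x y
        \<comment> \<open>In a chain the smaller of \<open>a\<close> and \<open>b\<close> estimates
          both terms. Totality is essential: an infimum of sublinear functionals need not be
          subadditive.\<close>
        have "u (x + y) \<le> a x + b y" if ab: "a \<in> C" "b \<in> C" for a b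
        proof -
          obtain c where c: "c \<in> C" "c \<le> a" "c \<le> b"
            using tot[OF ab] ab by (metis order_refl)
          have "u (x + y) \<le> c (x + y)" by (rule u_le) fact
          also have "\<dots> \<le> c x + c y" using c CA by (auto simp: sublinear_def)
          also have "\<dots> \<le> a x + b y" using c by (auto simp: le_fun_def intro: add_mono)
          finally show ?thesis .
        qed
        then have "u (x + y) - a x \<le> u y" if "a \<in> C" for a
          using that by (intro u_ge) (fastforce simp: algebra_simps)
        then have "u (x + y) - u y \<le> u x"
          by (intro u_ge) (auto simp: algebra_simps)
        then show "u (x + y) \<le> u x + u y" by simp
      next
        fix r :: real and x assume r: "r \<ge> 0"
        have hom: "a (r *\<^sub>R x) = r * a x" if "a \<in> C" for a
          using that CA r by (auto simp: sublinear_def)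
        show "u (r *\<^sub>R x) = r * u x"
        proof (cases "r = 0")
          case True
          then have "(\<lambda>a. a 0) ` C = {0}"
            using hom \<open>C \<noteq> {}\<close> by force
          then show ?thesis
            using True by (simp add: u_def)
        next
          case False
          with r have r: "r > 0" by simp
          have "u (r *\<^sub>R x) / r \<le> u x"
          proof (rule u_ge)
            fix a assume "a \<in> C"
            then have "u (r *\<^sub>R x) \<le> r * a x" using u_le hom by metis
            then show "u (r *\<^sub>R x) / r \<le> a x"
              using r by (simp add: pos_divide_le_eq mult.commute)
          qed
          moreover have "r * u x \<le> u (r *\<^sub>R x)"
          proof (rule u_ge)
            fix a assume a: "a \<in> C"
            show "r * u x \<le> a (r *\<^sub>R x)"
              unfolding hom[OF a] using u_le[OF a] r by simp
          qed
          ultimately show ?thesis using r by (simp add: field_simps)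
        qed
      qed
      moreover have "u \<le> p"
      proof (rule le_funI)
        fix x
        obtain a where a: "a \<in> C" using False by blast
        then have "a x \<le> p x" using CA by (auto simp: le_fun_def)
        then show "u x \<le> p x" using u_le[OF a, of x] by linarith
      qed
      ultimately show ?thesis using u_le by (auto simp: le_fun_def)
    qed
  qed
  then show ?thesis using that by (auto intro: order_trans)
qed

text \<open>The infimal convolution \<open>p\<close> of \<open>C * norm\<close> with
  \<open>u\<close> stays below \<open>C * norm\<close> everywhere and below \<open>u\<close> on
  \<open>V\<close>. A minimal sublinear \<open>q \<le> p\<close> is linear, and
  \<open>q \<le> u\<close> on \<open>V\<close>, applied to \<open>x\<close> and \<open>- x\<close>,
  becomes an equality.\<close>

lemma sublinear_dominated_extension:
  fixes u :: "'a::real_normed_vector \<Rightarrow> real"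
  assumes V: "subspace V" and add: "\<And>x y. x \<in> V \<Longrightarrow> y \<in> V \<Longrightarrow> u (x + y) = u x + u y"
    and scale: "\<And>r x. x \<in> V \<Longrightarrow> u (r *\<^sub>R x) = r * u x"
    and le: "\<And>x. x \<in> V \<Longrightarrow> u x \<le> C * norm x" and C: "C \<ge> 0"
  obtains U where "\<And>x y. U (x + y) = U x + U y" "\<And>r x. U (r *\<^sub>R x) = r * U x"
    "\<And>x. U x \<le> C * norm x" "\<And>x. x \<in> V \<Longrightarrow> U x = u x"
proof -
  define p where "p x = (INF v\<in>V. C * norm (x - v) + u v)" for x
  have V0: "0 \<in> V" using V by (rule subspace_0)
  have u0: "u 0 = 0" using scale[OF V0, of 0] by simp
  have um: "u (- v) = - u v" if "v \<in> V" for v using scale[OF that, of "-1"] by simp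
  have low: "- C * norm x \<le> C * norm (x - v) + u v" if "v \<in> V" for v x
  proof -
    have "- u v \<le> C * norm v" using le[of "-v"] that um V by (simp add: subspace_neg)
    also have "\<dots> \<le> C * (norm (x - v) + norm x)"
      using C norm_triangle_ineq4[of x "x - v"] by (intro mult_left_mono) auto
    finally show ?thesis by (simp add: algebra_simps)
  qed
  have bdd: "bdd_below ((\<lambda>v. C * norm (x - v) + u v) ` V)" for x
    using low by (intro bdd_belowI2[where m="- C * norm x"]) auto
  have p_le: "p x \<le> C * norm (x - v) + u v" if "v \<in> V" for x v
    unfolding p_def using that by (intro cINF_lower bdd) auto
  have p_ge: "c \<le> p x" if "\<And>v. v \<in> V \<Longrightarrow> c \<le> C * norm (x - v) + u v" for c x
    unfolding p_def using that V0 by (intro cINF_greatest) auto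
  have "sublinear p"
    unfolding sublinear_def
  proof (intro conjI allI impI)
    fix x y
    have "p (x + y) - (C * norm (x - v) + u v) \<le> C * norm (y - w) + u w"
      if "v \<in> V" "w \<in> V" for v w
    proof -
      have "p (x + y) \<le> C * norm (x + y - (v + w)) + u (v + w)"
        using that V by (intro p_le subspace_add)
      also have "C * norm (x + y - (v + w)) \<le> C * (norm (x - v) + norm (y - w))"
        using C norm_triangle_ineq[of "x - v" "y - w"]
        by (intro mult_left_mono) (auto simp: algebra_simps)
      finally show ?thesis using that by (simp add: add algebra_simps)
    qed
    then have "p (x + y) - (C * norm (x - v) + u v) \<le> p y" if "v \<in> V" for v
      using that by (intro p_ge) auto
    then have "p (x + y) - p y \<le> p x"
      by (intro p_ge) (simp add: algebra_simps)
    then show "p (x + y) \<le> p x + p y" by simp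
  next
    fix r :: real and x assume r: "r \<ge> 0"
    have *: "p (r *\<^sub>R x) \<le> r * p x" if "r > 0" for r x
    proof -
      have "p (r *\<^sub>R x) / r \<le> p x"
      proof (rule p_ge)
        fix v assume v: "v \<in> V"
        then have "p (r *\<^sub>R x) \<le> C * norm (r *\<^sub>R x - r *\<^sub>R v) + u (r *\<^sub>R v)"
          using V by (intro p_le subspace_scale)
        also have "\<dots> = r * (C * norm (x - v) + u v)"
          using that v by (simp add: scale algebra_simps flip: scaleR_diff_right)
        finally show "p (r *\<^sub>R x) / r \<le> C * norm (x - v) + u v"
          using that by (simp add: field_simps)
      qed
      then show ?thesis using that by (simp add: field_simps)
    qed
    show "p (r *\<^sub>R x) = r * p x"
    proof (cases "r = 0")
      case True
      have "p 0 \<le> 0" using p_le[OF V0, of 0] u0 by simp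
      moreover have "0 \<le> p 0" using low[of _ 0] by (intro p_ge) auto
      ultimately show ?thesis using True by simp
    next
      case False
      with r have r: "r > 0" by simp
      have "p x = p (inverse r *\<^sub>R (r *\<^sub>R x))" using r by simp
      also have "\<dots> \<le> inverse r * p (r *\<^sub>R x)" using r by (intro *) auto
      finally have "r * p x \<le> p (r *\<^sub>R x)" using r by (simp add: field_simps)
      with *[OF r, of x] show ?thesis by simp
    qed
  qed
  then obtain q where q: "sublinear q" "q \<le> p" and min: "\<And>r. sublinear r \<Longrightarrow> r \<le> q \<Longrightarrow> r = q"
    by (rule ex_minimal_sublinear) blast
  have qadd: "q (x + y) = q x + q y" for x y
    using minimal_sublinear_additive[OF q(1) min] by blast
  have qm: "q (- x) = - q x" for x
    using qadd[of x "-x"] sublinear_zero[OF q(1)] by simp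
  have qs: "q (r *\<^sub>R x) = r * q x" for r x
  proof (cases "r \<ge> 0")
    case True
    then show ?thesis using q by (simp add: sublinear_def)
  next
    case False
    then have "q ((- r) *\<^sub>R x) = (- r) * q x"
      using q(1) unfolding sublinear_def by (metis linear neg_0_le_iff_le)
    then show ?thesis using qm[of "r *\<^sub>R x"] by simp
  qed
  have "q x \<le> C * norm x" for x
    using p_le[OF V0, of x] q(2) u0 by (auto simp: le_fun_def intro: order_trans)
  moreover have q_le_u: "q x \<le> u x" if "x \<in> V" for x
    using p_le[OF that, of x] q(2) by (auto simp: le_fun_def intro: order_trans)
  then have "q x = u x" if "x \<in> V" for x
    using that q_le_u[of "-x"] um V qm by (fastforce simp: subspace_neg intro: antisym)
  ultimately show ?thesis using that qadd qs by blast
qed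

text \<open>A complex functional is recovered from its real part \<open>U\<close> as
  \<open>U x - \<i> U (\<i> x)\<close>, so the real part is extended first. The bound on the modulus
  follows from the bound on \<open>U\<close>, since \<open>x\<close> can be rotated until the value
  is real.\<close>

theorem Hahn_Banach:
  fixes g :: "'a::complex_normed_vector \<Rightarrow> complex"
  assumes V: "complex_vector.subspace V"
    and add: "\<And>x y. x \<in> V \<Longrightarrow> y \<in> V \<Longrightarrow> g (x + y) = g x + g y"
    and scale: "\<And>c x. x \<in> V \<Longrightarrow> g (c *\<^sub>C x) = c * g x"
    and le: "\<And>x. x \<in> V \<Longrightarrow> cmod (g x) \<le> C * norm x" and C: "C \<ge> 0"
  obtains \<phi> :: "'a \<Rightarrow>\<^sub>C\<^sub>L complex" where "\<And>x. x \<in> V \<Longrightarrow> \<phi> x = g x" "norm \<phi> \<le> C"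
proof -
  have "subspace V"
    using V by (auto simp: subspace_def complex_vector.subspace_def scaleC_of_real[symmetric])
  moreover have "Re (g x) \<le> C * norm x" if "x \<in> V" for x
    using le[OF that] complex_Re_le_cmod[of "g x"] by linarith
  ultimately obtain U where Uadd: "\<And>x y. U (x + y) = U x + U y"
    and Us: "\<And>r x. U (r *\<^sub>R x) = r * U x"
    and Ule: "\<And>x. U x \<le> C * norm x" and UV: "\<And>x. x \<in> V \<Longrightarrow> U x = Re (g x)"
    using sublinear_dominated_extension[of V "\<lambda>x. Re (g x)" C] add scale C
    by (auto simp: scaleC_of_real[symmetric])
  define f where "f x = Complex (U x) (- U (\<i> *\<^sub>C x))" for x
  have ii: "\<i> *\<^sub>C \<i> *\<^sub>C x = - x" for x :: 'a
    using scaleC_of_real[of "-1" x] by (simp add: scaleC_scaleC)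
  have fadd: "f (x + y) = f x + f y" for x y
    by (simp add: f_def Uadd scaleC_add_right complex_eq_iff)
  have fr: "f (r *\<^sub>R x) = of_real r * f x" for r x
    by (simp add: f_def Us scaleC_real_commute complex_eq_iff)
  have fi: "f (\<i> *\<^sub>C x) = \<i> * f x" for x
    using Us[of "-1" x] by (simp add: f_def ii complex_eq_iff)
  have fc: "f (c *\<^sub>C x) = c * f x" for c x
  proof -
    have "c *\<^sub>C x = Re c *\<^sub>R x + Im c *\<^sub>R (\<i> *\<^sub>C x)"
      by (subst complex_eq[of c], simp only: scaleC_add_left scaleC_of_real[symmetric] scaleC_scaleC)
        (simp add: mult.commute)
    then show ?thesis
      by (subst (2) complex_eq[of c]) (simp add: fadd fr fi algebra_simps)
  qed
  have fle: "cmod (f x) \<le> C * norm x" for x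
  proof (cases "f x = 0")
    case True
    then show ?thesis using C by simp
  next
    case False
    \<comment> \<open>The unimodular factor that turns \<open>f x\<close> into its modulus.\<close>
    define c where "c = cnj (f x) / cmod (f x)"
    have "c * f x = of_real (cmod (f x))"
      using False by (simp add: c_def complex_norm_square[symmetric] power2_eq_square mult.commute)
    then have "cmod (f x) = Re (f (c *\<^sub>C x))" by (simp add: fc)
    also have "\<dots> \<le> C * norm (c *\<^sub>C x)" using Ule by (simp add: f_def)
    also have "\<dots> = C * norm x"
      using False by (simp add: norm_scaleC c_def norm_divide)
    finally show ?thesis .
  qed
  obtain \<phi> where \<phi>: "cblinfun_apply \<phi> = f"
    by (rule ex_cblinfun[of f C]) (use fadd fc fle in \<open>auto simp: scaleC_complex_def\<close>)
  show ?thesis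
  proof (rule that)
    show "\<phi> x = g x" if "x \<in> V" for x
    proof -
      have "\<i> *\<^sub>C x \<in> V" using V that by (rule complex_vector.subspace_scale)
      then show ?thesis using that by (simp add: \<phi> f_def UV scale complex_eq_iff)
    qed
    show "norm \<phi> \<le> C" using fle C by (intro norm_cblinfun_le) (auto simp: \<phi>)
  qed
qed

corollary ex_norming_functional:
  obtains \<phi> :: "'a::complex_normed_vector \<Rightarrow>\<^sub>C\<^sub>L complex"
  where "\<phi> x = of_real (norm x)" "norm \<phi> \<le> 1"
proof (cases "x = 0")
  case True
  then show ?thesis using that[of 0] by simp
next
  case False
  define g where "g y = (THE c. y = c *\<^sub>C x) * of_real (norm x)" for y
  have g: "g (c *\<^sub>C x) = c * of_real (norm x)" for c
    using False by (simp add: g_def complex_vector.scale_cancel_right)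
  obtain \<phi> :: "'a \<Rightarrow>\<^sub>C\<^sub>L complex"
    where "\<And>y. y \<in> range (\<lambda>c. c *\<^sub>C x) \<Longrightarrow> \<phi> y = g y" "norm \<phi> \<le> 1"
  proof (rule Hahn_Banach[of "range (\<lambda>c. c *\<^sub>C x)" g 1])
    show "complex_vector.subspace (range (\<lambda>c. c *\<^sub>C x))"
      using complex_vector.subspace_span[of "{x}"] by (simp add: complex_vector.span_singleton)
    show "g (y + z) = g y + g z" if "y \<in> range (\<lambda>c. c *\<^sub>C x)" "z \<in> range (\<lambda>c. c *\<^sub>C x)" for y z
      using that by (auto simp: g distrib_right simp flip: scaleC_add_left)
    show "g (c *\<^sub>C y) = c * g y" if "y \<in> range (\<lambda>c. c *\<^sub>C x)" for c y
      using that by (auto simp: g scaleC_scaleC)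
    show "cmod (g y) \<le> 1 * norm y" if "y \<in> range (\<lambda>c. c *\<^sub>C x)" for y
      using that by (auto simp: g norm_scaleC norm_mult)
  qed auto
  then show ?thesis
    using that[of \<phi>] g[of 1] range_eqI[of x "\<lambda>c. c *\<^sub>C x" 1] by simp
qed

text \<open>The tool by which identities between operators or vector-valued integrals are reduced to
  scalar ones.\<close>

lemma functionals_separate:
  fixes x y :: "'a::complex_normed_vector"
  assumes "\<And>\<phi> :: 'a \<Rightarrow>\<^sub>C\<^sub>L complex. \<phi> x = \<phi> y"
  shows "x = y"
  using ex_norming_functional[of "x - y"] assms by (metis cblinfun_diff_right eq_iff_diff_eq_0
      norm_eq_zero of_real_eq_0_iff)

section \<open>Closed subspaces and finite-dimensional subspaces\<close>

text \<open>A ball of radius \<delta> around \<open>x\<close> misses \<open>W\<close>, and scaling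
  by \<open>1 / a\<close> carries this to every multiple of \<open>x\<close>. The estimate says that
  the coordinate along \<open>x\<close> is bounded on the sum of \<open>W\<close> and the line of
  \<open>x\<close>.\<close>

lemma closed_subspace_line_bound:
  fixes x :: "'a::complex_normed_vector"
  assumes W: "complex_vector.subspace W" "closed W" and x: "x \<notin> W"
  obtains \<delta> where "\<delta> > 0" "\<And>a w. w \<in> W \<Longrightarrow> cmod a * \<delta> \<le> norm (w + a *\<^sub>C x)"
proof -
  have "open (- W)" using W by (simp add: open_Compl)
  then obtain \<delta> where \<delta>: "\<delta> > 0" "ball x \<delta> \<subseteq> - W"
    using x by (auto elim: openE)
  have "cmod a * \<delta> \<le> norm (w + a *\<^sub>C x)" if w: "w \<in> W" for a w
  proof (cases "a = 0")
    case False
    have "- inverse a *\<^sub>C w \<in> W"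
      using W w by (simp add: complex_vector.subspace_scale complex_vector.subspace_neg)
    then have "- inverse a *\<^sub>C w \<notin> ball x \<delta>" using \<delta> by blast
    then have "\<delta> \<le> norm (x + inverse a *\<^sub>C w)" by (simp add: dist_norm)
    then have "cmod a * \<delta> \<le> norm (a *\<^sub>C (x + inverse a *\<^sub>C w))"
      by (simp add: norm_scaleC mult_left_mono)
    then show ?thesis using False
      by (simp add: scaleC_add_right scaleC_scaleC add.commute)
  qed simp
  with \<delta>(1) show ?thesis by (rule that)
qed

text \<open>The coordinates along \<open>x\<close> of a convergent sequence are Cauchy by the line
  bound, so its components in the closed span converge as well.\<close>

lemma closed_span_insert:
  fixes x :: "'a::complex_banach"
  assumes W: "closed (complex_vector.span W)"
  shows "closed (complex_vector.span (insert x W))"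
proof (cases "x \<in> complex_vector.span W")
  case True
  then show ?thesis using W by (simp add: complex_vector.span_redundant)
next
  case False
  let ?W = "complex_vector.span W"
  have sub: "complex_vector.subspace ?W" by (rule complex_vector.subspace_span)
  obtain \<delta> where \<delta>: "\<delta> > 0" and bound: "\<And>a w. w \<in> ?W \<Longrightarrow> cmod a * \<delta> \<le> norm (w + a *\<^sub>C x)"
    using closed_subspace_line_bound[OF sub W False] by blast
  show ?thesis
    unfolding closed_sequential_limits
  proof (intro allI impI)
    fix y l assume "(\<forall>n. y n \<in> complex_vector.span (insert x W)) \<and> y \<longlonglongrightarrow> l"
    then have y: "\<And>n. \<exists>a. y n - a *\<^sub>C x \<in> ?W" and lim: "y \<longlonglongrightarrow> l"
      by (auto simp: complex_vector.span_insert)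
    then obtain a where a: "\<And>n. y n - a n *\<^sub>C x \<in> ?W" by metis
    have le: "cmod (a n - a m) * \<delta> \<le> dist (y n) (y m)" for n m
    proof -
      have "(y n - a n *\<^sub>C x) - (y m - a m *\<^sub>C x) \<in> ?W"
        by (rule complex_vector.span_diff[OF a a])
      from bound[OF this, of "a n - a m"] show ?thesis
        by (simp add: dist_norm complex_vector.scale_left_diff_distrib)
    qed
    have "Cauchy a"
    proof (rule metric_CauchyI)
      fix e :: real assume "e > 0"
      then obtain M where "\<And>m n. m \<ge> M \<Longrightarrow> n \<ge> M \<Longrightarrow> dist (y m) (y n) < e * \<delta>"
        using LIMSEQ_imp_Cauchy[OF lim] \<delta> unfolding Cauchy_def by (meson mult_pos_pos)
      then have "cmod (a m - a n) * \<delta> < e * \<delta>" if "m \<ge> M" "n \<ge> M" for m n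
        using le that by (meson le_less_trans)
      then show "\<exists>M. \<forall>m\<ge>M. \<forall>n\<ge>M. dist (a m) (a n) < e"
        using \<delta> by (auto simp: dist_norm)
    qed
    then obtain b where "a \<longlonglongrightarrow> b" by (auto simp: Cauchy_convergent_iff convergent_def)
    then have "(\<lambda>n. y n - a n *\<^sub>C x) \<longlonglongrightarrow> l - b *\<^sub>C x" by (intro tendsto_intros lim)
    then have "l - b *\<^sub>C x \<in> ?W"
      by (rule closed_sequentially[OF W a])
    then show "l \<in> complex_vector.span (insert x W)"
      by (auto simp: complex_vector.span_insert)
  qed
qed

lemma closed_span_Un:
  fixes W :: "'a::complex_banach set"
  assumes "finite F" "complex_vector.subspace W" "closed W"
  shows "closed (complex_vector.span (F \<union> W))"
  using assms(1)
proof induction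
  case empty
  then show ?case using assms by (simp add: complex_vector.span_eq_iff[THEN iffD2])
next
  case (insert x F)
  then show ?case by (simp add: closed_span_insert)
qed

lemma closed_span_finite:
  "finite F \<Longrightarrow> closed (complex_vector.span (F :: 'a::complex_banach set))"
  using closed_span_Un[of F "{0}"] complex_vector.subspace_single_0
  by (metis Un_insert_right closed_singleton complex_vector.span_insert_0 sup_bot_right)

text \<open>Bolzano-Weierstrass by induction on the spanning set: the coordinate along the added
  vector is bounded by the line bound and converges on a subsequence; the induction hypothesis
  treats the rest.\<close>

lemma bounded_seq_span_finite:
  fixes X :: "nat \<Rightarrow> 'a::complex_banach"
  assumes "finite F" "\<And>n. X n \<in> complex_vector.span F" "bounded (range X)"
  obtains l r where "strict_mono r" "(X \<circ> r) \<longlonglongrightarrow> l"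
proof -
  have "\<exists>r :: nat \<Rightarrow> nat. strict_mono r \<and> convergent (X \<circ> r)"
    using assms
  proof (induction arbitrary: X)
    case empty
    then have "X = (\<lambda>_. 0)" by auto
    then show ?case
      by (intro exI[of _ id]) (auto simp: strict_mono_def convergent_const comp_def)
  next
    case (insert x F)
    let ?W = "complex_vector.span F"
    show ?case
    proof (cases "x \<in> ?W")
      case True
      then show ?thesis using insert by (simp add: complex_vector.span_redundant)
    next
      case False
      obtain \<delta> where \<delta>: "\<delta> > 0" and bound: "\<And>a w. w \<in> ?W \<Longrightarrow> cmod a * \<delta> \<le> norm (w + a *\<^sub>C x)"
        using closed_subspace_line_bound[OF complex_vector.subspace_span
            closed_span_finite[OF insert(1)] False] by blast
      obtain a where a: "\<And>n. X n - a n *\<^sub>C x \<in> ?W"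
        using insert.prems(1) by (simp add: complex_vector.span_insert) metis
      obtain B where B: "\<And>n. norm (X n) \<le> B"
        using insert.prems(2) by (auto simp: bounded_iff)
      have aB: "cmod (a n) \<le> B / \<delta>" for n
        using bound[OF a, of "a n" n] B[of n] \<delta> by (simp add: field_simps)
      then have "bounded (range a)" by (auto simp: bounded_iff)
      then obtain r b where r: "strict_mono r" "(a \<circ> r) \<longlonglongrightarrow> b"
        using bounded_imp_convergent_subsequence by blast
      define Y where "Y n = X (r n) - a (r n) *\<^sub>C x" for n
      have "norm (Y n) \<le> B + B / \<delta> * norm x" for n
      proof -
        have "norm (Y n) \<le> norm (X (r n)) + norm (a (r n) *\<^sub>C x)"
          unfolding Y_def by (rule norm_triangle_ineq4)
        also have "norm (a (r n) *\<^sub>C x) \<le> B / \<delta> * norm x"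
          unfolding norm_scaleC by (rule mult_right_mono[OF aB]) simp
        finally show ?thesis using B[of "r n"] by linarith
      qed
      then have "bounded (range Y)" by (auto simp: bounded_iff)
      moreover have "Y n \<in> ?W" for n using a by (simp add: Y_def)
      ultimately obtain s where s: "strict_mono s" "convergent (Y \<circ> s)"
        using insert.IH by blast
      then obtain l where "(Y \<circ> s) \<longlonglongrightarrow> l" by (auto simp: convergent_def)
      moreover have "(a \<circ> r \<circ> s) \<longlonglongrightarrow> b" using LIMSEQ_subseq_LIMSEQ[OF r(2) s(1)] .
      ultimately have "(\<lambda>n. (Y \<circ> s) n + (a \<circ> r \<circ> s) n *\<^sub>C x) \<longlonglongrightarrow> l + b *\<^sub>C x"
        by (intro tendsto_intros)
      then have "convergent (X \<circ> (r \<circ> s))"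
        by (auto simp: Y_def comp_def convergent_def)
      then show ?thesis using r s strict_mono_o by blast
    qed
  qed
  then show ?thesis using that by (auto simp: convergent_def)
qed

text \<open>Without a finite spanning set one can pick unit vectors in \<open>V\<close> with mutual
  distance at least 1/2, and no subsequence of these is Cauchy.\<close>

lemma cfinite_dimI_compact:
  fixes V :: "'a::complex_banach set"
  assumes V: "complex_vector.subspace V"
    and cpt: "\<And>X :: nat \<Rightarrow> 'a. (\<And>n. X n \<in> V) \<Longrightarrow> bounded (range X) \<Longrightarrow> \<exists>r. strict_mono r \<and> convergent (X \<circ> r)"
  shows "cfinite_dim V"
proof (rule ccontr)
  assume inf: "\<not> cfinite_dim V"
  \<comment> \<open>Riesz' lemma: there is always a unit vector far away from a given finite-dimensional subspace.\<close>
  have riesz: "\<exists>x\<in>V. norm x = 1 \<and> (\<forall>w\<in>F. norm (x - w) \<ge> 1/2)" if F: "finite F" "F \<subseteq> V" for F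
  proof -
    let ?W = "complex_vector.span F"
    have WV: "?W \<subseteq> V" using F V by (intro complex_vector.span_minimal)
    obtain y where y: "y \<in> V" "y \<notin> ?W" using inf F by (auto simp: cfinite_dim_def)
    define d where "d = infdist y ?W"
    have ne: "?W \<noteq> {}" using complex_vector.span_zero by blast
    have d: "d > 0"
      unfolding d_def using y closed_span_finite[OF F(1)] ne
      by (metis infdist_nonneg in_closed_iff_infdist_zero less_eq_real_def)
    have "\<exists>w\<in>?W. dist y w < 2 * d"
    proof (rule ccontr)
      assume "\<not> ?thesis"
      then have "2 * d \<le> d"
        unfolding d_def by (subst (2) infdist_notempty[OF ne]) (intro cINF_greatest ne, auto simp: not_less)
      then show False using d by simp
    qed
    then obtain w where w: "w \<in> ?W" "dist y w < 2 * d" by blast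
    \<comment> \<open>\<open>w\<close> is within twice the distance \<open>d\<close> of
      \<open>y\<close>, so after division by \<open>N < 2 * d\<close> the distance to the subspace
      is still more than 1/2.\<close>
    define N where "N = norm (y - w)"
    have N: "N > 0" using y w by (auto simp: N_def)
    have low: "d \<le> norm (y - v)" if "v \<in> ?W" for v
      using infdist_le[OF that, of y] by (simp add: d_def dist_norm)
    let ?x = "(1 / of_real N :: complex) *\<^sub>C (y - w)"
    have "norm ?x = 1" using N by (simp add: norm_scaleC N_def norm_divide)
    moreover have "?x \<in> V"
      using V y w WV by (intro complex_vector.subspace_scale complex_vector.subspace_diff) auto
    moreover have "1/2 \<le> norm (?x - v)" if "v \<in> F" for v
    proof -
      have "v \<in> ?W" using that by (rule complex_vector.span_base)
      then have "w + of_real N *\<^sub>C v \<in> ?W"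
        using w by (intro complex_vector.span_add complex_vector.span_scale)
      then have "d \<le> norm (y - (w + of_real N *\<^sub>C v))" by (rule low)
      also have "y - (w + of_real N *\<^sub>C v) = of_real N *\<^sub>C (?x - v)"
        using N by (simp add: complex_vector.scale_right_diff_distrib scaleC_scaleC)
      also have "norm \<dots> = N * norm (?x - v)" using N by (simp add: norm_scaleC)
      finally have "d \<le> N * norm (?x - v)" .
      moreover have "N < 2 * d" using w by (simp add: N_def dist_norm)
      ultimately have "N * (1/2) < N * norm (?x - v)" by simp
      then show ?thesis using N by simp
    qed
    ultimately show ?thesis by blast
  qed
  have "\<exists>f :: nat \<Rightarrow> 'a. \<forall>n. f n \<in> V \<and> norm (f n) = 1 \<and> (\<forall>m<n. norm (f n - f m) \<ge> 1/2)"
  proof (rule dependent_wellorder_choice)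
    fix n and f :: "nat \<Rightarrow> 'a"
    assume "\<And>y. y < n \<Longrightarrow> f y \<in> V \<and> norm (f y) = 1 \<and> (\<forall>m<y. norm (f y - f m) \<ge> 1/2)"
    then have "f ` {..<n} \<subseteq> V" by auto
    from riesz[OF _ this]
    show "\<exists>r. r \<in> V \<and> norm r = 1 \<and> (\<forall>m<n. norm (r - f m) \<ge> 1/2)" by auto
  qed auto
  then obtain f :: "nat \<Rightarrow> 'a" where f: "\<And>n. f n \<in> V" "\<And>n. norm (f n) = 1"
    "\<And>m n. m < n \<Longrightarrow> norm (f n - f m) \<ge> 1/2" by blast
  have "bounded (range f)" using f(2) by (auto simp: bounded_iff)
  then obtain r where r: "strict_mono r" "convergent (f \<circ> r)" using cpt[of f] f(1) by blast
  then have "Cauchy (f \<circ> r)" by (simp add: Cauchy_convergent_iff)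
  then obtain M where "\<And>m n. m \<ge> M \<Longrightarrow> n \<ge> M \<Longrightarrow> dist ((f \<circ> r) m) ((f \<circ> r) n) < 1/2"
    unfolding Cauchy_def by (metis half_gt_zero zero_less_one)
  from this[of "Suc M" M] have "norm (f (r (Suc M)) - f (r M)) < 1/2" by (simp add: dist_norm)
  moreover have "r M < r (Suc M)" using r by (simp add: strict_mono_Suc_iff)
  ultimately show False using f(3) by (meson not_le)
qed

text \<open>\<open>F\<close> may be dependent modulo \<open>W\<close>, so the coordinates are not
  unique; only some choice of them is bounded by the norm. Combined with open mapping this gives
  solutions of controlled size.\<close>

lemma span_Un_decomposition_bound:
  fixes W :: "'a::complex_banach set"
  assumes F: "finite F" and W: "complex_vector.subspace W" "closed W"
  obtains C where "C \<ge> 0"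
    "\<And>y. y \<in> complex_vector.span (F \<union> W) \<Longrightarrow>
      \<exists>a. y - (\<Sum>f\<in>F. a f *\<^sub>C f) \<in> W \<and> (\<forall>f\<in>F. cmod (a f) \<le> C * norm y)"
proof -
  have "\<exists>C\<ge>0. \<forall>y\<in>complex_vector.span (F \<union> W).
      \<exists>a. y - (\<Sum>f\<in>F. a f *\<^sub>C f) \<in> W \<and> (\<forall>f\<in>F. cmod (a f) \<le> C * norm y)"
    using F
  proof induction
    case empty
    then show ?case using W by (auto simp: complex_vector.span_eq_iff[THEN iffD2])
  next
    case (insert x F)
    let ?V = "complex_vector.span (F \<union> W)"
    obtain C where C: "C \<ge> 0" "\<And>y. y \<in> ?V \<Longrightarrow>
        \<exists>a. y - (\<Sum>f\<in>F. a f *\<^sub>C f) \<in> W \<and> (\<forall>f\<in>F. cmod (a f) \<le> C * norm y)"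
      using insert.IH by blast
    have "\<exists>K\<ge>0. \<forall>y\<in>complex_vector.span (insert x (F \<union> W)). \<exists>b. y - b *\<^sub>C x \<in> ?V \<and> cmod b \<le> K * norm y"
    proof (cases "x \<in> ?V")
      case True
      then show ?thesis
        by (intro exI[of _ 0]) (auto simp: complex_vector.span_redundant intro!: exI[of _ 0])
    next
      case False
      obtain \<delta> where \<delta>: "\<delta> > 0" and bound: "\<And>a w. w \<in> ?V \<Longrightarrow> cmod a * \<delta> \<le> norm (w + a *\<^sub>C x)"
        using closed_subspace_line_bound[OF complex_vector.subspace_span
            closed_span_Un[OF insert(1) W] False] by blast
      have "\<exists>b. y - b *\<^sub>C x \<in> ?V \<and> cmod b \<le> 1 / \<delta> * norm y"
        if y: "y \<in> complex_vector.span (insert x (F \<union> W))" for y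
      proof -
        obtain b where b: "y - b *\<^sub>C x \<in> ?V" using y by (auto simp: complex_vector.span_insert)
        with bound[OF b, of b] \<delta> show ?thesis by (auto simp: field_simps)
      qed
      then show ?thesis using \<delta> by (intro exI[of _ "1/\<delta>"]) auto
    qed
    then obtain K where K: "K \<ge> 0" "\<And>y. y \<in> complex_vector.span (insert x (F \<union> W)) \<Longrightarrow>
        \<exists>b. y - b *\<^sub>C x \<in> ?V \<and> cmod b \<le> K * norm y" by blast
    \<comment> \<open>\<open>K\<close> bounds the new coordinate \<open>b\<close>; the others belong
      to \<open>y - b x\<close>, whose norm is at most
      \<open>(1 + K * norm x) * norm y\<close>.\<close>
    define D where "D = max K (C * (1 + K * norm x))"
    show ?case
    proof (intro exI[of _ D] conjI ballI)
      show "D \<ge> 0" using K by (auto simp: D_def)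
      fix y assume "y \<in> complex_vector.span (insert x F \<union> W)"
      then obtain b where b: "y - b *\<^sub>C x \<in> ?V" "cmod b \<le> K * norm y" using K(2) by auto
      obtain a where a: "y - b *\<^sub>C x - (\<Sum>f\<in>F. a f *\<^sub>C f) \<in> W"
        "\<And>f. f \<in> F \<Longrightarrow> cmod (a f) \<le> C * norm (y - b *\<^sub>C x)"
        using C(2)[OF b(1)] by blast
      have *: "C * norm (y - b *\<^sub>C x) \<le> D * norm y"
      proof -
        have "norm (y - b *\<^sub>C x) \<le> norm y + cmod b * norm x"
          using norm_triangle_ineq4[of y "b *\<^sub>C x"] by (simp add: norm_scaleC)
        also have "\<dots> \<le> norm y + K * norm y * norm x"
          using b(2) by (intro add_left_mono mult_right_mono) auto
        finally have "C * norm (y - b *\<^sub>C x) \<le> C * (norm y + K * norm y * norm x)"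
          using C(1) by (rule mult_left_mono)
        also have "\<dots> = C * (1 + K * norm x) * norm y" by (simp add: algebra_simps)
        also have "\<dots> \<le> D * norm y" by (intro mult_right_mono) (auto simp: D_def)
        finally show ?thesis .
      qed
      have "K * norm y \<le> D * norm y" by (intro mult_right_mono) (auto simp: D_def)
      then have "cmod ((a(x := b)) f) \<le> D * norm y" if "f \<in> insert x F" for f
        using that b(2) a(2)[of f] * by auto
      moreover have "(\<Sum>f\<in>F. (a(x := b)) f *\<^sub>C f) = (\<Sum>f\<in>F. a f *\<^sub>C f)"
        using insert(2) by (intro sum.cong) auto
      then have "y - (\<Sum>f\<in>insert x F. (a(x := b)) f *\<^sub>C f) \<in> W"
        using a(1) insert(1,2) by (simp add: algebra_simps)
      ultimately show "\<exists>a. y - (\<Sum>f\<in>insert x F. a f *\<^sub>C f) \<in> W \<and>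
          (\<forall>f\<in>insert x F. cmod (a f) \<le> D * norm y)" by blast
    qed
  qed
  then show ?thesis using that by blast
qed

section \<open>Separation from closed subspaces and dual families\<close>

lemma Hahn_Banach_separate:
  fixes x :: "'a::complex_normed_vector"
  assumes W: "complex_vector.subspace W" "closed W" and x: "x \<notin> W"
  obtains \<phi> :: "'a \<Rightarrow>\<^sub>C\<^sub>L complex" where "\<phi> x = 1" "\<And>w. w \<in> W \<Longrightarrow> \<phi> w = 0"
proof -
  obtain \<delta> where \<delta>: "\<delta> > 0" and bound: "\<And>a w. w \<in> W \<Longrightarrow> cmod a * \<delta> \<le> norm (w + a *\<^sub>C x)"
    using closed_subspace_line_bound[OF assms] by blast
  define g where "g y = (THE a. y - a *\<^sub>C x \<in> W)" for y
  have g: "g y = a" if y: "y - a *\<^sub>C x \<in> W" for y a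
    unfolding g_def
  proof (rule the_equality)
    fix b assume b: "y - b *\<^sub>C x \<in> W"
    have "(y - b *\<^sub>C x) - (y - a *\<^sub>C x) \<in> W" using complex_vector.subspace_diff[OF W(1) b y] .
    then have "(a - b) *\<^sub>C x \<in> W" by (simp add: complex_vector.scale_left_diff_distrib)
    then have "inverse (a - b) *\<^sub>C (a - b) *\<^sub>C x \<in> W" by (rule complex_vector.subspace_scale[OF W(1)])
    then show "b = a" using x by (cases "a = b") (simp_all add: scaleC_scaleC)
  qed fact
  let ?V = "complex_vector.span (insert x W)"
  have V: "y \<in> ?V \<longleftrightarrow> (\<exists>a. y - a *\<^sub>C x \<in> W)" for y
    using W by (auto simp: complex_vector.span_insert complex_vector.span_eq_iff[THEN iffD2])
  obtain \<phi> :: "'a \<Rightarrow>\<^sub>C\<^sub>L complex" where \<phi>: "\<And>y. y \<in> ?V \<Longrightarrow> \<phi> y = g y"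
  proof (rule Hahn_Banach[of ?V g "1/\<delta>"])
    show "g (y + z) = g y + g z" if yz: "y \<in> ?V" "z \<in> ?V" for y z
    proof -
      obtain a b where ab: "y - a *\<^sub>C x \<in> W" "z - b *\<^sub>C x \<in> W" using yz V by blast
      have "(y - a *\<^sub>C x) + (z - b *\<^sub>C x) \<in> W" using W ab by (intro complex_vector.subspace_add)
      then have "y + z - (a + b) *\<^sub>C x \<in> W" by (simp add: scaleC_add_left algebra_simps)
      then show ?thesis using ab by (simp add: g)
    qed
    show "g (c *\<^sub>C y) = c * g y" if y: "y \<in> ?V" for c y
    proof -
      obtain a where a: "y - a *\<^sub>C x \<in> W" using y V by blast
      have "c *\<^sub>C (y - a *\<^sub>C x) \<in> W" using W a by (intro complex_vector.subspace_scale)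
      then have "c *\<^sub>C y - (c * a) *\<^sub>C x \<in> W"
        by (simp add: complex_vector.scale_right_diff_distrib scaleC_scaleC)
      then show ?thesis using a by (simp add: g)
    qed
    show "cmod (g y) \<le> 1 / \<delta> * norm y" if y: "y \<in> ?V" for y
    proof -
      obtain a where a: "y - a *\<^sub>C x \<in> W" using y V by blast
      show ?thesis using bound[OF a, of a] g[OF a] \<delta> by (simp add: field_simps)
    qed
  qed (use \<delta> in \<open>auto simp: complex_vector.subspace_span\<close>)
  have W0: "0 \<in> W" using W(1) by (rule complex_vector.subspace_0)
  show ?thesis
  proof (rule that)
    have gx: "g x = 1" by (rule g) (simp add: W0)
    have "x \<in> ?V" by (simp add: complex_vector.span_base)
    with gx show "\<phi> x = 1" by (simp add: \<phi>)
    show "\<phi> w = 0" if "w \<in> W" for w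
    proof -
      have "g w = 0" by (rule g) (simp add: that)
      moreover have "w \<in> ?V" using that by (simp add: complex_vector.span_base)
      ultimately show ?thesis by (simp add: \<phi>)
    qed
  qed
qed

lemma not_in_span_of_cindependent_mod:
  assumes "cindependent_mod W B" "finite B" "complex_vector.subspace W" "b \<in> B"
  shows "b \<notin> complex_vector.span ((B - {b}) \<union> W)"
proof
  assume "b \<in> complex_vector.span ((B - {b}) \<union> W)"
  then obtain s w where s: "b = s + w" "s \<in> complex_vector.span (B - {b})" "w \<in> W"
    using assms(3) by (auto simp: complex_vector.span_Un complex_vector.span_eq_iff[THEN iffD2])
  then obtain u where u: "s = (\<Sum>v\<in>B-{b}. u v *\<^sub>C v)"
    using assms(2) by (auto simp: complex_vector.span_finite)
  let ?a = "\<lambda>v. if v = b then 1 else - u v"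
  have "(\<Sum>v\<in>B. ?a v *\<^sub>C v) = b + (\<Sum>v\<in>B-{b}. ?a v *\<^sub>C v)"
    using assms by (subst sum.remove[of B b]) auto
  also have "(\<Sum>v\<in>B-{b}. ?a v *\<^sub>C v) = (\<Sum>v\<in>B-{b}. - (u v *\<^sub>C v))"
    by (intro sum.cong) auto
  also have "b + \<dots> = w" using s(1) u by (simp add: sum_negf algebra_simps)
  finally have "(\<Sum>v\<in>B. ?a v *\<^sub>C v) \<in> W" using s by simp
  then have "\<forall>v\<in>B. ?a v = 0"
    using assms(1)[unfolded cindependent_mod_def, rule_format, of B ?a] assms(2) by blast
  then show False using assms(4) by auto
qed

text \<open>Each functional separates \<open>b\<close> from the span of the other members together
  with \<open>W\<close>; this span is closed because only finitely many vectors are added to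
  \<open>W\<close>.\<close>

lemma ex_dual_family:
  fixes W :: "'a::complex_banach set"
  assumes W: "complex_vector.subspace W" "closed W" and B: "finite B" "cindependent_mod W B"
  obtains q :: "'a \<Rightarrow> 'a \<Rightarrow>\<^sub>C\<^sub>L complex" where
    "\<And>b b'. b \<in> B \<Longrightarrow> b' \<in> B \<Longrightarrow> q b b' = (if b = b' then 1 else 0)"
    "\<And>b w. b \<in> B \<Longrightarrow> w \<in> W \<Longrightarrow> q b w = 0"
proof -
  have "\<exists>\<phi> :: 'a \<Rightarrow>\<^sub>C\<^sub>L complex. \<phi> b = 1 \<and> (\<forall>w\<in>complex_vector.span ((B - {b}) \<union> W). \<phi> w = 0)"
    if b: "b \<in> B" for b
    using Hahn_Banach_separate[OF complex_vector.subspace_span closed_span_Un[OF _ W]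
        not_in_span_of_cindependent_mod[OF B(2,1) W(1) b]] B(1) by (metis finite_Diff)
  then obtain q :: "'a \<Rightarrow> 'a \<Rightarrow>\<^sub>C\<^sub>L complex" where q: "\<And>b. b \<in> B \<Longrightarrow> q b b = 1"
    "\<And>b w. b \<in> B \<Longrightarrow> w \<in> complex_vector.span ((B - {b}) \<union> W) \<Longrightarrow> q b w = 0" by metis
  show ?thesis
  proof (rule that[of q])
    show "q b b' = (if b = b' then 1 else 0)" if "b \<in> B" "b' \<in> B" for b b'
      using that q(1) q(2)[OF that(1) complex_vector.span_base[of b']] by auto
    show "q b w = 0" if "b \<in> B" "w \<in> W" for b w
      using that by (intro q(2) complex_vector.span_base) auto
  qed
qed

section \<open>The open mapping theorem\<close>

text \<open>Successive approximation: it suffices to solve \<open>T x = y\<close> up to an error of half the size of \<open>y\<close>.\<close>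

lemma approximate_preimages_imp_preimages:
  fixes T :: "'a::complex_banach \<Rightarrow>\<^sub>C\<^sub>L 'b::complex_normed_vector"
  assumes C: "C \<ge> 0"
    and approx: "\<And>y e. y \<in> range T \<Longrightarrow> e > 0 \<Longrightarrow> \<exists>x. norm (y - T x) < e \<and> norm x \<le> C * norm y"
    and y: "y \<in> range T"
  shows "\<exists>x. T x = y \<and> norm x \<le> (2 * C + 1) * norm y"
proof (cases "y = 0")
  case True
  then show ?thesis by (intro exI[of _ 0]) simp
next
  case False
  define N where "N = norm y"
  have N: "N > 0" using False by (simp add: N_def)
  \<comment> \<open>The error allowed in step \<open>n\<close> is half of the bound
    \<open>N / 2 ^ n\<close> for the current right-hand side, so that the corrections are dominated
    by a geometric series.\<close>
  define R where "R n z w = (norm (z - T w) < N / 2 ^ Suc n \<and> norm w \<le> C * norm z)" for n :: nat and z w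
  define step where "step n z = (SOME w. R n z w)" for n z
  have step: "R n z (step n z)" if "z \<in> range T" for n z
  proof -
    have "\<exists>w. R n z w" unfolding R_def using N that by (intro approx) auto
    then show ?thesis unfolding step_def by (rule someI_ex)
  qed
  define z where "z = rec_nat y (\<lambda>n z. z - T (step n z))"
  have z0: "z 0 = y" and zS: "z (Suc n) = z n - T (step n (z n))" for n
    by (simp_all add: z_def)
  have zr: "z n \<in> range T" for n
  proof (induction n)
    case (Suc n)
    then obtain x where "z n = T x" by auto
    then have "z (Suc n) = T (x - step n (z n))" by (simp add: zS cblinfun_diff_right)
    then show ?case by simp
  qed (simp add: z0 y)
  have zn: "norm (z n) \<le> N / 2 ^ n" for n
  proof (cases n)
    case (Suc m)
    then show ?thesis using step[OF zr[of m], of m] by (simp add: R_def zS)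
  qed (simp add: z0 N_def)
  define x where "x n = step n (z n)" for n
  have xn: "norm (x n) \<le> C * N * (1/2) ^ n" for n
  proof -
    have "norm (x n) \<le> C * norm (z n)" using step[OF zr, of n] by (simp add: R_def x_def)
    also have "\<dots> \<le> C * (N / 2 ^ n)" using zn C by (intro mult_left_mono)
    finally show ?thesis by (simp add: power_divide)
  qed
  have summ: "summable (\<lambda>n. norm (x n))"
    by (rule summable_comparison_test'[where g="\<lambda>n. C * N * (1/2) ^ n"])
      (use xn in \<open>auto intro!: summable_mult summable_geometric\<close>)
  have Tx: "T (\<Sum>i<n. x i) = y - z n" for n
    by (induction n) (auto simp: z0 zS x_def cblinfun_right_simps)
  have "z \<longlonglongrightarrow> 0"
  proof (rule Lim_null_comparison)
    show "\<forall>\<^sub>F n in sequentially. norm (z n) \<le> N * (1/2) ^ n"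
      using zn by (auto simp: power_divide)
    show "(\<lambda>n. N * (1/2) ^ n) \<longlonglongrightarrow> 0"
      by (intro tendsto_mult_right_zero LIMSEQ_power_zero) auto
  qed
  then have "(\<lambda>n. y - z n) \<longlonglongrightarrow> y - 0" by (intro tendsto_intros)
  moreover have "(\<lambda>n. T (\<Sum>i<n. x i)) \<longlonglongrightarrow> T (suminf x)"
    by (intro tendsto_intros summable_LIMSEQ summable_norm_cancel[OF summ])
  ultimately have "T (suminf x) = y"
    unfolding Tx using LIMSEQ_unique by fastforce
  moreover have "norm (suminf x) \<le> (2 * C + 1) * norm y"
  proof -
    have "norm (suminf x) \<le> (\<Sum>n. norm (x n))" by (rule summable_norm[OF summ])
    also have "\<dots> \<le> (\<Sum>n. C * N * (1/2) ^ n)"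
      by (rule suminf_le[OF xn summ]) (intro summable_mult summable_geometric, simp)
    also have "\<dots> = C * N * (\<Sum>n. (1/2) ^ n)" by (rule suminf_mult) (simp add: summable_geometric)
    also have "\<dots> = 2 * C * N" by (simp add: suminf_geometric)
    finally show ?thesis unfolding N_def
      by (rule order_trans) (simp add: algebra_simps)
  qed
  ultimately show ?thesis by blast
qed

text \<open>Baire's theorem is applied in the range itself, which is completely metrizable as a
  closed subset. The closure of the image of some ball then contains a relatively open piece of the
  range, and successive approximation removes the closure.\<close>

theorem open_mapping:
  fixes T :: "'a::complex_banach \<Rightarrow>\<^sub>C\<^sub>L 'b::complex_banach"
  assumes cl: "closed (range T)"
  obtains C where "C > 0" "\<And>y. y \<in> range T \<Longrightarrow> \<exists>x. T x = y \<and> norm x \<le> C * norm y"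
proof -
  let ?R = "range T"
  have R: "complex_vector.subspace ?R" by (rule subspace_range_cblinfun)
  define A where "A n = closure (T ` ball 0 (real n))" for n
  have AR: "A n \<subseteq> ?R" for n
    unfolding A_def using cl by (intro closure_minimal) auto
  have "\<exists>n. \<exists>y e. e > 0 \<and> y \<in> ?R \<and> ball y e \<inter> ?R \<subseteq> A n"
  proof (rule ccontr)
    assume neg: "\<not> ?thesis"
    have "(top_of_set ?R) interior_of (\<Union>n. A n) = {}"
    proof (rule Baire_category_alt)
      show "completely_metrizable_space (top_of_set ?R) \<or>
          locally_compact_space (top_of_set ?R) \<and> regular_space (top_of_set ?R)"
        using cl completely_metrizable_space_closedin[OF completely_metrizable_space_euclidean]
          closed_closedin by blast
      show "countable (range A)" by simp
      fix S assume "S \<in> range A"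
      then obtain n where S: "S = A n" by auto
      show "closedin (top_of_set ?R) S \<and> (top_of_set ?R) interior_of S = {}"
      proof
        show "closedin (top_of_set ?R) S"
          unfolding S using AR by (auto simp: A_def closedin_closed_eq[OF cl])
        show "(top_of_set ?R) interior_of S = {}"
        proof (rule ccontr)
          assume "\<not> ?thesis"
          then obtain y U where yU: "openin (top_of_set ?R) U" "y \<in> U" "U \<subseteq> A n"
            by (auto simp: S interior_of_def)
          then have "y \<in> ?R" "\<exists>e>0. ball y e \<inter> ?R \<subseteq> U"
            by (auto simp: openin_contains_ball)
          then show False using neg yU by blast
        qed
      qed
    qed
    moreover have "(\<Union>n. A n) = ?R"
    proof
      show "(\<Union>n. A n) \<subseteq> ?R" using AR by blast
      show "?R \<subseteq> (\<Union>n. A n)"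
      proof
        fix y assume "y \<in> ?R"
        then obtain x where x: "y = T x" by auto
        obtain n where "norm x < real n" using reals_Archimedean2 by blast
        then have "y \<in> A n" unfolding A_def x by (intro subsetD[OF closure_subset] imageI) simp
        then show "y \<in> (\<Union>n. A n)" by blast
      qed
    qed
    ultimately have "(top_of_set ?R) interior_of ?R = {}" by simp
    moreover have "(top_of_set ?R) interior_of ?R = ?R"
      by (metis interior_of_topspace topspace_euclidean_subtopology)
    ultimately show False by simp
  qed
  then obtain n y0 e where e: "e > 0" "y0 \<in> ?R" and sub: "ball y0 e \<inter> ?R \<subseteq> A n" by blast
  obtain x0 where x0: "y0 = T x0" using e by auto
  \<comment> \<open>\<open>y\<close> is scaled to norm \<open>e / 2\<close> and moved to the centre
    \<open>y0 = T x0\<close>; an approximate preimage of norm below \<open>n\<close> is shifted back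
    by \<open>x0\<close> and rescaled by \<open>2 * norm y / e\<close>.\<close>
  define C where "C = 2 * (real n + norm x0) / e"
  have C: "C \<ge> 0" using e by (simp add: C_def)
  have approx: "\<exists>x. norm (y - T x) < d \<and> norm x \<le> C * norm y" if y: "y \<in> ?R" and d: "d > 0" for y d
  proof (cases "y = 0")
    case True
    then show ?thesis using d by (intro exI[of _ 0]) auto
  next
    case False
    define r where "r = e / (2 * norm y)"
    have r: "r > 0" using e False by (simp add: r_def)
    have "y0 + of_real r *\<^sub>C y \<in> ?R"
      using R e y by (intro complex_vector.subspace_add complex_vector.subspace_scale)
    moreover have "y0 + of_real r *\<^sub>C y \<in> ball y0 e"
      using e False by (simp add: dist_norm norm_scaleC r_def norm_divide norm_mult)
    ultimately have "y0 + of_real r *\<^sub>C y \<in> A n" using sub by blast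
    then obtain v where v: "v \<in> T ` ball 0 (real n)" "dist v (y0 + of_real r *\<^sub>C y) < d * r"
      unfolding A_def closure_approachable using d r by (meson mult_pos_pos)
    then obtain u where u: "norm u < real n" "v = T u" by auto
    define x where "x = of_real (1 / r) *\<^sub>C (u - x0)"
    have "of_real r *\<^sub>C (T x - y) = v - (y0 + of_real r *\<^sub>C y)"
      using r by (simp add: x_def scaleC_scaleC cblinfun_right_simps u x0
          complex_vector.scale_right_diff_distrib del: of_real_divide flip: of_real_mult)
    then have "r * norm (T x - y) < d * r"
      using v r by (metis dist_norm norm_scaleC norm_of_real abs_of_pos)
    then have "norm (y - T x) < d" using r by (simp add: norm_minus_commute)
    moreover have "norm x \<le> C * norm y"
    proof -
      have "norm x = norm (u - x0) / r" using r by (simp add: x_def norm_scaleC norm_divide)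
      also have "\<dots> \<le> (real n + norm x0) / r"
        using r u norm_triangle_ineq4[of u x0] by (intro divide_right_mono) auto
      also have "\<dots> = C * norm y" using e False by (simp add: r_def C_def field_simps)
      finally show ?thesis .
    qed
    ultimately show ?thesis by blast
  qed
  show ?thesis
  proof (rule that)
    show "2 * C + 1 > 0" using C by simp
  qed (rule approximate_preimages_imp_preimages[OF C approx])
qed

section \<open>Upper semi-Fredholm operators\<close>

text \<open>Upper semi-Fredholm operators are those that are proper on bounded sets; in this form
  products and factors are immediate.\<close>

definition seq_proper :: "('a::complex_banach \<Rightarrow>\<^sub>C\<^sub>L 'b::complex_banach) \<Rightarrow> bool" where
  "seq_proper T \<longleftrightarrow> (\<forall>X. bounded (range X) \<and> convergent (\<lambda>n. T (X n)) \<longrightarrow>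
     (\<exists>r :: nat \<Rightarrow> nat. strict_mono r \<and> convergent (X \<circ> r)))"

lemma convergent_cblinfun: "convergent X \<Longrightarrow> convergent (\<lambda>n. cblinfun_apply T (X n))"
  unfolding convergent_def using tendsto_cblinfun by blast

lemma bounded_range_cblinfun:
  "bounded (range X) \<Longrightarrow> bounded (range (\<lambda>n. cblinfun_apply T (X n)))"
  using bounded_linear_image[OF _ bounded_linear_cblinfun, of "range X" T]
  by (simp add: image_image)

lemma seq_proper_compose:
  fixes S :: "'b::complex_banach \<Rightarrow>\<^sub>C\<^sub>L 'c::complex_banach" and T :: "'a::complex_banach \<Rightarrow>\<^sub>C\<^sub>L 'b"
  shows "seq_proper S \<Longrightarrow> seq_proper T \<Longrightarrow> seq_proper (S o\<^sub>C\<^sub>L T)"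
  unfolding seq_proper_def
proof (intro allI impI)
  fix X :: "nat \<Rightarrow> 'a"
  assume S: "\<forall>X. bounded (range X) \<and> convergent (\<lambda>n. S (X n)) \<longrightarrow>
      (\<exists>r :: nat \<Rightarrow> nat. strict_mono r \<and> convergent (X \<circ> r))"
    and T: "\<forall>X. bounded (range X) \<and> convergent (\<lambda>n. T (X n)) \<longrightarrow>
      (\<exists>r :: nat \<Rightarrow> nat. strict_mono r \<and> convergent (X \<circ> r))"
    and X: "bounded (range X) \<and> convergent (\<lambda>n. (S o\<^sub>C\<^sub>L T) (X n))"
  then obtain r :: "nat \<Rightarrow> nat" where r: "strict_mono r" "convergent ((\<lambda>n. T (X n)) \<circ> r)"
    using bounded_range_cblinfun[of X T] S[rule_format, of "\<lambda>n. T (X n)"] by auto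
  have "bounded (range (X \<circ> r))" using X by (auto intro: bounded_subset)
  then obtain s :: "nat \<Rightarrow> nat" where "strict_mono s" "convergent ((X \<circ> r) \<circ> s)"
    using T[rule_format, of "X \<circ> r"] r by (auto simp: comp_def)
  then show "\<exists>r :: nat \<Rightarrow> nat. strict_mono r \<and> convergent (X \<circ> r)"
    using r by (intro exI[of _ "r \<circ> s"]) (auto simp: strict_mono_o comp_assoc)
qed

lemma seq_proper_right_factor: "seq_proper (S o\<^sub>C\<^sub>L T) \<Longrightarrow> seq_proper T"
  unfolding seq_proper_def using convergent_cblinfun[of _ S] by simp

lemma nullity_finite_iff: "nullity T < \<infinity> \<longleftrightarrow> cfinite_dim (null_space T)"
  by (simp add: nullity_def ecdim_def)

text \<open>If the images converge, open mapping gives preimages of the differences that tend to 0,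
  and what is left lies in the finite-dimensional null space. Conversely, properness makes bounded
  sequences of the null space compact; the range is closed because preimages almost orthogonal to
  the null space must stay bounded.\<close>

theorem upper_semi_Fredholm_iff_seq_proper:
  fixes T :: "'a::complex_banach \<Rightarrow>\<^sub>C\<^sub>L 'a"
  shows "T \<in> upper_semi_Fredholm \<longleftrightarrow> seq_proper T"
proof
  assume "T \<in> upper_semi_Fredholm"
  then have cl: "closed (range T)" and fin: "cfinite_dim (null_space T)"
    by (simp_all add: upper_semi_Fredholm_def nullity_finite_iff del: enat_ord_simps)
  from fin obtain F where F: "finite F" "null_space T \<subseteq> complex_vector.span F"
    by (auto simp: cfinite_dim_def)
  obtain C where C: "C > 0" "\<And>y. y \<in> range T \<Longrightarrow> \<exists>x. T x = y \<and> norm x \<le> C * norm y"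
    using open_mapping[OF cl] by blast
  show "seq_proper T"
    unfolding seq_proper_def
  proof (intro allI impI)
    fix X :: "nat \<Rightarrow> 'a" assume X: "bounded (range X) \<and> convergent (\<lambda>n. T (X n))"
    then obtain l where l: "(\<lambda>n. T (X n)) \<longlonglongrightarrow> l" by (auto simp: convergent_def)
    have "l \<in> range T" by (rule closed_sequentially[OF cl _ l]) simp
    then obtain x0 where x0: "l = T x0" by auto
    have "\<exists>w. T w = T (X n - x0) \<and> norm w \<le> C * norm (T (X n - x0))" for n
      using C(2)[of "T (X n - x0)"] by simp
    then obtain w where w: "\<And>n. T (w n) = T (X n - x0)" "\<And>n. norm (w n) \<le> C * norm (T (X n - x0))"
      by metis
    have "(\<lambda>n. T (X n) - l) \<longlonglongrightarrow> 0" using l by (rule LIM_zero)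
    then have "(\<lambda>n. C * norm (T (X n) - l)) \<longlonglongrightarrow> 0"
      by (intro tendsto_mult_right_zero tendsto_norm_zero)
    then have w0: "w \<longlonglongrightarrow> 0"
      by (rule Lim_null_comparison[rotated]) (use w(2) in \<open>auto simp: x0 cblinfun_diff_right\<close>)
    define Y where "Y n = X n - x0 - w n" for n
    have "Y n \<in> complex_vector.span F" for n
    proof -
      have "T (Y n) = 0" using w(1)[of n] by (simp add: Y_def cblinfun_diff_right)
      then show ?thesis using F by (auto simp: null_space_def)
    qed
    moreover have "bounded (range Y)"
    proof -
      have "bounded (range w)" using w0 convergent_def convergent_imp_bounded by blast
      then obtain B1 where B1: "\<And>n. norm (w n) \<le> B1" by (auto simp: bounded_iff)
      obtain B2 where B2: "\<And>n. norm (X n) \<le> B2" using X by (auto simp: bounded_iff)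
      have "norm (Y n) \<le> B2 + norm x0 + B1" for n
        unfolding Y_def using norm_triangle_ineq4[of "X n - x0" "w n"]
          norm_triangle_ineq4[of "X n" x0] B1[of n] B2[of n] by linarith
      then show ?thesis by (auto simp: bounded_iff)
    qed
    ultimately obtain r :: "nat \<Rightarrow> nat" and m where r: "strict_mono r" "(Y \<circ> r) \<longlonglongrightarrow> m"
      using bounded_seq_span_finite[OF F(1), of Y] by blast
    have "(w \<circ> r) \<longlonglongrightarrow> 0" by (rule LIMSEQ_subseq_LIMSEQ[OF w0 r(1)])
    then have "(\<lambda>n. (Y \<circ> r) n + x0 + (w \<circ> r) n) \<longlonglongrightarrow> m + x0 + 0"
      by (intro tendsto_intros r)
    then have "convergent (X \<circ> r)" by (auto simp: Y_def comp_def convergent_def)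
    with r show "\<exists>r :: nat \<Rightarrow> nat. strict_mono r \<and> convergent (X \<circ> r)" by blast
  qed
next
  assume P: "seq_proper T"
  let ?N = "null_space T"
  have ne: "?N \<noteq> {}" by (auto simp: null_space_def intro: exI[of _ 0])
  have "cfinite_dim ?N"
  proof (rule cfinite_dimI_compact[OF subspace_null_space])
    fix X :: "nat \<Rightarrow> 'a" assume X: "\<And>n. X n \<in> null_space T" "bounded (range X)"
    then have "(\<lambda>n. T (X n)) = (\<lambda>_. 0)" by (auto simp: null_space_def)
    then show "\<exists>r. strict_mono r \<and> convergent (X \<circ> r)"
      using P X by (simp add: seq_proper_def convergent_const)
  qed
  moreover have "closed (range T)"
    unfolding closed_sequential_limits
  proof (intro allI impI)
    fix y l assume "(\<forall>n. y n \<in> range T) \<and> y \<longlonglongrightarrow> l"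
    then have lim: "y \<longlonglongrightarrow> l" and "\<And>n. \<exists>x. y n = T x" by auto
    then obtain x where x: "\<And>n. y n = T (x n)" by metis
    \<comment> \<open>choose preimages that are almost orthogonal to the kernel\<close>
    have "\<exists>v. T v = y n \<and> norm v \<le> 2 * infdist v ?N" for n
    proof (cases "x n \<in> ?N")
      case True
      then show ?thesis by (intro exI[of _ 0]) (simp add: x null_space_def)
    next
      case False
      define d where "d = infdist (x n) ?N"
      have d: "d > 0"
        unfolding d_def using False closed_null_space[of T] ne
        by (metis infdist_nonneg in_closed_iff_infdist_zero less_eq_real_def)
      have "\<exists>k\<in>?N. dist (x n) k < 2 * d"
      proof (rule ccontr)
        assume "\<not> ?thesis"
        then have "2 * d \<le> d"
          unfolding d_def by (subst (2) infdist_notempty[OF ne]) (intro cINF_greatest ne, auto simp: not_less)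
        then show False using d by simp
      qed
      then obtain k where k: "k \<in> ?N" "dist (x n) k < 2 * d" by blast
      have "d \<le> infdist (x n - k) ?N"
        unfolding infdist_notempty[OF ne]
      proof (rule cINF_greatest[OF ne])
        fix m assume "m \<in> ?N"
        then have "k + m \<in> ?N" using k by (auto simp: null_space_def cblinfun_add_right)
        then show "d \<le> dist (x n - k) m"
          unfolding d_def by (metis infdist_le dist_norm diff_diff_add)
      qed
      then show ?thesis using k
        by (intro exI[of _ "x n - k"]) (auto simp: x null_space_def cblinfun_diff_right dist_norm)
    qed
    then obtain v where v: "\<And>n. T (v n) = y n" "\<And>n. norm (v n) \<le> 2 * infdist (v n) ?N" by metis
    show "l \<in> range T"
    proof (cases "bounded (range v)")
      case True
      then obtain r where r: "strict_mono r" "convergent (v \<circ> r)"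
        using P[unfolded seq_proper_def, rule_format, of v] lim by (auto simp: v convergent_def)
      then obtain u where "(v \<circ> r) \<longlonglongrightarrow> u" by (auto simp: convergent_def)
      then have "(\<lambda>n. T ((v \<circ> r) n)) \<longlonglongrightarrow> T u" by (intro tendsto_intros)
      moreover have "(\<lambda>n. T ((v \<circ> r) n)) \<longlonglongrightarrow> l"
        using LIMSEQ_subseq_LIMSEQ[OF lim r(1)] by (simp add: v comp_def)
      ultimately have "l = T u" using LIMSEQ_unique by blast
      then show ?thesis by blast
    next
      case False
      have "\<exists>k. norm (v k) > real n" for n
        using False by (auto simp: bounded_iff not_le)
      then obtain r where r: "\<And>n. norm (v (r n)) > real n" by metis
      \<comment> \<open>If the preimages were unbounded, the normalized ones would accumulate at a
        vector of the null space, from which they keep the distance 1/2.\<close>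
      define u where "u n = of_real (1 / norm (v (r n))) *\<^sub>C v (r n)" for n
      have pos: "norm (v (r n)) > 0" for n using r[of n] by linarith
      have "norm (u n) = 1" for n using pos[of n] by (simp add: u_def norm_scaleC norm_divide)
      then have bu: "bounded (range u)" by (auto simp: bounded_iff)
      have "bounded (range y)" using lim convergent_def convergent_imp_bounded by blast
      then obtain B where B: "\<And>n. norm (y n) \<le> B" by (auto simp: bounded_iff)
      have "(\<lambda>n. T (u n)) \<longlonglongrightarrow> 0"
      proof (rule Lim_null_comparison)
        show "\<forall>\<^sub>F n in sequentially. norm (T (u n)) \<le> B / real n"
        proof (rule eventually_sequentiallyI[of 1])
          fix n :: nat assume n: "n \<ge> 1"
          have "norm (T (u n)) = norm (y (r n)) / norm (v (r n))"
            by (simp add: u_def norm_scaleC v norm_divide)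
          also have "\<dots> \<le> B / real n"
            using n r[of n] B[of "r n"] order_trans[OF norm_ge_zero B[of 0]]
            by (intro frac_le) auto
          finally show "norm (T (u n)) \<le> B / real n" .
        qed
        show "(\<lambda>n. B / real n) \<longlonglongrightarrow> 0" by (rule lim_const_over_n)
      qed
      then obtain s and w where s: "strict_mono (s :: nat \<Rightarrow> nat)" "(u \<circ> s) \<longlonglongrightarrow> w" and
          T0: "(\<lambda>n. T (u n)) \<longlonglongrightarrow> 0"
        using P bu unfolding seq_proper_def convergent_def by blast
      have "(\<lambda>n. T ((u \<circ> s) n)) \<longlonglongrightarrow> T w" by (intro tendsto_intros s)
      moreover have "(\<lambda>n. T ((u \<circ> s) n)) \<longlonglongrightarrow> 0"
        using LIMSEQ_subseq_LIMSEQ[OF T0 s(1)] by (simp add: comp_def)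
      ultimately have wN: "w \<in> ?N" using LIMSEQ_unique by (fastforce simp: null_space_def)
      have far: "1/2 \<le> dist (u n) w" for n
      proof -
        let ?c = "norm (v (r n))"
        have "of_real ?c *\<^sub>C w \<in> ?N" using wN by (simp add: null_space_def)
        then have "infdist (v (r n)) ?N \<le> dist (v (r n)) (of_real ?c *\<^sub>C w)" by (rule infdist_le)
        also have "v (r n) = of_real ?c *\<^sub>C u n" using pos[of n] by (simp add: u_def scaleC_scaleC)
        then have "dist (v (r n)) (of_real ?c *\<^sub>C w) = norm (of_real ?c *\<^sub>C (u n - w))"
          by (metis dist_norm complex_vector.scale_right_diff_distrib)
        also have "\<dots> = ?c * dist (u n) w" by (simp add: norm_scaleC dist_norm)
        finally have "?c \<le> 2 * (?c * dist (u n) w)" using v(2)[of "r n"] by linarith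
        then show ?thesis using pos[of n] by (simp add: field_simps)
      qed
      from s(2) have "\<exists>N. \<forall>n\<ge>N. dist ((u \<circ> s) n) w < 1/2"
        by (rule metric_LIMSEQ_D) simp
      then show ?thesis using far by (metis comp_apply not_le order_refl)
    qed
  qed
  ultimately show "T \<in> upper_semi_Fredholm"
    by (simp add: upper_semi_Fredholm_def nullity_finite_iff del: enat_ord_simps)
qed

lemma upper_semi_Fredholm_compose:
  "S \<in> upper_semi_Fredholm \<Longrightarrow> T \<in> upper_semi_Fredholm \<Longrightarrow> S o\<^sub>C\<^sub>L T \<in> upper_semi_Fredholm"
  for S T :: "'a::complex_banach \<Rightarrow>\<^sub>C\<^sub>L 'a"
  by (simp add: upper_semi_Fredholm_iff_seq_proper seq_proper_compose)

lemma upper_semi_Fredholm_right_factor: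
  "S o\<^sub>C\<^sub>L T \<in> upper_semi_Fredholm \<Longrightarrow> T \<in> upper_semi_Fredholm"
  for S T :: "'a::complex_banach \<Rightarrow>\<^sub>C\<^sub>L 'a"
  unfolding upper_semi_Fredholm_iff_seq_proper by (rule seq_proper_right_factor)

section \<open>Underdetermined holomorphic linear systems\<close>

text \<open>Gaussian elimination with cleared denominators: the new coefficients \<open>b\<close>
  are 2 by 2 minors with the pivot \<open>a i0 j0\<close>. On a connected open set a product of two
  nonzero holomorphic functions is nonzero, so multiplying a solution by the pivot does not kill
  it.\<close>

lemma holomorphic_underdetermined_system:
  fixes a :: "'i \<Rightarrow> 'j \<Rightarrow> complex \<Rightarrow> complex"
  assumes U: "open U" "connected U"
  assumes "finite I" "finite J" "card I < card J"
    "\<And>i j. i \<in> I \<Longrightarrow> j \<in> J \<Longrightarrow> a i j holomorphic_on U" "U \<noteq> {}"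
  shows "\<exists>c. (\<forall>j\<in>J. c j holomorphic_on U) \<and> (\<exists>j\<in>J. \<exists>z\<in>U. c j z \<noteq> 0) \<and>
    (\<forall>i\<in>I. \<forall>z\<in>U. (\<Sum>j\<in>J. a i j z * c j z) = 0)"
  using assms(3-)
proof (induction I arbitrary: J a rule: finite_induct)
  case empty
  then show ?case
    by (intro exI[of _ "\<lambda>_ _. 1"]) (auto simp: card_gt_0_iff)
next
  case (insert i0 I)
  show ?case
  proof (cases "\<forall>j\<in>J. \<forall>z\<in>U. a i0 j z = 0")
    case True
    have "\<exists>c. (\<forall>j\<in>J. c j holomorphic_on U) \<and> (\<exists>j\<in>J. \<exists>z\<in>U. c j z \<noteq> 0) \<and>
      (\<forall>i\<in>I. \<forall>z\<in>U. (\<Sum>j\<in>J. a i j z * c j z) = 0)"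
      using insert by (intro insert.IH) auto
    then show ?thesis using True by auto
  next
    case False
    then obtain j0 z0 where j0: "j0 \<in> J" "z0 \<in> U" "a i0 j0 z0 \<noteq> 0" by blast
    define b where "b i j z = a i0 j0 z * a i j z - a i j0 z * a i0 j z" for i j z
    let ?J = "J - {j0}"
    have "\<exists>c. (\<forall>j\<in>?J. c j holomorphic_on U) \<and> (\<exists>j\<in>?J. \<exists>z\<in>U. c j z \<noteq> 0) \<and>
      (\<forall>i\<in>I. \<forall>z\<in>U. (\<Sum>j\<in>?J. b i j z * c j z) = 0)"
      using insert.prems insert.hyps j0(1) unfolding b_def
      by (intro insert.IH) (auto intro!: holomorphic_intros)
    then obtain c where c: "\<And>j. j \<in> ?J \<Longrightarrow> c j holomorphic_on U" "\<exists>j\<in>?J. \<exists>z\<in>U. c j z \<noteq> 0"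
      "\<And>i z. i \<in> I \<Longrightarrow> z \<in> U \<Longrightarrow> (\<Sum>j\<in>?J. b i j z * c j z) = 0" by blast
    \<comment> \<open>Back substitution multiplied by the pivot: the component \<open>j0\<close>
      solves equation \<open>i0\<close>, and the others carry the pivot as a factor.\<close>
    define d where "d j z = (if j = j0 then - (\<Sum>j\<in>?J. a i0 j z * c j z) else a i0 j0 z * c j z)" for j z
    have split: "(\<Sum>j\<in>J. a i j z * d j z) =
        (\<Sum>j\<in>?J. b i j z * c j z)" for i z
    proof -
      have "(\<Sum>j\<in>J. a i j z * d j z) = a i j0 z * d j0 z + (\<Sum>j\<in>?J. a i j z * d j z)"
        using insert.prems j0(1) by (intro sum.remove)
      also have "(\<Sum>j\<in>?J. a i j z * d j z) = (\<Sum>j\<in>?J. a i0 j0 z * a i j z * c j z)"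
        by (intro sum.cong) (auto simp: d_def)
      also have "a i j0 z * d j0 z = - (\<Sum>j\<in>?J. a i j0 z * a i0 j z * c j z)"
        by (simp add: d_def sum_distrib_left mult.assoc)
      finally show ?thesis by (simp add: b_def left_diff_distrib sum_subtractf)
    qed
    show ?thesis
    proof (intro exI[of _ d] conjI ballI)
      fix j assume "j \<in> J"
      then have "(if j = j0 then (\<lambda>z. - (\<Sum>j\<in>?J. a i0 j z * c j z))
          else (\<lambda>z. a i0 j0 z * c j z)) holomorphic_on U"
        using insert.prems(3) c(1) j0(1) by (auto intro!: holomorphic_intros)
      moreover have "d j = (if j = j0 then (\<lambda>z. - (\<Sum>j\<in>?J. a i0 j z * c j z))
          else (\<lambda>z. a i0 j0 z * c j z))" by (auto simp: d_def)
      ultimately show "d j holomorphic_on U" by simp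
    next
      obtain j z1 where j: "j \<in> ?J" "z1 \<in> U" "c j z1 \<noteq> 0" using c(2) by blast
      have "\<exists>z\<in>U. a i0 j0 z * c j z \<noteq> 0"
      proof (rule ccontr)
        assume "\<not> ?thesis"
        then have "\<And>z. z \<in> U \<Longrightarrow> a i0 j0 z = 0 \<or> c j z = 0" by auto
        moreover have "open (U \<inter> c j -` (- {0}))"
          using c(1)[OF j(1)] U(1)
          by (intro continuous_open_preimage) (auto intro: holomorphic_on_imp_continuous_on)
        then have "open {z\<in>U. c j z \<noteq> 0}" by (simp add: vimage_def Int_def conj_commute)
        ultimately have "a i0 j0 z0 = 0"
          using analytic_continuation_open[of "{z\<in>U. c j z \<noteq> 0}" U "a i0 j0" "\<lambda>_. 0" z0]
            insert.prems(3)[of i0 j0] U j j0 by auto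
        with j0 show False by blast
      qed
      then show "\<exists>j\<in>J. \<exists>z\<in>U. d j z \<noteq> 0" using j by (auto simp: d_def)
    next
      fix i z assume i: "i \<in> insert i0 I" and z: "z \<in> U"
      show "(\<Sum>j\<in>J. a i j z * d j z) = 0"
        unfolding split using i c(3) z by (auto simp: b_def)
    qed
  qed
qed

text \<open>Plain linear algebra as the case of constant coefficients, evaluated at a point where
  the solution does not vanish.\<close>

corollary underdetermined_system:
  fixes m :: "'i \<Rightarrow> 'j \<Rightarrow> complex"
  assumes "finite I" "finite J" "card I < card J"
  obtains c where "\<exists>j\<in>J. c j \<noteq> 0" "\<And>i. i \<in> I \<Longrightarrow> (\<Sum>j\<in>J. m i j * c j) = 0"
proof -
  obtain c where c: "\<exists>j\<in>J. \<exists>z. c j z \<noteq> 0" "\<And>i z. i \<in> I \<Longrightarrow> (\<Sum>j\<in>J. m i j * c j z) = 0"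
    using holomorphic_underdetermined_system[OF open_UNIV connected_UNIV assms, of "\<lambda>i j _. m i j"]
    by auto
  then obtain z where "\<exists>j\<in>J. c j z \<noteq> 0" by blast
  with c(2) show ?thesis by (intro that[of "\<lambda>j. c j z"]) auto
qed

lemma divide_out_zero:
  fixes c :: "complex \<Rightarrow> complex"
  assumes "c holomorphic_on ball 0 r" "c 0 = 0" "r > 0"
  obtains d where "d holomorphic_on ball 0 r" "\<And>z. c z = z * d z"
proof -
  define d where "d z = (if z = 0 then deriv c 0 else c z / z)" for z
  have "d holomorphic_on ball 0 r"
    unfolding d_def using pole_lemma_open[of c "ball 0 r" 0, unfolded assms(2) diff_zero] assms(1)
    by simp
  moreover have "c z = z * d z" for z
    using assms by (simp add: d_def)
  ultimately show ?thesis by (rule that)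
qed

lemma holomorphic_on_ball_tendsto:
  "f holomorphic_on ball a r \<Longrightarrow> r > 0 \<Longrightarrow> f \<midarrow>a\<rightarrow> f a"
  for f :: "complex \<Rightarrow> complex"
  by (meson centre_in_ball continuous_on_eq_continuous_at holomorphic_on_imp_continuous_on
      isContD open_ball)

text \<open>The solution will serve as the coefficients of an eigenvector and must not vanish at the
  origin. A common factor \<open>z\<close> can be divided out of all components, and the order of
  the zero of one fixed component bounds how often this happens.\<close>

lemma holomorphic_underdetermined_system_normalized:
  fixes a :: "'i \<Rightarrow> 'j \<Rightarrow> complex \<Rightarrow> complex"
  assumes r: "r > 0" and I: "finite I" and J: "finite J" "card I < card J"
    and hol: "\<And>i j. i \<in> I \<Longrightarrow> j \<in> J \<Longrightarrow> a i j holomorphic_on ball 0 r"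
  obtains c where "\<And>j. j \<in> J \<Longrightarrow> c j holomorphic_on ball 0 r" "\<exists>j\<in>J. c j 0 \<noteq> 0"
    "\<And>i z. i \<in> I \<Longrightarrow> z \<in> ball 0 r \<Longrightarrow> (\<Sum>j\<in>J. a i j z * c j z) = 0"
proof -
  let ?B = "ball (0::complex) r"
  define P where "P c \<longleftrightarrow> (\<forall>j\<in>J. c j holomorphic_on ?B) \<and>
    (\<forall>i\<in>I. \<forall>z\<in>?B. (\<Sum>j\<in>J. a i j z * c j z) = 0)" for c
  obtain c where c: "P c" "\<exists>j\<in>J. \<exists>z\<in>?B. c j z \<noteq> 0"
    using holomorphic_underdetermined_system[of ?B I J a] I J hol r by (auto simp: P_def)
  then obtain j0 z0 where j0: "j0 \<in> J" "z0 \<in> ?B" "c j0 z0 \<noteq> 0" by blast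
  \<comment> \<open>The order of \<open>c j0\<close> at the origin, in a form that includes order
    0.\<close>
  have "\<exists>n g. g \<midarrow>0\<rightarrow> g 0 \<and> g 0 \<noteq> 0 \<and> (\<forall>\<^sub>F z in at 0. c j0 z = z ^ n * g z)"
  proof (cases "c j0 0 = 0")
    case False
    have "c j0 \<midarrow>0\<rightarrow> c j0 0"
      using c r j0 by (intro holomorphic_on_ball_tendsto) (auto simp: P_def)
    with False show ?thesis by (intro exI[of _ 0] exI[of _ "c j0"]) auto
  next
    case True
    have "\<not> c j0 constant_on ?B" using True j0 r by (force simp: constant_on_def)
    then obtain g s n where s: "0 < s" "g holomorphic_on ball 0 s"
        "\<And>w. w \<in> ball 0 s \<Longrightarrow> c j0 w = (w - 0) ^ n * g w" "\<And>w. w \<in> ball 0 s \<Longrightarrow> g w \<noteq> 0"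
      using holomorphic_factor_zero_nonconstant[of "c j0" ?B 0] c j0 True r
      by (auto simp: P_def) metis
    have "g \<midarrow>0\<rightarrow> g 0"
      using s by (intro holomorphic_on_ball_tendsto)
    moreover have "\<forall>\<^sub>F z in at 0. c j0 z = z ^ n * g z"
      using s by (auto simp: eventually_at dist_norm intro!: exI[of _ s])
    ultimately show ?thesis using s by (intro exI[of _ n] exI[of _ g]) auto
  qed
  then obtain n g where g: "g \<midarrow>0\<rightarrow> g 0" "g 0 \<noteq> 0"
    and n: "\<forall>\<^sub>F z in at 0. c j0 z = z ^ n * g z" by blast
  \<comment> \<open>as long as all components vanish at the origin, divide by the variable\<close>
  have "\<exists>c. P c \<and> (\<exists>j\<in>J. c j 0 \<noteq> 0)"
    using c(1) n
  proof (induction n arbitrary: c)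
    case 0
    have "c j0 \<midarrow>0\<rightarrow> c j0 0"
      using 0 r j0 by (intro holomorphic_on_ball_tendsto) (auto simp: P_def)
    moreover have "c j0 \<midarrow>0\<rightarrow> g 0"
      using g(1) 0(2) by (subst tendsto_cong[of _ g]) auto
    ultimately have "c j0 0 = g 0" using LIM_unique by blast
    then show ?case using j0(1) g(2) 0(1) by (intro exI[of _ c] conjI bexI[of _ j0]) simp_all
  next
    case (Suc n)
    show ?case
    proof (cases "\<exists>j\<in>J. c j 0 \<noteq> 0")
      case True
      then show ?thesis using Suc by blast
    next
      case False
      have "\<exists>d. d holomorphic_on ?B \<and> (\<forall>z. c j z = z * d z)" if "j \<in> J" for j
        using divide_out_zero[of "c j" r] False Suc.prems(1) that r unfolding P_def by metis
      then obtain d where d: "\<And>j. j \<in> J \<Longrightarrow> d j holomorphic_on ?B"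
        "\<And>j z. j \<in> J \<Longrightarrow> c j z = z * d j z" by metis
      have "P d"
        unfolding P_def
      proof (intro conjI ballI)
        fix i z assume i: "i \<in> I" and z: "z \<in> ?B"
        let ?f = "\<lambda>z. \<Sum>j\<in>J. a i j z * d j z"
        have f0: "?f z = 0" if "z \<in> ?B" "z \<noteq> 0" for z
        proof -
          have "z * ?f z = (\<Sum>j\<in>J. a i j z * c j z)"
            using d(2) by (auto simp: sum_distrib_left algebra_simps intro!: sum.cong)
          then show ?thesis using Suc.prems(1) i that by (auto simp: P_def)
        qed
        have "?f holomorphic_on ?B" using hol d(1) i by (intro holomorphic_intros)
        then have "?f \<midarrow>0\<rightarrow> ?f 0"
          using r by (intro holomorphic_on_ball_tendsto)
        moreover have "?f \<midarrow>0\<rightarrow> 0"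
        proof (rule tendsto_eventually)
          show "\<forall>\<^sub>F z in at 0. ?f z = 0"
            using f0 r by (auto simp: eventually_at dist_norm intro!: exI[of _ r])
        qed
        ultimately have "?f 0 = 0" using LIM_unique by blast
        then show "?f z = 0" using f0 z by (cases "z = 0") auto
      qed (use d in auto)
      moreover have "\<forall>\<^sub>F z in at 0. d j0 z = z ^ n * g z"
        using Suc.prems(2) eventually_neq_at_within[of 0 0]
        by eventually_elim (use d(2)[OF j0(1)] in auto)
      ultimately show ?thesis by (rule Suc.IH)
    qed
  qed
  then show ?thesis using that unfolding P_def by blast
qed

section \<open>Dimension of quotients and the index of a product\<close>

lemma cindependent_mod_subset:
  "cindependent_mod W B \<Longrightarrow> B' \<subseteq> B \<Longrightarrow> cindependent_mod W B'"
  unfolding cindependent_mod_def by blast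

lemma cindependent_modD:
  "cindependent_mod W B \<Longrightarrow> finite S \<Longrightarrow> S \<subseteq> B \<Longrightarrow> (\<Sum>x\<in>S. a x *\<^sub>C x) \<in> W \<Longrightarrow> x \<in> S \<Longrightarrow> a x = 0"
  unfolding cindependent_mod_def by blast

lemma cindependent_mod_finite:
  assumes "finite B"
  shows "cindependent_mod W B \<longleftrightarrow> (\<forall>a. (\<Sum>x\<in>B. a x *\<^sub>C x) \<in> W \<longrightarrow> (\<forall>x\<in>B. a x = 0))"
proof
  assume "cindependent_mod W B"
  then show "\<forall>a. (\<Sum>x\<in>B. a x *\<^sub>C x) \<in> W \<longrightarrow> (\<forall>x\<in>B. a x = 0)"
    using assms unfolding cindependent_mod_def by (metis subset_refl)
next
  assume *: "\<forall>a. (\<Sum>x\<in>B. a x *\<^sub>C x) \<in> W \<longrightarrow> (\<forall>x\<in>B. a x = 0)"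
  show "cindependent_mod W B"
    unfolding cindependent_mod_def
  proof (intro allI impI)
    fix S a assume S: "finite S \<and> S \<subseteq> B \<and> (\<Sum>x\<in>S. a x *\<^sub>C x) \<in> W"
    let ?b = "\<lambda>x. if x \<in> S then a x else 0"
    have "(\<Sum>x\<in>B. ?b x *\<^sub>C x) = (\<Sum>x\<in>S. ?b x *\<^sub>C x)"
      using S assms by (intro sum.mono_neutral_right) auto
    also have "\<dots> = (\<Sum>x\<in>S. a x *\<^sub>C x)" by (intro sum.cong) auto
    finally have "\<forall>x\<in>B. ?b x = 0" using S *[rule_format, of ?b] by simp
    then show "\<forall>x\<in>S. a x = 0" using S by (metis subsetD)
  qed
qed

text \<open>For subspaces \<open>W \<subseteq> V\<close> this is the dimension of
  \<open>V / W\<close>. Nullity and defect are both instances, so one dimension theory serves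
  kernels and cokernels, infinite values included.\<close>

definition reldim :: "'a::complex_normed_vector set \<Rightarrow> 'a set \<Rightarrow> enat" where
  "reldim V W = (SUP B \<in> {B. finite B \<and> B \<subseteq> V \<and> cindependent_mod W B}. enat (card B))"

lemma ecodim_eq_reldim: "ecodim W = reldim UNIV W"
  by (simp add: ecodim_def reldim_def)

text \<open>Subsets of independent sets are independent, so the sizes occurring in the supremum form
  an initial segment and every finite lower bound is attained. Arguing with finite lower bounds
  treats infinite dimensions uniformly.\<close>

lemma le_reldim_iff:
  "enat n \<le> reldim V W \<longleftrightarrow> (\<exists>B. finite B \<and> B \<subseteq> V \<and> cindependent_mod W B \<and> card B = n)"
proof
  assume n: "enat n \<le> reldim V W"
  show "\<exists>B. finite B \<and> B \<subseteq> V \<and> cindependent_mod W B \<and> card B = n"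
  proof (rule ccontr)
    assume neg: "\<not> ?thesis"
    have lt: "card B < n" if B: "finite B" "B \<subseteq> V" "cindependent_mod W B" for B
    proof (rule ccontr)
      assume "\<not> card B < n"
      then obtain B' where "B' \<subseteq> B" "card B' = n" "finite B'"
        using obtain_subset_with_card_n[of n B] B(1) by (metis not_less)
      moreover from this have "cindependent_mod W B'" "B' \<subseteq> V"
        using cindependent_mod_subset[OF B(3)] B(2) by auto
      ultimately show False using neg by blast
    qed
    have "cindependent_mod W {}" by (simp add: cindependent_mod_def)
    with lt[of "{}"] have n0: "n > 0" by simp
    have "reldim V W \<le> enat (n - 1)"
      unfolding reldim_def
    proof (rule SUP_least)
      fix B assume "B \<in> {B. finite B \<and> B \<subseteq> V \<and> cindependent_mod W B}"
      then have "card B < n" using lt by blast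
      then show "enat (card B) \<le> enat (n - 1)" by simp
    qed
    also have "\<dots> < enat n" using n0 by simp
    finally show False using n by simp
  qed
next
  assume "\<exists>B. finite B \<and> B \<subseteq> V \<and> cindependent_mod W B \<and> card B = n"
  then show "enat n \<le> reldim V W"
    unfolding reldim_def by (auto intro: SUP_upper)
qed

lemma enat_eqI: "(\<And>n. enat n \<le> a \<longleftrightarrow> enat n \<le> b) \<Longrightarrow> a = b"
proof -
  assume *: "\<And>n. enat n \<le> a \<longleftrightarrow> enat n \<le> b"
  show "a = b"
  proof (cases a)
    case (enat m)
    with *[of m] *[of "Suc m"] show ?thesis by (cases b) auto
  next
    case infinity
    have "b \<noteq> enat m" for m using *[of "Suc m"] infinity by auto
    then show ?thesis using infinity by (cases b) auto
  qed
qed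

lemma enat_add_leI:
  assumes "\<And>m n. enat m \<le> a \<Longrightarrow> enat n \<le> b \<Longrightarrow> enat (m + n) \<le> c"
  shows "a + b \<le> c"
proof (cases c)
  case (enat k)
  have "\<exists>m. a = enat m"
    using assms[of "Suc k" 0] enat by (cases a) (auto simp: zero_enat_def[symmetric])
  moreover have "\<exists>m. b = enat m"
    using assms[of 0 "Suc k"] enat by (cases b) (auto simp: zero_enat_def[symmetric])
  ultimately show ?thesis using assms by auto
qed simp

text \<open>The exchange argument: more vectors than generators modulo \<open>W\<close> give an
  underdetermined system, whose solution is a nontrivial relation modulo \<open>W\<close>.\<close>

lemma reldim_le_card:
  assumes S: "finite S" and W: "complex_vector.subspace W" and V: "V \<subseteq> complex_vector.span (S \<union> W)"
  shows "reldim V W \<le> enat (card S)"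
proof -
  have "card B \<le> card S" if B: "finite B" "B \<subseteq> V" "cindependent_mod W B" for B
  proof (rule ccontr)
    assume "\<not> ?thesis"
    then have card: "card S < card B" by simp
    have "\<exists>u. b - (\<Sum>s\<in>S. u s *\<^sub>C s) \<in> W" if b: "b \<in> B" for b
    proof -
      have "b \<in> complex_vector.span (S \<union> W)" using b B V by blast
      then obtain s w where "b = s + w" "s \<in> complex_vector.span S" "w \<in> W"
        using W by (auto simp: complex_vector.span_Un complex_vector.span_eq_iff[THEN iffD2])
      moreover from this obtain u where "s = (\<Sum>v\<in>S. u v *\<^sub>C v)"
        using S by (auto simp: complex_vector.span_finite)
      ultimately show ?thesis by (intro exI[of _ u]) simp
    qed
    then obtain u where u: "\<And>b. b \<in> B \<Longrightarrow> b - (\<Sum>s\<in>S. u b s *\<^sub>C s) \<in> W" by metis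
    obtain c where c: "\<exists>b\<in>B. c b \<noteq> 0" "\<And>s. s \<in> S \<Longrightarrow> (\<Sum>b\<in>B. u b s * c b) = 0"
      using underdetermined_system[OF S B(1) card, of "\<lambda>s b. u b s"] by blast
    have "(\<Sum>b\<in>B. c b *\<^sub>C (b - (\<Sum>s\<in>S. u b s *\<^sub>C s))) \<in> W"
      using W u by (intro complex_vector.subspace_sum complex_vector.subspace_scale) auto
    also have "(\<Sum>b\<in>B. c b *\<^sub>C (b - (\<Sum>s\<in>S. u b s *\<^sub>C s))) =
        (\<Sum>b\<in>B. c b *\<^sub>C b) - (\<Sum>b\<in>B. \<Sum>s\<in>S. (u b s * c b) *\<^sub>C s)"
      by (simp add: complex_vector.scale_right_diff_distrib sum_subtractf
          complex_vector.scale_sum_right scaleC_scaleC mult.commute)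
    also have "(\<Sum>b\<in>B. \<Sum>s\<in>S. (u b s * c b) *\<^sub>C s) = (\<Sum>s\<in>S. (\<Sum>b\<in>B. u b s * c b) *\<^sub>C s)"
      by (subst sum.swap) (simp add: complex_vector.scale_sum_left)
    also have "\<dots> = 0" using c(2) by simp
    finally have "(\<Sum>b\<in>B. c b *\<^sub>C b) \<in> W" by simp
    then show False using B c(1) by (auto simp: cindependent_mod_finite)
  qed
  then show ?thesis unfolding reldim_def by (intro SUP_least) auto
qed

lemma ex_basis_mod:
  assumes W: "complex_vector.subspace W" and n: "reldim V W = enat n"
  obtains B where "finite B" "B \<subseteq> V" "cindependent_mod W B" "card B = n"
    "V \<subseteq> complex_vector.span (B \<union> W)"
proof -
  obtain B where B: "finite B" "B \<subseteq> V" "cindependent_mod W B" "card B = n"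
    using n le_reldim_iff[of n V W] by auto
  have "v \<in> complex_vector.span (B \<union> W)" if v: "v \<in> V" for v
  proof (rule ccontr)
    assume v': "v \<notin> complex_vector.span (B \<union> W)"
    then have vB: "v \<notin> B" by (auto intro: complex_vector.span_base)
    have "cindependent_mod W (insert v B)"
      unfolding cindependent_mod_finite[OF finite.insertI[OF B(1)]]
    proof (intro allI impI)
      fix a assume "(\<Sum>x\<in>insert v B. a x *\<^sub>C x) \<in> W"
      then have *: "a v *\<^sub>C v + (\<Sum>x\<in>B. a x *\<^sub>C x) \<in> W" using B(1) vB by simp
      have "(\<Sum>x\<in>B. a x *\<^sub>C x) \<in> complex_vector.span (B \<union> W)"
        by (intro complex_vector.span_sum complex_vector.span_scale complex_vector.span_base) auto
      from complex_vector.span_diff[OF complex_vector.span_base[of _ "B \<union> W"] this] *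
      have "a v *\<^sub>C v \<in> complex_vector.span (B \<union> W)" by fastforce
      then have "inverse (a v) *\<^sub>C a v *\<^sub>C v \<in> complex_vector.span (B \<union> W)"
        by (rule complex_vector.span_scale)
      then have a0: "a v = 0" using v' by (cases "a v = 0") (simp_all add: scaleC_scaleC)
      then have "\<forall>x\<in>B. a x = 0" using * B by (simp add: cindependent_mod_finite)
      with a0 show "\<forall>x\<in>insert v B. a x = 0" by simp
    qed
    then have "enat (Suc n) \<le> reldim V W"
      unfolding le_reldim_iff using B v vB by (intro exI[of _ "insert v B"]) auto
    then show False using n by simp
  qed
  with B show ?thesis using that by blast
qed

text \<open>Bases of \<open>U\<close> modulo \<open>V\<close> and of \<open>V\<close> modulo
  \<open>W\<close> combine to one of \<open>U\<close> modulo \<open>W\<close>; the lower bound uses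
  finite independent sets only and so covers infinite dimensions.\<close>

lemma reldim_add:
  assumes W: "complex_vector.subspace W" and V: "complex_vector.subspace V" and sub: "W \<subseteq> V" "V \<subseteq> U"
  shows "reldim U W = reldim U V + reldim V W"
proof (rule antisym)
  show "reldim U W \<le> reldim U V + reldim V W"
  proof (cases "reldim U V = \<infinity> \<or> reldim V W = \<infinity>")
    case True
    then show ?thesis by auto
  next
    case False
    then obtain m n where mn: "reldim U V = enat m" "reldim V W = enat n" by auto
    obtain B where B: "finite B" "card B = m" "U \<subseteq> complex_vector.span (B \<union> V)"
      using ex_basis_mod[OF V mn(1)] by metis
    obtain B' where B': "finite B'" "card B' = n" "V \<subseteq> complex_vector.span (B' \<union> W)"
      using ex_basis_mod[OF W mn(2)] by metis
    have "B \<union> V \<subseteq> complex_vector.span (B \<union> B' \<union> W)"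
      using B'(3) complex_vector.span_mono[of "B' \<union> W" "B \<union> B' \<union> W"]
      by (auto intro: complex_vector.span_base)
    then have "U \<subseteq> complex_vector.span (B \<union> B' \<union> W)"
      using B(3) complex_vector.span_minimal[OF _ complex_vector.subspace_span] by blast
    then have "reldim U W \<le> enat (card (B \<union> B'))"
      using B B' W by (intro reldim_le_card) auto
    also have "\<dots> \<le> enat (m + n)" using B B' card_Un_le[of B B'] by simp
    finally show ?thesis by (simp add: mn)
  qed
  show "reldim U V + reldim V W \<le> reldim U W"
  proof (rule enat_add_leI)
    fix m n assume "enat m \<le> reldim U V" "enat n \<le> reldim V W"
    then obtain B B' where B: "finite B" "B \<subseteq> U" "cindependent_mod V B" "card B = m"
      and B': "finite B'" "B' \<subseteq> V" "cindependent_mod W B'" "card B' = n"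
      unfolding le_reldim_iff by blast
    have sumV: "(\<Sum>x\<in>B'. a x *\<^sub>C x) \<in> V" for a
      using V B' by (intro complex_vector.subspace_sum complex_vector.subspace_scale) auto
    have disj: "B \<inter> B' = {}"
    proof (rule ccontr)
      assume "B \<inter> B' \<noteq> {}"
      then obtain b where b: "b \<in> B" "b \<in> V" using B' by blast
      then show False using cindependent_modD[OF B(3), of "{b}" "\<lambda>_. 1" b] by simp
    qed
    have "cindependent_mod W (B \<union> B')"
      unfolding cindependent_mod_finite[OF finite_UnI[OF B(1) B'(1)]]
    proof (intro allI impI)
      fix a assume "(\<Sum>x\<in>B \<union> B'. a x *\<^sub>C x) \<in> W"
      then have *: "(\<Sum>x\<in>B. a x *\<^sub>C x) + (\<Sum>x\<in>B'. a x *\<^sub>C x) \<in> W"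
        using B B' disj by (simp add: sum.union_disjoint)
      then have "(\<Sum>x\<in>B. a x *\<^sub>C x) + (\<Sum>x\<in>B'. a x *\<^sub>C x) - (\<Sum>x\<in>B'. a x *\<^sub>C x) \<in> V"
        using sub sumV V by (intro complex_vector.subspace_diff) auto
      then have 0: "\<forall>x\<in>B. a x = 0" using B by (simp add: cindependent_mod_finite)
      then have "\<forall>x\<in>B'. a x = 0" using * B' by (simp add: cindependent_mod_finite)
      with 0 show "\<forall>x\<in>B \<union> B'. a x = 0" by blast
    qed
    then show "enat (m + n) \<le> reldim U W"
      unfolding le_reldim_iff using B B' sub disj
      by (intro exI[of _ "B \<union> B'"]) (auto simp: card_Un_disjoint)
  qed
qed

text \<open>\<open>A\<close> induces a map of quotients that is injective because its null space
  lies in \<open>W\<close>; independent sets are transported in both directions.\<close>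

lemma reldim_image:
  fixes A :: "'a::complex_normed_vector \<Rightarrow>\<^sub>C\<^sub>L 'b::complex_normed_vector"
  assumes W: "complex_vector.subspace W" and N: "null_space A \<subseteq> W"
  shows "reldim (A ` V) (A ` W) = reldim V W"
proof (rule enat_eqI)
  fix n
  have mem: "x \<in> W" if "A x \<in> A ` W" for x
  proof -
    obtain w where w: "w \<in> W" "A x = A w" using \<open>A x \<in> A ` W\<close> by blast
    then have "x - w \<in> W" using N by (auto simp: null_space_def cblinfun_diff_right)
    from complex_vector.subspace_add[OF W this w(1)] show ?thesis by simp
  qed
  show "enat n \<le> reldim (A ` V) (A ` W) \<longleftrightarrow> enat n \<le> reldim V W"
  proof
    assume "enat n \<le> reldim V W"
    then obtain B where B: "finite B" "B \<subseteq> V" "cindependent_mod W B" "card B = n"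
      unfolding le_reldim_iff by blast
    have inj: "inj_on A B"
    proof (rule inj_onI, rule ccontr)
      fix x y assume xy: "x \<in> B" "y \<in> B" "A x = A y" "x \<noteq> y"
      then have "x - y \<in> W" using N by (auto simp: null_space_def cblinfun_diff_right)
      then have "(\<Sum>v\<in>{x, y}. (if v = x then 1 else - 1) *\<^sub>C v) \<in> W"
        using xy by (simp add: complex_vector.scale_minus_left)
      then show False
        using cindependent_modD[OF B(3), of "{x, y}" "\<lambda>v. if v = x then 1 else - 1" x] xy by simp
    qed
    have "cindependent_mod (A ` W) (A ` B)"
      unfolding cindependent_mod_finite[OF finite_imageI[OF B(1)]]
    proof (intro allI impI)
      fix a assume "(\<Sum>y\<in>A ` B. a y *\<^sub>C y) \<in> A ` W"
      then have "A (\<Sum>x\<in>B. a (A x) *\<^sub>C x) \<in> A ` W"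
        using inj by (simp add: sum.reindex cblinfun_right_simps)
      then have "(\<Sum>x\<in>B. a (A x) *\<^sub>C x) \<in> W" by (rule mem)
      then show "\<forall>y\<in>A ` B. a y = 0"
        using cindependent_modD[OF B(3,1) subset_refl, of "\<lambda>x. a (A x)"] by blast
    qed
    then show "enat n \<le> reldim (A ` V) (A ` W)"
      unfolding le_reldim_iff using B inj by (intro exI[of _ "A ` B"]) (auto simp: card_image)
  next
    assume "enat n \<le> reldim (A ` V) (A ` W)"
    then obtain B where B: "finite B" "B \<subseteq> A ` V" "cindependent_mod (A ` W) B" "card B = n"
      unfolding le_reldim_iff by blast
    have "\<forall>y\<in>B. \<exists>x\<in>V. A x = y" using B by blast
    then obtain g where g: "\<And>y. y \<in> B \<Longrightarrow> g y \<in> V" "\<And>y. y \<in> B \<Longrightarrow> A (g y) = y" by metis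
    have inj: "inj_on g B" using g by (metis inj_onI)
    have "cindependent_mod W (g ` B)"
      unfolding cindependent_mod_finite[OF finite_imageI[OF B(1)]]
    proof (intro allI impI)
      fix a assume "(\<Sum>x\<in>g ` B. a x *\<^sub>C x) \<in> W"
      then have "A (\<Sum>y\<in>B. a (g y) *\<^sub>C g y) \<in> A ` W"
        using inj by (intro imageI) (simp add: sum.reindex)
      then have "(\<Sum>y\<in>B. a (g y) *\<^sub>C y) \<in> A ` W"
        using g(2) by (simp add: cblinfun_right_simps cong: sum.cong)
      then show "\<forall>x\<in>g ` B. a x = 0"
        using cindependent_modD[OF B(3,1) subset_refl, of "\<lambda>y. a (g y)"] by blast
    qed
    then show "enat n \<le> reldim V W"
      unfolding le_reldim_iff using B inj g
      by (intro exI[of _ "g ` B"]) (auto simp: card_image)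
  qed
qed

text \<open>The second isomorphism theorem: \<open>(N + R) / R\<close> against
  \<open>N / (N \<inter> R)\<close>.\<close>

lemma reldim_span_Un:
  assumes N: "complex_vector.subspace N" and R: "complex_vector.subspace R"
  shows "reldim (complex_vector.span (N \<union> R)) R = reldim N (N \<inter> R)"
proof (rule antisym)
  show "reldim (complex_vector.span (N \<union> R)) R \<le> reldim N (N \<inter> R)"
  proof (cases "reldim N (N \<inter> R)")
    case (enat n)
    obtain B where B: "finite B" "card B = n" "N \<subseteq> complex_vector.span (B \<union> (N \<inter> R))"
      using ex_basis_mod[OF complex_vector.subspace_inter[OF N R] enat] by metis
    have "N \<union> R \<subseteq> complex_vector.span (B \<union> R)"
      using B(3) complex_vector.span_mono[of "B \<union> (N \<inter> R)" "B \<union> R"]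
      by (auto intro: complex_vector.span_base)
    then have "complex_vector.span (N \<union> R) \<subseteq> complex_vector.span (B \<union> R)"
      by (rule complex_vector.span_minimal[OF _ complex_vector.subspace_span])
    then show ?thesis using reldim_le_card[OF B(1) R] B(2) enat by simp
  qed simp
  show "reldim N (N \<inter> R) \<le> reldim (complex_vector.span (N \<union> R)) R"
  proof -
    have "cindependent_mod R B" if B: "finite B" "B \<subseteq> N" "cindependent_mod (N \<inter> R) B" for B
    proof -
      have "(\<Sum>x\<in>B. a x *\<^sub>C x) \<in> N" for a
        using N B by (intro complex_vector.subspace_sum complex_vector.subspace_scale) auto
      then show ?thesis using B by (simp add: cindependent_mod_finite)
    qed
    moreover have "N \<subseteq> complex_vector.span (N \<union> R)" by (auto intro: complex_vector.span_base)
    ultimately show ?thesis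
      unfolding reldim_def by (intro SUP_subset_mono) auto
  qed
qed

lemma ecdim_eq_reldim:
  assumes V: "complex_vector.subspace V"
  shows "ecdim V = reldim V {0}"
proof (cases "cfinite_dim V")
  case True
  then obtain F where F: "finite F" "V \<subseteq> complex_vector.span F" by (auto simp: cfinite_dim_def)
  obtain B where B: "B \<subseteq> V" "complex_vector.independent B" "V \<subseteq> complex_vector.span B"
    "card B = complex_vector.dim V"
    using complex_vector.basis_exists by blast
  have fin: "finite B" using complex_vector.independent_span_bound[OF F(1) B(2)] B(1) F(2) by blast
  have "cindependent_mod {0} B"
    unfolding cindependent_mod_finite[OF fin]
    using complex_vector.independentD[OF B(2) fin] by auto
  then have "enat (card B) \<le> reldim V {0}" using B fin unfolding le_reldim_iff by blast
  moreover have "reldim V {0} \<le> enat (card B)"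
    using B(3) fin complex_vector.span_mono[of B "B \<union> {0}"]
    by (intro reldim_le_card complex_vector.subspace_single_0) auto
  ultimately show ?thesis using True B by (simp add: ecdim_def)
next
  case False
  have "reldim V {0} \<noteq> enat n" for n
    using ex_basis_mod[OF complex_vector.subspace_single_0, of V n] False
    by (metis cfinite_dim_def finite.emptyI finite.insertI finite_UnI)
  then show ?thesis using False by (cases "reldim V {0}") (auto simp: ecdim_def)
qed

lemma nullity_eq_reldim: "nullity T = reldim (null_space T) {0}"
  by (simp add: nullity_def ecdim_eq_reldim subspace_null_space)

lemma defect_eq_reldim: "defect T = reldim UNIV (range T)"
  by (simp add: defect_def ecodim_eq_reldim)

text \<open>The additivity of the index, with all terms moved to where they are added, since nullities and
  defects may be infinite.\<close>

theorem index_compose: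
  fixes A B :: "'a::complex_normed_vector \<Rightarrow>\<^sub>C\<^sub>L 'a"
  shows "nullity (A o\<^sub>C\<^sub>L B) + defect A + defect B = defect (A o\<^sub>C\<^sub>L B) + nullity A + nullity B"
proof -
  let ?N = "null_space A" and ?R = "range B"
  let ?S = "complex_vector.span (?N \<union> ?R)"
  \<comment> \<open>The common pieces are \<open>N \<inter> R\<close>, the quotient of
    \<open>N\<close> by it, and the quotient of the whole space by \<open>N + R\<close>. In terms of
    them \<alpha>(AB) = d + \<alpha>(B), \<alpha>(A) = e + d, \<beta>(B) = g + e and \<beta>(AB) =
    \<beta>(A) + g.\<close>
  define d where "d = reldim (?N \<inter> ?R) {0}"
  define e where "e = reldim ?N (?N \<inter> ?R)"
  define g where "g = reldim UNIV ?S"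
  note sub = subspace_null_space subspace_range_cblinfun complex_vector.subspace_inter
    complex_vector.subspace_single_0 complex_vector.subspace_span
  have N0: "{0} \<subseteq> null_space T" for T :: "'a \<Rightarrow>\<^sub>C\<^sub>L 'a" by (simp add: null_space_def)
  have "nullity (A o\<^sub>C\<^sub>L B) = reldim (null_space (A o\<^sub>C\<^sub>L B)) (null_space B) + nullity B"
    unfolding nullity_eq_reldim by (intro reldim_add sub N0) (auto simp: null_space_def)
  also have "reldim (null_space (A o\<^sub>C\<^sub>L B)) (null_space B) =
      reldim (B ` null_space (A o\<^sub>C\<^sub>L B)) (B ` null_space B)"
    by (rule reldim_image[symmetric]) (auto intro: sub)
  also have "B ` null_space (A o\<^sub>C\<^sub>L B) = ?N \<inter> ?R" by (auto simp: null_space_def)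
  also have "B ` null_space B = {0}"
    by (auto simp: null_space_def intro!: image_eqI[of _ _ 0])
  finally have 1: "nullity (A o\<^sub>C\<^sub>L B) = d + nullity B" by (simp add: d_def)
  have 2: "nullity A = e + d"
    unfolding nullity_eq_reldim d_def e_def
    by (intro reldim_add sub) (auto simp: null_space_def intro: range_eqI[of _ _ 0])
  have "defect B = g + reldim ?S ?R"
    unfolding defect_eq_reldim g_def
    by (intro reldim_add sub) (auto intro: complex_vector.span_base)
  then have 3: "defect B = g + e"
    by (simp add: e_def reldim_span_Un sub)
  have "defect (A o\<^sub>C\<^sub>L B) = defect A + reldim (range A) (range (A o\<^sub>C\<^sub>L B))"
    unfolding defect_eq_reldim by (intro reldim_add sub) auto
  \<comment> \<open>Adding the null space of \<open>A\<close> to the range of \<open>B\<close> does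
    not change the image under \<open>A\<close>, and it makes the comparison of quotients under
    \<open>A\<close> applicable.\<close>
  also have "range (A o\<^sub>C\<^sub>L B) = A ` ?S"
  proof
    show "range (A o\<^sub>C\<^sub>L B) \<subseteq> A ` ?S" by (auto intro!: imageI complex_vector.span_base)
    show "A ` ?S \<subseteq> range (A o\<^sub>C\<^sub>L B)"
    proof
      fix y assume "y \<in> A ` ?S"
      then obtain n x where "n \<in> ?N" "y = A (n + B x)"
        by (auto simp: complex_vector.span_Un complex_vector.span_eq_iff[THEN iffD2] sub)
      then have "y = (A o\<^sub>C\<^sub>L B) x" by (simp add: null_space_def cblinfun_add_right)
      then show "y \<in> range (A o\<^sub>C\<^sub>L B)" by blast
    qed
  qed
  also have "reldim (range A) (A ` ?S) = g"
    unfolding g_def by (rule reldim_image) (auto intro: sub complex_vector.span_base)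
  finally have 4: "defect (A o\<^sub>C\<^sub>L B) = defect A + g" .
  show ?thesis unfolding 1 2 3 4 by (simp add: ac_simps)
qed

text \<open>The index condition without a subtraction, valid because the nullity is finite.\<close>

lemma upper_semi_Weyl_iff:
  "T \<in> upper_semi_Weyl \<longleftrightarrow> T \<in> upper_semi_Fredholm \<and> nullity T \<le> defect T"
proof -
  have "Fredholm_index T \<le> 0 \<longleftrightarrow> nullity T \<le> defect T" if "nullity T < \<infinity>"
    using that unfolding Fredholm_index_def
    by (cases "nullity T"; cases "defect T") (auto simp: zero_ereal_def)
  then show ?thesis by (auto simp: upper_semi_Weyl_def upper_semi_Fredholm_def)
qed

section \<open>Vector-valued analytic functions\<close>

lemma vec_analytic_on_subset: "vec_analytic_on f U \<Longrightarrow> V \<subseteq> U \<Longrightarrow> vec_analytic_on f V"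
  unfolding vec_analytic_on_def by blast

lemma vec_analytic_onE:
  assumes "vec_analytic_on f U" "z \<in> U"
  obtains D where "(f has_derivative (\<lambda>h. h *\<^sub>C D)) (at z)"
  using assms unfolding vec_analytic_on_def by blast

lemma vec_analytic_on_const: "vec_analytic_on (\<lambda>z. c) U"
  unfolding vec_analytic_on_def
  by (auto intro!: exI[of _ 0] derivative_eq_intros)

lemma vec_analytic_on_add:
  assumes "vec_analytic_on f U" "vec_analytic_on g U"
  shows "vec_analytic_on (\<lambda>z. f z + g z) U"
  unfolding vec_analytic_on_def
proof
  fix z assume z: "z \<in> U"
  obtain D where "(f has_derivative (\<lambda>h. h *\<^sub>C D)) (at z)" by (rule vec_analytic_onE[OF assms(1) z])
  moreover obtain E where "(g has_derivative (\<lambda>h. h *\<^sub>C E)) (at z)" by (rule vec_analytic_onE[OF assms(2) z])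
  ultimately have "((\<lambda>z. f z + g z) has_derivative (\<lambda>h. h *\<^sub>C D + h *\<^sub>C E)) (at z)"
    by (rule has_derivative_add)
  then show "\<exists>D. ((\<lambda>z. f z + g z) has_derivative (\<lambda>h. h *\<^sub>C D)) (at z)"
    by (auto simp flip: scaleC_add_right)
qed

lemma vec_analytic_on_sum:
  "(\<And>i. i \<in> I \<Longrightarrow> vec_analytic_on (f i) U) \<Longrightarrow> vec_analytic_on (\<lambda>z. \<Sum>i\<in>I. f i z) U"
  by (induction I rule: infinite_finite_induct)
    (auto intro: vec_analytic_on_const vec_analytic_on_add)

lemma vec_analytic_on_scaleC:
  assumes c: "c holomorphic_on U" "open U" and f: "vec_analytic_on f U"
  shows "vec_analytic_on (\<lambda>z. c z *\<^sub>C f z) U"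
  unfolding vec_analytic_on_def
proof
  fix z assume z: "z \<in> U"
  then obtain D where D: "(f has_derivative (\<lambda>h. h *\<^sub>C D)) (at z)"
    using f by (auto simp: vec_analytic_on_def)
  have "(c has_derivative (*) (deriv c z)) (at z)"
    using holomorphic_derivI[OF c z] by (simp add: has_field_derivative_def)
  from bounded_bilinear.FDERIV[OF bounded_bilinear_scaleC this D]
  have "((\<lambda>z. c z *\<^sub>C f z) has_derivative (\<lambda>h. h *\<^sub>C (c z *\<^sub>C D + deriv c z *\<^sub>C f z))) (at z)"
    by (simp add: scaleC_add_right scaleC_scaleC mult.commute)
  then show "\<exists>D. ((\<lambda>z. c z *\<^sub>C f z) has_derivative (\<lambda>h. h *\<^sub>C D)) (at z)" by blast
qed

lemma vec_analytic_on_cblinfun: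
  assumes "vec_analytic_on f U"
  shows "vec_analytic_on (\<lambda>z. cblinfun_apply T (f z)) U"
  unfolding vec_analytic_on_def
proof
  fix z assume "z \<in> U"
  then obtain D where D: "(f has_derivative (\<lambda>h. h *\<^sub>C D)) (at z)"
    using assms by (auto simp: vec_analytic_on_def)
  from bounded_linear.has_derivative[OF bounded_linear_cblinfun this, of T]
  show "\<exists>D. ((\<lambda>z. T (f z)) has_derivative (\<lambda>h. h *\<^sub>C D)) (at z)" by auto
qed

lemma vec_analytic_on_imp_continuous_on: "vec_analytic_on f U \<Longrightarrow> continuous_on U f"
  unfolding vec_analytic_on_def
  by (meson continuous_at_imp_continuous_on has_derivative_continuous)

lemma vec_analytic_on_complex_iff:
  fixes f :: "complex \<Rightarrow> complex"
  assumes "open U"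
  shows "vec_analytic_on f U \<longleftrightarrow> f holomorphic_on U"
  unfolding vec_analytic_on_def scaleC_complex_def holomorphic_on_open[OF assms]
    has_field_derivative_def
  by (simp add: mult_commute_abs)

lemma vec_analytic_on_shift:
  assumes "vec_analytic_on f (ball 0 r)"
  shows "vec_analytic_on (\<lambda>w. f (w - l)) (ball l r)"
  unfolding vec_analytic_on_def
proof
  fix w assume "w \<in> ball l r"
  then have "w - l \<in> ball 0 r" by (simp add: dist_norm norm_minus_commute)
  then obtain D where "(f has_derivative (\<lambda>h. h *\<^sub>C D)) (at (w - l))"
    by (rule vec_analytic_onE[OF assms])
  moreover have "((\<lambda>w. w - l) has_derivative (\<lambda>h. h)) (at w)"
    by (auto intro!: derivative_eq_intros)
  ultimately have "((\<lambda>w. f (w - l)) has_derivative (\<lambda>h. h *\<^sub>C D)) (at w)"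
    by (rule has_derivative_compose[rotated])
  then show "\<exists>D. ((\<lambda>w. f (w - l)) has_derivative (\<lambda>h. h *\<^sub>C D)) (at w)" by blast
qed

lemma summable_vec_power_series:
  fixes c :: "nat \<Rightarrow> 'b::complex_banach"
  assumes c: "\<And>n. norm (c n) \<le> K * M ^ n" and M: "M > 0" and z: "z \<in> ball 0 (1 / M)"
  shows "summable (\<lambda>n. z ^ n *\<^sub>C c n)"
proof (rule summable_comparison_test')
  have "cmod z * M < 1" using z M by (simp add: field_simps)
  then show "summable (\<lambda>n. K * (cmod z * M) ^ n)"
    using M by (intro summable_mult summable_geometric) simp
  show "norm (z ^ n *\<^sub>C c n) \<le> K * (cmod z * M) ^ n" for n
    using mult_left_mono[OF c[of n], of "cmod z ^ n"]
    by (simp add: norm_scaleC norm_power power_mult_distrib mult_ac)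
qed

lemma vec_analytic_on_power_series:
  fixes c :: "nat \<Rightarrow> 'b::complex_banach"
  assumes c: "\<And>n. norm (c n) \<le> K * M ^ n" and M: "M > 0"
  shows "vec_analytic_on (\<lambda>z. \<Sum>n. z ^ n *\<^sub>C c n) (ball 0 (1 / M))"
  unfolding vec_analytic_on_def
proof
  fix z :: complex assume z: "z \<in> ball 0 (1 / M)"
  \<comment> \<open>A slightly larger radius, so that the differentiated series is dominated
    uniformly on a ball containing \<open>z\<close>.\<close>
  then obtain \<rho> where \<rho>: "cmod z < \<rho>" "\<rho> < 1 / M" using dense by auto
  have \<rho>0: "\<rho> > 0" using \<rho>(1) norm_ge_zero[of z] by linarith
  define S where "S = ball (0::complex) \<rho>"
  have SB: "S \<subseteq> ball 0 (1 / M)" using \<rho> by (auto simp: S_def)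
  define d where "d n x = (of_nat n * x ^ (n - 1)) *\<^sub>C c n" for n and x :: complex
  have K: "K \<ge> 0" using order_trans[OF norm_ge_zero c[of 0]] by simp
  have bd: "norm (d n x) \<le> K * M * (real n * (\<rho> * M) ^ (n - 1))" if "x \<in> S" for n x
  proof (cases n)
    case (Suc m)
    have "norm (d n x) = real n * cmod x ^ m * norm (c n)"
      by (simp add: d_def norm_scaleC norm_mult norm_power Suc del: of_nat_Suc)
    also have "\<dots> \<le> real n * \<rho> ^ m * (K * M ^ n)"
      using that c[of n] \<rho>0 by (intro mult_mono power_mono) (auto simp: S_def)
    finally show ?thesis by (simp add: Suc power_mult_distrib mult_ac)
  qed (simp add: d_def)
  have sm: "summable (\<lambda>n. K * M * (real n * (\<rho> * M) ^ (n - 1)))"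
  proof -
    have "norm (\<rho> * M) < 1" using \<rho> \<rho>0 M by (simp add: field_simps)
    from geometric_deriv_sums[OF this] have "summable (\<lambda>n. real (Suc n) * (\<rho> * M) ^ n)"
      by (rule sums_summable)
    then have "summable (\<lambda>n. real (Suc n) * (\<rho> * M) ^ (Suc n - 1))" by simp
    then have "summable (\<lambda>n. real n * (\<rho> * M) ^ (n - 1))" by (subst (asm) summable_Suc_iff)
    then show ?thesis by (rule summable_mult)
  qed
  have lim: "uniform_limit S (\<lambda>n x. \<Sum>i<n. d i x) (\<lambda>x. \<Sum>i. d i x) sequentially"
    by (rule Weierstrass_m_test[OF bd sm])
  have "\<exists>g. \<forall>x\<in>S. (\<lambda>n. x ^ n *\<^sub>C c n) sums g x \<and>
      (g has_derivative (\<lambda>h. h *\<^sub>C (\<Sum>i. d i x))) (at x within S)"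
  proof (rule has_derivative_series)
    show "convex S" by (simp add: S_def)
    show "((\<lambda>x. x ^ n *\<^sub>C c n) has_derivative (\<lambda>h. h *\<^sub>C d n x)) (at x within S)" for n x
    proof -
      have "((\<lambda>x. x ^ n) has_derivative (\<lambda>h. h * (of_nat n * x ^ (n - 1)))) (at x within S)"
        by (auto intro!: derivative_eq_intros)
      from bounded_linear.has_derivative[OF bounded_bilinear.bounded_linear_left[OF bounded_bilinear_scaleC] this]
      show ?thesis by (simp add: d_def scaleC_scaleC)
    qed
    show "\<forall>\<^sub>F n in sequentially. \<forall>x\<in>S. \<forall>h.
        norm ((\<Sum>i<n. h *\<^sub>C d i x) - h *\<^sub>C (\<Sum>i. d i x)) \<le> e * cmod h" if e: "e > 0" for e
      using uniform_limitD[OF lim e]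
    proof eventually_elim
      case (elim n)
      show ?case
      proof (intro ballI allI)
        fix x h assume "x \<in> S"
        then have "norm ((\<Sum>i<n. d i x) - (\<Sum>i. d i x)) \<le> e" using elim by (auto simp: dist_norm)
        then have "cmod h * norm ((\<Sum>i<n. d i x) - (\<Sum>i. d i x)) \<le> cmod h * e"
          by (intro mult_left_mono) auto
        then show "norm ((\<Sum>i<n. h *\<^sub>C d i x) - h *\<^sub>C (\<Sum>i. d i x)) \<le> e * cmod h"
          by (simp add: norm_scaleC[symmetric] complex_vector.scale_right_diff_distrib
              complex_vector.scale_sum_right mult.commute)
      qed
    qed
    show "0 \<in> S" using \<rho>0 by (simp add: S_def)
    show "(\<lambda>n. 0 ^ n *\<^sub>C c n) sums (\<Sum>n. 0 ^ n *\<^sub>C c n)"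
      by (rule summable_sums[OF summable_vec_power_series[OF c M]]) (use M in simp)
  qed
  then obtain g where g: "\<And>x. x \<in> S \<Longrightarrow> (\<lambda>n. x ^ n *\<^sub>C c n) sums g x"
    "\<And>x. x \<in> S \<Longrightarrow> (g has_derivative (\<lambda>h. h *\<^sub>C (\<Sum>i. d i x))) (at x within S)" by blast
  have zS: "z \<in> S" "open S" using \<rho> by (auto simp: S_def)
  have "(g has_derivative (\<lambda>h. h *\<^sub>C (\<Sum>i. d i z))) (at z)"
    using g(2)[OF zS(1)] at_within_open[OF zS] by simp
  then have "((\<lambda>z. \<Sum>n. z ^ n *\<^sub>C c n) has_derivative (\<lambda>h. h *\<^sub>C (\<Sum>i. d i z))) (at z)"
    by (rule has_derivative_transform_within_open[OF _ zS(2,1)]) (use g(1) in \<open>auto simp: sums_iff\<close>)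
  then show "\<exists>D. ((\<lambda>z. \<Sum>n. z ^ n *\<^sub>C c n) has_derivative (\<lambda>h. h *\<^sub>C D)) (at z)" by blast
qed

section \<open>Analytic eigenvectors\<close>

text \<open>The preimages \<open>x\<close> are chosen without any linearity; iterating the choice still gives
  geometric series that solve the resolvent equation up to a finite-dimensional error.\<close>

lemma resolvent_equation_mod_finite:
  fixes A :: "'b::complex_banach \<Rightarrow>\<^sub>C\<^sub>L 'b" and f :: "'i \<Rightarrow> 'b"
  assumes C: "C > 0"
    and sol: "\<And>y. \<exists>x a. A x + (\<Sum>i\<in>I. a i *\<^sub>C f i) = y \<and> norm x \<le> C * norm y \<and>
      (\<forall>i\<in>I. cmod (a i) \<le> C * norm y)"
  obtains X q where "\<And>y. vec_analytic_on (X y) (ball 0 (1 / C))"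
    "\<And>y i. i \<in> I \<Longrightarrow> q y i holomorphic_on ball 0 (1 / C)"
    "\<And>y z. z \<in> ball 0 (1 / C) \<Longrightarrow> A (X y z) - z *\<^sub>C X y z = y - (\<Sum>i\<in>I. q y i z *\<^sub>C f i)"
proof -
  obtain B a where Ba: "\<And>y. A (B y) + (\<Sum>i\<in>I. a y i *\<^sub>C f i) = y"
    "\<And>y. norm (B y) \<le> C * norm y" "\<And>y i. i \<in> I \<Longrightarrow> cmod (a y i) \<le> C * norm y"
    using sol by metis
  \<comment> \<open>\<open>b y (Suc k)\<close> is the chosen preimage of \<open>b y k\<close> modulo
    the \<open>f i\<close>; weighted by \<open>z ^ k\<close> and summed, \<open>A X - z X\<close>
    telescopes to \<open>y\<close> up to the errors.\<close>
  define b where "b y k = (B ^^ k) y" for y and k :: nat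
  have b: "b y 0 = y" "b y (Suc k) = B (b y k)" for y k by (simp_all add: b_def)
  have nb: "norm (b y k) \<le> norm y * C ^ k" for y k
  proof (induction k)
    case (Suc k)
    have "norm (b y (Suc k)) \<le> C * norm (b y k)" using Ba(2) by (simp add: b)
    also have "\<dots> \<le> C * (norm y * C ^ k)" using Suc C by (intro mult_left_mono) auto
    finally show ?case by (simp add: mult_ac)
  qed (simp add: b)
  have nb': "norm (b y (Suc k)) \<le> (norm y * C) * C ^ k" for y k
    using nb[of y "Suc k"] by (simp add: mult_ac)
  have na: "norm (a (b y k) i) \<le> (C * norm y) * C ^ k" if "i \<in> I" for y k i
    using order_trans[OF Ba(3)[OF that, of "b y k"] mult_left_mono[OF nb]] C by (simp add: mult_ac)
  define X where "X y z = (\<Sum>k. z ^ k *\<^sub>C b y (Suc k))" for y z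
  define q where "q y i z = (\<Sum>k. z ^ k *\<^sub>C a (b y k) i)" for y i z
  show ?thesis
  proof (rule that[of X q])
    show "vec_analytic_on (X y) (ball 0 (1 / C))" for y
      unfolding X_def by (rule vec_analytic_on_power_series[OF nb' C])
    show "q y i holomorphic_on ball 0 (1 / C)" if "i \<in> I" for y i
      unfolding q_def vec_analytic_on_complex_iff[OF open_ball, symmetric]
      by (rule vec_analytic_on_power_series[OF na[OF that] C])
    fix y and z :: complex assume z: "z \<in> ball 0 (1 / C)"
    have sb: "(\<lambda>k. z ^ k *\<^sub>C b y (Suc k)) sums X y z"
      unfolding X_def by (intro summable_sums summable_vec_power_series[OF nb' C z])
    have sq: "(\<lambda>k. z ^ k *\<^sub>C a (b y k) i) sums q y i z" if "i \<in> I" for i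
      unfolding q_def by (intro summable_sums summable_vec_power_series[OF na[OF that] C z])
    have 1: "(\<lambda>k. z ^ k *\<^sub>C A (b y (Suc k))) sums A (X y z)"
      using bounded_linear.sums[OF bounded_linear_cblinfun sb, of A] by simp
    have "(\<lambda>k. z *\<^sub>C z ^ k *\<^sub>C b y (Suc k)) sums (z *\<^sub>C X y z)"
      by (rule bounded_linear.sums[OF bounded_linear_scaleC_right sb])
    then have "(\<lambda>k. z ^ Suc k *\<^sub>C b y (Suc k)) sums (z *\<^sub>C X y z)"
      by (simp add: scaleC_scaleC)
    then have 2: "(\<lambda>k. z ^ k *\<^sub>C b y k) sums (z *\<^sub>C X y z + y)"
      by (subst (asm) sums_Suc_iff) (simp add: b)
    have "(\<lambda>k. \<Sum>i\<in>I. (z ^ k *\<^sub>C a (b y k) i) *\<^sub>C f i) sums (\<Sum>i\<in>I. q y i z *\<^sub>C f i)"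
      by (intro sums_sum bounded_linear.sums[OF
            bounded_bilinear.bounded_linear_left[OF bounded_bilinear_scaleC]] sq)
    from sums_add[OF 1 this]
    have "(\<lambda>k. z ^ k *\<^sub>C (A (B (b y k)) + (\<Sum>i\<in>I. a (b y k) i *\<^sub>C f i))) sums
        (A (X y z) + (\<Sum>i\<in>I. q y i z *\<^sub>C f i))"
      by (simp add: b scaleC_add_right complex_vector.scale_sum_right scaleC_scaleC scaleC_complex_def)
    then have "A (X y z) + (\<Sum>i\<in>I. q y i z *\<^sub>C f i) = z *\<^sub>C X y z + y"
      using 2 sums_unique2 unfolding Ba(1) by blast
    then show "A (X y z) - z *\<^sub>C X y z = y - (\<Sum>i\<in>I. q y i z *\<^sub>C f i)"
      by (simp add: algebra_simps)
  qed
qed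

text \<open>The kernel vector \<open>e j\<close> is continued to \<open>e j + z X(z)\<close>, where
  \<open>X\<close> solves the resolvent equation with right-hand side \<open>e j\<close>. Since
  \<open>e j\<close> is in the kernel, the error keeps a factor \<open>z\<close>.\<close>

lemma kernel_equation_mod_finite:
  fixes A :: "'b::complex_banach \<Rightarrow>\<^sub>C\<^sub>L 'b" and f :: "'i \<Rightarrow> 'b" and e :: "'j \<Rightarrow> 'b"
  assumes C: "C > 0"
    and sol: "\<And>y. \<exists>x a. A x + (\<Sum>i\<in>I. a i *\<^sub>C f i) = y \<and> norm x \<le> C * norm y \<and>
      (\<forall>i\<in>I. cmod (a i) \<le> C * norm y)"
    and e: "\<And>j. j \<in> J \<Longrightarrow> A (e j) = 0"
  obtains u p where "\<And>j. vec_analytic_on (u j) (ball 0 (1 / C))"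
    "\<And>i j. i \<in> I \<Longrightarrow> p i j holomorphic_on ball 0 (1 / C)" "\<And>j. u j 0 = e j"
    "\<And>j z. j \<in> J \<Longrightarrow> z \<in> ball 0 (1 / C) \<Longrightarrow>
      A (u j z) - z *\<^sub>C u j z = - (z *\<^sub>C (\<Sum>i\<in>I. p i j z *\<^sub>C f i))"
proof -
  obtain X q where X: "\<And>y. vec_analytic_on (X y) (ball 0 (1 / C))"
    and q: "\<And>y i. i \<in> I \<Longrightarrow> q y i holomorphic_on ball 0 (1 / C)"
    and eq: "\<And>y z. z \<in> ball 0 (1 / C) \<Longrightarrow> A (X y z) - z *\<^sub>C X y z = y - (\<Sum>i\<in>I. q y i z *\<^sub>C f i)"
    by (rule resolvent_equation_mod_finite[OF C sol]) (rule that; assumption)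
  show ?thesis
  proof (rule that[of "\<lambda>j z. e j + z *\<^sub>C X (e j) z" "\<lambda>i j. q (e j) i"])
    show "vec_analytic_on (\<lambda>z. e j + z *\<^sub>C X (e j) z) (ball 0 (1 / C))" for j
      by (intro vec_analytic_on_add vec_analytic_on_const vec_analytic_on_scaleC X holomorphic_intros) auto
    fix j and z :: complex assume j: "j \<in> J" and z: "z \<in> ball 0 (1 / C)"
    have "A (e j + z *\<^sub>C X (e j) z) - z *\<^sub>C (e j + z *\<^sub>C X (e j) z) =
        z *\<^sub>C (A (X (e j) z) - z *\<^sub>C X (e j) z) - z *\<^sub>C e j"
      using e[OF j] by (simp add: cblinfun_right_simps scaleC_add_right
          complex_vector.scale_right_diff_distrib)
    also have "\<dots> = - (z *\<^sub>C (\<Sum>i\<in>I. q (e j) i z *\<^sub>C f i))"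
      by (simp add: eq[OF z] complex_vector.scale_right_diff_distrib)
    finally show "A (e j + z *\<^sub>C X (e j) z) - z *\<^sub>C (e j + z *\<^sub>C X (e j) z) =
        - (z *\<^sub>C (\<Sum>i\<in>I. q (e j) i z *\<^sub>C f i))" .
  qed (use q in auto)
qed

lemma vec_analytic_nonzero_near:
  assumes "vec_analytic_on X (ball 0 r)" "r > 0" "X 0 \<noteq> 0"
  obtains s where "s > 0" "s \<le> r" "\<And>z. z \<in> ball 0 s \<Longrightarrow> X z \<noteq> 0"
proof -
  have "isCont X 0"
    using vec_analytic_on_imp_continuous_on[OF assms(1)] assms(2)
    by (simp add: continuous_on_eq_continuous_at)
  then obtain s where "s > 0" "\<And>y. dist 0 y < s \<Longrightarrow> X y \<noteq> 0"
    using continuous_at_avoid[of 0 X 0] assms(3) by blast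
  then show ?thesis using assms(2) by (intro that[of "min s r"]) auto
qed

text \<open>There are more kernel vectors to continue than directions in which errors occur, so
  coefficients holomorphic in \<open>z\<close> can cancel all errors. Their normalization at the
  origin and the independence of the \<open>e j\<close> keep the result nonzero. \<open>A\<close>
  will be both an operator and an adjoint.\<close>

lemma analytic_eigenvector:
  fixes A :: "'b::complex_banach \<Rightarrow>\<^sub>C\<^sub>L 'b" and f :: "'i \<Rightarrow> 'b" and e :: "'j \<Rightarrow> 'b"
  assumes C: "C > 0"
    and sol: "\<And>y. \<exists>x a. A x + (\<Sum>i\<in>I. a i *\<^sub>C f i) = y \<and> norm x \<le> C * norm y \<and>
      (\<forall>i\<in>I. cmod (a i) \<le> C * norm y)"
    and e: "\<And>j. j \<in> J \<Longrightarrow> A (e j) = 0"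
    and ind: "\<And>c. (\<Sum>j\<in>J. c j *\<^sub>C e j) = 0 \<Longrightarrow> \<forall>j\<in>J. c j = 0"
    and fin: "finite I" "finite J" "card I < card J"
  obtains X r where "r > 0" "vec_analytic_on X (ball 0 r)"
    "\<And>z. z \<in> ball 0 r \<Longrightarrow> A (X z) = z *\<^sub>C X z" "\<And>z. z \<in> ball 0 r \<Longrightarrow> X z \<noteq> 0"
proof -
  let ?B = "ball (0::complex) (1 / C)"
  obtain u p where u: "\<And>j. vec_analytic_on (u j) ?B" "\<And>j. u j 0 = e j"
    and p: "\<And>i j. i \<in> I \<Longrightarrow> p i j holomorphic_on ?B"
    and eq: "\<And>j z. j \<in> J \<Longrightarrow> z \<in> ?B \<Longrightarrow>
      A (u j z) - z *\<^sub>C u j z = - (z *\<^sub>C (\<Sum>i\<in>I. p i j z *\<^sub>C f i))"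
    by (rule kernel_equation_mod_finite[where J=J and e=e, OF C sol e]) (assumption, (rule that; assumption))
  obtain c where c: "\<And>j. j \<in> J \<Longrightarrow> c j holomorphic_on ?B" "\<exists>j\<in>J. c j 0 \<noteq> 0"
    "\<And>i z. i \<in> I \<Longrightarrow> z \<in> ?B \<Longrightarrow> (\<Sum>j\<in>J. p i j z * c j z) = 0"
    using holomorphic_underdetermined_system_normalized[of "1 / C" I J p] C fin p by auto
  define X where "X z = (\<Sum>j\<in>J. c j z *\<^sub>C u j z)" for z
  have X: "vec_analytic_on X ?B"
    unfolding X_def by (intro vec_analytic_on_sum vec_analytic_on_scaleC c u open_ball)
  have eig: "A (X z) = z *\<^sub>C X z" if z: "z \<in> ?B" for z
  proof -
    have "A (X z) - z *\<^sub>C X z = (\<Sum>j\<in>J. c j z *\<^sub>C (A (u j z) - z *\<^sub>C u j z))"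
      unfolding X_def cblinfun_right_simps complex_vector.scale_sum_right sum_subtractf[symmetric]
      by (intro sum.cong) (auto simp: complex_vector.scale_right_diff_distrib scaleC_scaleC mult.commute)
    also have "\<dots> = (\<Sum>j\<in>J. - (z *\<^sub>C (\<Sum>i\<in>I. (p i j z * c j z) *\<^sub>C f i)))"
      using eq z by (intro sum.cong)
        (auto simp: complex_vector.scale_sum_right scaleC_scaleC mult_ac)
    also have "\<dots> = - (z *\<^sub>C (\<Sum>i\<in>I. (\<Sum>j\<in>J. p i j z * c j z) *\<^sub>C f i))"
      by (subst complex_vector.scale_sum_left, subst sum.swap)
        (simp add: sum_negf complex_vector.scale_sum_right)
    finally show ?thesis using c(3) z by simp
  qed
  have "X 0 \<noteq> 0"
    using ind[of "\<lambda>j. c j 0"] c(2) by (auto simp: X_def u)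
  then obtain s where "s > 0" "s \<le> 1 / C" "\<And>z. z \<in> ball 0 s \<Longrightarrow> X z \<noteq> 0"
    using vec_analytic_nonzero_near[OF X] C by auto
  then show ?thesis
    using X eig by (intro that[of s X]) (auto intro: vec_analytic_on_subset)
qed

text \<open>\<open>y\<close> is split boundedly into a combination of \<open>F\<close> and a part in
  the range, and the latter has a bounded preimage; \<open>C\<close> dominates both
  estimates.\<close>

lemma solvable_mod_finite:
  fixes T :: "'a::complex_banach \<Rightarrow>\<^sub>C\<^sub>L 'a"
  assumes cl: "closed (range T)" and F: "finite F" "complex_vector.span (F \<union> range T) = UNIV"
  obtains C where "C > 0" "\<And>y. \<exists>x a. T x + (\<Sum>f\<in>F. a f *\<^sub>C f) = y \<and> norm x \<le> C * norm y \<and>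
      (\<forall>f\<in>F. cmod (a f) \<le> C * norm y)"
proof -
  obtain C1 where C1: "C1 \<ge> 0"
    "\<And>y. \<exists>a. y - (\<Sum>f\<in>F. a f *\<^sub>C f) \<in> range T \<and> (\<forall>f\<in>F. cmod (a f) \<le> C1 * norm y)"
    using span_Un_decomposition_bound[OF F(1) subspace_range_cblinfun cl] F(2) by (metis UNIV_I)
  obtain C2 where C2: "C2 > 0" "\<And>y. y \<in> range T \<Longrightarrow> \<exists>x. T x = y \<and> norm x \<le> C2 * norm y"
    using open_mapping[OF cl] by blast
  define C where "C = max C1 (C2 * (1 + C1 * (\<Sum>f\<in>F. norm f)))"
  have "C2 * (1 + C1 * (\<Sum>f\<in>F. norm f)) > 0"
    using C1 C2 by (intro mult_pos_pos add_pos_nonneg mult_nonneg_nonneg sum_nonneg) auto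
  then have C: "C > 0" by (simp add: C_def)
  have "\<exists>x a. T x + (\<Sum>f\<in>F. a f *\<^sub>C f) = y \<and> norm x \<le> C * norm y \<and> (\<forall>f\<in>F. cmod (a f) \<le> C * norm y)"
    for y
  proof -
    obtain a where a: "y - (\<Sum>f\<in>F. a f *\<^sub>C f) \<in> range T" "\<And>f. f \<in> F \<Longrightarrow> cmod (a f) \<le> C1 * norm y"
      using C1(2) by blast
    obtain x where x: "T x = y - (\<Sum>f\<in>F. a f *\<^sub>C f)" "norm x \<le> C2 * norm (y - (\<Sum>f\<in>F. a f *\<^sub>C f))"
      using C2(2)[OF a(1)] by blast
    have "norm (\<Sum>f\<in>F. a f *\<^sub>C f) \<le> (\<Sum>f\<in>F. C1 * norm y * norm f)"
      using a(2) by (intro sum_norm_le) (simp add: norm_scaleC mult_right_mono)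
    then have "norm (y - (\<Sum>f\<in>F. a f *\<^sub>C f)) \<le> norm y + C1 * norm y * (\<Sum>f\<in>F. norm f)"
      using norm_triangle_ineq4[of y "\<Sum>f\<in>F. a f *\<^sub>C f"] by (simp add: sum_distrib_left)
    then have "norm x \<le> C2 * (norm y + C1 * norm y * (\<Sum>f\<in>F. norm f))"
      using x(2) C2(1) by (meson mult_left_mono order_trans less_imp_le)
    also have "\<dots> = C2 * (1 + C1 * (\<Sum>f\<in>F. norm f)) * norm y" by (simp add: algebra_simps)
    also have "\<dots> \<le> C * norm y" by (intro mult_right_mono) (auto simp: C_def)
    finally have "norm x \<le> C * norm y" .
    moreover have "C1 * norm y \<le> C * norm y" by (intro mult_right_mono) (auto simp: C_def)
    then have "\<forall>f\<in>F. cmod (a f) \<le> C * norm y" using a(2) by force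
    ultimately show ?thesis using x(1) by (intro exI[of _ x] exI[of _ a]) auto
  qed
  with C show ?thesis by (rule that)
qed

lemma Fredholm_complement:
  assumes "defect T = enat m"
  obtains F where "finite F" "card F = m" "complex_vector.span (F \<union> range (cblinfun_apply T)) = UNIV"
proof -
  obtain F where "finite F" "card F = m" "UNIV \<subseteq> complex_vector.span (F \<union> range T)"
    by (rule ex_basis_mod[OF subspace_range_cblinfun assms[unfolded defect_eq_reldim]])
  then show ?thesis using that[of F] by auto
qed

lemma kernel_independent_family:
  assumes "enat m \<le> nullity T"
  obtains E where "finite E" "card E = m" "\<And>e. e \<in> E \<Longrightarrow> cblinfun_apply T e = 0"
    "cindependent_mod {0} E"
  using assms unfolding nullity_eq_reldim le_reldim_iff by (auto simp: null_space_def)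

lemma cindependent_mod_0D:
  "cindependent_mod {0} E \<Longrightarrow> finite E \<Longrightarrow> (\<Sum>j\<in>E. c j *\<^sub>C j) = 0 \<Longrightarrow> \<forall>j\<in>E. c j = 0"
  by (simp add: cindependent_mod_finite)

lemma positive_index_imp_eigenvector:
  fixes T :: "'a::complex_banach \<Rightarrow>\<^sub>C\<^sub>L 'a"
  assumes cl: "closed (range T)" and lt: "defect T < nullity T"
  obtains X r where "r > 0" "vec_analytic_on X (ball 0 r)"
    "\<And>z. z \<in> ball 0 r \<Longrightarrow> T (X z) = z *\<^sub>C X z" "\<And>z. z \<in> ball 0 r \<Longrightarrow> X z \<noteq> 0"
proof -
  obtain m where m: "defect T = enat m" using lt by (cases "defect T") auto
  obtain F where F: "finite F" "card F = m" "complex_vector.span (F \<union> range T) = UNIV"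
    using Fredholm_complement[OF m] by blast
  have "enat (Suc m) \<le> nullity T" using lt m by (metis Suc_ile_eq)
  then obtain E where E: "finite E" "card E = Suc m" "\<And>e. e \<in> E \<Longrightarrow> T e = 0" "cindependent_mod {0} E"
    using kernel_independent_family by blast
  obtain C where C: "C > 0" "\<And>y. \<exists>x a. T x + (\<Sum>f\<in>F. a f *\<^sub>C f) = y \<and> norm x \<le> C * norm y \<and>
      (\<forall>f\<in>F. cmod (a f) \<le> C * norm y)"
    using solvable_mod_finite[OF cl F(1,3)] by blast
  show ?thesis
    by (rule analytic_eigenvector[OF C, of E "\<lambda>e. e"])
      (use E F cindependent_mod_0D[OF E(4,1)] that in auto)
qed

text \<open>The closed range theorem is bypassed: a functional that vanishes on the null space of
  \<open>T\<close> factors through \<open>T\<close>, so the adjoint is solvable modulo the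
  functionals dual to a basis of the null space. Functionals annihilating the range of
  \<open>T\<close> are in the kernel of the adjoint. The defect may be infinite; one vector more
  than the nullity is enough.\<close>

lemma negative_index_imp_adjoint_eigenvector:
  fixes T :: "'a::complex_banach \<Rightarrow>\<^sub>C\<^sub>L 'a"
  assumes T: "T \<in> upper_semi_Fredholm" and lt: "nullity T < defect T"
  obtains X r where "r > 0" "vec_analytic_on X (ball 0 r)"
    "\<And>z. z \<in> ball 0 r \<Longrightarrow> cadjoint T (X z) = z *\<^sub>C X z" "\<And>z. z \<in> ball 0 r \<Longrightarrow> X z \<noteq> 0"
proof -
  have cl: "closed (range T)" using T by (simp add: upper_semi_Fredholm_def)
  obtain m where m: "nullity T = enat m" using lt by (cases "nullity T") auto
  obtain E where E: "finite E" "E \<subseteq> null_space T" "cindependent_mod {0} E" "card E = m"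
    "null_space T \<subseteq> complex_vector.span (E \<union> {0})"
    using ex_basis_mod[OF complex_vector.subspace_single_0 m[unfolded nullity_eq_reldim]] by metis
  obtain q :: "'a \<Rightarrow> 'a \<Rightarrow>\<^sub>C\<^sub>L complex"
    where q: "\<And>b b'. b \<in> E \<Longrightarrow> b' \<in> E \<Longrightarrow> q b b' = (if b = b' then 1 else 0)"
    using ex_dual_family[OF complex_vector.subspace_single_0 closed_singleton E(1,3)] by metis
  have "enat (Suc m) \<le> reldim UNIV (range T)" using lt m by (metis Suc_ile_eq defect_eq_reldim)
  then obtain B where B: "finite B" "cindependent_mod (range T) B" "card B = Suc m"
    unfolding le_reldim_iff by blast
  obtain p :: "'a \<Rightarrow> 'a \<Rightarrow>\<^sub>C\<^sub>L complex"
    where p: "\<And>b b'. b \<in> B \<Longrightarrow> b' \<in> B \<Longrightarrow> p b b' = (if b = b' then 1 else 0)"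
      "\<And>b w. b \<in> B \<Longrightarrow> w \<in> range T \<Longrightarrow> p b w = 0"
    using ex_dual_family[OF subspace_range_cblinfun cl B(1,2)] by metis
  obtain K where K: "K > 0" "\<And>y. y \<in> range T \<Longrightarrow> \<exists>x. T x = y \<and> norm x \<le> K * norm y"
    using open_mapping[OF cl] by blast
  define L where "L = 1 + (\<Sum>e\<in>E. norm e * norm (q e))"
  have L: "L \<ge> 1" by (simp add: L_def sum_nonneg)
  define C where "C = K * L + (\<Sum>e\<in>E. norm e)"
  have C: "C > 0" using K L unfolding C_def by (intro add_pos_nonneg mult_pos_pos sum_nonneg) auto
  have sol: "\<exists>\<phi> a. cadjoint T \<phi> + (\<Sum>e\<in>E. a e *\<^sub>C q e) = \<psi> \<and> norm \<phi> \<le> C * norm \<psi> \<and>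
      (\<forall>e\<in>E. cmod (a e) \<le> C * norm \<psi>)" for \<psi> :: "'a \<Rightarrow>\<^sub>C\<^sub>L complex"
  proof -
    \<comment> \<open>Subtracting the values on the basis \<open>E\<close> makes the functional
      vanish on the null space of \<open>T\<close>.\<close>
    define \<theta> where "\<theta> = \<psi> - (\<Sum>e\<in>E. \<psi> e *\<^sub>C q e)"
    have "\<theta> e = 0" if e: "e \<in> E" for e
    proof -
      have "(\<Sum>e'\<in>E. \<psi> e' * q e' e) = (\<Sum>e'\<in>E. if e' = e then \<psi> e' else 0)"
        using e q by (intro sum.cong) auto
      then show ?thesis using e E(1) by (simp add: \<theta>_def cblinfun_sum_left scaleC_complex_def)
    qed
    then have "E \<union> {0} \<subseteq> null_space \<theta>" by (auto simp: null_space_def)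
    then have ker: "\<theta> x = 0" if "T x = 0" for x
      using that E(5) complex_vector.span_minimal[OF _ subspace_null_space, of "E \<union> {0}" \<theta>]
      by (auto simp: null_space_def)
    have n\<theta>: "norm \<theta> \<le> L * norm \<psi>"
    proof -
      have "norm (\<Sum>e\<in>E. \<psi> e *\<^sub>C q e) \<le> (\<Sum>e\<in>E. norm \<psi> * (norm e * norm (q e)))"
      proof (rule sum_norm_le)
        fix e
        show "norm (\<psi> e *\<^sub>C q e) \<le> norm \<psi> * (norm e * norm (q e))"
          unfolding norm_scaleC mult.assoc[symmetric]
          by (intro mult_right_mono norm_cblinfun_apply) auto
      qed
      then show ?thesis
        unfolding \<theta>_def L_def using norm_triangle_ineq4[of \<psi> "\<Sum>e\<in>E. \<psi> e *\<^sub>C q e"]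
        by (simp add: sum_distrib_left algebra_simps)
    qed
    \<comment> \<open>The functional on the range of \<open>T\<close> through which \<theta>
      factors. The choice of the preimage does not matter, as \<theta> vanishes on the null
      space.\<close>
    define g where "g y = \<theta> (SOME x. T x = y)" for y
    have g: "g (T x) = \<theta> x" for x
    proof -
      have "T (SOME x'. T x' = T x) = T x" by (rule someI) simp
      then have "\<theta> ((SOME x'. T x' = T x) - x) = 0" by (intro ker) (simp add: cblinfun_diff_right)
      then show ?thesis by (simp add: g_def cblinfun_diff_right)
    qed
    obtain \<phi> :: "'a \<Rightarrow>\<^sub>C\<^sub>L complex"
      where \<phi>: "\<And>y. y \<in> range T \<Longrightarrow> \<phi> y = g y" "norm \<phi> \<le> K * L * norm \<psi>"
    proof (rule Hahn_Banach[of "range T" g "K * L * norm \<psi>"])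
      show "g (x + y) = g x + g y" if xy: "x \<in> range T" "y \<in> range T" for x y
      proof -
        obtain v w where "x = T v" "y = T w" using xy by blast
        then show ?thesis using g[of "v + w"] g[of v] g[of w] by (simp add: cblinfun_add_right)
      qed
      show "g (c *\<^sub>C x) = c * g x" if x: "x \<in> range T" for c x
      proof -
        obtain v where "x = T v" using x by blast
        then show ?thesis using g[of "c *\<^sub>C v"] g[of v] by (simp add: scaleC_complex_def)
      qed
      show "cmod (g y) \<le> K * L * norm \<psi> * norm y" if y: "y \<in> range T" for y
      proof -
        obtain x where x: "T x = y" "norm x \<le> K * norm y" using K(2)[OF y] by blast
        have "cmod (g y) \<le> norm \<theta> * norm x"
          using g[of x] x norm_cblinfun_apply[of \<theta> x] by simp
        also have "\<dots> \<le> (L * norm \<psi>) * (K * norm y)"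
          using n\<theta> x L by (intro mult_mono) auto
        finally show ?thesis by (simp add: mult_ac)
      qed
    qed (use K L in \<open>auto simp: subspace_range_cblinfun\<close>)
    have "cadjoint T \<phi> + (\<Sum>e\<in>E. \<psi> e *\<^sub>C q e) = \<psi>"
      by (rule cblinfun_eqI) (simp add: \<phi> g \<theta>_def)
    moreover have "K * L * norm \<psi> \<le> C * norm \<psi>"
      by (intro mult_right_mono) (auto simp: C_def sum_nonneg)
    then have "norm \<phi> \<le> C * norm \<psi>" using \<phi>(2) by simp
    moreover have "cmod (\<psi> e) \<le> C * norm \<psi>" if "e \<in> E" for e
    proof -
      have "norm e \<le> C"
        using member_le_sum[OF that, of norm] E(1) K L unfolding C_def
        by (smt (verit) mult_nonneg_nonneg norm_ge_zero)
      then have "norm \<psi> * norm e \<le> norm \<psi> * C" by (intro mult_left_mono) auto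
      then show ?thesis using norm_cblinfun_apply[of \<psi> e] by (simp add: mult.commute)
    qed
    ultimately show ?thesis by blast
  qed
  show ?thesis
  proof (rule analytic_eigenvector[OF C sol, of B p])
    show "cadjoint T (p b) = 0" if "b \<in> B" for b
      using that p(2) by (intro cblinfun_eqI) simp
    show "\<forall>b\<in>B. c b = 0" if "(\<Sum>b\<in>B. c b *\<^sub>C p b) = 0" for c
    proof
      fix b assume b: "b \<in> B"
      have "(\<Sum>b'\<in>B. c b' * p b' b) = (\<Sum>b'\<in>B. if b' = b then c b' else 0)"
        using b p(1) by (intro sum.cong) auto
      moreover have "(\<Sum>b'\<in>B. c b' *\<^sub>C p b') b = 0" using that by simp
      ultimately show "c b = 0"
        using b B(1) by (simp add: cblinfun_sum_left scaleC_complex_def)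
    qed
  qed (use E B that in auto)
qed

lemma cadjoint_diff_scaleC:
  "cadjoint (T - c *\<^sub>C id_cblinfun) = cadjoint T - c *\<^sub>C id_cblinfun"
  by (rule cblinfun_eqI, rule cblinfun_eqI) (simp add: cblinfun_diff_right)

text \<open>Translated from the origin to \<open>l\<close>, the family becomes a test function in
  the definition of SVEP.\<close>

lemma SVEP_no_eigenvector:
  assumes "SVEP T" "r > 0" "vec_analytic_on X (ball 0 r)"
    "\<And>z. z \<in> ball 0 r \<Longrightarrow> (T - l *\<^sub>C id_cblinfun) (X z) = z *\<^sub>C X z"
  shows "X 0 = 0"
proof -
  have "(T - w *\<^sub>C id_cblinfun) (X (w - l)) = 0" if "w \<in> ball l r" for w
    using assms(4)[of "w - l"] that
    by (simp add: dist_norm norm_minus_commute complex_vector.scale_left_diff_distrib)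
  then have "\<forall>z\<in>ball l r. X (z - l) = 0"
    using assms(1) vec_analytic_on_shift[OF assms(3), of l] unfolding SVEP_def
    by (metis (no_types, lifting) open_ball)
  then show ?thesis using assms(2) by (metis centre_in_ball diff_self)
qed

theorem SVEP_imp_nullity_le_defect:
  fixes T :: "'a::complex_banach \<Rightarrow>\<^sub>C\<^sub>L 'a"
  assumes "SVEP T" "T - l *\<^sub>C id_cblinfun \<in> upper_semi_Fredholm"
  shows "nullity (T - l *\<^sub>C id_cblinfun) \<le> defect (T - l *\<^sub>C id_cblinfun)"
proof (rule ccontr)
  assume "\<not> ?thesis"
  then have lt: "defect (T - l *\<^sub>C id_cblinfun) < nullity (T - l *\<^sub>C id_cblinfun)" by simp
  have cl: "closed (range (T - l *\<^sub>C id_cblinfun))" using assms(2) by (simp add: upper_semi_Fredholm_def)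
  obtain X r where "r > 0" "vec_analytic_on X (ball 0 r)"
    "\<And>z. z \<in> ball 0 r \<Longrightarrow> (T - l *\<^sub>C id_cblinfun) (X z) = z *\<^sub>C X z" "\<And>z. z \<in> ball 0 r \<Longrightarrow> X z \<noteq> 0"
    by (rule positive_index_imp_eigenvector[OF cl lt]) blast
  then show False using SVEP_no_eigenvector[OF assms(1)] by (metis centre_in_ball)
qed

theorem SVEP_cadjoint_imp_defect_le_nullity:
  fixes T :: "'a::complex_banach \<Rightarrow>\<^sub>C\<^sub>L 'a"
  assumes "SVEP (cadjoint T)" "T - l *\<^sub>C id_cblinfun \<in> upper_semi_Fredholm"
  shows "defect (T - l *\<^sub>C id_cblinfun) \<le> nullity (T - l *\<^sub>C id_cblinfun)"
proof (rule ccontr)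
  assume "\<not> ?thesis"
  then have lt: "nullity (T - l *\<^sub>C id_cblinfun) < defect (T - l *\<^sub>C id_cblinfun)" by simp
  obtain X r where "r > 0" "vec_analytic_on X (ball 0 r)"
    "\<And>z. z \<in> ball 0 r \<Longrightarrow> cadjoint (T - l *\<^sub>C id_cblinfun) (X z) = z *\<^sub>C X z"
    "\<And>z. z \<in> ball 0 r \<Longrightarrow> X z \<noteq> 0"
    by (rule negative_index_imp_adjoint_eigenvector[OF assms(2) lt]) blast
  then show False using SVEP_no_eigenvector[OF assms(1)] cadjoint_diff_scaleC by (metis centre_in_ball)
qed

section \<open>The spectrum\<close>

lemma is_inverse_of_imp_bij: "is_inverse_of S T \<Longrightarrow> bij T"
  unfolding is_inverse_of_def
  by (metis bij_betw_def cblinfun_compose_apply id_cblinfun_apply injI surjI)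

lemma bij_imp_ex_inverse:
  fixes T :: "'a::complex_banach \<Rightarrow>\<^sub>C\<^sub>L 'a"
  assumes "bij T"
  shows "\<exists>S. is_inverse_of S T"
proof -
  have surj: "range T = UNIV" and inj: "inj T" using assms by (auto simp: bij_def)
  obtain C where C: "C > 0" "\<And>y. \<exists>x. T x = y \<and> norm x \<le> C * norm y"
    using open_mapping[of T] surj by auto
  have inv: "T (inv T y) = y" "inv T (T y) = y" for y
    using surj inj by (simp_all add: surj_f_inv_f)
  obtain S where S: "cblinfun_apply S = inv T"
  proof (rule ex_cblinfun[of "inv T" C])
    show "inv T (x + y) = inv T x + inv T y" for x y
      using inj by (metis cblinfun_add_right injD inv(1))
    show "inv T (c *\<^sub>C x) = c *\<^sub>C inv T x" for c x
      using inj by (metis cblinfun_scaleC_right injD inv(1))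
    show "norm (inv T x) \<le> C * norm x" for x
      using C(2)[of x] inv(2) by metis
  qed
  then show ?thesis
    by (intro exI[of _ S]) (auto simp: is_inverse_of_def inv intro!: cblinfun_eqI)
qed

lemma cspectrum_iff: "z \<in> cspectrum T \<longleftrightarrow> \<not> bij (T - z *\<^sub>C id_cblinfun)"
  for T :: "'a::complex_banach \<Rightarrow>\<^sub>C\<^sub>L 'a"
  unfolding cspectrum_def using is_inverse_of_imp_bij bij_imp_ex_inverse by blast

text \<open>\<open>(A - B) x = y\<close> is the fixed point equation of the contraction sending
  \<open>x\<close> to \<open>S y + S (B x)\<close>. The contraction principle takes the place of the
  Neumann series, and the fixed point equation yields the norm bound.\<close>

lemma Neumann_inverse:
  fixes A :: "'a::complex_banach \<Rightarrow>\<^sub>C\<^sub>L 'a"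
  assumes S: "is_inverse_of S A" and lt: "norm S * norm B < 1"
  obtains S' where "is_inverse_of S' (A - B)" "norm S' \<le> norm S / (1 - norm S * norm B)"
proof -
  have SA: "S (A x) = x" "A (S x) = x" for x
    using S unfolding is_inverse_of_def by (metis cblinfun_compose_apply id_cblinfun_apply)+
  have nSB: "norm (S (B x)) \<le> norm S * norm B * norm x" for x
  proof -
    have "norm (S (B x)) \<le> norm S * (norm B * norm x)"
      by (rule order_trans[OF norm_cblinfun_apply mult_left_mono[OF norm_cblinfun_apply]]) simp
    then show ?thesis by (simp add: mult.assoc)
  qed
  have eq: "(A - B) x = y \<longleftrightarrow> S y + S (B x) = x" for x y
  proof
    assume "(A - B) x = y"
    then have "S (A x - B x) = S y" by simp
    then show "S y + S (B x) = x" by (simp add: cblinfun_diff_right SA algebra_simps)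
  next
    assume "S y + S (B x) = x"
    then have "A (S y + S (B x)) = A x" by simp
    then show "(A - B) x = y" by (simp add: cblinfun_add_right SA algebra_simps)
  qed
  have "\<exists>!x. S y + S (B x) = x" for y
  proof (rule banach_fix_type)
    show "\<forall>x x'. dist (S y + S (B x)) (S y + S (B x')) \<le> norm S * norm B * dist x x'"
    proof (intro allI)
      fix x x'
      show "dist (S y + S (B x)) (S y + S (B x')) \<le> norm S * norm B * dist x x'"
        using nSB[of "x - x'"] by (simp add: dist_norm cblinfun_diff_right)
    qed
  qed (use lt in auto)
  then have "\<exists>!x. (A - B) x = y" for y unfolding eq by blast
  then have "bij (A - B)" unfolding bij_iff by blast
  then obtain S' where S': "is_inverse_of S' (A - B)" using bij_imp_ex_inverse by blast
  have "norm S' \<le> norm S / (1 - norm S * norm B)"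
  proof (rule norm_cblinfun_le)
    fix y
    have "(A - B) (S' y) = y"
      using S' unfolding is_inverse_of_def by (metis cblinfun_compose_apply id_cblinfun_apply)
    then have "S' y = S y + S (B (S' y))" by (simp only: eq)
    then have "norm (S' y) \<le> norm (S y) + norm (S (B (S' y)))"
      using norm_triangle_ineq[of "S y" "S (B (S' y))"] by metis
    then have "norm (S' y) \<le> norm S * norm y + norm S * norm B * norm (S' y)"
      using nSB[of "S' y"] norm_cblinfun_apply[of S y] by linarith
    then show "norm (S' y) \<le> norm S / (1 - norm S * norm B) * norm y"
      using lt by (simp add: field_simps)
  qed (use lt in auto)
  with S' show ?thesis by (rule that)
qed

lemma norm_id_cblinfun_le: "norm (id_cblinfun :: 'a::complex_normed_vector \<Rightarrow>\<^sub>C\<^sub>L 'a) \<le> 1"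
  by (rule norm_cblinfun_le) auto

lemma norm_scaleC_id_le: "norm (c *\<^sub>C id_cblinfun :: 'a::complex_normed_vector \<Rightarrow>\<^sub>C\<^sub>L 'a) \<le> cmod c"
  unfolding norm_scaleC using norm_id_cblinfun_le mult_left_mono[of _ 1 "cmod c"] by fastforce

lemma closed_cspectrum: "closed (cspectrum T)"
  for T :: "'a::complex_banach \<Rightarrow>\<^sub>C\<^sub>L 'a"
proof -
  have "\<exists>e>0. ball z e \<subseteq> - cspectrum T" if z: "z \<in> - cspectrum T" for z
  proof -
    obtain S where S: "is_inverse_of S (T - z *\<^sub>C id_cblinfun)"
      using z by (auto simp: cspectrum_def)
    define e where "e = 1 / (norm S + 1)"
    have e: "e > 0" by (simp add: e_def add_nonneg_pos)
    have "w \<notin> cspectrum T" if w: "w \<in> ball z e" for w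
    proof -
      have "norm S * norm ((w - z) *\<^sub>C id_cblinfun :: 'a \<Rightarrow>\<^sub>C\<^sub>L 'a) \<le> norm S * cmod (w - z)"
        by (intro mult_left_mono norm_scaleC_id_le) auto
      also have "\<dots> \<le> norm S * e"
        using w by (intro mult_left_mono) (auto simp: dist_norm norm_minus_commute)
      also have "\<dots> < 1" using add_nonneg_pos[of "norm S" 1] by (simp add: e_def divide_less_eq)
      finally obtain S' where "is_inverse_of S' (T - z *\<^sub>C id_cblinfun - (w - z) *\<^sub>C id_cblinfun)"
        using Neumann_inverse[OF S] by blast
      then show ?thesis
        by (auto simp: cspectrum_def complex_vector.scale_left_diff_distrib)
    qed
    with e show ?thesis by blast
  qed
  then have "open (- cspectrum T)" by (simp add: open_contains_ball)
  then show ?thesis by (simp add: closed_def)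
qed

text \<open>\<open>T - z\<close> is regarded as a perturbation of \<open>- z\<close>. The bound on
  the inverse decays as \<open>z\<close> grows, which later makes the integral over a large circle
  computable.\<close>

lemma cspectrum_bounded_by_norm:
  fixes T :: "'a::complex_banach \<Rightarrow>\<^sub>C\<^sub>L 'a"
  assumes "cmod z > norm T"
  obtains S where "is_inverse_of S (T - z *\<^sub>C id_cblinfun)" "norm S \<le> 1 / (cmod z - norm T)"
proof -
  have z: "z \<noteq> 0" using assms norm_ge_zero[of T] by fastforce
  have S: "is_inverse_of ((- 1 / z) *\<^sub>C id_cblinfun) ((- z) *\<^sub>C id_cblinfun :: 'a \<Rightarrow>\<^sub>C\<^sub>L 'a)"
    using z by (auto simp: is_inverse_of_def scaleC_scaleC intro!: cblinfun_eqI)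
  have n: "norm ((- 1 / z) *\<^sub>C id_cblinfun :: 'a \<Rightarrow>\<^sub>C\<^sub>L 'a) \<le> 1 / cmod z" (is "?n \<le> _")
    using norm_scaleC_id_le[of "- 1 / z", where 'a='a] by (simp add: norm_divide)
  have "?n * norm (- T) \<le> 1 / cmod z * norm T"
    unfolding norm_minus_cancel by (intro mult_right_mono n) auto
  also have "\<dots> < 1" using assms z by (simp add: field_simps)
  finally have lt: "?n * norm (- T) < 1" .
  obtain S' where S': "is_inverse_of S' ((- z) *\<^sub>C id_cblinfun - (- T))"
    "norm S' \<le> ?n / (1 - ?n * norm (- T))"
    by (rule Neumann_inverse[OF S lt])
  have "?n / (1 - ?n * norm (- T)) \<le> (1 / cmod z) / (1 - (1 / cmod z) * norm T)"
    using n lt assms z by (intro frac_le diff_left_mono mult_mono) (auto simp: field_simps)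
  also have "\<dots> = 1 / (cmod z - norm T)" using z by (simp add: field_simps)
  finally show ?thesis
    using S' by (intro that[of S']) (auto simp: complex_vector.scale_minus_left)
qed

lemma compact_cspectrum: "compact (cspectrum T)"
  for T :: "'a::complex_banach \<Rightarrow>\<^sub>C\<^sub>L 'a"
proof -
  have "cmod z \<le> norm T" if "z \<in> cspectrum T" for z
    using that cspectrum_bounded_by_norm[of T z] by (force simp: cspectrum_def not_le[symmetric])
  then have "bounded (cspectrum T)" by (auto simp: bounded_iff)
  then show ?thesis using closed_cspectrum by (simp add: compact_eq_bounded_closed)
qed

lemma cspectrum_diff_scaleC:
  "cspectrum (T - l *\<^sub>C id_cblinfun) = (+) (- l) ` cspectrum T"
proof -
  have "z \<in> cspectrum (T - l *\<^sub>C id_cblinfun) \<longleftrightarrow> z + l \<in> cspectrum T" for z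
    by (simp add: cspectrum_def scaleC_add_left diff_diff_add add.commute)
  then show ?thesis by (force simp: image_iff algebra_simps)
qed

section \<open>Semi-Fredholm points on the boundary of the spectrum\<close>

lemma nullity_pos:
  assumes "cblinfun_apply T e = 0" "e \<noteq> 0"
  shows "enat 1 \<le> nullity T"
  unfolding nullity_eq_reldim le_reldim_iff
proof (intro exI conjI)
  show "cindependent_mod {0} {e}"
    using assms by (simp add: cindependent_mod_finite)
qed (use assms in \<open>auto simp: null_space_def\<close>)

lemma defect_zero: "range (cblinfun_apply T) = UNIV \<Longrightarrow> defect T = 0"
  using reldim_le_card[of "{}" UNIV UNIV]
  by (simp add: defect_eq_reldim zero_enat_def[symmetric])

text \<open>Near a boundary point there are \<open>z\<close> with \<open>A - z\<close> bijective,
  which excludes analytic eigenvectors of \<open>A\<close> and of its adjoint, so the index is 0.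
  Then there are as many kernel vectors as complementary directions, \<open>A - z\<close> is onto
  for small \<open>z \<noteq> 0\<close>, and in the connected punctured disc the spectrum is open
  and closed, hence empty.\<close>

lemma frontier_cspectrum_imp_isolated_0:
  fixes A :: "'a::complex_banach \<Rightarrow>\<^sub>C\<^sub>L 'a"
  assumes A: "A \<in> upper_semi_Fredholm" and fr: "0 \<in> frontier (cspectrum A)"
  shows "\<exists>r>0. ball 0 r \<inter> cspectrum A \<subseteq> {0}"
proof -
  let ?A = "\<lambda>z. A - z *\<^sub>C id_cblinfun"
  have cl: "closed (range A)" using A by (simp add: upper_semi_Fredholm_def)
  have D0: "0 \<in> cspectrum A"
    using fr closed_cspectrum[of A] by (auto simp: frontier_def)
  have near: "\<exists>z\<in>ball 0 s. bij (?A z)" if "s > 0" for s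
  proof -
    have "0 \<in> closure (- cspectrum A)" using fr by (simp add: frontier_closures)
    then show ?thesis using that by (force simp: closure_approachable cspectrum_iff dist_commute)
  qed
  have no_eig: "\<not> (\<forall>z\<in>ball 0 s. A (X z) = z *\<^sub>C X z \<and> X z \<noteq> 0)" if s: "s > 0" for s and X :: "complex \<Rightarrow> 'a"
  proof
    assume X: "\<forall>z\<in>ball 0 s. A (X z) = z *\<^sub>C X z \<and> X z \<noteq> 0"
    obtain z where z: "z \<in> ball 0 s" "bij (?A z)" using near[OF s] by blast
    then have "(?A z) (X z) = (?A z) 0" using X by simp
    then have "X z = 0" using z(2) by (metis bij_is_inj injD)
    then show False using X z by blast
  qed
  have "\<not> defect A < nullity A"
  proof
    assume lt: "defect A < nullity A"
    obtain X r where "r > 0" "\<And>z. z \<in> ball 0 r \<Longrightarrow> A (X z) = z *\<^sub>C X z" "\<And>z. z \<in> ball 0 r \<Longrightarrow> X z \<noteq> 0"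
      by (rule positive_index_imp_eigenvector[OF cl lt]) blast
    then show False using no_eig[of r X] by blast
  qed
  moreover have "\<not> nullity A < defect A"
  proof
    assume lt: "nullity A < defect A"
    obtain X r where X: "r > 0" "\<And>z. z \<in> ball 0 r \<Longrightarrow> cadjoint A (X z) = z *\<^sub>C X z"
        "\<And>z. z \<in> ball 0 r \<Longrightarrow> X z \<noteq> 0"
      by (rule negative_index_imp_adjoint_eigenvector[OF A lt]) blast
    obtain z where z: "z \<in> ball 0 r" "bij (?A z)" using near[OF X(1)] by blast
    have "(X z) y = 0" for y
    proof -
      obtain x where x: "(?A z) x = y" using z(2) by (metis bij_is_surj surjE)
      have "(X z o\<^sub>C\<^sub>L A) x = (z *\<^sub>C X z) x" using X(2)[OF z(1)] by simp
      then show ?thesis unfolding x[symmetric] by (simp add: cblinfun_diff_right)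
    qed
    then have "X z = 0" by (intro cblinfun_eqI) simp
    then show False using X(3) z by blast
  qed
  ultimately have eq: "nullity A = defect A" by simp
  moreover have "nullity A < \<infinity>" using A by (simp add: upper_semi_Fredholm_def)
  ultimately obtain m where m: "nullity A = enat m" "defect A = enat m" by (cases "nullity A") auto
  obtain F where F: "finite F" "card F = m" "complex_vector.span (F \<union> range A) = UNIV"
    using Fredholm_complement[OF m(2)] by blast
  obtain E where E: "finite E" "card E = m" "\<And>e. e \<in> E \<Longrightarrow> A e = 0" "cindependent_mod {0} E"
    using kernel_independent_family[of m A] m(1) by auto
  obtain C where C: "C > 0" and sol: "\<And>y. \<exists>x a. A x + (\<Sum>f\<in>F. a f *\<^sub>C f) = y \<and> norm x \<le> C * norm y \<and>
      (\<forall>f\<in>F. cmod (a f) \<le> C * norm y)"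
    using solvable_mod_finite[OF cl F(1,3)] by blast
  let ?B = "ball (0::complex) (1 / C)"
  obtain u p where u: "\<And>j. vec_analytic_on (u j) ?B" and p: "\<And>i j. i \<in> F \<Longrightarrow> p i j holomorphic_on ?B"
    and u0: "\<And>j. u j 0 = j"
    and ueq: "\<And>j z. j \<in> E \<Longrightarrow> z \<in> ?B \<Longrightarrow> A (u j z) - z *\<^sub>C u j z = - (z *\<^sub>C (\<Sum>i\<in>F. p i j z *\<^sub>C i))"
    by (rule kernel_equation_mod_finite[where J=E and e="\<lambda>e. e", OF C sol E(3)])
      (assumption, (rule that; assumption))
  \<comment> \<open>By Cramer's rule in disguise, every complementary direction lies in the range of \<open>A - z\<close> for
    \<open>z\<close> close to but different from \<open>0\<close>, unless there are analytic eigenvectors.\<close>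
  have ev: "\<forall>\<^sub>F z in at 0. f0 \<in> range (?A z)" if f0: "f0 \<in> F" for f0
  proof -
    \<comment> \<open>\<open>None\<close> is an additional unknown, the multiple of
      \<open>f0\<close> that is to be left over; with it there is one unknown more than there are
      equations.\<close>
    let ?J = "insert None (Some ` E)"
    define a where "a f j z = (case j of None \<Rightarrow> if f = f0 then - 1 else 0 | Some e \<Rightarrow> p f e z)" for f j z
    have aS: "a f (Some e) = p f e" and aN: "a f None = (\<lambda>_. if f = f0 then - 1 else 0)" for f e
      by (auto simp: a_def)
    have cardJ: "card F < card ?J" using E F by (simp add: card_image)
    have hol: "a f j holomorphic_on ?B" if "f \<in> F" "j \<in> ?J" for f j
      using that p by (cases j) (auto simp: aS aN)
    have Cpos: "1 / C > 0" and finJ: "finite ?J" using C E by auto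
    obtain c where c: "\<And>j. j \<in> ?J \<Longrightarrow> c j holomorphic_on ?B" "\<exists>j\<in>?J. c j 0 \<noteq> 0"
      "\<And>f z. f \<in> F \<Longrightarrow> z \<in> ?B \<Longrightarrow> (\<Sum>j\<in>?J. a f j z * c j z) = 0"
      by (rule holomorphic_underdetermined_system_normalized[OF Cpos F(1) finJ cardJ hol])
        (assumption, assumption, (rule that; assumption))
    have sys: "(\<Sum>e\<in>E. p f e z * c (Some e) z) = (if f = f0 then c None z else 0)"
      if "f \<in> F" "z \<in> ?B" for f z
      using c(3)[OF that] E(1) by (auto simp: aS aN sum.reindex split: if_splits)
    define X where "X z = (\<Sum>e\<in>E. c (Some e) z *\<^sub>C u e z)" for z
    have X: "vec_analytic_on X ?B"
      unfolding X_def by (intro vec_analytic_on_sum vec_analytic_on_scaleC c u open_ball) auto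
    have Xeq: "A (X z) - z *\<^sub>C X z = - (z * c None z) *\<^sub>C f0" if z: "z \<in> ?B" for z
    proof -
      have "A (X z) - z *\<^sub>C X z = (\<Sum>e\<in>E. c (Some e) z *\<^sub>C (A (u e z) - z *\<^sub>C u e z))"
        unfolding X_def cblinfun_right_simps complex_vector.scale_sum_right sum_subtractf[symmetric]
        by (intro sum.cong) (auto simp: complex_vector.scale_right_diff_distrib scaleC_scaleC mult.commute)
      also have "\<dots> = (\<Sum>e\<in>E. - (z *\<^sub>C (\<Sum>f\<in>F. (p f e z * c (Some e) z) *\<^sub>C f)))"
        using ueq z by (intro sum.cong)
          (auto simp: complex_vector.scale_sum_right scaleC_scaleC mult_ac)
      also have "\<dots> = - (z *\<^sub>C (\<Sum>f\<in>F. (\<Sum>e\<in>E. p f e z * c (Some e) z) *\<^sub>C f))"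
        by (subst complex_vector.scale_sum_left, subst sum.swap)
          (simp add: sum_negf complex_vector.scale_sum_right)
      also have "(\<Sum>f\<in>F. (\<Sum>e\<in>E. p f e z * c (Some e) z) *\<^sub>C f) = (\<Sum>f\<in>F. if f = f0 then c None z *\<^sub>C f else 0)"
        using sys z by (intro sum.cong) auto
      also have "\<dots> = c None z *\<^sub>C f0" using F(1) f0 by simp
      finally show ?thesis by (simp add: scaleC_scaleC complex_vector.scale_minus_left)
    qed
    \<comment> \<open>Otherwise nothing is left over, and \<open>X\<close> would be an analytic
      family of eigenvectors.\<close>
    have "\<exists>z\<in>?B. c None z \<noteq> 0"
    proof (rule ccontr)
      assume "\<not> ?thesis"
      then have c0: "\<And>z. z \<in> ?B \<Longrightarrow> c None z = 0" by blast
      have "c None 0 = 0" using C by (intro c0) simp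
      then obtain e where "e \<in> E" "c (Some e) 0 \<noteq> 0" using c(2) by auto
      then have "X 0 \<noteq> 0"
        using cindependent_mod_0D[OF E(4,1), of "\<lambda>e. c (Some e) 0"] by (auto simp: X_def u0)
      then obtain s where s: "s > 0" "s \<le> 1 / C" "\<And>z. z \<in> ball 0 s \<Longrightarrow> X z \<noteq> 0"
        using vec_analytic_nonzero_near[OF X] C by auto
      have "A (X z) = z *\<^sub>C X z" if "z \<in> ball 0 s" for z
      proof -
        have "z \<in> ?B" using that s by auto
        then show ?thesis using Xeq[of z] c0[of z] by simp
      qed
      then show False using no_eig[OF s(1), of X] s(3) by blast
    qed
    then obtain z1 where z1: "z1 \<in> ?B" "c None z1 \<noteq> 0" by blast
    have "\<forall>\<^sub>F z in at 0. c None z \<noteq> 0"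
    proof (cases "c None 0 = 0")
      case True
      have B0: "0 \<in> ?B" using C by simp
      obtain r where "0 < r" "\<And>z. z \<in> ball 0 r - {0} \<Longrightarrow> c None z \<noteq> 0"
        by (rule isolated_zeros[OF c(1)[of None] open_ball connected_ball B0 True z1]) auto
      then show ?thesis by (auto simp: eventually_at dist_norm intro!: exI[of _ r])
    next
      case False
      have "c None \<midarrow>0\<rightarrow> c None 0" by (rule holomorphic_on_ball_tendsto[OF c(1)]) (use C in auto)
      from tendsto_imp_eventually_ne[OF this False] show ?thesis .
    qed
    moreover have "\<forall>\<^sub>F z in at 0. z \<in> ?B"
      using C by (auto simp: eventually_at dist_norm intro!: exI[of _ "1 / C"])
    moreover have "\<forall>\<^sub>F z in at (0::complex). z \<noteq> 0" by (rule eventually_neq_at_within)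
    ultimately show ?thesis
    proof eventually_elim
      case (elim z)
      let ?k = "- inverse (z * c None z)"
      have "(?A z) (?k *\<^sub>C X z) = ?k *\<^sub>C (A (X z) - z *\<^sub>C X z)"
        by (simp add: complex_vector.scale_right_diff_distrib scaleC_scaleC mult_ac cblinfun_minus_right)
      also have "\<dots> = (inverse (z * c None z) * (z * c None z)) *\<^sub>C f0"
        unfolding Xeq[OF elim(2)] by (simp add: scaleC_scaleC)
      also have "inverse (z * c None z) * (z * c None z) = 1" by (rule left_inverse) (use elim in simp)
      also have "1 *\<^sub>C f0 = f0" by simp
      finally show ?case by (metis rangeI)
    qed
  qed
  have "\<forall>\<^sub>F z in at 0. \<forall>f\<in>F. f \<in> range (?A z)"
    using ev F(1) by (simp add: eventually_ball_finite_distrib)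
  then obtain r1 where r1: "r1 > 0" "\<And>z f. z \<noteq> 0 \<Longrightarrow> cmod z < r1 \<Longrightarrow> f \<in> F \<Longrightarrow> f \<in> range (?A z)"
    by (auto simp: eventually_at dist_norm)
  obtain X q where Xq: "\<And>y z. z \<in> ?B \<Longrightarrow> A (X y z) - z *\<^sub>C X y z = y - (\<Sum>i\<in>F. q y i z *\<^sub>C i)"
    by (rule resolvent_equation_mod_finite[OF C sol]) (rule that; assumption)
  define r where "r = min r1 (1 / C)"
  have r: "r > 0" using r1 C by (simp add: r_def)
  define P where "P = ball (0::complex) r - {0}"
  \<comment> \<open>\<open>X y z\<close> solves the equation up to a combination of
    \<open>F\<close>, and by the choice of \<open>r\<close> each member of \<open>F\<close> is in
    the range.\<close>
  have surj: "range (?A z) = UNIV" if z: "z \<in> P" for z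
  proof -
    have "y \<in> range (?A z)" for y
    proof -
      have "y = (?A z) (X y z) + (\<Sum>i\<in>F. q y i z *\<^sub>C i)"
        using Xq[of z y] z by (simp add: P_def r_def)
      also have "\<dots> \<in> range (?A z)"
        using r1(2)[of z] z
        by (intro complex_vector.subspace_add[OF subspace_range_cblinfun]
            complex_vector.subspace_sum[OF subspace_range_cblinfun]
            complex_vector.subspace_scale[OF subspace_range_cblinfun]) (auto simp: P_def r_def)
      finally show ?thesis .
    qed
    then show ?thesis by blast
  qed
  have "cspectrum A \<inter> P = {} \<or> cspectrum A \<inter> P = P"
  proof -
    have "connected P" unfolding P_def by (intro connected_punctured_ball) simp
    \<comment> \<open>At a spectral point in \<open>P\<close> the operator is onto but not
      injective, so its defect is 0 and its nullity positive; the resulting analytic eigenvectors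
      put a whole neighbourhood into the spectrum.\<close>
    moreover have "open (cspectrum A \<inter> P)"
      unfolding open_contains_ball
    proof
      fix z assume z: "z \<in> cspectrum A \<inter> P"
      then have "\<not> inj (?A z)" using surj[of z] by (metis IntD1 IntD2 bijI cspectrum_iff)
      then obtain x y where xy: "x \<noteq> y" "(?A z) x = (?A z) y" by (auto simp: inj_on_def)
      have "enat 1 \<le> nullity (?A z)"
        using xy by (intro nullity_pos[of _ "x - y"]) (simp_all add: cblinfun_diff_right del: cblinfun_diff_left)
      moreover have d0: "defect (?A z) = 0" by (rule defect_zero[OF surj]) (use z in blast)
      ultimately have lt: "defect (?A z) < nullity (?A z)"
        by (cases "nullity (?A z)") (auto simp: zero_enat_def)
      obtain Y s where Y: "s > 0" "\<And>w. w \<in> ball 0 s \<Longrightarrow> (?A z) (Y w) = w *\<^sub>C Y w"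
        "\<And>w. w \<in> ball 0 s \<Longrightarrow> Y w \<noteq> 0"
      proof (rule positive_index_imp_eigenvector[OF _ lt])
        have "z \<in> P" using z by blast
        then show "closed (range (?A z))" by (simp only: surj closed_UNIV)
      qed blast
      have "ball z s \<subseteq> cspectrum A"
      proof
        fix w assume "w \<in> ball z s"
        then have w: "w - z \<in> ball 0 s" by (simp add: dist_norm norm_minus_commute)
        have "(?A w) (Y (w - z)) = (?A w) 0"
          using Y(2)[OF w] by (simp add: complex_vector.scale_left_diff_distrib)
        then show "w \<in> cspectrum A"
          using Y(3)[OF w] unfolding cspectrum_iff by (metis bij_is_inj injD)
      qed
      moreover have "open P" by (simp add: P_def open_Diff)
      then obtain t where "t > 0" "ball z t \<subseteq> P" using z by (auto elim: openE)
      ultimately show "\<exists>e>0. ball z e \<subseteq> cspectrum A \<inter> P"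
        using Y(1) by (intro exI[of _ "min s t"]) auto
    qed
    then have "openin (top_of_set P) (cspectrum A \<inter> P)" by (simp add: openin_subtopology_Int2 open_openin[symmetric] openin_open_eq P_def open_Diff)
    moreover have "closedin (top_of_set P) (cspectrum A \<inter> P)"
      using closedin_closed_Int[OF closed_cspectrum, of P A] by (simp add: Int_commute)
    ultimately show ?thesis using connected_clopen by blast
  qed
  moreover have "cspectrum A \<inter> P \<noteq> P"
  proof -
    obtain z where z: "z \<in> ball 0 r" "bij (?A z)" using near[OF r] by blast
    then have zA: "z \<notin> cspectrum A" unfolding cspectrum_iff by blast
    then have "z \<noteq> 0" using D0 by blast
    then have "z \<in> P" using z(1) by (simp add: P_def)
    then show ?thesis using zA by blast
  qed
  ultimately show ?thesis using r by (auto simp: P_def)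
qed

theorem frontier_cspectrum_imp_isolated:
  fixes T :: "'a::complex_banach \<Rightarrow>\<^sub>C\<^sub>L 'a"
  assumes "T - l *\<^sub>C id_cblinfun \<in> upper_semi_Fredholm" "l \<in> frontier (cspectrum T)"
  obtains r where "r > 0" "ball l r \<inter> cspectrum T \<subseteq> {l}"
proof -
  have "0 \<in> frontier (cspectrum (T - l *\<^sub>C id_cblinfun))"
    unfolding cspectrum_diff_scaleC frontier_translation
    using assms(2) by (intro image_eqI[of _ _ l]) auto
  then obtain r where r: "r > 0" "ball 0 r \<inter> cspectrum (T - l *\<^sub>C id_cblinfun) \<subseteq> {0}"
    using frontier_cspectrum_imp_isolated_0[OF assms(1)] by blast
  have "z = l" if "z \<in> ball l r \<inter> cspectrum T" for z
  proof -
    have "z - l \<in> ball 0 r \<inter> cspectrum (T - l *\<^sub>C id_cblinfun)"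
      using that unfolding cspectrum_diff_scaleC
      by (intro IntI image_eqI[of _ _ z]) (simp_all add: dist_norm norm_minus_commute)
    then show ?thesis using r(2) by auto
  qed
  then show ?thesis using r(1) that[of r] by blast
qed

section \<open>Surrounding a compact set by a grid polygon\<close>

text \<open>A finite set \<open>E\<close> of oriented edges is balanced if every vertex has as many incoming as
  outgoing edges; this is expressed by testing against all functions on the vertices.\<close>

definition balanced :: "('v \<times> 'v) set \<Rightarrow> bool" where
  "balanced E \<longleftrightarrow> (\<forall>h :: 'v \<Rightarrow> real. (\<Sum>e\<in>E. h (snd e) - h (fst e)) = 0)"

text \<open>The boundary of the unit square with lower left corner \<open>(i, j)\<close>,
  counterclockwise; with this orientation neighbouring squares traverse their common edge in
  opposite directions.\<close>

definition grid_edges :: "int \<times> int \<Rightarrow> ((int \<times> int) \<times> (int \<times> int)) set" where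
  "grid_edges = (\<lambda>(i, j). {((i, j), (i + 1, j)), ((i + 1, j), (i + 1, j + 1)),
     ((i + 1, j + 1), (i, j + 1)), ((i, j + 1), (i, j))})"

lemma finite_grid_edges [simp]: "finite (grid_edges s)"
  by (cases s) (simp add: grid_edges_def)

lemma sum_grid_edges:
  "(\<Sum>e\<in>grid_edges (i, j). w e) = w ((i, j), (i + 1, j)) + w ((i + 1, j), (i + 1, j + 1)) +
     w ((i + 1, j + 1), (i, j + 1)) + w ((i, j + 1), (i, j))"
  for w :: "_ \<Rightarrow> 'b::comm_monoid_add"
  by (simp add: grid_edges_def add.assoc)

lemma grid_edges_disjoint: "s \<noteq> t \<Longrightarrow> grid_edges s \<inter> grid_edges t = {}"
  by (cases s; cases t) (auto simp: grid_edges_def)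

definition boundary_edges :: "(int \<times> int) set \<Rightarrow> ((int \<times> int) \<times> (int \<times> int)) set" where
  "boundary_edges S = {e \<in> (\<Union>s\<in>S. grid_edges s). prod.swap e \<notin> (\<Union>s\<in>S. grid_edges s)}"

text \<open>Interior edges are traversed in both directions, hence cancel.\<close>

lemma sum_boundary_edges:
  fixes w :: "(int \<times> int) \<times> (int \<times> int) \<Rightarrow> 'b::real_vector"
  assumes S: "finite S" and anti: "\<And>e. e \<in> (\<Union>s\<in>S. grid_edges s) \<Longrightarrow> w (prod.swap e) = - w e"
  shows "(\<Sum>e\<in>boundary_edges S. w e) = (\<Sum>s\<in>S. \<Sum>e\<in>grid_edges s. w e)"
proof -
  let ?D = "\<Union>s\<in>S. grid_edges s"
  let ?I = "{e\<in>?D. prod.swap e \<in> ?D}"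
  have "(\<Sum>s\<in>S. \<Sum>e\<in>grid_edges s. w e) = (\<Sum>e\<in>?D. w e)"
    using S grid_edges_disjoint by (intro sum.UNION_disjoint[symmetric]) auto
  also have "\<dots> = (\<Sum>e\<in>boundary_edges S. w e) + (\<Sum>e\<in>?I. w e)"
    using S unfolding boundary_edges_def
    by (subst sum.union_disjoint[symmetric]) (auto intro!: sum.cong)
  also have "(\<Sum>e\<in>?I. w e) = 0"
  proof -
    have "(\<Sum>e\<in>?I. w e) = (\<Sum>e\<in>?I. w (prod.swap e))"
      by (rule sum.reindex_bij_witness[of _ prod.swap prod.swap]) auto
    also have "\<dots> = - (\<Sum>e\<in>?I. w e)"
      unfolding sum_negf[symmetric] using anti by (intro sum.cong) auto
    finally have "2 *\<^sub>R (\<Sum>e\<in>?I. w e) = 0" by (simp add: scaleR_2 eq_neg_iff_add_eq_0)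
    then show ?thesis by simp
  qed
  finally show ?thesis by simp
qed

lemma balanced_boundary_edges:
  assumes "finite S"
  shows "balanced (boundary_edges S)"
  unfolding balanced_def
proof
  fix h :: "int \<times> int \<Rightarrow> real"
  have "(\<Sum>e\<in>boundary_edges S. h (snd e) - h (fst e)) =
      (\<Sum>s\<in>S. \<Sum>e\<in>grid_edges s. h (snd e) - h (fst e))"
    using assms by (intro sum_boundary_edges) auto
  also have "\<dots> = 0"
  proof (rule sum.neutral, rule ballI)
    fix s show "(\<Sum>e\<in>grid_edges s. h (snd e) - h (fst e)) = 0"
      by (cases s) (simp add: sum_grid_edges)
  qed
  finally show "(\<Sum>e\<in>boundary_edges S. h (snd e) - h (fst e)) = 0" .
qed

text \<open>The indicator of the end vertex of \<open>e\<close> as test function counts incoming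
  minus outgoing edges there.\<close>

lemma balanced_imp_edge_from:
  assumes "balanced E" "finite E" "e \<in> E"
  shows "\<exists>e'\<in>E. fst e' = snd e"
proof (rule ccontr)
  assume neg: "\<not> ?thesis"
  let ?h = "\<lambda>v. if v = snd e then 1 else 0 :: real"
  have "(\<Sum>x\<in>E. ?h (snd x) - ?h (fst x)) = (\<Sum>x\<in>E. ?h (snd x))"
    using neg by (intro sum.cong) auto
  moreover have "(\<Sum>x\<in>E. ?h (snd x)) \<ge> ?h (snd e)"
    using assms by (intro member_le_sum) auto
  ultimately show False using assms(1)[unfolded balanced_def, rule_format, of ?h] by simp
qed

section \<open>Closed paths from balanced edge sets\<close>

fun chained :: "('v \<times> 'v) list \<Rightarrow> bool" where
  "chained [] \<longleftrightarrow> True"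
| "chained [e] \<longleftrightarrow> True"
| "chained (e # e' # es) \<longleftrightarrow> snd e = fst e' \<and> chained (e' # es)"

lemma chained_map_upt:
  "(\<And>k. i \<le> k \<Longrightarrow> Suc k < j \<Longrightarrow> snd (f k) = fst (f (Suc k))) \<Longrightarrow> chained (map f [i..<j])"
proof (induction "j - i" arbitrary: i)
  case (Suc n)
  have ij: "i < j" using Suc(2) by simp
  have IH: "chained (map f [Suc i..<j])" using Suc by (intro Suc(1)) auto
  show ?case
  proof (cases "Suc i < j")
    case True
    then have "[i..<j] = i # Suc i # [Suc (Suc i)..<j]" "[Suc i..<j] = Suc i # [Suc (Suc i)..<j]"
      using ij by (simp_all add: upt_conv_Cons)
    then show ?thesis using IH Suc.prems[of i] True by simp
  next
    case False
    then have "[i..<j] = [i]" using ij by (simp add: upt_conv_Cons)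
    then show ?thesis by simp
  qed
qed simp

lemma chained_sum:
  fixes h :: "'v \<Rightarrow> real"
  shows "chained es \<Longrightarrow> es \<noteq> [] \<Longrightarrow>
    (\<Sum>e\<leftarrow>es. h (snd e) - h (fst e)) = h (snd (last es)) - h (fst (hd es))"
  by (induction es rule: chained.induct) auto

lemma balanced_imp_cycle:
  assumes E: "balanced E" "finite E" "E \<noteq> {}"
  obtains es where "distinct es" "es \<noteq> []" "set es \<subseteq> E" "chained es" "snd (last es) = fst (hd es)"
proof -
  obtain e0 where e0: "e0 \<in> E" using E by blast
  have "\<forall>e\<in>E. \<exists>e'\<in>E. fst e' = snd e" using balanced_imp_edge_from[OF E(1,2)] by blast
  then obtain nx where nx: "\<And>e. e \<in> E \<Longrightarrow> nx e \<in> E" "\<And>e. e \<in> E \<Longrightarrow> fst (nx e) = snd e" by metis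
  define s where "s n = (nx ^^ n) e0" for n :: nat
  have sS: "s (Suc n) = nx (s n)" for n by (simp add: s_def)
  have sE: "s n \<in> E" for n by (induction n) (use e0 nx in \<open>auto simp: s_def\<close>)
  have "\<not> inj s"
  proof
    assume "inj s"
    then have "infinite (range s)" using finite_imageD by blast
    then show False using sE E(2) finite_subset[of "range s" E] by blast
  qed
  then have "\<exists>j. \<exists>i<j. s i = s j" unfolding inj_def by (metis linorder_neqE_nat)
  \<comment> \<open>The first time at which the walk returns to an earlier edge; by minimality there
    are no repetitions between the two visits.\<close>
  define j where "j = (LEAST j. \<exists>i<j. s i = s j)"
  obtain i where i: "i < j" "s i = s j"
    using LeastI_ex[OF \<open>\<exists>j. \<exists>i<j. s i = s j\<close>] unfolding j_def by blast
  have min: "s a \<noteq> s b" if "a < b" "b < j" for a b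
    using not_less_Least[of b "\<lambda>j. \<exists>i<j. s i = s j"] that unfolding j_def by blast
  show ?thesis
  proof (rule that[of "map s [i..<j]"])
    show "distinct (map s [i..<j])"
      unfolding distinct_map using min by (auto intro!: inj_onI) (metis linorder_neqE_nat)
    show "map s [i..<j] \<noteq> []" using i by simp
    show "set (map s [i..<j]) \<subseteq> E" using sE by auto
    show "chained (map s [i..<j])" by (rule chained_map_upt) (simp add: sS nx sE)
    obtain k where k: "j = Suc k" using i by (cases j) auto
    have "last (map s [i..<j]) = s k" "hd (map s [i..<j]) = s i"
      using i k by (simp_all add: last_map hd_map hd_upt del: upt_Suc)
    moreover have "fst (s (Suc k)) = snd (s k)" by (simp add: sS nx sE)
    ultimately show "snd (last (map s [i..<j])) = fst (hd (map s [i..<j]))"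
      using i k by (simp del: upt_Suc)
  qed
qed

fun polygon_path :: "(complex \<times> complex) list \<Rightarrow> real \<Rightarrow> complex" where
  "polygon_path [] = linepath 0 0"
| "polygon_path [e] = linepath (fst e) (snd e)"
| "polygon_path (e # e' # es) = linepath (fst e) (snd e) +++ polygon_path (e' # es)"

definition edge_set :: "complex \<times> complex \<Rightarrow> complex set" where
  "edge_set e = closed_segment (fst e) (snd e)"

lemma polygon_path:
  assumes "chained es" "es \<noteq> []"
  shows "pathstart (polygon_path es) = fst (hd es) \<and> pathfinish (polygon_path es) = snd (last es) \<and>
    valid_path (polygon_path es) \<and> path_image (polygon_path es) = \<Union> (edge_set ` set es)"
  using assms
proof (induction es rule: chained.induct)
  case (3 e e' es)
  then show ?case by (simp add: path_image_join edge_set_def)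
qed (auto simp: edge_set_def)

lemma polygon_path_integral:
  assumes "chained es" "es \<noteq> []" "continuous_on (\<Union> (edge_set ` set es)) g"
  shows "(g has_contour_integral (\<Sum>e\<leftarrow>es. contour_integral (linepath (fst e) (snd e)) g)) (polygon_path es)"
  using assms
proof (induction es rule: chained.induct)
  case (2 e)
  then have "g contour_integrable_on linepath (fst e) (snd e)"
    by (intro contour_integrable_continuous_linepath) (simp add: edge_set_def)
  then show ?case by (simp add: has_contour_integral_integral)
next
  case (3 e e' es)
  have "g contour_integrable_on linepath (fst e) (snd e)"
    using 3(4) by (intro contour_integrable_continuous_linepath)
      (auto simp: edge_set_def intro: continuous_on_subset)
  moreover have "(g has_contour_integral (\<Sum>e\<leftarrow>e' # es. contour_integral (linepath (fst e) (snd e)) g))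
      (polygon_path (e' # es))"
    using 3 by (intro 3(1)) (auto intro: continuous_on_subset)
  moreover have "valid_path (polygon_path (e' # es))" using polygon_path[of "e' # es"] 3(2) by simp
  ultimately show ?case
    by (auto intro!: has_contour_integral_join has_contour_integral_integral)
qed simp

text \<open>A cycle is split off, and the remaining edges are still balanced because a closed chain
  contributes 0 to every test function.\<close>

lemma balanced_imp_closed_paths:
  fixes E :: "(complex \<times> complex) set"
  assumes "finite E" "balanced E"
  obtains \<Gamma> where "\<And>\<gamma>. \<gamma> \<in> set \<Gamma> \<Longrightarrow> valid_path \<gamma>" "\<And>\<gamma>. \<gamma> \<in> set \<Gamma> \<Longrightarrow> pathfinish \<gamma> = pathstart \<gamma>"
    "\<And>\<gamma>. \<gamma> \<in> set \<Gamma> \<Longrightarrow> path_image \<gamma> \<subseteq> \<Union> (edge_set ` E)"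
    "\<And>g. continuous_on (\<Union> (edge_set ` E)) g \<Longrightarrow>
      (\<Sum>\<gamma>\<leftarrow>\<Gamma>. contour_integral \<gamma> g) = (\<Sum>e\<in>E. contour_integral (linepath (fst e) (snd e)) g)"
proof -
  have "\<exists>\<Gamma>. (\<forall>\<gamma>\<in>set \<Gamma>. valid_path \<gamma> \<and> pathfinish \<gamma> = pathstart \<gamma> \<and> path_image \<gamma> \<subseteq> \<Union> (edge_set ` E)) \<and>
    (\<forall>g. continuous_on (\<Union> (edge_set ` E)) g \<longrightarrow>
      (\<Sum>\<gamma>\<leftarrow>\<Gamma>. contour_integral \<gamma> g) = (\<Sum>e\<in>E. contour_integral (linepath (fst e) (snd e)) g))"
    using assms
  proof (induction E rule: finite_psubset_induct)
    case (psubset E)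
    show ?case
    proof (cases "E = {}")
      case True
      then show ?thesis by (intro exI[of _ "[]"]) auto
    next
      case False
      obtain es where es: "distinct es" "es \<noteq> []" "set es \<subseteq> E" "chained es" "snd (last es) = fst (hd es)"
        using balanced_imp_cycle[OF psubset.prems psubset.hyps(1) False] by blast
      let ?E = "E - set es"
      have split: "(\<Sum>e\<in>E. w e) = (\<Sum>e\<leftarrow>es. w e) + (\<Sum>e\<in>?E. w e)" for w :: "_ \<Rightarrow> 'b::ab_group_add"
        using sum.subset_diff[OF es(3) psubset.hyps(1), of w] sum_list_distinct_conv_sum_set[OF es(1), of w]
        by (simp add: add.commute)
      have "balanced ?E"
        unfolding balanced_def
      proof
        fix h :: "complex \<Rightarrow> real"
        show "(\<Sum>e\<in>?E. h (snd e) - h (fst e)) = 0"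
          using psubset.prems split[of "\<lambda>e. h (snd e) - h (fst e)"] chained_sum[OF es(4,2), of h] es(5)
          unfolding balanced_def by simp
      qed
      moreover have "?E \<subset> E" using es(2,3) by (cases es) auto
      ultimately obtain \<Gamma> where \<Gamma>: "\<And>\<gamma>. \<gamma> \<in> set \<Gamma> \<Longrightarrow>
          valid_path \<gamma> \<and> pathfinish \<gamma> = pathstart \<gamma> \<and> path_image \<gamma> \<subseteq> \<Union> (edge_set ` ?E)"
        "\<And>g. continuous_on (\<Union> (edge_set ` ?E)) g \<Longrightarrow>
          (\<Sum>\<gamma>\<leftarrow>\<Gamma>. contour_integral \<gamma> g) = (\<Sum>e\<in>?E. contour_integral (linepath (fst e) (snd e)) g)"
        using psubset.IH[of ?E] by blast
      let ?\<Gamma> = "polygon_path es # \<Gamma>"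
      have "\<forall>\<gamma>\<in>set ?\<Gamma>. valid_path \<gamma> \<and> pathfinish \<gamma> = pathstart \<gamma> \<and> path_image \<gamma> \<subseteq> \<Union> (edge_set ` E)"
        using \<Gamma>(1) polygon_path[OF es(4,2)] es(3,5) by fastforce
      moreover have "(\<Sum>\<gamma>\<leftarrow>?\<Gamma>. contour_integral \<gamma> g) = (\<Sum>e\<in>E. contour_integral (linepath (fst e) (snd e)) g)"
        if g: "continuous_on (\<Union> (edge_set ` E)) g" for g
      proof -
        have "continuous_on (\<Union> (edge_set ` set es)) g" "continuous_on (\<Union> (edge_set ` ?E)) g"
          using es(3) by (auto intro: continuous_on_subset[OF g])
        then show ?thesis
          using \<Gamma>(2) polygon_path_integral[OF es(4,2)] unfolding split
          by (simp add: contour_integral_unique)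
      qed
      ultimately show ?thesis by blast
    qed
  qed
  then show ?thesis using that by blast
qed

section \<open>Square grids and the Cauchy formula for grid polygons\<close>

definition grid_point :: "real \<Rightarrow> int \<times> int \<Rightarrow> complex" where
  "grid_point \<delta> v = Complex (\<delta> * of_int (fst v)) (\<delta> * of_int (snd v))"

definition grid_square :: "real \<Rightarrow> int \<times> int \<Rightarrow> complex set" where
  "grid_square \<delta> s = cbox (grid_point \<delta> s) (grid_point \<delta> (fst s + 1, snd s + 1))"

lemma mem_grid_square:
  "z \<in> grid_square \<delta> (i, j) \<longleftrightarrow> \<delta> * of_int i \<le> Re z \<and> Re z \<le> \<delta> * of_int (i + 1) \<and>
    \<delta> * of_int j \<le> Im z \<and> Im z \<le> \<delta> * of_int (j + 1)"
  by (auto simp: grid_square_def grid_point_def in_cbox_complex_iff)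

definition grid_edge :: "real \<Rightarrow> (int \<times> int) \<times> (int \<times> int) \<Rightarrow> complex \<times> complex" where
  "grid_edge \<delta> e = (grid_point \<delta> (fst e), grid_point \<delta> (snd e))"

lemma inj_grid_point: "\<delta> > 0 \<Longrightarrow> inj (grid_point \<delta>)"
  by (auto simp: inj_def grid_point_def prod_eq_iff)

lemma inj_grid_edge: "\<delta> > 0 \<Longrightarrow> inj (grid_edge \<delta>)"
  using inj_grid_point[of \<delta>] by (auto simp: inj_def grid_edge_def prod_eq_iff)

lemma grid_edge_subset_square:
  assumes "\<delta> > 0" "e \<in> grid_edges s"
  shows "edge_set (grid_edge \<delta> e) \<subseteq> grid_square \<delta> s"
proof -
  obtain i j where s: "s = (i, j)" by (cases s)
  have "convex (grid_square \<delta> s)" by (simp add: grid_square_def convex_box)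
  moreover have "grid_point \<delta> (fst e) \<in> grid_square \<delta> s" "grid_point \<delta> (snd e) \<in> grid_square \<delta> s"
    using assms by (auto simp: s grid_edges_def mem_grid_square grid_point_def)
  ultimately show ?thesis
    unfolding edge_set_def grid_edge_def by (simp add: closed_segment_subset)
qed

lemma swap_edge_neighbour:
  assumes "e \<in> grid_edges s"
  obtains t where "prod.swap e \<in> grid_edges t"
proof -
  obtain i j where s: "s = (i, j)" by (cases s)
  have "prod.swap e \<in> grid_edges (i, j - 1) \<or> prod.swap e \<in> grid_edges (i + 1, j) \<or>
      prod.swap e \<in> grid_edges (i, j + 1) \<or> prod.swap e \<in> grid_edges (i - 1, j)"
    using assms by (auto simp: s grid_edges_def)
  then show ?thesis using that by blast
qed

lemma edge_set_swap: "edge_set (grid_edge \<delta> (prod.swap e)) = edge_set (grid_edge \<delta> e)"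
  by (simp add: edge_set_def grid_edge_def closed_segment_commute)

text \<open>An edge that meets \<open>K\<close> belongs to two squares that meet \<open>K\<close>;
  both are in \<open>S\<close>, so the edge occurs in both directions and is not on the
  boundary.\<close>

lemma boundary_edges_avoid:
  assumes "\<delta> > 0" and S: "\<And>s. grid_square \<delta> s \<inter> K \<noteq> {} \<Longrightarrow> s \<in> S" and e: "e \<in> boundary_edges S"
  shows "edge_set (grid_edge \<delta> e) \<inter> K = {}"
proof (rule ccontr)
  assume neg: "\<not> ?thesis"
  obtain s where "e \<in> grid_edges s" using e by (auto simp: boundary_edges_def)
  then obtain t where t: "prod.swap e \<in> grid_edges t" by (rule swap_edge_neighbour)
  then have "edge_set (grid_edge \<delta> e) \<subseteq> grid_square \<delta> t"
    using grid_edge_subset_square[OF assms(1) t] by (simp add: edge_set_swap)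
  then have "t \<in> S" using neg by (intro S) auto
  then show False using e t by (auto simp: boundary_edges_def)
qed

lemma square_Cauchy_formula:
  assumes \<delta>: "\<delta> > 0" and V: "open V" "grid_square \<delta> s \<subseteq> V" and g: "g holomorphic_on V"
    and z: "z \<in> box (grid_point \<delta> s) (grid_point \<delta> (fst s + 1, snd s + 1)) \<or> z \<notin> grid_square \<delta> s"
  shows "(\<Sum>e\<in>grid_edges s. contour_integral (linepath (fst (grid_edge \<delta> e)) (snd (grid_edge \<delta> e)))
      (\<lambda>w. g w / (w - z))) = (if z \<in> grid_square \<delta> s then 2 * of_real pi * \<i> * g z else 0)"
proof -
  obtain i j where s: "s = (i, j)" by (cases s)
  let ?p = "\<lambda>a b. grid_point \<delta> (a, b)"
  let ?R = "rectpath (?p i j) (?p (i + 1) (j + 1))"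
  let ?f = "\<lambda>w. g w / (w - z)"
  have le: "Re (?p i j) < Re (?p (i + 1) (j + 1))" "Im (?p i j) < Im (?p (i + 1) (j + 1))"
    using \<delta> by (auto simp: grid_point_def)
  have R: "?R = linepath (?p i j) (?p (i + 1) j) +++ linepath (?p (i + 1) j) (?p (i + 1) (j + 1)) +++
      linepath (?p (i + 1) (j + 1)) (?p i (j + 1)) +++ linepath (?p i (j + 1)) (?p i j)"
    by (simp add: rectpath_def Let_def grid_point_def)
  have sq: "grid_square \<delta> s = cbox (?p i j) (?p (i + 1) (j + 1))"
    by (simp add: s grid_square_def)
  have pR: "path_image ?R = cbox (?p i j) (?p (i + 1) (j + 1)) - box (?p i j) (?p (i + 1) (j + 1))"
    using le by (intro path_image_rectpath_cbox_minus_box) auto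
  have zR: "z \<notin> path_image ?R"
    using z by (auto simp: pR s grid_square_def)
  have cont: "continuous_on (path_image ?R) ?f"
    using zR V by (intro continuous_intros
        continuous_on_subset[OF holomorphic_on_imp_continuous_on[OF g]]) (auto simp: pR sq)
  have seg: "?f contour_integrable_on linepath a b" if "closed_segment a b \<subseteq> path_image ?R" for a b
    using that by (intro contour_integrable_continuous_linepath continuous_on_subset[OF cont])
  have pi: "path_image ?R = closed_segment (?p i j) (?p (i + 1) j) \<union>
      closed_segment (?p (i + 1) j) (?p (i + 1) (j + 1)) \<union>
      closed_segment (?p (i + 1) (j + 1)) (?p i (j + 1)) \<union> closed_segment (?p i (j + 1)) (?p i j)"
    unfolding R by (simp add: path_image_join Un_assoc)
  have "(?f has_contour_integral (\<Sum>e\<in>grid_edges s. contour_integral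
      (linepath (fst (grid_edge \<delta> e)) (snd (grid_edge \<delta> e))) ?f)) ?R"
    unfolding R s sum_grid_edges grid_edge_def fst_conv snd_conv add.assoc
    by (intro has_contour_integral_join has_contour_integral_integral seg) (auto simp: pi)
  then have sum: "(\<Sum>e\<in>grid_edges s. contour_integral
      (linepath (fst (grid_edge \<delta> e)) (snd (grid_edge \<delta> e))) ?f) = contour_integral ?R ?f"
    by (simp add: contour_integral_unique)
  have conv: "convex (grid_square \<delta> s)" by (simp add: sq convex_box)
  have gs: "g holomorphic_on grid_square \<delta> s" using V g by (auto intro: holomorphic_on_subset)
  show ?thesis
  proof (cases "z \<in> grid_square \<delta> s")
    case True
    then have zb: "z \<in> box (?p i j) (?p (i + 1) (j + 1))" using z s by simp
    have "(?f has_contour_integral of_real (2 * pi) * \<i> * winding_number ?R z * g z) ?R"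
    proof (rule Cauchy_integral_formula_convex_simple[OF conv gs])
      show "z \<in> interior (grid_square \<delta> s)" using zb by (simp add: sq interior_cbox)
    qed (use zR pR sq in auto)
    then show ?thesis
      using sum True winding_number_rectpath[OF zb] by (simp add: contour_integral_unique)
  next
    case False
    have "(?f has_contour_integral 0) ?R"
    proof (rule Cauchy_theorem_convex_simple[OF _ conv])
      show "?f holomorphic_on grid_square \<delta> s"
        using False by (intro holomorphic_intros gs) auto
    qed (use pR sq in auto)
    then show ?thesis using sum False by (simp add: contour_integral_unique)
  qed
qed

text \<open>Velocity continuous on the whole parameter interval permits interchanging contour
  integrals and differentiating Cauchy-type integrals. A valid path guarantees it only off finitely
  many points, near which the velocity may be unbounded.\<close>

definition C1_path :: "(real \<Rightarrow> complex) \<Rightarrow> bool" where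
  "C1_path \<gamma> \<longleftrightarrow> valid_path \<gamma> \<and> continuous_on {0..1} (\<lambda>t. vector_derivative \<gamma> (at t))"

lemma C1_path_linepath: "C1_path (linepath a b)"
  by (simp add: C1_path_def)

lemma C1_path_contour_integrable:
  assumes "C1_path \<gamma>" "continuous_on (path_image \<gamma>) f"
  shows "f contour_integrable_on \<gamma>"
proof -
  have "continuous_on {0..1} \<gamma>"
    using assms(1) by (auto simp: C1_path_def path_def dest: valid_path_imp_path)
  then have "continuous_on {0..1} (\<lambda>t. f (\<gamma> t) * vector_derivative \<gamma> (at t))"
    using assms by (intro continuous_intros continuous_on_compose2[OF assms(2)])
      (auto simp: C1_path_def path_image_def)
  then show ?thesis
    unfolding contour_integrable_on by (rule integrable_continuous_interval)
qed

text \<open>Differentiation under the integral sign; the velocity is bounded by compactness of the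
  parameter interval.\<close>

lemma Cauchy_type_integral_holomorphic:
  assumes \<gamma>: "C1_path \<gamma>" and g: "continuous_on (path_image \<gamma>) g"
  shows "(\<lambda>u. contour_integral \<gamma> (\<lambda>w. g w / (w - u))) holomorphic_on - path_image \<gamma>"
proof -
  have vp: "valid_path \<gamma>" using \<gamma> by (simp add: C1_path_def)
  then have op: "open (- path_image \<gamma>)" by (simp add: closed_valid_path_image open_Compl)
  have "compact ((\<lambda>t. vector_derivative \<gamma> (at t)) ` {0..1})"
    using \<gamma> by (intro compact_continuous_image) (auto simp: C1_path_def)
  then have "bounded ((\<lambda>t. vector_derivative \<gamma> (at t)) ` {0..1})" by (rule compact_imp_bounded)
  then obtain B where "\<forall>x\<in>(\<lambda>t. vector_derivative \<gamma> (at t)) ` {0..1}. norm x \<le> B"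
    unfolding bounded_iff by blast
  then have B: "norm (vector_derivative \<gamma> (at t)) \<le> B" if "t \<in> {0..1}" for t
    using that by blast
  have int: "((\<lambda>w. g w / (w - u) ^ 1) has_contour_integral contour_integral \<gamma> (\<lambda>w. g w / (w - u))) \<gamma>"
    if "u \<in> UNIV - path_image \<gamma>" for u
    using that by (auto intro!: has_contour_integral_integral C1_path_contour_integrable \<gamma>
        continuous_intros g)
  have "((\<lambda>u. contour_integral \<gamma> (\<lambda>w. g w / (w - u))) has_field_derivative
      of_nat 1 * contour_integral \<gamma> (\<lambda>w. g w / (w - u) ^ Suc 1)) (at u)"
    if "u \<in> - path_image \<gamma>" for u
    using Cauchy_next_derivative(2)[OF g B int _ open_UNIV vp, of u] that by simp
  then show ?thesis
    unfolding holomorphic_on_open[OF op] by blast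
qed

lemma grid_edge_meets_square_interior:
  assumes "\<delta> > 0" "e \<in> grid_edges s"
  shows "edge_set (grid_edge \<delta> e) \<inter> box (grid_point \<delta> s) (grid_point \<delta> (fst s + 1, snd s + 1)) = {}"
proof -
  obtain i j where s: "s = (i, j)" by (cases s)
  show ?thesis
    using assms
    by (auto simp: s grid_edges_def edge_set_def grid_edge_def grid_point_def in_box_complex_iff
        closed_segment_same_Re closed_segment_same_Im)
qed

lemma grid_square_unique:
  assumes "\<delta> > 0" "z \<in> box (grid_point \<delta> s) (grid_point \<delta> (fst s + 1, snd s + 1))" "z \<in> grid_square \<delta> t"
  shows "t = s"
proof -
  obtain i j k l where st: "s = (i, j)" "t = (k, l)" by (cases s; cases t) auto
  have eq: "a = b" if "\<delta> * of_int a < x" "x < \<delta> * (of_int a + 1)" "\<delta> * of_int b \<le> x" "x \<le> \<delta> * (of_int b + 1)"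
    for a b :: int and x
  proof -
    have "\<delta> * of_int a < \<delta> * (of_int b + 1)" "\<delta> * of_int b < \<delta> * (of_int a + 1)" using that by linarith+
    then show ?thesis using assms(1) by simp
  qed
  show ?thesis
    using assms(2,3) eq unfolding st
    by (auto simp: mem_grid_square grid_point_def in_box_complex_iff)
qed

text \<open>All grid squares that meet \<open>K\<close> are joined: edges inside cancel, and the
  remaining ones avoid \<open>K\<close>. For \<open>z\<close> in the interior of a square only this
  square contributes; a point of \<open>K\<close> on a grid line is a limit of such points.\<close>

theorem grid_Cauchy_formula:
  fixes K V :: "complex set"
  assumes K: "compact K" and V: "open V" "K \<subseteq> V"
  obtains E :: "(complex \<times> complex) set" where "finite E" "balanced E"
    "\<And>e. e \<in> E \<Longrightarrow> edge_set e \<subseteq> V - K"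
    "\<And>g z. g holomorphic_on V \<Longrightarrow> z \<in> K \<Longrightarrow>
      (\<Sum>e\<in>E. contour_integral (linepath (fst e) (snd e)) (\<lambda>w. g w / (w - z))) = 2 * of_real pi * \<i> * g z"
proof -
  obtain d where d: "d > 0" "(\<Union>x\<in>K. ball x d) \<subseteq> V"
    using compact_subset_open_imp_ball_epsilon_subset[OF K V] by blast
  \<comment> \<open>Two points of a square of side \<delta> are at most \<open>2 * \<delta>\<close>
    apart, which is less than \<open>d\<close>, so the squares that meet \<open>K\<close> lie in
    \<open>V\<close>.\<close>
  define \<delta> where "\<delta> = d / 4"
  have \<delta>: "\<delta> > 0" using d by (simp add: \<delta>_def)
  define S where "S = {s. grid_square \<delta> s \<inter> K \<noteq> {}}"
  have SV: "grid_square \<delta> s \<subseteq> V" if sS: "s \<in> S" for s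
  proof
    fix x assume x: "x \<in> grid_square \<delta> s"
    obtain y where y: "y \<in> grid_square \<delta> s" "y \<in> K" using sS by (auto simp: S_def)
    obtain i j where s: "s = (i, j)" by (cases s)
    have "\<bar>Re (y - x)\<bar> \<le> \<delta>" "\<bar>Im (y - x)\<bar> \<le> \<delta>"
      using x y unfolding s mem_grid_square by (auto simp: algebra_simps)
    then have "cmod (y - x) \<le> 2 * \<delta>" using cmod_le[of "y - x"] by linarith
    then have "x \<in> ball y d" using d by (simp add: dist_norm \<delta>_def)
    then show "x \<in> V" using d(2) y by blast
  qed
  have finS: "finite S"
  proof -
    obtain B where B: "\<And>x. x \<in> K \<Longrightarrow> cmod x \<le> B" using compact_imp_bounded[OF K] by (auto simp: bounded_iff)
    define N where "N = \<lceil>B / \<delta>\<rceil> + 1"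
    have N: "B / \<delta> \<le> of_int N - 1" by (simp add: N_def)
    have rng: "a \<in> {-N..N}" if "\<delta> * of_int a \<le> x" "x \<le> \<delta> * of_int (a + 1)" "\<bar>x\<bar> \<le> B" for a :: int and x
    proof -
      have "\<delta> * of_int a \<le> B" "- B \<le> \<delta> * of_int (a + 1)" using that by linarith+
      then have "of_int a \<le> B / \<delta>" "- (B / \<delta>) \<le> of_int (a + 1)"
        using \<delta> by (simp_all add: field_simps)
      then have "(of_int a :: real) \<le> of_int N" "(of_int (- N) :: real) \<le> of_int a" using N by simp_all
      then have "a \<le> N" "- N \<le> a" by (simp_all only: of_int_le_iff)
      then show ?thesis by simp
    qed
    have "S \<subseteq> {-N..N} \<times> {-N..N}"
    proof
      fix s assume "s \<in> S"
      then obtain x where x: "x \<in> grid_square \<delta> s" "x \<in> K" by (auto simp: S_def)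
      obtain i j where s: "s = (i, j)" by (cases s)
      have "\<bar>Re x\<bar> \<le> B" "\<bar>Im x\<bar> \<le> B"
        using B[OF x(2)] abs_Re_le_cmod[of x] abs_Im_le_cmod[of x] by linarith+
      then show "s \<in> {-N..N} \<times> {-N..N}"
        using x(1) rng[of i "Re x"] rng[of j "Im x"] unfolding s mem_grid_square by blast
    qed
    then show ?thesis by (rule finite_subset) simp
  qed
  let ?D = "boundary_edges S"
  define E where "E = grid_edge \<delta> ` ?D"
  have finD: "finite ?D"
    using finS by (intro finite_subset[of ?D "\<Union>s\<in>S. grid_edges s"]) (auto simp: boundary_edges_def)
  have sumE: "(\<Sum>e\<in>E. w e) = (\<Sum>e\<in>?D. w (grid_edge \<delta> e))" for w :: "_ \<Rightarrow> 'b::comm_monoid_add"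
    unfolding E_def using inj_grid_edge[OF \<delta>] by (subst sum.reindex) (auto intro: inj_on_subset)
  have avoid: "edge_set e \<subseteq> V - K" if eE: "e \<in> E" for e
  proof -
    obtain e' where e': "e = grid_edge \<delta> e'" "e' \<in> ?D" using eE unfolding E_def by blast
    then obtain s where s: "s \<in> S" "e' \<in> grid_edges s" by (auto simp: boundary_edges_def)
    have "edge_set e \<subseteq> V" using grid_edge_subset_square[OF \<delta> s(2)] SV[OF s(1)] e' by blast
    moreover have "edge_set e \<inter> K = {}"
      unfolding e'(1) by (rule boundary_edges_avoid[OF \<delta> _ e'(2)]) (simp add: S_def)
    ultimately show ?thesis by blast
  qed
  have formula: "(\<Sum>e\<in>E. contour_integral (linepath (fst e) (snd e)) (\<lambda>w. g w / (w - z))) = 2 * of_real pi * \<i> * g z"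
    if g: "g holomorphic_on V" and s: "s \<in> S" and z: "z \<in> box (grid_point \<delta> s) (grid_point \<delta> (fst s + 1, snd s + 1))"
    for g z s
  proof -
    let ?w = "\<lambda>e. contour_integral (linepath (fst (grid_edge \<delta> e)) (snd (grid_edge \<delta> e))) (\<lambda>w. g w / (w - z))"
    have zs: "z \<in> grid_square \<delta> s" using z box_subset_cbox unfolding grid_square_def by blast
    have "(\<Sum>e\<in>?D. ?w e) = (\<Sum>t\<in>S. \<Sum>e\<in>grid_edges t. ?w e)"
    proof (rule sum_boundary_edges[OF finS])
      fix e assume "e \<in> (\<Union>s\<in>S. grid_edges s)"
      then obtain t where t: "t \<in> S" "e \<in> grid_edges t" by blast
      have sub: "edge_set (grid_edge \<delta> e) \<subseteq> grid_square \<delta> t" by (rule grid_edge_subset_square[OF \<delta> t(2)])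
      have "z \<notin> edge_set (grid_edge \<delta> e)"
      proof
        assume ze: "z \<in> edge_set (grid_edge \<delta> e)"
        then have "t = s" using grid_square_unique[OF \<delta> z] sub by blast
        then show False using grid_edge_meets_square_interior[OF \<delta> t(2)] z ze by blast
      qed
      then have "continuous_on (edge_set (grid_edge \<delta> e)) (\<lambda>w. g w / (w - z))"
        using sub SV[OF t(1)]
        by (intro continuous_intros continuous_on_subset[OF holomorphic_on_imp_continuous_on[OF g]]) auto
      then show "?w (prod.swap e) = - ?w e"
        by (subst contour_integral_reverse_linepath)
          (auto simp: edge_set_def grid_edge_def closed_segment_commute)
    qed
    also have "\<dots> = (\<Sum>t\<in>S. if t = s then 2 * of_real pi * \<i> * g z else 0)"
    proof (rule sum.cong[OF refl])
      fix t assume t: "t \<in> S"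
      have ts: "z \<in> grid_square \<delta> t \<longleftrightarrow> t = s"
        using grid_square_unique[OF \<delta> z] zs by blast
      have "z \<in> box (grid_point \<delta> t) (grid_point \<delta> (fst t + 1, snd t + 1)) \<or> z \<notin> grid_square \<delta> t"
        using ts z by blast
      from square_Cauchy_formula[OF \<delta> V(1) SV[OF t] g this]
      show "(\<Sum>e\<in>grid_edges t. ?w e) = (if t = s then 2 * of_real pi * \<i> * g z else 0)"
        by (simp only: ts)
    qed
    also have "\<dots> = 2 * of_real pi * \<i> * g z" using finS s by simp
    finally show ?thesis by (simp add: sumE)
  qed
  show ?thesis
  proof (rule that[of E])
    show "finite E" using finD by (simp add: E_def)
    show "balanced E"
      unfolding balanced_def
    proof
      fix h :: "complex \<Rightarrow> real"
      show "(\<Sum>e\<in>E. h (snd e) - h (fst e)) = 0"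
        using balanced_boundary_edges[OF finS, unfolded balanced_def, rule_format, of "\<lambda>v. h (grid_point \<delta> v)"]
        by (simp add: sumE grid_edge_def)
    qed
    fix g z assume g: "g holomorphic_on V" and z: "z \<in> K"
    define i where "i = \<lfloor>Re z / \<delta>\<rfloor>"
    define j where "j = \<lfloor>Im z / \<delta>\<rfloor>"
    have i: "\<delta> * of_int i \<le> Re z" "Re z < \<delta> * (of_int i + 1)"
      and j: "\<delta> * of_int j \<le> Im z" "Im z < \<delta> * (of_int j + 1)"
    proof -
      have fl: "\<delta> * of_int \<lfloor>x / \<delta>\<rfloor> \<le> x" "x < \<delta> * (of_int \<lfloor>x / \<delta>\<rfloor> + 1)" for x :: real
        using \<delta> mult_left_mono[OF of_int_floor_le[of "x / \<delta>"], of \<delta>]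
          mult_strict_left_mono[OF floor_correct[of "x / \<delta>", THEN conjunct2] \<delta>] by simp_all
      show "\<delta> * of_int i \<le> Re z" "Re z < \<delta> * (of_int i + 1)"
        "\<delta> * of_int j \<le> Im z" "Im z < \<delta> * (of_int j + 1)"
        unfolding i_def j_def by (rule fl)+
    qed
    have "z \<in> grid_square \<delta> (i, j)" using i j by (simp add: mem_grid_square)
    then have ijS: "(i, j) \<in> S" using z by (auto simp: S_def)
    \<comment> \<open>push \<open>z\<close> off the grid lines and pass to the limit\<close>
    define zt where "zt t = z + of_real t * Complex 1 1" for t :: real
    define m where "m = min (\<delta> * (of_int i + 1) - Re z) (\<delta> * (of_int j + 1) - Im z)"
    have m: "m > 0" using i j by (simp add: m_def)
    let ?F = "\<lambda>u. \<Sum>e\<in>E. contour_integral (linepath (fst e) (snd e)) (\<lambda>w. g w / (w - u))"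
    have ev: "\<forall>\<^sub>F t in at_right 0. ?F (zt t) = 2 * of_real pi * \<i> * g (zt t)"
      unfolding eventually_at_right_field
    proof (intro exI[of _ m] conjI allI impI m)
      fix t assume t: "0 < t" "t < m"
      have "zt t \<in> box (grid_point \<delta> (i, j)) (grid_point \<delta> (i + 1, j + 1))"
        using t i j by (auto simp: zt_def m_def in_box_complex_iff grid_point_def)
      then show "?F (zt t) = 2 * of_real pi * \<i> * g (zt t)"
        by (intro formula[OF g ijS]) simp
    qed
    have lim: "(zt \<longlongrightarrow> z) (at_right 0)"
    proof -
      have "((\<lambda>t. z + of_real t * Complex 1 1) \<longlongrightarrow> z + of_real 0 * Complex 1 1) (at_right 0)"
        by (intro tendsto_intros)
      then show ?thesis by (simp add: zt_def[abs_def])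
    qed
    have "isCont (\<lambda>u. contour_integral (linepath (fst e) (snd e)) (\<lambda>w. g w / (w - u))) z" if e: "e \<in> E" for e
    proof -
      have "(\<lambda>u. contour_integral (linepath (fst e) (snd e)) (\<lambda>w. g w / (w - u)))
          holomorphic_on - path_image (linepath (fst e) (snd e))"
        using avoid[OF e] unfolding edge_set_def
        by (intro Cauchy_type_integral_holomorphic C1_path_linepath
            continuous_on_subset[OF holomorphic_on_imp_continuous_on[OF g]]) auto
      moreover have "z \<in> - path_image (linepath (fst e) (snd e))"
        using avoid[OF e] z by (auto simp: edge_set_def)
      ultimately show ?thesis
        by (meson continuous_on_eq_continuous_at holomorphic_on_imp_continuous_on open_Compl closed_path_image path_linepath)
    qed
    then have "isCont ?F z" by (intro continuous_intros) auto
    then have "((\<lambda>t. ?F (zt t)) \<longlongrightarrow> ?F z) (at_right 0)" using lim by (rule isCont_tendsto_compose)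
    moreover have "isCont g z"
      using g V z by (meson continuous_on_eq_continuous_at holomorphic_on_imp_continuous_on subsetD)
    then have "((\<lambda>t. 2 * of_real pi * \<i> * g (zt t)) \<longlongrightarrow> 2 * of_real pi * \<i> * g z) (at_right 0)"
      using lim by (intro tendsto_intros isCont_tendsto_compose[of _ g])
    then have "((\<lambda>t. ?F (zt t)) \<longlongrightarrow> 2 * of_real pi * \<i> * g z) (at_right 0)"
      using ev by (simp add: tendsto_cong)
    ultimately show "?F z = 2 * of_real pi * \<i> * g z"
      by (rule tendsto_unique[OF trivial_limit_at_right_real])
  qed (rule avoid)
qed

lemma sum_list_map_nth: "(\<Sum>x\<leftarrow>xs. f x) = (\<Sum>i<length xs. f (xs ! i))"
  by (simp add: sum_list_sum_nth lessThan_atLeast0)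

text \<open>The winding numbers are read off the Cauchy formula on the edges; the constant function
  1 gives the value 1 on \<open>K\<close>. \<open>M\<close> contains the curves and \<open>L\<close>
  is the total length of the edges; they later serve to estimate powers in the functional
  calculus.\<close>

theorem ex_surrounds_within:
  assumes K: "compact K" and V: "open V" "K \<subseteq> V"
  obtains \<Gamma> M L where "surrounds_within \<Gamma> K V" "compact M" "M \<subseteq> V - K" "\<And>\<gamma>. \<gamma> \<in> set \<Gamma> \<Longrightarrow> path_image \<gamma> \<subseteq> M"
    "L \<ge> 0" "\<And>g B. continuous_on M g \<Longrightarrow> (\<And>z. z \<in> M \<Longrightarrow> cmod (g z) \<le> B) \<Longrightarrow> B \<ge> 0 \<Longrightarrow>
      cmod (\<Sum>\<gamma>\<leftarrow>\<Gamma>. contour_integral \<gamma> g) \<le> L * B"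
proof (cases "K = {}")
  case True
  then show ?thesis
    by (intro that[of "[]" "{}" 0]) (auto simp: surrounds_within_def)
next
  case False
  then obtain \<zeta> where \<zeta>: "\<zeta> \<in> K" by blast
  obtain E :: "(complex \<times> complex) set" where E: "finite E" "balanced E"
    and avoid: "\<And>e. e \<in> E \<Longrightarrow> edge_set e \<subseteq> V - K"
    and formula: "\<And>g z. g holomorphic_on V \<Longrightarrow> z \<in> K \<Longrightarrow>
      (\<Sum>e\<in>E. contour_integral (linepath (fst e) (snd e)) (\<lambda>w. g w / (w - z))) = 2 * of_real pi * \<i> * g z"
    using grid_Cauchy_formula[OF K V] by blast
  let ?M = "\<Union> (edge_set ` E)"
  obtain \<Gamma> where \<Gamma>: "\<And>\<gamma>. \<gamma> \<in> set \<Gamma> \<Longrightarrow> valid_path \<gamma>" "\<And>\<gamma>. \<gamma> \<in> set \<Gamma> \<Longrightarrow> pathfinish \<gamma> = pathstart \<gamma>"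
    "\<And>\<gamma>. \<gamma> \<in> set \<Gamma> \<Longrightarrow> path_image \<gamma> \<subseteq> ?M"
    "\<And>g. continuous_on ?M g \<Longrightarrow>
      (\<Sum>\<gamma>\<leftarrow>\<Gamma>. contour_integral \<gamma> g) = (\<Sum>e\<in>E. contour_integral (linepath (fst e) (snd e)) g)"
    using balanced_imp_closed_paths[OF E] by blast
  have M: "?M \<subseteq> V - K" using avoid by blast
  have wn: "(\<Sum>\<gamma>\<leftarrow>\<Gamma>. winding_number \<gamma> z) = 1 / (2 * of_real pi * \<i>) *
      (\<Sum>e\<in>E. contour_integral (linepath (fst e) (snd e)) (\<lambda>w. 1 / (w - z)))" if "z \<notin> ?M" for z
  proof -
    have "(\<Sum>\<gamma>\<leftarrow>\<Gamma>. winding_number \<gamma> z) = (\<Sum>\<gamma>\<leftarrow>\<Gamma>. 1 / (2 * of_real pi * \<i>) * contour_integral \<gamma> (\<lambda>w. 1 / (w - z)))"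
    proof (rule arg_cong[where f=sum_list], rule map_cong[OF refl])
      fix \<gamma> assume "\<gamma> \<in> set \<Gamma>"
      then show "winding_number \<gamma> z = 1 / (2 * of_real pi * \<i>) * contour_integral \<gamma> (\<lambda>w. 1 / (w - z))"
        using winding_number_valid_path[OF \<Gamma>(1), of \<gamma> z] \<Gamma>(3)[of \<gamma>] that by auto
    qed
    also have "\<dots> = 1 / (2 * of_real pi * \<i>) * (\<Sum>\<gamma>\<leftarrow>\<Gamma>. contour_integral \<gamma> (\<lambda>w. 1 / (w - z)))"
      by (rule sum_list_const_mult)
    also have "(\<Sum>\<gamma>\<leftarrow>\<Gamma>. contour_integral \<gamma> (\<lambda>w. 1 / (w - z))) =
        (\<Sum>e\<in>E. contour_integral (linepath (fst e) (snd e)) (\<lambda>w. 1 / (w - z)))"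
      using that by (intro \<Gamma>(4) continuous_intros) auto
    finally show ?thesis .
  qed
  define L where "L = (\<Sum>e\<in>E. cmod (snd e - fst e))"
  show ?thesis
  proof (rule that[of \<Gamma> ?M L])
    show "surrounds_within \<Gamma> K V"
      unfolding surrounds_within_def
    proof (intro conjI ballI allI impI)
      fix \<gamma> assume \<gamma>: "\<gamma> \<in> set \<Gamma>"
      show "valid_path \<gamma>" "pathfinish \<gamma> = pathstart \<gamma>" by (rule \<Gamma>(1)[OF \<gamma>], rule \<Gamma>(2)[OF \<gamma>])
      show "path_image \<gamma> \<subseteq> V - K" by (rule subset_trans[OF \<Gamma>(3)[OF \<gamma>] M])
    next
      fix z assume z: "z \<in> K"
      then have "z \<notin> ?M" using M by blast
      then show "(\<Sum>\<gamma>\<leftarrow>\<Gamma>. winding_number \<gamma> z) = 1"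
        using formula[of "\<lambda>_. 1" z] z by (simp add: wn)
    next
      fix z assume z: "z \<notin> V"
      then have zM: "z \<notin> ?M" using M by blast
      \<comment> \<open>For \<open>z\<close> outside \<open>V\<close>, \<open>1 / (w - z)\<close> is
        written as \<open>g w / (w - \<zeta>)\<close>, where \<open>g\<close> is holomorphic on
        \<open>V\<close> and vanishes at the point \<zeta> of \<open>K\<close>; the Cauchy formula
        at \<zeta> then gives 0.\<close>
      have "(\<lambda>w. (w - \<zeta>) / (w - z)) holomorphic_on V" using z by (auto intro!: holomorphic_intros)
      from formula[OF this \<zeta>]
      have "(\<Sum>e\<in>E. contour_integral (linepath (fst e) (snd e)) (\<lambda>w. (w - \<zeta>) / (w - z) / (w - \<zeta>))) = 0"
        by simp
      also have "(\<Sum>e\<in>E. contour_integral (linepath (fst e) (snd e)) (\<lambda>w. (w - \<zeta>) / (w - z) / (w - \<zeta>))) =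
          (\<Sum>e\<in>E. contour_integral (linepath (fst e) (snd e)) (\<lambda>w. 1 / (w - z)))"
      proof (intro sum.cong refl contour_integral_eq)
        fix e w assume "e \<in> E" "w \<in> path_image (linepath (fst e) (snd e))"
        then have "w \<noteq> \<zeta>" using avoid[of e] \<zeta> by (auto simp: edge_set_def)
        then show "(w - \<zeta>) / (w - z) / (w - \<zeta>) = 1 / (w - z)" by simp
      qed
      finally show "(\<Sum>\<gamma>\<leftarrow>\<Gamma>. winding_number \<gamma> z) = 0" by (simp add: wn[OF zM])
    qed
    show "compact ?M" using E by (auto simp: edge_set_def)
    show "L \<ge> 0" by (simp add: L_def sum_nonneg)
    fix g B assume g: "continuous_on ?M g" and B: "\<And>z. z \<in> ?M \<Longrightarrow> cmod (g z) \<le> B" "B \<ge> 0"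
    have "cmod (\<Sum>e\<in>E. contour_integral (linepath (fst e) (snd e)) g) \<le> (\<Sum>e\<in>E. B * cmod (snd e - fst e))"
    proof (rule sum_norm_le, rule contour_integral_bound_linepath)
      fix e assume e: "e \<in> E"
      show "g contour_integrable_on linepath (fst e) (snd e)"
        using e by (intro contour_integrable_continuous_linepath continuous_on_subset[OF g])
          (auto simp: edge_set_def)
      show "cmod (g x) \<le> B" if "x \<in> closed_segment (fst e) (snd e)" for x
        using that e by (intro B) (auto simp: edge_set_def)
    qed (rule B(2))
    then show "cmod (\<Sum>\<gamma>\<leftarrow>\<Gamma>. contour_integral \<gamma> g) \<le> L * B"
      by (simp add: \<Gamma>(4)[OF g] L_def sum_distrib_left mult.commute)
  qed (rule M, rule \<Gamma>(3))
qed

section \<open>Cauchy's theorem for cycles\<close>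

text \<open>A polynomial path close to \<gamma> with the same end points gives the same integrals of
  functions holomorphic on \<open>W\<close>; this trades a valid path for one with continuous
  velocity.\<close>

lemma C1_approximation:
  assumes W: "open W" and \<gamma>: "valid_path \<gamma>" "pathfinish \<gamma> = pathstart \<gamma>" "path_image \<gamma> \<subseteq> W"
  obtains p where "C1_path p" "pathfinish p = pathstart p" "path_image p \<subseteq> W"
    "\<And>f. f holomorphic_on W \<Longrightarrow> contour_integral p f = contour_integral \<gamma> f"
proof -
  have path: "path \<gamma>" by (rule valid_path_imp_path[OF \<gamma>(1)])
  obtain d where d: "0 < d" "\<forall>g h. valid_path g \<and> valid_path h \<and>
      (\<forall>t\<in>{0..1}. cmod (g t - \<gamma> t) < d \<and> cmod (h t - \<gamma> t) < d) \<and>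
      pathstart h = pathstart g \<and> pathfinish h = pathfinish g \<longrightarrow>
      path_image g \<subseteq> W \<and> path_image h \<subseteq> W \<and>
      (\<forall>f. f holomorphic_on W \<longrightarrow> contour_integral h f = contour_integral g f)"
    using contour_integral_nearby_ends[OF W path \<gamma>(3)] by (elim exE conjE) (rule that; assumption)
  obtain p where p: "polynomial_function p" "pathstart p = pathstart \<gamma>" "pathfinish p = pathfinish \<gamma>"
    "\<And>t. t \<in> {0..1} \<Longrightarrow> norm (p t - \<gamma> t) < d"
    using path_approx_polynomial_function[OF path d(1)] by blast
  obtain p' where p': "polynomial_function p'" "\<And>x. (p has_vector_derivative (p' x)) (at x)"
    using has_vector_derivative_polynomial_function[OF p(1)] by blast
  have "(\<lambda>t. vector_derivative p (at t)) = p'" using p'(2) by (auto intro: vector_derivative_at)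
  then have C1: "C1_path p"
    using p(1) p'(1) by (simp add: C1_path_def valid_path_polynomial_function continuous_on_polymonial_function)
  have "path_image \<gamma> \<subseteq> W \<and> path_image p \<subseteq> W \<and>
      (\<forall>f. f holomorphic_on W \<longrightarrow> contour_integral p f = contour_integral \<gamma> f)"
  proof (rule d(2)[rule_format], intro conjI ballI)
    show "valid_path p" using C1 by (simp add: C1_path_def)
    show "cmod (\<gamma> t - \<gamma> t) < d" "cmod (p t - \<gamma> t) < d" if "t \<in> {0..1}" for t
      using p(4)[OF that] d(1) by auto
  qed (use p(2,3) \<gamma>(1) in auto)
  moreover have "pathfinish p = pathstart p" using p(2,3) \<gamma>(2) by simp
  ultimately show ?thesis using that[of p] C1 by blast
qed

lemma C1_approximation_list:
  assumes W: "open W" and \<Gamma>: "\<And>\<gamma>. \<gamma> \<in> set \<Gamma> \<Longrightarrow> valid_path \<gamma> \<and> pathfinish \<gamma> = pathstart \<gamma> \<and> path_image \<gamma> \<subseteq> W"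
  obtains \<Delta> where "\<And>\<gamma>. \<gamma> \<in> set \<Delta> \<Longrightarrow> C1_path \<gamma> \<and> pathfinish \<gamma> = pathstart \<gamma> \<and> path_image \<gamma> \<subseteq> W"
    "\<And>f. f holomorphic_on W \<Longrightarrow> (\<Sum>\<gamma>\<leftarrow>\<Delta>. contour_integral \<gamma> f) = (\<Sum>\<gamma>\<leftarrow>\<Gamma>. contour_integral \<gamma> f)"
    "\<And>z. z \<notin> W \<Longrightarrow> (\<Sum>\<gamma>\<leftarrow>\<Delta>. winding_number \<gamma> z) = (\<Sum>\<gamma>\<leftarrow>\<Gamma>. winding_number \<gamma> z)"
proof -
  have "\<exists>p. C1_path p \<and> pathfinish p = pathstart p \<and> path_image p \<subseteq> W \<and>
      (\<forall>f. f holomorphic_on W \<longrightarrow> contour_integral p f = contour_integral \<gamma> f)" if "\<gamma> \<in> set \<Gamma>" for \<gamma>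
    using C1_approximation[OF W, of \<gamma>] \<Gamma>[OF that] by metis
  then obtain p where p: "\<And>\<gamma>. \<gamma> \<in> set \<Gamma> \<Longrightarrow> C1_path (p \<gamma>) \<and> pathfinish (p \<gamma>) = pathstart (p \<gamma>) \<and> path_image (p \<gamma>) \<subseteq> W"
    "\<And>\<gamma> f. \<gamma> \<in> set \<Gamma> \<Longrightarrow> f holomorphic_on W \<Longrightarrow> contour_integral (p \<gamma>) f = contour_integral \<gamma> f" by metis
  show ?thesis
  proof (rule that[of "map p \<Gamma>"])
    show "C1_path \<gamma> \<and> pathfinish \<gamma> = pathstart \<gamma> \<and> path_image \<gamma> \<subseteq> W" if "\<gamma> \<in> set (map p \<Gamma>)" for \<gamma>
      using that p(1) by auto
    show "(\<Sum>\<gamma>\<leftarrow>map p \<Gamma>. contour_integral \<gamma> f) = (\<Sum>\<gamma>\<leftarrow>\<Gamma>. contour_integral \<gamma> f)" if "f holomorphic_on W" for f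
      unfolding map_map comp_def using p(2) that by (intro arg_cong[where f=sum_list] map_cong) auto
    show "(\<Sum>\<gamma>\<leftarrow>map p \<Gamma>. winding_number \<gamma> z) = (\<Sum>\<gamma>\<leftarrow>\<Gamma>. winding_number \<gamma> z)" if z: "z \<notin> W" for z
      unfolding map_map comp_def
    proof (intro arg_cong[where f=sum_list] map_cong refl)
      fix \<gamma> assume \<gamma>: "\<gamma> \<in> set \<Gamma>"
      have "(\<lambda>w. 1 / (w - z)) holomorphic_on W" using z by (auto intro!: holomorphic_intros)
      then show "winding_number (p \<gamma>) z = winding_number \<gamma> z"
        using p(2)[OF \<gamma>] p(1)[OF \<gamma>] \<Gamma>[OF \<gamma>] z
        by (subst (1 2) winding_number_valid_path) (auto simp: C1_path_def)
    qed
  qed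
qed

text \<open>The curves together with the points of nonzero winding number form a compact set
  \<open>K\<close> in \<open>V\<close>. On \<open>K\<close> the function \<open>g\<close> is a
  Cauchy integral over edges off \<open>K\<close>; interchanging the integrals leaves the winding
  number of the cycle around points of these edges, which is 0.\<close>

lemma Cauchy_theorem_cycle_C1:
  assumes V: "open V" and \<Gamma>: "\<And>\<gamma>. \<gamma> \<in> set \<Gamma> \<Longrightarrow> C1_path \<gamma> \<and> pathfinish \<gamma> = pathstart \<gamma> \<and> path_image \<gamma> \<subseteq> V"
    and wn0: "\<And>z. z \<notin> V \<Longrightarrow> (\<Sum>\<gamma>\<leftarrow>\<Gamma>. winding_number \<gamma> z) = 0" and g: "g holomorphic_on V"
  shows "(\<Sum>\<gamma>\<leftarrow>\<Gamma>. contour_integral \<gamma> g) = 0"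
proof -
  define n where "n z = (\<Sum>\<gamma>\<leftarrow>\<Gamma>. winding_number \<gamma> z)" for z
  define I where "I = (\<Union>\<gamma>\<in>set \<Gamma>. path_image \<gamma>)"
  have vp: "valid_path \<gamma>" "path \<gamma>" if "\<gamma> \<in> set \<Gamma>" for \<gamma>
    using \<Gamma>[OF that] by (auto simp: C1_path_def intro: valid_path_imp_path)
  have I: "compact I" unfolding I_def using vp by (intro compact_UN compact_path_image) auto
  have n_sum: "n z = (\<Sum>i<length \<Gamma>. winding_number (\<Gamma> ! i) z)" for z
    by (simp add: n_def sum_list_map_nth)
  have cont_n: "continuous_on (- I) n"
    unfolding n_sum[abs_def]
    by (intro continuous_on_sum continuous_on_subset[OF continuous_on_winding_number])
      (auto simp: I_def vp)
  define K where "K = I \<union> {z. z \<notin> I \<and> n z \<noteq> 0}"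
  have n_int: "n z \<in> \<int>" if "z \<notin> I" for z
    unfolding n_sum using that \<Gamma> vp by (intro Ints_sum integer_winding_number) (auto simp: I_def)
  have "compact K"
    unfolding compact_eq_bounded_closed
  proof
    have "\<exists>B. \<forall>z. B \<le> norm z \<longrightarrow> winding_number \<gamma> z = 0" if "\<gamma> \<in> set \<Gamma>" for \<gamma>
      using \<Gamma>[OF that] vp[OF that] by (intro winding_number_zero_at_infinity) auto
    then obtain B where B: "\<And>\<gamma> z. \<gamma> \<in> set \<Gamma> \<Longrightarrow> B \<gamma> \<le> norm z \<Longrightarrow> winding_number \<gamma> z = 0" by metis
    obtain B' where B': "\<And>z. z \<in> I \<Longrightarrow> norm z \<le> B'" using compact_imp_bounded[OF I] by (auto simp: bounded_iff)
    have "norm z \<le> max B' (\<Sum>\<gamma>\<in>set \<Gamma>. \<bar>B \<gamma>\<bar>)" if "z \<in> K" for z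
    proof (rule ccontr)
      assume neg: "\<not> ?thesis"
      then have "z \<notin> I" using B'[of z] by auto
      then have "n z \<noteq> 0" using that by (auto simp: K_def)
      moreover have "winding_number (\<Gamma> ! i) z = 0" if "i < length \<Gamma>" for i
      proof (rule B)
        have "\<bar>B (\<Gamma> ! i)\<bar> \<le> (\<Sum>\<gamma>\<in>set \<Gamma>. \<bar>B \<gamma>\<bar>)" using that by (intro member_le_sum) auto
        then show "B (\<Gamma> ! i) \<le> norm z" using neg by auto
      qed (use that in auto)
      ultimately show False by (simp add: n_sum)
    qed
    then show "bounded K" by (auto simp: bounded_iff)
    \<comment> \<open>Winding numbers of closed paths are integers, so vanishing can be replaced by
      the open condition of having modulus below 1.\<close>
    have eq: "- K = (- I) \<inter> n -` ball 0 1"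
    proof -
      have "n z = 0 \<longleftrightarrow> cmod (n z) < 1" if "z \<notin> I" for z
        using n_int[OF that] by (auto elim!: Ints_cases simp flip: of_int_abs)
      then show ?thesis unfolding K_def vimage_def by (auto simp only: mem_ball_0)
    qed
    have "open (- K)"
      unfolding eq using I by (intro continuous_open_preimage[OF cont_n]) (auto simp: compact_imp_closed open_Compl)
    then show "closed K" by (simp add: closed_def)
  qed
  moreover have KV: "K \<subseteq> V"
  proof
    fix z assume "z \<in> K"
    then show "z \<in> V" using \<Gamma> wn0[of z] by (cases "z \<in> I") (auto simp: K_def I_def n_def)
  qed
  ultimately obtain E :: "(complex \<times> complex) set" where E: "finite E"
    and avoid: "\<And>e. e \<in> E \<Longrightarrow> edge_set e \<subseteq> V - K"
    and formula: "\<And>g z. g holomorphic_on V \<Longrightarrow> z \<in> K \<Longrightarrow>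
      (\<Sum>e\<in>E. contour_integral (linepath (fst e) (snd e)) (\<lambda>w. g w / (w - z))) = 2 * of_real pi * \<i> * g z"
    by (rule grid_Cauchy_formula[OF _ V]) (rule that; assumption)
  let ?l = "\<lambda>e. linepath (fst e) (snd e)"
  have gc: "continuous_on (edge_set e) g" if "e \<in> E" for e
    using avoid[OF that] by (intro continuous_on_subset[OF holomorphic_on_imp_continuous_on[OF g]]) auto
  \<comment> \<open>The minus sign comes from reading \<open>1 / (w - z)\<close> as a function of
    \<open>z\<close> along \<gamma>.\<close>
  have swap: "contour_integral \<gamma> (\<lambda>z. contour_integral (?l e) (\<lambda>w. g w / (w - z))) =
      contour_integral (?l e) (\<lambda>w. - (2 * of_real pi * \<i>) * g w * winding_number \<gamma> w)"
    if e: "e \<in> E" and \<gamma>: "\<gamma> \<in> set \<Gamma>" for e \<gamma>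
  proof -
    have disj: "edge_set e \<inter> path_image \<gamma> = {}" using avoid[OF e] \<gamma> by (auto simp: K_def I_def)
    have "contour_integral \<gamma> (\<lambda>z. contour_integral (?l e) (\<lambda>w. g w / (w - z))) =
        contour_integral (?l e) (\<lambda>w. contour_integral \<gamma> (\<lambda>z. g w / (w - z)))"
    proof (rule contour_integral_swap)
      show "continuous_on (path_image \<gamma> \<times> path_image (?l e)) (\<lambda>(z, w). g w / (w - z))"
        using disj unfolding case_prod_unfold
        by (intro continuous_intros continuous_on_compose2[OF gc[OF e]]) (auto simp: edge_set_def)
    qed (use \<Gamma>[OF \<gamma>] C1_path_linepath[of "fst e" "snd e"] in \<open>auto simp: C1_path_def\<close>)
    also have "\<dots> = contour_integral (?l e) (\<lambda>w. - (2 * of_real pi * \<i>) * g w * winding_number \<gamma> w)"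
    proof (rule contour_integral_eq)
      fix w assume "w \<in> path_image (?l e)"
      then have w: "w \<notin> path_image \<gamma>" using disj by (auto simp: edge_set_def)
      have "(\<lambda>z. 1 / (z - w)) contour_integrable_on \<gamma>"
        using w \<Gamma>[OF \<gamma>] by (intro C1_path_contour_integrable continuous_intros) auto
      then have "contour_integral \<gamma> (\<lambda>z. - g w * (1 / (z - w))) = - g w * contour_integral \<gamma> (\<lambda>z. 1 / (z - w))"
        by (rule contour_integral_lmul)
      also have "(\<lambda>z. - g w * (1 / (z - w))) = (\<lambda>z. g w / (w - z))"
        by (rule ext) (metis minus_diff_eq minus_divide_right mult.right_neutral times_divide_eq_right minus_divide_left)
      finally show "contour_integral \<gamma> (\<lambda>z. g w / (w - z)) = - (2 * of_real pi * \<i>) * g w * winding_number \<gamma> w"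
        by (simp add: winding_number_valid_path[OF vp(1)[OF \<gamma>] w])
    qed
    finally show ?thesis .
  qed
  have "2 * of_real pi * \<i> * (\<Sum>\<gamma>\<leftarrow>\<Gamma>. contour_integral \<gamma> g) =
      (\<Sum>i<length \<Gamma>. contour_integral (\<Gamma> ! i) (\<lambda>z. 2 * of_real pi * \<i> * g z))"
    unfolding sum_list_map_nth sum_distrib_left
  proof (intro sum.cong refl)
    fix i assume "i \<in> {..<length \<Gamma>}"
    then have "\<Gamma> ! i \<in> set \<Gamma>" by simp
    then have "g contour_integrable_on \<Gamma> ! i"
      using \<Gamma> by (intro C1_path_contour_integrable continuous_on_subset[OF holomorphic_on_imp_continuous_on[OF g]]) auto
    then show "2 * of_real pi * \<i> * contour_integral (\<Gamma> ! i) g = contour_integral (\<Gamma> ! i) (\<lambda>z. 2 * of_real pi * \<i> * g z)"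
      by (simp add: contour_integral_lmul)
  qed
  also have "\<dots> = (\<Sum>i<length \<Gamma>. \<Sum>e\<in>E. contour_integral (\<Gamma> ! i) (\<lambda>z. contour_integral (?l e) (\<lambda>w. g w / (w - z))))"
  proof (intro sum.cong refl)
    fix i assume "i \<in> {..<length \<Gamma>}"
    then have i: "\<Gamma> ! i \<in> set \<Gamma>" by simp
    have "contour_integral (\<Gamma> ! i) (\<lambda>z. 2 * of_real pi * \<i> * g z) =
        contour_integral (\<Gamma> ! i) (\<lambda>z. \<Sum>e\<in>E. contour_integral (?l e) (\<lambda>w. g w / (w - z)))"
    proof (rule contour_integral_eq)
      fix z assume "z \<in> path_image (\<Gamma> ! i)"
      then have "z \<in> K" using i by (auto simp: K_def I_def)
      from formula[OF g this]
      show "2 * of_real pi * \<i> * g z = (\<Sum>e\<in>E. contour_integral (?l e) (\<lambda>w. g w / (w - z)))" by simp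
    qed
    also have "\<dots> = (\<Sum>e\<in>E. contour_integral (\<Gamma> ! i) (\<lambda>z. contour_integral (?l e) (\<lambda>w. g w / (w - z))))"
    proof (rule contour_integral_sum[OF E])
      fix e assume e: "e \<in> E"
      have "(\<lambda>u. contour_integral (?l e) (\<lambda>w. g w / (w - u))) holomorphic_on - path_image (?l e)"
        using gc[OF e] by (intro Cauchy_type_integral_holomorphic C1_path_linepath) (simp add: edge_set_def)
      then show "(\<lambda>u. contour_integral (?l e) (\<lambda>w. g w / (w - u))) contour_integrable_on \<Gamma> ! i"
        using \<Gamma>[OF i] avoid[OF e] i
        by (intro C1_path_contour_integrable continuous_on_subset[OF holomorphic_on_imp_continuous_on])
          (auto simp: edge_set_def K_def I_def)
    qed
    finally show "contour_integral (\<Gamma> ! i) (\<lambda>z. 2 * of_real pi * \<i> * g z) =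
        (\<Sum>e\<in>E. contour_integral (\<Gamma> ! i) (\<lambda>z. contour_integral (?l e) (\<lambda>w. g w / (w - z))))" .
  qed
  also have "\<dots> = (\<Sum>i<length \<Gamma>. \<Sum>e\<in>E. contour_integral (?l e) (\<lambda>w. - (2 * of_real pi * \<i>) * g w * winding_number (\<Gamma> ! i) w))"
    by (intro sum.cong refl swap) auto
  also have "\<dots> = (\<Sum>e\<in>E. \<Sum>i<length \<Gamma>. contour_integral (?l e) (\<lambda>w. - (2 * of_real pi * \<i>) * g w * winding_number (\<Gamma> ! i) w))"
    by (rule sum.swap)
  also have "\<dots> = (\<Sum>e\<in>E. 0)"
  proof (intro sum.cong refl)
    fix e assume e: "e \<in> E"
    have "(\<Sum>i<length \<Gamma>. contour_integral (?l e) (\<lambda>w. - (2 * of_real pi * \<i>) * g w * winding_number (\<Gamma> ! i) w)) =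
        contour_integral (?l e) (\<lambda>w. \<Sum>i<length \<Gamma>. - (2 * of_real pi * \<i>) * g w * winding_number (\<Gamma> ! i) w)"
    proof (rule contour_integral_sum[symmetric])
      fix i assume "i \<in> {..<length \<Gamma>}"
      then have i: "\<Gamma> ! i \<in> set \<Gamma>" by simp
      show "(\<lambda>w. - (2 * of_real pi * \<i>) * g w * winding_number (\<Gamma> ! i) w) contour_integrable_on ?l e"
        using gc[OF e] avoid[OF e] i vp[OF i]
        by (intro contour_integrable_continuous_linepath continuous_intros
            continuous_on_subset[OF continuous_on_winding_number]) (auto simp: edge_set_def K_def I_def)
    qed simp
    also have "\<dots> = contour_integral (?l e) (\<lambda>w. - (2 * of_real pi * \<i>) * g w * n w)"
      by (simp add: n_sum sum_distrib_left)
    also have "\<dots> = 0"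
      using avoid[OF e] by (intro contour_integral_eq_0) (auto simp: edge_set_def K_def)
    finally show "(\<Sum>i<length \<Gamma>. contour_integral (?l e) (\<lambda>w. - (2 * of_real pi * \<i>) * g w * winding_number (\<Gamma> ! i) w)) = 0" .
  qed
  finally show ?thesis by simp
qed

theorem Cauchy_theorem_cycle:
  assumes V: "open V" and \<Gamma>: "\<And>\<gamma>. \<gamma> \<in> set \<Gamma> \<Longrightarrow> valid_path \<gamma> \<and> pathfinish \<gamma> = pathstart \<gamma> \<and> path_image \<gamma> \<subseteq> V"
    and wn0: "\<And>z. z \<notin> V \<Longrightarrow> (\<Sum>\<gamma>\<leftarrow>\<Gamma>. winding_number \<gamma> z) = 0" and g: "g holomorphic_on V"
  shows "(\<Sum>\<gamma>\<leftarrow>\<Gamma>. contour_integral \<gamma> g) = 0"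
proof -
  obtain \<Delta> where \<Delta>: "\<And>\<gamma>. \<gamma> \<in> set \<Delta> \<Longrightarrow> C1_path \<gamma> \<and> pathfinish \<gamma> = pathstart \<gamma> \<and> path_image \<gamma> \<subseteq> V"
    "\<And>f. f holomorphic_on V \<Longrightarrow> (\<Sum>\<gamma>\<leftarrow>\<Delta>. contour_integral \<gamma> f) = (\<Sum>\<gamma>\<leftarrow>\<Gamma>. contour_integral \<gamma> f)"
    "\<And>z. z \<notin> V \<Longrightarrow> (\<Sum>\<gamma>\<leftarrow>\<Delta>. winding_number \<gamma> z) = (\<Sum>\<gamma>\<leftarrow>\<Gamma>. winding_number \<gamma> z)"
    using C1_approximation_list[OF V \<Gamma>] by blast
  have "(\<Sum>\<gamma>\<leftarrow>\<Delta>. contour_integral \<gamma> g) = 0"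
    using \<Delta> wn0 by (intro Cauchy_theorem_cycle_C1[OF V _ _ g]) auto
  then show ?thesis using \<Delta>(2)[OF g] by simp
qed

section \<open>Vector-valued contour integrals\<close>

lemma vec_analytic_on_functional:
  "vec_analytic_on F U \<Longrightarrow> open U \<Longrightarrow> (\<lambda>z. cblinfun_apply \<phi> (F z)) holomorphic_on U"
  for \<phi> :: "'b::complex_normed_vector \<Rightarrow>\<^sub>C\<^sub>L complex"
  using vec_analytic_on_cblinfun vec_analytic_on_complex_iff by blast

lemma vec_linepath_integral_functional:
  fixes F :: "complex \<Rightarrow> 'b::complex_banach" and \<phi> :: "'b \<Rightarrow>\<^sub>C\<^sub>L complex"
  assumes "continuous_on (closed_segment a b) F"
  shows "\<phi> (integral {0..1} (\<lambda>t. (b - a) *\<^sub>C F (linepath a b t))) =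
    contour_integral (linepath a b) (\<lambda>z. \<phi> (F z))"
proof -
  have c: "continuous_on {0..1} (\<lambda>t. (b - a) *\<^sub>C F (linepath a b t))"
    by (intro continuous_intros continuous_on_compose2[OF assms])
      (auto simp: linepath_in_path intro!: continuous_on_linepath)
  have "integral {0..1} (\<phi> \<circ> (\<lambda>t. (b - a) *\<^sub>C F (linepath a b t))) =
      \<phi> (integral {0..1} (\<lambda>t. (b - a) *\<^sub>C F (linepath a b t)))"
    by (rule integral_linear[OF integrable_continuous_interval[OF c] bounded_linear_cblinfun])
  then show ?thesis
    by (simp add: contour_integral_integral vector_derivative_linepath_at comp_def
        scaleC_complex_def mult.commute)
qed

text \<open>Integrals along segments from the centre form a primitive. That they are additive around
  a triangle is checked by functionals, since scalar holomorphic functions on a disc have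
  primitives.\<close>

lemma vec_analytic_primitive:
  fixes F :: "complex \<Rightarrow> 'b::complex_banach"
  assumes F: "vec_analytic_on F (ball a r)"
  obtains G where "\<And>z. z \<in> ball a r \<Longrightarrow> (G has_derivative (\<lambda>h. h *\<^sub>C F z)) (at z)"
proof -
  define l where "l u v = integral {0..1} (\<lambda>t. (v - u) *\<^sub>C F (linepath u v t))" for u v
  have cF: "continuous_on (ball a r) F" by (rule vec_analytic_on_imp_continuous_on[OF F])
  have seg: "closed_segment u v \<subseteq> ball a r" if "u \<in> ball a r" "v \<in> ball a r" for u v
    using that by (simp add: closed_segment_subset)
  have l: "l a v - l a u = l u v" if uv: "u \<in> ball a r" "v \<in> ball a r" for u v
  proof (rule functionals_separate)
    fix \<phi> :: "'b \<Rightarrow>\<^sub>C\<^sub>L complex"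
    have "0 < r" using uv by (metis ball_eq_empty empty_iff linorder_not_le)
    then have a: "a \<in> ball a r" by simp
    have "(\<lambda>z. \<phi> (F z)) holomorphic_on ball a r" by (rule vec_analytic_on_functional[OF F open_ball])
    then obtain g where g: "\<And>x. x \<in> ball a r \<Longrightarrow> (g has_field_derivative \<phi> (F x)) (at x)"
      using holomorphic_convex_primitive'[of "ball a r" "\<lambda>z. \<phi> (F z)"]
      by (metis at_within_open convex_ball open_ball)
    have int: "\<phi> (l x y) = g y - g x" if xy: "x \<in> ball a r" "y \<in> ball a r" for x y
    proof -
      have "\<phi> (l x y) = contour_integral (linepath x y) (\<lambda>z. \<phi> (F z))"
        unfolding l_def by (intro vec_linepath_integral_functional continuous_on_subset[OF cF] seg xy)
      also have "\<dots> = g y - g x"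
        using seg[OF xy] g
        by (intro contour_integral_unique contour_integral_primitive[where S="ball a r", of g _ "linepath x y", simplified])
          (auto intro: has_field_derivative_at_within)
      finally show ?thesis .
    qed
    show "\<phi> (l a v - l a u) = \<phi> (l u v)"
      using uv a by (simp add: cblinfun_diff_right int)
  qed
  show ?thesis
  proof (rule that[of "l a"])
    fix z assume z: "z \<in> ball a r"
    show "(l a has_derivative (\<lambda>h. h *\<^sub>C F z)) (at z)"
      unfolding has_derivative_at_alt
    proof (intro conjI allI impI)
      show "bounded_linear (\<lambda>h. h *\<^sub>C F z)"
        by (rule bounded_bilinear.bounded_linear_left[OF bounded_bilinear_scaleC])
      fix e :: real assume e: "e > 0"
      have "isCont F z" using cF z by (simp add: continuous_on_eq_continuous_at)
      then obtain d where d: "d > 0" "\<And>w. dist w z < d \<Longrightarrow> dist (F w) (F z) < e"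
        using e unfolding continuous_at_eps_delta by (auto simp: dist_commute dist_norm)
      obtain s where s: "s > 0" "ball z s \<subseteq> ball a r" using z open_ball by (meson openE)
      show "\<exists>d>0. \<forall>y. norm (y - z) < d \<longrightarrow> norm (l a y - l a z - (y - z) *\<^sub>C F z) \<le> e * norm (y - z)"
      proof (intro exI[of _ "min d s"] conjI allI impI)
        show "min d s > 0" using d s by simp
        fix y assume y: "norm (y - z) < min d s"
        then have "y \<in> ball z s" by (simp add: dist_norm norm_minus_commute)
        then have yb: "y \<in> ball a r" using s(2) by blast
        have cont: "continuous_on {0..1} (\<lambda>t. (y - z) *\<^sub>C F (linepath z y t))"
          using seg[OF z yb]
          by (intro continuous_intros continuous_on_compose2[OF cF])
            (auto simp: linepath_in_path simp del: mem_ball intro!: continuous_on_linepath subsetD[OF seg[OF z yb]])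
        have "l a y - l a z - (y - z) *\<^sub>C F z = integral {0..1} (\<lambda>t. (y - z) *\<^sub>C F (linepath z y t)) -
            integral {0..1} (\<lambda>t::real. (y - z) *\<^sub>C F z)"
          using l[OF z yb] by (simp add: l_def)
        also have "\<dots> = integral {0..1} (\<lambda>t. (y - z) *\<^sub>C F (linepath z y t) - (y - z) *\<^sub>C F z)"
          by (intro integral_diff[symmetric] integrable_continuous_interval cont continuous_intros)
        also have "norm \<dots> \<le> (e * norm (y - z)) * (1 - 0)"
        proof (rule integral_bound)
          show "continuous_on {0..1} (\<lambda>t. (y - z) *\<^sub>C F (linepath z y t) - (y - z) *\<^sub>C F z)"
            by (intro continuous_intros cont)
          fix t :: real assume t: "t \<in> {0..1}"
          have "dist (linepath z y t) z < d"
          proof -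
            have "linepath z y t - z = t *\<^sub>R (y - z)" by (simp add: linepath_def algebra_simps)
            then have "dist (linepath z y t) z = t * norm (y - z)" using t by (simp add: dist_norm)
            also have "\<dots> \<le> 1 * norm (y - z)" using t by (intro mult_right_mono) auto
            finally show ?thesis using y by simp
          qed
          then have "norm (F (linepath z y t) - F z) \<le> e" using d(2) by (force simp: dist_norm)
          then have "cmod (y - z) * norm (F (linepath z y t) - F z) \<le> cmod (y - z) * e"
            by (intro mult_left_mono) auto
          then show "norm ((y - z) *\<^sub>C F (linepath z y t) - (y - z) *\<^sub>C F z) \<le> e * norm (y - z)"
            by (simp add: complex_vector.scale_right_diff_distrib[symmetric] norm_scaleC mult.commute)
        qed simp
        finally show "norm (l a y - l a z - (y - z) *\<^sub>C F z) \<le> e * norm (y - z)" by simp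
      qed
    qed
  qed
qed

text \<open>A valid path may have an unbounded, not even absolutely integrable velocity, so that
  integrability has to come from local primitives.\<close>

lemma vec_contour_integrable:
  fixes F :: "complex \<Rightarrow> 'b::complex_banach"
  assumes F: "vec_analytic_on F W" "open W" and \<gamma>: "valid_path \<gamma>" "path_image \<gamma> \<subseteq> W"
  shows "(\<lambda>t. vector_derivative \<gamma> (at t within {0..1}) *\<^sub>C F (\<gamma> t)) integrable_on {0..1}"
proof -
  obtain S where S: "finite S" "\<gamma> C1_differentiable_on {0..1} - S" and c\<gamma>: "continuous_on {0..1} \<gamma>"
    using \<gamma>(1) by (auto simp: valid_path_def piecewise_C1_differentiable_on_def)
  let ?f = "\<lambda>t. vector_derivative \<gamma> (at t within {0..1}) *\<^sub>C F (\<gamma> t)"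
  have "?f integrable_on cbox 0 1"
  proof (rule integrable_on_little_subintervals, intro ballI)
    fix x :: real assume x: "x \<in> cbox 0 1"
    then have "\<gamma> x \<in> W" using \<gamma>(2) by (auto simp: path_image_def)
    then obtain r where r: "r > 0" "ball (\<gamma> x) r \<subseteq> W" using F(2) by (meson openE)
    \<comment> \<open>On a short interval the integrand is the derivative of
      \<open>G \<circ> \<gamma>\<close> off finitely many points, which makes it gauge integrable
      even where it is unbounded.\<close>
    obtain G where G: "\<And>z. z \<in> ball (\<gamma> x) r \<Longrightarrow> (G has_derivative (\<lambda>h. h *\<^sub>C F z)) (at z)"
      using vec_analytic_primitive[OF vec_analytic_on_subset[OF F(1) r(2)]] by blast
    obtain d where d: "d > 0" "\<And>t. t \<in> {0..1} \<Longrightarrow> dist t x < d \<Longrightarrow> \<gamma> t \<in> ball (\<gamma> x) r"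
    proof -
      have "\<forall>e>0. \<exists>d>0. \<forall>t\<in>{0..1}. dist t x < d \<longrightarrow> dist (\<gamma> t) (\<gamma> x) < e"
        using c\<gamma>[unfolded continuous_on_iff, rule_format, of x] x by (simp add: dist_commute)
      then obtain d where "d > 0" "\<forall>t\<in>{0..1}. dist t x < d \<longrightarrow> dist (\<gamma> t) (\<gamma> x) < r"
        using r(1) by blast
      then show ?thesis using that[of d] by (simp add: dist_commute)
    qed
    show "\<exists>d>0. \<forall>u v. x \<in> cbox u v \<and> cbox u v \<subseteq> ball x d \<and> cbox u v \<subseteq> cbox 0 1 \<longrightarrow>
        ?f integrable_on cbox u v"
    proof (intro exI[of _ d] conjI allI impI d(1))
      fix u v assume uv: "x \<in> cbox u v \<and> cbox u v \<subseteq> ball x d \<and> cbox u v \<subseteq> cbox 0 1"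
      then have le: "u \<le> v" by auto
      have sub: "{u..v} \<subseteq> {0..1}" using uv by simp
      have inb: "\<gamma> t \<in> ball (\<gamma> x) r" if "t \<in> {u..v}" for t
      proof (rule d(2))
        have "t \<in> cbox u v" using that by simp
        then have "t \<in> ball x d" using uv by blast
        then show "dist t x < d" by (simp add: dist_commute)
      qed (use that sub in blast)
      have "(?f has_integral ((G \<circ> \<gamma>) v - (G \<circ> \<gamma>) u)) {u..v}"
      proof (rule fundamental_theorem_of_calculus_interior_strong[OF S(1) le])
        show "((G \<circ> \<gamma>) has_vector_derivative ?f t) (at t)" if t: "t \<in> {u<..<v} - S" for t
        proof -
          have "u \<in> {0..1}" "v \<in> {0..1}" using sub le by auto
          then have t01: "t \<in> {0<..<1}" using t by auto
          have within: "at t within {0..1} = at t" using t01 by (intro at_within_interior) simp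
          have "\<gamma> differentiable at t"
            using S(2) t t01 within unfolding C1_differentiable_on_eq
            by (auto dest!: bspec[of _ _ t])
          then have "(\<gamma> has_vector_derivative vector_derivative \<gamma> (at t)) (at t)"
            by (simp add: vector_derivative_works)
          then have "(\<gamma> has_derivative (\<lambda>h. h *\<^sub>R vector_derivative \<gamma> (at t))) (at t)"
            by (simp add: has_vector_derivative_def)
          moreover have "(G has_derivative (\<lambda>h. h *\<^sub>C F (\<gamma> t))) (at (\<gamma> t))"
            using t by (intro G inb) auto
          ultimately have "((\<lambda>t. G (\<gamma> t)) has_derivative (\<lambda>h. (h *\<^sub>R vector_derivative \<gamma> (at t)) *\<^sub>C F (\<gamma> t))) (at t)"
            by (rule has_derivative_compose)
          then show ?thesis
            unfolding has_vector_derivative_def within comp_def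
            by (simp add: bounded_bilinear.scaleR_left[OF bounded_bilinear_scaleC])
        qed
        show "continuous_on {u..v} (G \<circ> \<gamma>)"
        proof (rule continuous_on_compose)
          show "continuous_on {u..v} \<gamma>" by (rule continuous_on_subset[OF c\<gamma> sub])
          have "continuous_on (ball (\<gamma> x) r) G"
            using G by (meson continuous_at_imp_continuous_on has_derivative_continuous)
          then show "continuous_on (\<gamma> ` {u..v}) G"
            by (rule continuous_on_subset) (use inb in blast)
        qed
      qed
      then show "?f integrable_on cbox u v" by (auto simp: integrable_on_def)
    qed
  qed
  then show ?thesis by simp
qed

lemma vec_contour_integral_functional:
  fixes F :: "complex \<Rightarrow> 'b::complex_banach" and \<phi> :: "'b \<Rightarrow>\<^sub>C\<^sub>L complex"
  assumes "vec_analytic_on F W" "open W" "valid_path \<gamma>" "path_image \<gamma> \<subseteq> W"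
  shows "\<phi> (vec_contour_integral \<gamma> F) = contour_integral \<gamma> (\<lambda>z. \<phi> (F z))"
proof -
  have "((\<lambda>t. vector_derivative \<gamma> (at t within {0..1}) *\<^sub>C F (\<gamma> t)) has_integral vec_contour_integral \<gamma> F) {0..1}"
    unfolding vec_contour_integral_def by (rule integrable_integral[OF vec_contour_integrable[OF assms]])
  from has_integral_linear[OF this bounded_linear_cblinfun, of \<phi>]
  have "((\<lambda>z. \<phi> (F z)) has_contour_integral \<phi> (vec_contour_integral \<gamma> F)) \<gamma>"
    by (simp add: has_contour_integral_def comp_def scaleC_complex_def mult.commute)
  then show ?thesis by (simp add: contour_integral_unique)
qed

section \<open>The resolvent\<close>

lemma is_inverse_of_unique: "is_inverse_of S A \<Longrightarrow> is_inverse_of S' A \<Longrightarrow> S = S'"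
  unfolding is_inverse_of_def by (metis cblinfun_compose_assoc cblinfun_compose_id_left cblinfun_compose_id_right)

lemma is_inverse_of_minus: "is_inverse_of S A \<Longrightarrow> is_inverse_of (- S) (- A)"
  unfolding is_inverse_of_def
  by (auto simp: cblinfun_minus_right intro!: cblinfun_eqI dest: arg_cong[where f="\<lambda>T. cblinfun_apply T _"])

lemma resolvent_is_inverse:
  assumes "z \<notin> cspectrum T"
  shows "is_inverse_of (resolvent T z) (z *\<^sub>C id_cblinfun - T)"
proof -
  obtain S where "is_inverse_of S (T - z *\<^sub>C id_cblinfun)" using assms by (auto simp: cspectrum_def)
  then have S: "is_inverse_of (- S) (z *\<^sub>C id_cblinfun - T)" using is_inverse_of_minus by fastforce
  then show ?thesis
    unfolding resolvent_def by (rule theI) (metis S is_inverse_of_unique)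
qed

lemma resolvent_apply:
  assumes "z \<notin> cspectrum T"
  shows "T (resolvent T z x) = z *\<^sub>C resolvent T z x - x" "resolvent T z (T x) = z *\<^sub>C resolvent T z x - x"
proof -
  have "(z *\<^sub>C id_cblinfun - T) (resolvent T z x) = x" "resolvent T z ((z *\<^sub>C id_cblinfun - T) x) = x"
    using resolvent_is_inverse[OF assms] unfolding is_inverse_of_def
    by (metis cblinfun_compose_apply id_cblinfun_apply)+
  then show "T (resolvent T z x) = z *\<^sub>C resolvent T z x - x" "resolvent T z (T x) = z *\<^sub>C resolvent T z x - x"
    by (auto simp: cblinfun_diff_right algebra_simps)
qed

lemma resolvent_identity:
  assumes z: "z \<notin> cspectrum T" and w: "w \<notin> cspectrum T"
  shows "resolvent T z - resolvent T w = (w - z) *\<^sub>C (resolvent T z o\<^sub>C\<^sub>L resolvent T w)"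
proof (rule cblinfun_eqI)
  fix x
  have "resolvent T z (T (resolvent T w x)) = z *\<^sub>C resolvent T z (resolvent T w x) - resolvent T w x"
    by (rule resolvent_apply(2)[OF z])
  moreover have "resolvent T z (T (resolvent T w x)) = w *\<^sub>C resolvent T z (resolvent T w x) - resolvent T z x"
    unfolding resolvent_apply(1)[OF w] by (simp add: cblinfun_diff_right)
  ultimately show "(resolvent T z - resolvent T w) x = ((w - z) *\<^sub>C (resolvent T z o\<^sub>C\<^sub>L resolvent T w)) x"
    by (simp add: complex_vector.scale_left_diff_distrib algebra_simps)
qed

lemma resolvent_commute:
  assumes "z \<notin> cspectrum T" "w \<notin> cspectrum T"
  shows "resolvent T z o\<^sub>C\<^sub>L resolvent T w = resolvent T w o\<^sub>C\<^sub>L resolvent T z"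
proof (cases "z = w")
  case False
  have "(w - z) *\<^sub>C (resolvent T z o\<^sub>C\<^sub>L resolvent T w) = - ((z - w) *\<^sub>C (resolvent T w o\<^sub>C\<^sub>L resolvent T z))"
    using resolvent_identity[OF assms] resolvent_identity[OF assms(2,1)] by (metis minus_diff_eq)
  then have "(w - z) *\<^sub>C (resolvent T z o\<^sub>C\<^sub>L resolvent T w) = (w - z) *\<^sub>C (resolvent T w o\<^sub>C\<^sub>L resolvent T z)"
    by (simp add: complex_vector.scale_minus_left[symmetric])
  then show ?thesis using False by (simp add: complex_vector.scale_cancel_left)
qed simp

text \<open>The Neumann estimate at \<open>z\<close>: the radius makes the perturbation factor at
  most 1/2, so the norm of the resolvent at most doubles.\<close>

lemma resolvent_locally_bounded:
  fixes T :: "'a::complex_banach \<Rightarrow>\<^sub>C\<^sub>L 'a"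
  assumes z: "z \<notin> cspectrum T"
  obtains e B where "e > 0" "B \<ge> 0" "\<And>w. dist w z < e \<Longrightarrow> w \<notin> cspectrum T \<and> norm (resolvent T w) \<le> B"
proof -
  let ?S = "resolvent T z"
  define e where "e = 1 / (2 * (norm ?S + 1))"
  have n1: "norm ?S + 1 > 0" by (simp add: add_nonneg_pos)
  have e: "e > 0" using n1 by (simp add: e_def)
  have S: "is_inverse_of ?S (z *\<^sub>C id_cblinfun - T)" by (rule resolvent_is_inverse[OF z])
  have "w \<notin> cspectrum T \<and> norm (resolvent T w) \<le> 2 * norm ?S" if w: "dist w z < e" for w
  proof -
    let ?B = "(z - w) *\<^sub>C id_cblinfun :: 'a \<Rightarrow>\<^sub>C\<^sub>L 'a"
    have "norm ?S * norm ?B \<le> norm ?S * cmod (z - w)"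
      by (intro mult_left_mono norm_scaleC_id_le) auto
    also have "\<dots> \<le> norm ?S * e"
      using w by (intro mult_left_mono) (auto simp: dist_norm norm_minus_commute)
    also have "\<dots> \<le> 1/2" using n1 by (simp add: e_def field_simps)
    finally have half: "norm ?S * norm ?B \<le> 1/2" .
    then have lt: "norm ?S * norm ?B < 1" by simp
    obtain S' where S': "is_inverse_of S' (z *\<^sub>C id_cblinfun - T - ?B)"
      "norm S' \<le> norm ?S / (1 - norm ?S * norm ?B)"
      by (rule Neumann_inverse[OF S lt])
    have eq: "z *\<^sub>C id_cblinfun - T - ?B = w *\<^sub>C id_cblinfun - T"
      by (simp add: complex_vector.scale_left_diff_distrib)
    have "is_inverse_of (- S') (T - w *\<^sub>C id_cblinfun)"
      using is_inverse_of_minus[OF S'(1)[unfolded eq]] by simp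
    then have wK: "w \<notin> cspectrum T" by (auto simp: cspectrum_def)
    then have "resolvent T w = S'"
      using is_inverse_of_unique[OF resolvent_is_inverse S'(1)[unfolded eq]] by blast
    moreover have "norm ?S / (1 - norm ?S * norm ?B) \<le> norm ?S / (1/2)"
      using half by (intro divide_left_mono) auto
    ultimately show ?thesis using S'(2) wK by simp
  qed
  then show ?thesis using e by (intro that[of e "2 * norm ?S"]) auto
qed

text \<open>The resolvent identity computes the difference quotient; a second use of it, with local
  boundedness, shows that the quotient tends to minus the square of the resolvent.\<close>

lemma vec_analytic_resolvent:
  fixes T :: "'a::complex_banach \<Rightarrow>\<^sub>C\<^sub>L 'a"
  shows "vec_analytic_on (resolvent T) (- cspectrum T)"
  unfolding vec_analytic_on_def
proof
  fix z assume "z \<in> - cspectrum T"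
  then have z: "z \<notin> cspectrum T" by simp
  obtain e B where e: "e > 0" "B \<ge> 0" and near: "\<And>w. dist w z < e \<Longrightarrow> w \<notin> cspectrum T \<and> norm (resolvent T w) \<le> B"
    using resolvent_locally_bounded[OF z] by blast
  let ?R = "resolvent T"
  have Bz: "norm (?R z) \<le> B" using near[of z] e by simp
  have "(?R has_derivative (\<lambda>h. h *\<^sub>C - (?R z o\<^sub>C\<^sub>L ?R z))) (at z)"
  proof (rule has_derivativeI_sandwich[OF e(1)])
    show "bounded_linear (\<lambda>h. h *\<^sub>C - (?R z o\<^sub>C\<^sub>L ?R z))"
      by (rule bounded_bilinear.bounded_linear_left[OF bounded_bilinear_scaleC])
    show "((\<lambda>w. B * B * B * norm (w - z)) \<longlongrightarrow> 0) (at z)"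
      by (rule tendsto_eq_intros refl | simp)+
    fix w assume "w \<noteq> z" "dist w z < e"
    then have w: "w \<notin> cspectrum T" "norm (?R w) \<le> B" "w \<noteq> z" using near by auto
    have d: "?R w - ?R z = (z - w) *\<^sub>C (?R w o\<^sub>C\<^sub>L ?R z)" by (rule resolvent_identity[OF w(1) z])
    have "?R w - ?R z - (w - z) *\<^sub>C - (?R z o\<^sub>C\<^sub>L ?R z) = (z - w) *\<^sub>C ((?R w - ?R z) o\<^sub>C\<^sub>L ?R z)"
    proof -
      have "(w - z) *\<^sub>C - (?R z o\<^sub>C\<^sub>L ?R z) = (z - w) *\<^sub>C (?R z o\<^sub>C\<^sub>L ?R z)"
        by (simp add: complex_vector.scale_left_diff_distrib)
      then have "?R w - ?R z - (w - z) *\<^sub>C - (?R z o\<^sub>C\<^sub>L ?R z) =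
          (z - w) *\<^sub>C (?R w o\<^sub>C\<^sub>L ?R z) - (z - w) *\<^sub>C (?R z o\<^sub>C\<^sub>L ?R z)"
        by (simp only: d)
      also have "\<dots> = (z - w) *\<^sub>C ((?R w - ?R z) o\<^sub>C\<^sub>L ?R z)"
        by (rule cblinfun_eqI) (simp add: complex_vector.scale_right_diff_distrib)
      finally show ?thesis .
    qed
    also have "norm \<dots> = norm (w - z) * norm ((?R w - ?R z) o\<^sub>C\<^sub>L ?R z)"
      by (simp add: norm_scaleC norm_minus_commute)
    finally have eq: "norm (?R w - ?R z - (w - z) *\<^sub>C - (?R z o\<^sub>C\<^sub>L ?R z)) / norm (w - z) =
        norm ((?R w - ?R z) o\<^sub>C\<^sub>L ?R z)" using w(3) by simp
    have "norm ((?R w - ?R z) o\<^sub>C\<^sub>L ?R z) \<le> norm (?R w - ?R z) * norm (?R z)"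
      by (rule norm_cblinfun_compose)
    also have "\<dots> = norm (w - z) * norm (?R w o\<^sub>C\<^sub>L ?R z) * norm (?R z)"
      unfolding d norm_scaleC by (simp add: norm_minus_commute)
    also have "\<dots> \<le> norm (w - z) * (B * B) * B"
      using norm_cblinfun_compose[of "?R w" "?R z"] w(2) Bz e(2)
      by (intro mult_mono order_trans[OF norm_cblinfun_compose]) auto
    finally show "norm (?R w - ?R z - (w - z) *\<^sub>C - (?R z o\<^sub>C\<^sub>L ?R z)) / norm (w - z) \<le> B * B * B * norm (w - z)"
      unfolding eq by (simp add: mult_ac)
  qed
  then show "\<exists>D. (?R has_derivative (\<lambda>h. h *\<^sub>C D)) (at z)" by blast
qed

lemma open_Compl_cspectrum: "open (- cspectrum T)"
  for T :: "'a::complex_banach \<Rightarrow>\<^sub>C\<^sub>L 'a"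
  by (simp add: closed_cspectrum open_Compl)

section \<open>The holomorphic functional calculus\<close>

text \<open>Multiplication by a fixed operator as a bounded operator on operators: a functional
  composed with it is again a functional, so that the scalar formula for the calculus also applies
  to products.\<close>

lift_definition left_mult :: "('a::complex_normed_vector \<Rightarrow>\<^sub>C\<^sub>L 'a) \<Rightarrow> ('a \<Rightarrow>\<^sub>C\<^sub>L 'a) \<Rightarrow>\<^sub>C\<^sub>L ('a \<Rightarrow>\<^sub>C\<^sub>L 'a)"
  is "\<lambda>A B. A o\<^sub>C\<^sub>L B"
proof (intro conjI allI)
  fix A :: "'a \<Rightarrow>\<^sub>C\<^sub>L 'a"
  show "bounded_linear (\<lambda>B. A o\<^sub>C\<^sub>L B)"
  proof (rule bounded_linear_intro[where K = "norm A"])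
    show "A o\<^sub>C\<^sub>L (B + C) = (A o\<^sub>C\<^sub>L B) + (A o\<^sub>C\<^sub>L C)" for B C
      by (rule cblinfun_eqI) (simp add: cblinfun_add_right)
    show "A o\<^sub>C\<^sub>L (r *\<^sub>R B) = r *\<^sub>R (A o\<^sub>C\<^sub>L B)" for r B
      by (rule cblinfun_eqI) (simp add: scaleC_of_real[symmetric])
    show "norm (A o\<^sub>C\<^sub>L B) \<le> norm B * norm A" for B
      using norm_cblinfun_compose[of A B] by (simp add: mult.commute)
  qed
  show "A o\<^sub>C\<^sub>L (c *\<^sub>C B) = c *\<^sub>C (A o\<^sub>C\<^sub>L B)" for c B
    by (rule cblinfun_eqI) simp
qed

lift_definition right_mult :: "('a::complex_normed_vector \<Rightarrow>\<^sub>C\<^sub>L 'a) \<Rightarrow> ('a \<Rightarrow>\<^sub>C\<^sub>L 'a) \<Rightarrow>\<^sub>C\<^sub>L ('a \<Rightarrow>\<^sub>C\<^sub>L 'a)"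
  is "\<lambda>A B. B o\<^sub>C\<^sub>L A"
proof (intro conjI allI)
  fix A :: "'a \<Rightarrow>\<^sub>C\<^sub>L 'a"
  show "bounded_linear (\<lambda>B. B o\<^sub>C\<^sub>L A)"
  proof (rule bounded_linear_intro[where K = "norm A"])
    show "(B + C) o\<^sub>C\<^sub>L A = (B o\<^sub>C\<^sub>L A) + (C o\<^sub>C\<^sub>L A)" for B C
      by (rule cblinfun_eqI) simp
    show "(r *\<^sub>R B) o\<^sub>C\<^sub>L A = r *\<^sub>R (B o\<^sub>C\<^sub>L A)" for r B
      by (rule cblinfun_eqI) (simp add: scaleC_of_real[symmetric])
    show "norm (B o\<^sub>C\<^sub>L A) \<le> norm B * norm A" for B
      by (rule norm_cblinfun_compose)
  qed
  show "(c *\<^sub>C B) o\<^sub>C\<^sub>L A = c *\<^sub>C (B o\<^sub>C\<^sub>L A)" for c B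
    by (rule cblinfun_eqI) simp
qed

lemma left_mult_apply [simp]: "left_mult A B = A o\<^sub>C\<^sub>L B"
  by (simp add: left_mult.rep_eq)

lemma right_mult_apply [simp]: "right_mult A B = B o\<^sub>C\<^sub>L A"
  by (simp add: right_mult.rep_eq)

text \<open>The integral in \<open>hol_calc\<close> for one given cycle, before independence of the
  cycle is known.\<close>

definition cycle_calc ::
  "('a::complex_banach \<Rightarrow>\<^sub>C\<^sub>L 'a) \<Rightarrow> (complex \<Rightarrow> complex) \<Rightarrow> (real \<Rightarrow> complex) list \<Rightarrow> ('a \<Rightarrow>\<^sub>C\<^sub>L 'a)" where
  "cycle_calc T f \<Gamma> = (1 / (2 * of_real pi * \<i>)) *\<^sub>C
     (\<Sum>\<gamma>\<leftarrow>\<Gamma>. vec_contour_integral \<gamma> (\<lambda>z. f z *\<^sub>C resolvent T z))"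

lemma surrounds_withinD:
  assumes "surrounds_within \<Gamma> K U"
  shows "\<And>\<gamma>. \<gamma> \<in> set \<Gamma> \<Longrightarrow> valid_path \<gamma> \<and> pathfinish \<gamma> = pathstart \<gamma> \<and> path_image \<gamma> \<subseteq> U - K"
    "\<And>z. z \<in> K \<Longrightarrow> (\<Sum>\<gamma>\<leftarrow>\<Gamma>. winding_number \<gamma> z) = 1"
    "\<And>z. z \<notin> U \<Longrightarrow> (\<Sum>\<gamma>\<leftarrow>\<Gamma>. winding_number \<gamma> z) = 0"
  using assms unfolding surrounds_within_def by blast+

lemma surrounds_Cauchy:
  assumes "surrounds_within \<Gamma> K U" "open U" "f holomorphic_on U"
  shows "(\<Sum>\<gamma>\<leftarrow>\<Gamma>. contour_integral \<gamma> f) = 0"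
  using surrounds_withinD[OF assms(1)] assms(2,3)
  by (intro Cauchy_theorem_cycle[of U]) blast+

lemma contour_sum_add:
  assumes W: "open W" and \<Gamma>: "\<And>\<gamma>. \<gamma> \<in> set \<Gamma> \<Longrightarrow> valid_path \<gamma> \<and> path_image \<gamma> \<subseteq> W"
    and f: "f holomorphic_on W" and g: "g holomorphic_on W"
  shows "(\<Sum>\<gamma>\<leftarrow>\<Gamma>. contour_integral \<gamma> (\<lambda>z. f z + g z)) =
    (\<Sum>\<gamma>\<leftarrow>\<Gamma>. contour_integral \<gamma> f) + (\<Sum>\<gamma>\<leftarrow>\<Gamma>. contour_integral \<gamma> g)"
  unfolding sum_list_addf[symmetric]
proof (rule arg_cong[where f=sum_list], rule map_cong[OF refl])
  fix \<gamma> assume "\<gamma> \<in> set \<Gamma>"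
  then show "contour_integral \<gamma> (\<lambda>z. f z + g z) = contour_integral \<gamma> f + contour_integral \<gamma> g"
    using \<Gamma> by (intro contour_integral_add contour_integrable_holomorphic_simple[OF _ W] f g) auto
qed

lemma contour_sum_cmult:
  assumes W: "open W" and \<Gamma>: "\<And>\<gamma>. \<gamma> \<in> set \<Gamma> \<Longrightarrow> valid_path \<gamma> \<and> path_image \<gamma> \<subseteq> W"
    and f: "f holomorphic_on W"
  shows "(\<Sum>\<gamma>\<leftarrow>\<Gamma>. contour_integral \<gamma> (\<lambda>z. c * f z)) = c * (\<Sum>\<gamma>\<leftarrow>\<Gamma>. contour_integral \<gamma> f)"
  unfolding sum_list_const_mult[symmetric]
proof (rule arg_cong[where f=sum_list], rule map_cong[OF refl])
  fix \<gamma> assume "\<gamma> \<in> set \<Gamma>"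
  then show "contour_integral \<gamma> (\<lambda>z. c * f z) = c * contour_integral \<gamma> f"
    using \<Gamma> by (intro contour_integral_lmul contour_integrable_holomorphic_simple[OF _ W] f) auto
qed

context
  fixes T :: "'a::complex_banach \<Rightarrow>\<^sub>C\<^sub>L 'a"
begin

lemma resolvent_functional_holomorphic:
  fixes \<phi> :: "('a \<Rightarrow>\<^sub>C\<^sub>L 'a) \<Rightarrow>\<^sub>C\<^sub>L complex"
  shows "(\<lambda>z. \<phi> (resolvent T z)) holomorphic_on - cspectrum T"
  by (rule vec_analytic_on_functional[OF vec_analytic_resolvent open_Compl_cspectrum])

lemma open_Diff_cspectrum: "open U \<Longrightarrow> open (U - cspectrum T)"
  using closed_cspectrum[of T] by (simp add: open_Diff)

lemma cycle_calc_functional: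
  fixes \<phi> :: "('a \<Rightarrow>\<^sub>C\<^sub>L 'a) \<Rightarrow>\<^sub>C\<^sub>L complex"
  assumes \<Gamma>: "surrounds_within \<Gamma> (cspectrum T) U" and U: "open U" and f: "f holomorphic_on U"
  shows "\<phi> (cycle_calc T f \<Gamma>) = 1 / (2 * of_real pi * \<i>) *
    (\<Sum>\<gamma>\<leftarrow>\<Gamma>. contour_integral \<gamma> (\<lambda>z. f z * \<phi> (resolvent T z)))"
proof -
  let ?W = "U - cspectrum T"
  have an: "vec_analytic_on (\<lambda>z. f z *\<^sub>C resolvent T z) ?W"
    using f by (intro vec_analytic_on_scaleC open_Diff_cspectrum[OF U]
        vec_analytic_on_subset[OF vec_analytic_resolvent]) (auto intro: holomorphic_on_subset)
  have eq: "\<phi> (vec_contour_integral \<gamma> (\<lambda>z. f z *\<^sub>C resolvent T z)) = contour_integral \<gamma> (\<lambda>z. f z * \<phi> (resolvent T z))"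
    if "\<gamma> \<in> set \<Gamma>" for \<gamma>
    using vec_contour_integral_functional[OF an open_Diff_cspectrum[OF U], of \<gamma> \<phi>]
      surrounds_withinD(1)[OF \<Gamma> that] by (simp add: scaleC_complex_def)
  have "\<phi> (\<Sum>\<gamma>\<leftarrow>\<Gamma>. vec_contour_integral \<gamma> (\<lambda>z. f z *\<^sub>C resolvent T z)) =
      (\<Sum>\<gamma>\<leftarrow>\<Gamma>. \<phi> (vec_contour_integral \<gamma> (\<lambda>z. f z *\<^sub>C resolvent T z)))"
    unfolding sum_list_map_nth by (rule cblinfun_sum_right)
  also have "\<dots> = (\<Sum>\<gamma>\<leftarrow>\<Gamma>. contour_integral \<gamma> (\<lambda>z. f z * \<phi> (resolvent T z)))"
    using eq by (intro arg_cong[where f=sum_list] map_cong) auto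
  finally show ?thesis by (simp add: cycle_calc_def scaleC_complex_def)
qed

lemma functional_mult_holomorphic:
  fixes \<phi> :: "('a \<Rightarrow>\<^sub>C\<^sub>L 'a) \<Rightarrow>\<^sub>C\<^sub>L complex"
  assumes "f holomorphic_on U"
  shows "(\<lambda>z. f z * \<phi> (resolvent T z)) holomorphic_on U - cspectrum T"
  using assms by (intro holomorphic_intros holomorphic_on_subset[OF resolvent_functional_holomorphic])
    (auto intro: holomorphic_on_subset)

lemma cycle_calc_C1:
  assumes \<Gamma>: "surrounds_within \<Gamma> (cspectrum T) U" and U: "open U"
  obtains \<Delta> where "surrounds_within \<Delta> (cspectrum T) U" "\<And>\<gamma>. \<gamma> \<in> set \<Delta> \<Longrightarrow> C1_path \<gamma>"
    "\<And>f. f holomorphic_on U \<Longrightarrow> cycle_calc T f \<Delta> = cycle_calc T f \<Gamma>"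
proof -
  obtain \<Delta> where \<Delta>: "\<And>\<gamma>. \<gamma> \<in> set \<Delta> \<Longrightarrow> C1_path \<gamma> \<and> pathfinish \<gamma> = pathstart \<gamma> \<and> path_image \<gamma> \<subseteq> U - cspectrum T"
    "\<And>f. f holomorphic_on U - cspectrum T \<Longrightarrow> (\<Sum>\<gamma>\<leftarrow>\<Delta>. contour_integral \<gamma> f) = (\<Sum>\<gamma>\<leftarrow>\<Gamma>. contour_integral \<gamma> f)"
    "\<And>z. z \<notin> U - cspectrum T \<Longrightarrow> (\<Sum>\<gamma>\<leftarrow>\<Delta>. winding_number \<gamma> z) = (\<Sum>\<gamma>\<leftarrow>\<Gamma>. winding_number \<gamma> z)"
    by (rule C1_approximation_list[OF open_Diff_cspectrum[OF U] surrounds_withinD(1)[OF \<Gamma>]])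
      (assumption, (rule that; assumption))
  have s: "surrounds_within \<Delta> (cspectrum T) U"
    unfolding surrounds_within_def
    using \<Delta>(1) \<Delta>(3) surrounds_withinD(2,3)[OF \<Gamma>] by (simp add: C1_path_def)
  have "cycle_calc T f \<Delta> = cycle_calc T f \<Gamma>" if f: "f holomorphic_on U" for f
    by (rule functionals_separate)
      (simp add: cycle_calc_functional[OF s U f] cycle_calc_functional[OF \<Gamma> U f]
        \<Delta>(2)[OF functional_mult_holomorphic[OF f]])
  then show ?thesis using s \<Delta>(1) by (intro that[of \<Delta>]) auto
qed

lemma cycle_calc_add:
  assumes \<Gamma>: "surrounds_within \<Gamma> (cspectrum T) U" and U: "open U"
    and f: "f holomorphic_on U" and g: "g holomorphic_on U"
  shows "cycle_calc T (\<lambda>z. f z + g z) \<Gamma> = cycle_calc T f \<Gamma> + cycle_calc T g \<Gamma>"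
proof (rule functionals_separate)
  fix \<phi> :: "('a \<Rightarrow>\<^sub>C\<^sub>L 'a) \<Rightarrow>\<^sub>C\<^sub>L complex"
  have fg: "(\<lambda>z. f z + g z) holomorphic_on U" by (intro holomorphic_intros f g)
  have "(\<Sum>\<gamma>\<leftarrow>\<Gamma>. contour_integral \<gamma> (\<lambda>z. f z * \<phi> (resolvent T z) + g z * \<phi> (resolvent T z))) =
      (\<Sum>\<gamma>\<leftarrow>\<Gamma>. contour_integral \<gamma> (\<lambda>z. f z * \<phi> (resolvent T z))) +
      (\<Sum>\<gamma>\<leftarrow>\<Gamma>. contour_integral \<gamma> (\<lambda>z. g z * \<phi> (resolvent T z)))"
    using surrounds_withinD(1)[OF \<Gamma>]
    by (intro contour_sum_add[OF open_Diff_cspectrum[OF U]] functional_mult_holomorphic f g) blast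
  then show "\<phi> (cycle_calc T (\<lambda>z. f z + g z) \<Gamma>) = \<phi> (cycle_calc T f \<Gamma> + cycle_calc T g \<Gamma>)"
    unfolding cblinfun_add_right cycle_calc_functional[OF \<Gamma> U f] cycle_calc_functional[OF \<Gamma> U g]
      cycle_calc_functional[OF \<Gamma> U fg] by (simp add: distrib_right distrib_left)
qed

lemma cycle_calc_cmult:
  assumes \<Gamma>: "surrounds_within \<Gamma> (cspectrum T) U" and U: "open U" and f: "f holomorphic_on U"
  shows "cycle_calc T (\<lambda>z. c * f z) \<Gamma> = c *\<^sub>C cycle_calc T f \<Gamma>"
proof (rule functionals_separate)
  fix \<phi> :: "('a \<Rightarrow>\<^sub>C\<^sub>L 'a) \<Rightarrow>\<^sub>C\<^sub>L complex"
  have cf: "(\<lambda>z. c * f z) holomorphic_on U" by (intro holomorphic_intros f)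
  have "(\<Sum>\<gamma>\<leftarrow>\<Gamma>. contour_integral \<gamma> (\<lambda>z. c * (f z * \<phi> (resolvent T z)))) =
      c * (\<Sum>\<gamma>\<leftarrow>\<Gamma>. contour_integral \<gamma> (\<lambda>z. f z * \<phi> (resolvent T z)))"
    using surrounds_withinD(1)[OF \<Gamma>]
    by (intro contour_sum_cmult[OF open_Diff_cspectrum[OF U]] functional_mult_holomorphic f) blast
  then show "\<phi> (cycle_calc T (\<lambda>z. c * f z) \<Gamma>) = \<phi> (c *\<^sub>C cycle_calc T f \<Gamma>)"
    unfolding cblinfun_scaleC_right cycle_calc_functional[OF \<Gamma> U f] cycle_calc_functional[OF \<Gamma> U cf]
    by (simp add: scaleC_complex_def mult.assoc)
qed

text \<open>Comparison with a large circle, on which the resolvent is close to \<open>1 / z\<close>.\<close>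

lemma cycle_calc_one:
  assumes \<Gamma>: "surrounds_within \<Gamma> (cspectrum T) U"
  shows "cycle_calc T (\<lambda>_. 1) \<Gamma> = id_cblinfun"
proof (rule functionals_separate)
  fix \<phi> :: "('a \<Rightarrow>\<^sub>C\<^sub>L 'a) \<Rightarrow>\<^sub>C\<^sub>L complex"
  let ?K = "cspectrum T" and ?R = "\<lambda>z. \<phi> (resolvent T z)"
  define c where "c = (\<Sum>\<gamma>\<leftarrow>\<Gamma>. contour_integral \<gamma> ?R)"
  have \<Gamma>': "surrounds_within \<Gamma> ?K UNIV"
    using \<Gamma> unfolding surrounds_within_def by blast
  have est: "cmod (c - 2 * of_real pi * \<i> * \<phi> id_cblinfun) \<le> 2 * pi * (norm \<phi> * norm T) / (\<rho> - norm T)"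
    if \<rho>: "\<rho> > norm T" for \<rho>
  proof -
    let ?C = "circlepath 0 \<rho>"
    have \<rho>0: "\<rho> > 0" using \<rho> norm_ge_zero[of T] by linarith
    have res: "z \<notin> ?K \<and> norm (resolvent T z) \<le> 1 / (\<rho> - norm T)" if z: "cmod z = \<rho>" for z
    proof -
      obtain S where S: "is_inverse_of S (T - z *\<^sub>C id_cblinfun)" "norm S \<le> 1 / (cmod z - norm T)"
        using cspectrum_bounded_by_norm[of T z] \<rho> z by auto
      then have zK: "z \<notin> ?K" by (auto simp: cspectrum_def)
      have "is_inverse_of (- S) (z *\<^sub>C id_cblinfun - T)" using is_inverse_of_minus[OF S(1)] by simp
      then have "resolvent T z = - S" using is_inverse_of_unique resolvent_is_inverse[OF zK] by blast
      then show ?thesis using S zK z by simp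
    qed
    have KB: "cmod z < \<rho>" if "z \<in> ?K" for z
      using that cspectrum_bounded_by_norm[of T z] \<rho> by (force simp: cspectrum_def not_le[symmetric])
    have im: "path_image ?C = sphere 0 \<rho>" using \<rho>0 by (simp add: path_image_circlepath_nonneg)
    have imK: "path_image ?C \<subseteq> - ?K" unfolding im using KB by (force simp: dist_norm)
    have hol: "?R holomorphic_on - ?K" by (rule resolvent_functional_holomorphic)
    have int: "?R contour_integrable_on ?C"
      using imK by (intro contour_integrable_holomorphic_simple[OF hol open_Compl_cspectrum]) auto
    \<comment> \<open>\<Gamma> and the large circle both wind once around every point of the
      spectrum, so their difference is null-homologous in its complement, where the resolvent is
      analytic.\<close>
    have "(\<Sum>\<gamma>\<leftarrow>reversepath ?C # \<Gamma>. contour_integral \<gamma> ?R) = 0"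
    proof (rule Cauchy_theorem_cycle[OF open_Compl_cspectrum _ _ hol])
      show "valid_path \<gamma> \<and> pathfinish \<gamma> = pathstart \<gamma> \<and> path_image \<gamma> \<subseteq> - ?K"
        if "\<gamma> \<in> set (reversepath ?C # \<Gamma>)" for \<gamma>
        using that imK surrounds_withinD(1)[OF \<Gamma>] by (auto simp: valid_path_imp_reverse)
      show "(\<Sum>\<gamma>\<leftarrow>reversepath ?C # \<Gamma>. winding_number \<gamma> z) = 0" if "z \<notin> - ?K" for z
      proof -
        have "cmod z < \<rho>" using that KB by simp
        then have "winding_number ?C z = 1" by (intro winding_number_circlepath) simp
        moreover have "z \<notin> path_image ?C" using \<open>cmod z < \<rho>\<close> by (simp add: im)
        ultimately show ?thesis
          using surrounds_withinD(2)[OF \<Gamma>, of z] that by (simp add: winding_number_reversepath)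
      qed
    qed
    then have c: "c = contour_integral ?C ?R"
      by (simp add: c_def contour_integral_reversepath)
    have one: "((\<lambda>z. \<phi> id_cblinfun / (z - 0)) has_contour_integral 2 * of_real pi * \<i> * \<phi> id_cblinfun) ?C"
      using Cauchy_integral_circlepath_simple[of "\<lambda>_. \<phi> id_cblinfun" 0 \<rho> 0] \<rho>0 by simp
    have "((\<lambda>z. ?R z - \<phi> id_cblinfun / (z - 0)) has_contour_integral
        c - 2 * of_real pi * \<i> * \<phi> id_cblinfun) ?C"
      using int unfolding c by (intro has_contour_integral_diff one has_contour_integral_integral)
    then have "cmod (c - 2 * of_real pi * \<i> * \<phi> id_cblinfun) \<le>
        (norm \<phi> * norm T / (\<rho> * (\<rho> - norm T))) * (2 * pi * \<rho>)"
    proof (rule has_contour_integral_bound_circlepath)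
      show "0 \<le> norm \<phi> * norm T / (\<rho> * (\<rho> - norm T))" using \<rho> \<rho>0 by simp
      fix z :: complex assume "norm (z - 0) = \<rho>"
      then have z: "cmod z = \<rho>" by simp
      have zK: "z \<notin> ?K" and nR: "norm (resolvent T z) \<le> 1 / (\<rho> - norm T)" using res[OF z] by auto
      have "z \<noteq> 0" using z \<rho>0 by auto
      \<comment> \<open>\<open>T R(z) = z R(z) - 1\<close> shows that the resolvent deviates from
        \<open>1 / z\<close> by \<open>T R(z) / z\<close>, which is of order
        \<open>1 / \<rho>^2\<close> on the circle.\<close>
      have "T o\<^sub>C\<^sub>L resolvent T z = z *\<^sub>C resolvent T z - id_cblinfun"
        by (rule cblinfun_eqI) (simp add: resolvent_apply(1)[OF zK])
      then have "\<phi> (T o\<^sub>C\<^sub>L resolvent T z) = z * ?R z - \<phi> id_cblinfun"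
        by (simp add: cblinfun_diff_right scaleC_complex_def)
      then have "?R z - \<phi> id_cblinfun / (z - 0) = \<phi> (T o\<^sub>C\<^sub>L resolvent T z) / z"
        using \<open>z \<noteq> 0\<close> by (simp add: field_simps)
      also have "cmod \<dots> = cmod (\<phi> (T o\<^sub>C\<^sub>L resolvent T z)) / \<rho>" by (simp add: norm_divide z)
      also have "cmod (\<phi> (T o\<^sub>C\<^sub>L resolvent T z)) \<le> norm \<phi> * (norm T * (1 / (\<rho> - norm T)))"
        by (rule order_trans[OF norm_cblinfun_apply mult_left_mono[OF order_trans[OF norm_cblinfun_compose
                  mult_left_mono[OF nR]]]]) auto
      finally show "cmod (?R z - \<phi> id_cblinfun / (z - 0)) \<le> norm \<phi> * norm T / (\<rho> * (\<rho> - norm T))"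
        using \<rho>0 by (simp add: divide_right_mono field_simps)
    qed fact
    also have "\<dots> = 2 * pi * (norm \<phi> * norm T) / (\<rho> - norm T)"
      using \<rho>0 \<rho> by (simp add: divide_simps)
    finally show ?thesis .
  qed
  have "((\<lambda>\<rho>. 2 * pi * (norm \<phi> * norm T) / (\<rho> - norm T)) \<longlongrightarrow> 0) at_top"
    by real_asymp
  then have "cmod (c - 2 * of_real pi * \<i> * \<phi> id_cblinfun) \<le> 0"
    by (rule tendsto_lowerbound) (use est in \<open>auto intro: eventually_mono[OF eventually_gt_at_top]\<close>)
  then have "c = 2 * of_real pi * \<i> * \<phi> id_cblinfun" by simp
  then show "\<phi> (cycle_calc T (\<lambda>_. 1) \<Gamma>) = \<phi> id_cblinfun"
    using cycle_calc_functional[OF \<Gamma>' open_UNIV, of "\<lambda>_. 1" \<phi>] by (simp add: c_def)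
qed

text \<open>\<open>(T - l) R(z) = (z - l) R(z) - 1\<close>, and the last term contributes the
  integral of \<open>f\<close> over a cycle that is null-homologous in \<open>U\<close>, which is
  0.\<close>

lemma cycle_calc_mult_linear:
  assumes \<Gamma>: "surrounds_within \<Gamma> (cspectrum T) U" and U: "open U" and f: "f holomorphic_on U"
  shows "cycle_calc T (\<lambda>z. (z - l) * f z) \<Gamma> = (T - l *\<^sub>C id_cblinfun) o\<^sub>C\<^sub>L cycle_calc T f \<Gamma>"
proof (rule functionals_separate)
  fix \<phi> :: "('a \<Rightarrow>\<^sub>C\<^sub>L 'a) \<Rightarrow>\<^sub>C\<^sub>L complex"
  let ?A = "T - l *\<^sub>C id_cblinfun"
  have hf: "(\<lambda>z. (z - l) * f z) holomorphic_on U" by (intro holomorphic_intros f)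
  have "\<phi> (?A o\<^sub>C\<^sub>L cycle_calc T f \<Gamma>) = (\<phi> o\<^sub>C\<^sub>L left_mult ?A) (cycle_calc T f \<Gamma>)" by simp
  also have "\<dots> = 1 / (2 * of_real pi * \<i>) *
      (\<Sum>\<gamma>\<leftarrow>\<Gamma>. contour_integral \<gamma> (\<lambda>z. f z * \<phi> (?A o\<^sub>C\<^sub>L resolvent T z)))"
    by (subst cycle_calc_functional[OF \<Gamma> U f]) simp
  also have "(\<Sum>\<gamma>\<leftarrow>\<Gamma>. contour_integral \<gamma> (\<lambda>z. f z * \<phi> (?A o\<^sub>C\<^sub>L resolvent T z))) =
      (\<Sum>\<gamma>\<leftarrow>\<Gamma>. contour_integral \<gamma> (\<lambda>z. (z - l) * f z * \<phi> (resolvent T z) + (- \<phi> id_cblinfun) * f z))"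
  proof (intro arg_cong[where f=sum_list] map_cong refl contour_integral_eq)
    fix \<gamma> z assume "\<gamma> \<in> set \<Gamma>" "z \<in> path_image \<gamma>"
    then have z: "z \<notin> cspectrum T" using surrounds_withinD(1)[OF \<Gamma>] by blast
    have "?A o\<^sub>C\<^sub>L resolvent T z = (z - l) *\<^sub>C resolvent T z - id_cblinfun"
      by (rule cblinfun_eqI) (simp add: resolvent_apply(1)[OF z] complex_vector.scale_left_diff_distrib)
    then show "f z * \<phi> (?A o\<^sub>C\<^sub>L resolvent T z) = (z - l) * f z * \<phi> (resolvent T z) + (- \<phi> id_cblinfun) * f z"
      by (simp only: cblinfun_diff_right cblinfun_scaleC_right scaleC_complex_def) (simp add: algebra_simps)
  qed
  also have "\<dots> = (\<Sum>\<gamma>\<leftarrow>\<Gamma>. contour_integral \<gamma> (\<lambda>z. (z - l) * f z * \<phi> (resolvent T z))) +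
      (\<Sum>\<gamma>\<leftarrow>\<Gamma>. contour_integral \<gamma> (\<lambda>z. (- \<phi> id_cblinfun) * f z))"
  proof (rule contour_sum_add[OF open_Diff_cspectrum[OF U]])
    show "(\<lambda>z. (- \<phi> id_cblinfun) * f z) holomorphic_on U - cspectrum T"
      by (intro holomorphic_intros holomorphic_on_subset[OF f]) auto
  qed (use surrounds_withinD(1)[OF \<Gamma>] functional_mult_holomorphic[OF hf] in blast)+
  also have "(\<Sum>\<gamma>\<leftarrow>\<Gamma>. contour_integral \<gamma> (\<lambda>z. (- \<phi> id_cblinfun) * f z)) = 0"
    by (rule surrounds_Cauchy[OF \<Gamma> U]) (intro holomorphic_intros f)
  finally show "\<phi> (cycle_calc T (\<lambda>z. (z - l) * f z) \<Gamma>) = \<phi> (?A o\<^sub>C\<^sub>L cycle_calc T f \<Gamma>)"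
    by (simp add: cycle_calc_functional[OF \<Gamma> U hf])
qed

lemma cycle_calc_commute_resolvent:
  assumes \<Gamma>: "surrounds_within \<Gamma> (cspectrum T) U" and U: "open U" and f: "f holomorphic_on U"
    and z: "z \<notin> cspectrum T"
  shows "cycle_calc T f \<Gamma> o\<^sub>C\<^sub>L resolvent T z = resolvent T z o\<^sub>C\<^sub>L cycle_calc T f \<Gamma>"
proof (rule functionals_separate)
  fix \<phi> :: "('a \<Rightarrow>\<^sub>C\<^sub>L 'a) \<Rightarrow>\<^sub>C\<^sub>L complex"
  have "(\<Sum>\<gamma>\<leftarrow>\<Gamma>. contour_integral \<gamma> (\<lambda>w. f w * \<phi> (resolvent T w o\<^sub>C\<^sub>L resolvent T z))) =
      (\<Sum>\<gamma>\<leftarrow>\<Gamma>. contour_integral \<gamma> (\<lambda>w. f w * \<phi> (resolvent T z o\<^sub>C\<^sub>L resolvent T w)))"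
  proof (intro arg_cong[where f=sum_list] map_cong refl contour_integral_eq)
    fix \<gamma> w assume "\<gamma> \<in> set \<Gamma>" "w \<in> path_image \<gamma>"
    then have "w \<notin> cspectrum T" using surrounds_withinD(1)[OF \<Gamma>] by blast
    then show "f w * \<phi> (resolvent T w o\<^sub>C\<^sub>L resolvent T z) = f w * \<phi> (resolvent T z o\<^sub>C\<^sub>L resolvent T w)"
      using resolvent_commute[OF z] by simp
  qed
  then have "(\<phi> o\<^sub>C\<^sub>L right_mult (resolvent T z)) (cycle_calc T f \<Gamma>) =
      (\<phi> o\<^sub>C\<^sub>L left_mult (resolvent T z)) (cycle_calc T f \<Gamma>)"
    unfolding cycle_calc_functional[OF \<Gamma> U f] by simp
  then show "\<phi> (cycle_calc T f \<Gamma> o\<^sub>C\<^sub>L resolvent T z) = \<phi> (resolvent T z o\<^sub>C\<^sub>L cycle_calc T f \<Gamma>)"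
    by simp
qed

text \<open>The operator \<open>k\<^sub>z(T)\<close>, where \<open>k\<^sub>z(w) = (f(w) - f(z)) / (w - z)\<close>, satisfies
  \<open>f(T) R(z) = f(z) R(z) - k\<^sub>z(T)\<close> and, unlike the resolvent \<open>R(z)\<close>, depends analytically on \<open>z\<close> across
  the spectrum; integrating against \<open>h(z)\<close> therefore gives \<open>f(T) h(T) = (f h)(T)\<close>, even if the two
  integrals use different cycles.\<close>

definition diff_quot :: "(complex \<Rightarrow> complex) \<Rightarrow> complex \<Rightarrow> complex \<Rightarrow> complex" where
  "diff_quot f z w = (if w = z then deriv f z else (f w - f z) / (w - z))"

lemma cycle_calc_diff_quot:
  assumes \<Gamma>: "surrounds_within \<Gamma> (cspectrum T) U" and U: "open U" and f: "f holomorphic_on U"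
    and z: "z \<notin> cspectrum T"
  shows "cycle_calc T f \<Gamma> o\<^sub>C\<^sub>L resolvent T z = f z *\<^sub>C resolvent T z - cycle_calc T (diff_quot f z) \<Gamma>"
proof -
  have k: "diff_quot f z holomorphic_on U"
    unfolding diff_quot_def[abs_def] by (rule pole_lemma_open[OF f U])
  have "(T - z *\<^sub>C id_cblinfun) o\<^sub>C\<^sub>L cycle_calc T (diff_quot f z) \<Gamma> =
      cycle_calc T (\<lambda>w. (w - z) * diff_quot f z w) \<Gamma>"
    by (rule cycle_calc_mult_linear[OF \<Gamma> U k, symmetric])
  also have "(\<lambda>w. (w - z) * diff_quot f z w) = (\<lambda>w. f w + (- f z) * 1)"
    by (auto simp: diff_quot_def)
  also have "cycle_calc T \<dots> \<Gamma> = cycle_calc T f \<Gamma> + (- f z) *\<^sub>C id_cblinfun"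
    using cycle_calc_add[OF \<Gamma> U f, of "\<lambda>_. (- f z) * 1"] cycle_calc_cmult[OF \<Gamma> U, of "\<lambda>_. 1" "- f z"]
      cycle_calc_one[OF \<Gamma>] by simp
  finally have eq: "(T - z *\<^sub>C id_cblinfun) o\<^sub>C\<^sub>L cycle_calc T (diff_quot f z) \<Gamma> =
      cycle_calc T f \<Gamma> + (- f z) *\<^sub>C id_cblinfun" .
  show ?thesis
  proof (rule cblinfun_eqI)
    fix x
    let ?k = "cycle_calc T (diff_quot f z) \<Gamma> x"
    have "T ?k - z *\<^sub>C ?k = cycle_calc T f \<Gamma> x - f z *\<^sub>C x"
      using arg_cong[OF eq, of "\<lambda>S. cblinfun_apply S x"] by (simp add: complex_vector.scale_minus_left)
    then have "resolvent T z (T ?k) - z *\<^sub>C resolvent T z ?k =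
        resolvent T z (cycle_calc T f \<Gamma> x) - f z *\<^sub>C resolvent T z x"
      by (metis cblinfun_diff_right cblinfun_scaleC_right)
    then have "- ?k = resolvent T z (cycle_calc T f \<Gamma> x) - f z *\<^sub>C resolvent T z x"
      by (simp add: resolvent_apply(2)[OF z])
    moreover have "resolvent T z (cycle_calc T f \<Gamma> x) = cycle_calc T f \<Gamma> (resolvent T z x)"
      using arg_cong[OF cycle_calc_commute_resolvent[OF \<Gamma> U f z], of "\<lambda>S. cblinfun_apply S x"] by simp
    ultimately show "(cycle_calc T f \<Gamma> o\<^sub>C\<^sub>L resolvent T z) x = (f z *\<^sub>C resolvent T z - cycle_calc T (diff_quot f z) \<Gamma>) x"
      by (simp add: algebra_simps)
  qed
qed

text \<open>Off the spectrum the operator is expressed by the resolvent, off the curves it is a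
  combination of Cauchy-type integrals; the curves avoid the spectrum, so the two regions cover
  \<open>U\<close>.\<close>

lemma cycle_calc_diff_quot_holomorphic:
  fixes \<phi> :: "('a \<Rightarrow>\<^sub>C\<^sub>L 'a) \<Rightarrow>\<^sub>C\<^sub>L complex"
  assumes \<Gamma>: "surrounds_within \<Gamma> (cspectrum T) U" and C1: "\<And>\<gamma>. \<gamma> \<in> set \<Gamma> \<Longrightarrow> C1_path \<gamma>"
    and U: "open U" and f: "f holomorphic_on U"
  shows "(\<lambda>z. \<phi> (cycle_calc T (diff_quot f z) \<Gamma>)) holomorphic_on U"
proof -
  let ?\<kappa> = "\<lambda>z. \<phi> (cycle_calc T (diff_quot f z) \<Gamma>)"
  define I where "I = (\<Union>\<gamma>\<in>set \<Gamma>. path_image \<gamma>)"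
  have cI: "closed I"
    unfolding I_def using surrounds_withinD(1)[OF \<Gamma>] by (intro closed_UN) (auto intro!: closed_valid_path_image)
  have 1: "?\<kappa> holomorphic_on U - cspectrum T"
  proof (rule holomorphic_transform)
    show "(\<lambda>z. f z * \<phi> (resolvent T z) - (\<phi> o\<^sub>C\<^sub>L left_mult (cycle_calc T f \<Gamma>)) (resolvent T z))
        holomorphic_on U - cspectrum T"
      by (intro holomorphic_on_diff functional_mult_holomorphic f
          holomorphic_on_subset[OF resolvent_functional_holomorphic]) auto
    fix z assume "z \<in> U - cspectrum T"
    then have z: "z \<notin> cspectrum T" by simp
    have "(\<phi> o\<^sub>C\<^sub>L left_mult (cycle_calc T f \<Gamma>)) (resolvent T z) = \<phi> (f z *\<^sub>C resolvent T z - cycle_calc T (diff_quot f z) \<Gamma>)"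
      by (simp add: cycle_calc_diff_quot[OF \<Gamma> U f z])
    then show "f z * \<phi> (resolvent T z) - (\<phi> o\<^sub>C\<^sub>L left_mult (cycle_calc T f \<Gamma>)) (resolvent T z) = ?\<kappa> z"
      by (simp only: cblinfun_diff_right cblinfun_scaleC_right scaleC_complex_def) simp
  qed
  have 2: "?\<kappa> holomorphic_on U - I"
  proof -
    let ?R = "\<lambda>w. \<phi> (resolvent T w)"
    have cR: "continuous_on (path_image \<gamma>) ?R" and cf: "continuous_on (path_image \<gamma>) f"
      if "\<gamma> \<in> set \<Gamma>" for \<gamma>
      using surrounds_withinD(1)[OF \<Gamma> that]
      by (auto intro!: continuous_on_subset[OF holomorphic_on_imp_continuous_on[OF resolvent_functional_holomorphic]]
          continuous_on_subset[OF holomorphic_on_imp_continuous_on[OF f]])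
    have "?\<kappa> z = 1 / (2 * of_real pi * \<i>) * (\<Sum>i<length \<Gamma>. contour_integral (\<Gamma> ! i) (\<lambda>w. f w * ?R w / (w - z)) -
        f z * contour_integral (\<Gamma> ! i) (\<lambda>w. ?R w / (w - z)))" if z: "z \<in> U - I" for z
    proof -
      have k: "diff_quot f z holomorphic_on U"
        unfolding diff_quot_def[abs_def] by (rule pole_lemma_open[OF f U])
      have "contour_integral (\<Gamma> ! i) (\<lambda>w. diff_quot f z w * ?R w) =
          contour_integral (\<Gamma> ! i) (\<lambda>w. f w * ?R w / (w - z)) - f z * contour_integral (\<Gamma> ! i) (\<lambda>w. ?R w / (w - z))"
        if i: "i \<in> {..<length \<Gamma>}" for i
      proof -
        have \<gamma>: "\<Gamma> ! i \<in> set \<Gamma>" using i by simp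
        have zi: "z \<notin> path_image (\<Gamma> ! i)" using z \<gamma> by (auto simp: I_def)
        have i1: "(\<lambda>w. f w * ?R w / (w - z)) contour_integrable_on \<Gamma> ! i"
          using zi by (intro C1_path_contour_integrable C1 \<gamma> continuous_intros cf cR) auto
        have i2: "(\<lambda>w. ?R w / (w - z)) contour_integrable_on \<Gamma> ! i"
          using zi by (intro C1_path_contour_integrable C1 \<gamma> continuous_intros cR) auto
        have "contour_integral (\<Gamma> ! i) (\<lambda>w. diff_quot f z w * ?R w) =
            contour_integral (\<Gamma> ! i) (\<lambda>w. f w * ?R w / (w - z) - f z * (?R w / (w - z)))"
        proof (rule contour_integral_eq)
          fix w assume "w \<in> path_image (\<Gamma> ! i)"
          then have "w \<noteq> z" using zi by auto
          then show "diff_quot f z w * ?R w = f w * ?R w / (w - z) - f z * (?R w / (w - z))"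
            by (simp add: diff_quot_def left_diff_distrib diff_divide_distrib)
        qed
        also have "\<dots> = contour_integral (\<Gamma> ! i) (\<lambda>w. f w * ?R w / (w - z)) - contour_integral (\<Gamma> ! i) (\<lambda>w. f z * (?R w / (w - z)))"
          by (rule contour_integral_diff[OF i1 contour_integrable_lmul[OF i2]])
        finally show ?thesis by (simp only: contour_integral_lmul[OF i2])
      qed
      then show ?thesis
        unfolding cycle_calc_functional[OF \<Gamma> U k] sum_list_map_nth by (simp cong: sum.cong_simp)
    qed
    moreover have "(\<lambda>z. 1 / (2 * of_real pi * \<i>) * (\<Sum>i<length \<Gamma>. contour_integral (\<Gamma> ! i) (\<lambda>w. f w * ?R w / (w - z)) -
        f z * contour_integral (\<Gamma> ! i) (\<lambda>w. ?R w / (w - z)))) holomorphic_on U - I"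
    proof (intro holomorphic_on_mult holomorphic_on_const holomorphic_on_sum holomorphic_on_diff)
      fix i assume "i \<in> {..<length \<Gamma>}"
      then have \<gamma>: "\<Gamma> ! i \<in> set \<Gamma>" by simp
      show "(\<lambda>z. contour_integral (\<Gamma> ! i) (\<lambda>w. f w * ?R w / (w - z))) holomorphic_on U - I"
        by (rule holomorphic_on_subset[OF Cauchy_type_integral_holomorphic[OF C1[OF \<gamma>]]])
          (use \<gamma> in \<open>auto simp: I_def intro!: continuous_intros cf cR\<close>)
      show "(\<lambda>z. contour_integral (\<Gamma> ! i) (\<lambda>w. ?R w / (w - z))) holomorphic_on U - I"
        by (rule holomorphic_on_subset[OF Cauchy_type_integral_holomorphic[OF C1[OF \<gamma>] cR[OF \<gamma>]]])
          (use \<gamma> in \<open>auto simp: I_def\<close>)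
      show "f holomorphic_on U - I" by (rule holomorphic_on_subset[OF f]) auto
    qed
    ultimately show ?thesis by (subst holomorphic_cong[OF refl]) auto
  qed
  have "?\<kappa> holomorphic_on (U - cspectrum T) \<union> (U - I)"
    using 1 2 open_Diff_cspectrum[OF U] U cI by (intro holomorphic_on_Un) (auto simp: open_Diff)
  moreover have "(U - cspectrum T) \<union> (U - I) = U"
    using surrounds_withinD(1)[OF \<Gamma>] by (fastforce simp: I_def)
  ultimately show ?thesis by simp
qed

lemma cycle_calc_mult:
  assumes \<Gamma>: "surrounds_within \<Gamma> (cspectrum T) U" and U: "open U" and f: "f holomorphic_on U"
    and \<Gamma>': "surrounds_within \<Gamma>' (cspectrum T) U'" and U': "open U'" "U' \<subseteq> U" and h: "h holomorphic_on U'"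
  shows "cycle_calc T f \<Gamma> o\<^sub>C\<^sub>L cycle_calc T h \<Gamma>' = cycle_calc T (\<lambda>z. f z * h z) \<Gamma>'"
proof -
  obtain \<Delta> where \<Delta>: "surrounds_within \<Delta> (cspectrum T) U" "\<And>\<gamma>. \<gamma> \<in> set \<Delta> \<Longrightarrow> C1_path \<gamma>"
    "cycle_calc T f \<Delta> = cycle_calc T f \<Gamma>"
    using cycle_calc_C1[OF \<Gamma> U] f by metis
  have "cycle_calc T f \<Delta> o\<^sub>C\<^sub>L cycle_calc T h \<Gamma>' = cycle_calc T (\<lambda>z. f z * h z) \<Gamma>'"
  proof (rule functionals_separate)
    fix \<phi> :: "('a \<Rightarrow>\<^sub>C\<^sub>L 'a) \<Rightarrow>\<^sub>C\<^sub>L complex"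
    let ?S = "cycle_calc T f \<Delta>" and ?\<kappa> = "\<lambda>z. \<phi> (cycle_calc T (diff_quot f z) \<Delta>)"
    have f': "f holomorphic_on U'" using f U' by (auto intro: holomorphic_on_subset)
    have fh: "(\<lambda>z. f z * h z) holomorphic_on U'" by (intro holomorphic_intros f' h)
    have \<kappa>: "(\<lambda>z. - (h z * ?\<kappa> z)) holomorphic_on U'"
      by (intro holomorphic_intros h
          holomorphic_on_subset[OF cycle_calc_diff_quot_holomorphic[OF \<Delta>(1,2) U f] U'(2)])
    have "\<phi> (?S o\<^sub>C\<^sub>L cycle_calc T h \<Gamma>') = (\<phi> o\<^sub>C\<^sub>L left_mult ?S) (cycle_calc T h \<Gamma>')" by simp
    also have "\<dots> = 1 / (2 * of_real pi * \<i>) *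
        (\<Sum>\<gamma>\<leftarrow>\<Gamma>'. contour_integral \<gamma> (\<lambda>z. h z * \<phi> (?S o\<^sub>C\<^sub>L resolvent T z)))"
      by (subst cycle_calc_functional[OF \<Gamma>' U'(1) h]) simp
    also have "(\<Sum>\<gamma>\<leftarrow>\<Gamma>'. contour_integral \<gamma> (\<lambda>z. h z * \<phi> (?S o\<^sub>C\<^sub>L resolvent T z))) =
        (\<Sum>\<gamma>\<leftarrow>\<Gamma>'. contour_integral \<gamma> (\<lambda>z. f z * h z * \<phi> (resolvent T z) + - (h z * ?\<kappa> z)))"
    proof (intro arg_cong[where f=sum_list] map_cong refl contour_integral_eq)
      fix \<gamma> z assume "\<gamma> \<in> set \<Gamma>'" "z \<in> path_image \<gamma>"
      then have z: "z \<notin> cspectrum T" using surrounds_withinD(1)[OF \<Gamma>'] by blast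
      show "h z * \<phi> (?S o\<^sub>C\<^sub>L resolvent T z) = f z * h z * \<phi> (resolvent T z) + - (h z * ?\<kappa> z)"
        unfolding cycle_calc_diff_quot[OF \<Delta>(1) U f z]
        by (simp add: cblinfun_diff_right scaleC_complex_def algebra_simps)
    qed
    also have "\<dots> = (\<Sum>\<gamma>\<leftarrow>\<Gamma>'. contour_integral \<gamma> (\<lambda>z. f z * h z * \<phi> (resolvent T z))) +
        (\<Sum>\<gamma>\<leftarrow>\<Gamma>'. contour_integral \<gamma> (\<lambda>z. - (h z * ?\<kappa> z)))"
    proof (rule contour_sum_add[OF open_Diff_cspectrum[OF U'(1)]])
      show "valid_path \<gamma> \<and> path_image \<gamma> \<subseteq> U' - cspectrum T" if "\<gamma> \<in> set \<Gamma>'" for \<gamma>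
        using surrounds_withinD(1)[OF \<Gamma>' that] by blast
      show "(\<lambda>z. f z * h z * \<phi> (resolvent T z)) holomorphic_on U' - cspectrum T"
        by (rule functional_mult_holomorphic[OF fh])
      show "(\<lambda>z. - (h z * ?\<kappa> z)) holomorphic_on U' - cspectrum T"
        by (rule holomorphic_on_subset[OF \<kappa>]) auto
    qed
    \<comment> \<open>The remainder is holomorphic on all of \<open>U'\<close>, across the spectrum,
      so Cauchy's theorem removes it.\<close>
    also have "(\<Sum>\<gamma>\<leftarrow>\<Gamma>'. contour_integral \<gamma> (\<lambda>z. - (h z * ?\<kappa> z))) = 0"
      by (rule surrounds_Cauchy[OF \<Gamma>' U'(1) \<kappa>])
    finally show "\<phi> (?S o\<^sub>C\<^sub>L cycle_calc T h \<Gamma>') = \<phi> (cycle_calc T (\<lambda>z. f z * h z) \<Gamma>')"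
      by (simp add: cycle_calc_functional[OF \<Gamma>' U'(1) fh])
  qed
  then show ?thesis by (simp add: \<Delta>(3))
qed

text \<open>Both sides are multiplied by \<open>cycle_calc T (\<lambda>_. 1) \<Delta>\<close>, which
  is the identity, for a cycle \<Delta> in the intersection of the two domains; multiplicativity
  moves both integrals to \<Delta>.\<close>

lemma cycle_calc_independent:
  assumes \<Gamma>: "surrounds_within \<Gamma> (cspectrum T) U" and U: "open U" "cspectrum T \<subseteq> U" and f: "f holomorphic_on U"
    and \<Gamma>': "surrounds_within \<Gamma>' (cspectrum T) U'" and U': "open U'" "cspectrum T \<subseteq> U'" and f': "f holomorphic_on U'"
  shows "cycle_calc T f \<Gamma> = cycle_calc T f \<Gamma>'"
proof -
  have op: "open (U \<inter> U')" "cspectrum T \<subseteq> U \<inter> U'" using U U' by auto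
  obtain \<Delta> where \<Delta>: "surrounds_within \<Delta> (cspectrum T) (U \<inter> U')"
    by (rule ex_surrounds_within[OF compact_cspectrum op])
  have "cycle_calc T f \<Gamma> o\<^sub>C\<^sub>L cycle_calc T (\<lambda>_. 1) \<Delta> = cycle_calc T (\<lambda>z. f z * 1) \<Delta>"
    by (rule cycle_calc_mult[OF \<Gamma> U(1) f \<Delta> op(1)]) auto
  moreover have "cycle_calc T f \<Gamma>' o\<^sub>C\<^sub>L cycle_calc T (\<lambda>_. 1) \<Delta> = cycle_calc T (\<lambda>z. f z * 1) \<Delta>"
    by (rule cycle_calc_mult[OF \<Gamma>' U'(1) f' \<Delta> op(1)]) auto
  ultimately show ?thesis by (simp add: cycle_calc_one[OF \<Delta>])
qed

lemma hol_calc_eq_cycle_calc: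
  assumes \<Gamma>: "surrounds_within \<Gamma> (cspectrum T) U" and U: "open U" "cspectrum T \<subseteq> U" and f: "f holomorphic_on U"
  shows "hol_calc f T = cycle_calc T f \<Gamma>"
proof -
  let ?P = "\<lambda>S. \<exists>U \<Gamma>. open U \<and> cspectrum T \<subseteq> U \<and> f holomorphic_on U \<and> surrounds_within \<Gamma> (cspectrum T) U \<and>
     S = cycle_calc T f \<Gamma>"
  have "?P (cycle_calc T f \<Gamma>)" using assms by blast
  then have "?P (hol_calc f T)"
    unfolding hol_calc_def cycle_calc_def[symmetric] by (rule someI)
  then obtain U' \<Gamma>' where U': "open U'" "cspectrum T \<subseteq> U'" "f holomorphic_on U'"
    and \<Gamma>': "surrounds_within \<Gamma>' (cspectrum T) U'" and eq: "hol_calc f T = cycle_calc T f \<Gamma>'" by blast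
  show ?thesis unfolding eq by (rule cycle_calc_independent[OF \<Gamma>' U' \<Gamma> U f])
qed

lemma hol_calc_cycle:
  assumes U: "open U" "cspectrum T \<subseteq> U"
  obtains \<Gamma> where "surrounds_within \<Gamma> (cspectrum T) U" "\<And>f. f holomorphic_on U \<Longrightarrow> hol_calc f T = cycle_calc T f \<Gamma>"
proof -
  obtain \<Gamma> where "surrounds_within \<Gamma> (cspectrum T) U"
    by (rule ex_surrounds_within[OF compact_cspectrum U])
  then show ?thesis using that[of \<Gamma>] hol_calc_eq_cycle_calc[OF _ U] by blast
qed

section \<open>Algebra and norm estimates of the functional calculus\<close>

lemma hol_calc_add:
  assumes U: "open U" "cspectrum T \<subseteq> U" and f: "f holomorphic_on U" and g: "g holomorphic_on U"
  shows "hol_calc (\<lambda>z. f z + g z) T = hol_calc f T + hol_calc g T"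
proof -
  obtain \<Gamma> where \<Gamma>: "surrounds_within \<Gamma> (cspectrum T) U" "\<And>f. f holomorphic_on U \<Longrightarrow> hol_calc f T = cycle_calc T f \<Gamma>"
    using hol_calc_cycle[OF U] by blast
  have "(\<lambda>z. f z + g z) holomorphic_on U" by (intro holomorphic_intros f g)
  then show ?thesis using \<Gamma>(2) f g cycle_calc_add[OF \<Gamma>(1) U(1) f g] by simp
qed

lemma hol_calc_const: "hol_calc (\<lambda>_. c) T = c *\<^sub>C id_cblinfun"
proof -
  obtain \<Gamma> where \<Gamma>: "surrounds_within \<Gamma> (cspectrum T) UNIV" "\<And>f. f holomorphic_on UNIV \<Longrightarrow> hol_calc f T = cycle_calc T f \<Gamma>"
    using hol_calc_cycle[of UNIV] by auto
  show ?thesis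
    using cycle_calc_cmult[OF \<Gamma>(1) open_UNIV, of "\<lambda>_. 1" c] by (simp add: \<Gamma>(2) cycle_calc_one[OF \<Gamma>(1)])
qed

lemma hol_calc_linear: "hol_calc (\<lambda>z. z - l) T = T - l *\<^sub>C id_cblinfun"
proof -
  obtain \<Gamma> where \<Gamma>: "surrounds_within \<Gamma> (cspectrum T) UNIV" "\<And>f. f holomorphic_on UNIV \<Longrightarrow> hol_calc f T = cycle_calc T f \<Gamma>"
    using hol_calc_cycle[of UNIV] by auto
  have "(\<lambda>z. z - l) holomorphic_on UNIV" by (intro holomorphic_intros)
  then show ?thesis
    using cycle_calc_mult_linear[OF \<Gamma>(1) open_UNIV, of "\<lambda>_. 1" l] by (simp add: \<Gamma>(2) cycle_calc_one[OF \<Gamma>(1)])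
qed

lemma hol_calc_mult:
  assumes U: "open U" "cspectrum T \<subseteq> U" and f: "f holomorphic_on U" and g: "g holomorphic_on U"
  shows "hol_calc (\<lambda>z. f z * g z) T = hol_calc f T o\<^sub>C\<^sub>L hol_calc g T"
proof -
  obtain \<Gamma> where \<Gamma>: "surrounds_within \<Gamma> (cspectrum T) U" "\<And>f. f holomorphic_on U \<Longrightarrow> hol_calc f T = cycle_calc T f \<Gamma>"
    using hol_calc_cycle[OF U] by blast
  have "(\<lambda>z. f z * g z) holomorphic_on U" by (intro holomorphic_intros f g)
  then show ?thesis using \<Gamma>(2) f g cycle_calc_mult[OF \<Gamma>(1) U(1) f \<Gamma>(1) U(1) order_refl g] by simp
qed

lemma hol_calc_cong:
  assumes U: "open U" "cspectrum T \<subseteq> U" and f: "f holomorphic_on U" and eq: "\<And>z. z \<in> U \<Longrightarrow> f z = g z"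
  shows "hol_calc f T = hol_calc g T"
proof -
  obtain \<Gamma> where \<Gamma>: "surrounds_within \<Gamma> (cspectrum T) U" "\<And>f. f holomorphic_on U \<Longrightarrow> hol_calc f T = cycle_calc T f \<Gamma>"
    using hol_calc_cycle[OF U] by blast
  have g: "g holomorphic_on U" using f eq holomorphic_cong[OF refl, of U f g] by blast
  have "cycle_calc T f \<Gamma> = cycle_calc T g \<Gamma>"
  proof (rule functionals_separate)
    fix \<phi> :: "('a \<Rightarrow>\<^sub>C\<^sub>L 'a) \<Rightarrow>\<^sub>C\<^sub>L complex"
    have "(\<Sum>\<gamma>\<leftarrow>\<Gamma>. contour_integral \<gamma> (\<lambda>z. f z * \<phi> (resolvent T z))) = (\<Sum>\<gamma>\<leftarrow>\<Gamma>. contour_integral \<gamma> (\<lambda>z. g z * \<phi> (resolvent T z)))"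
      using eq surrounds_withinD(1)[OF \<Gamma>(1)]
      by (intro arg_cong[where f=sum_list] map_cong refl contour_integral_eq) (metis Diff_iff subsetD)
    then show "\<phi> (cycle_calc T f \<Gamma>) = \<phi> (cycle_calc T g \<Gamma>)"
      unfolding cycle_calc_functional[OF \<Gamma>(1) U(1) f] cycle_calc_functional[OF \<Gamma>(1) U(1) g] by simp
  qed
  then show ?thesis using \<Gamma>(2) f g by simp
qed

text \<open>The spectral radius estimate in the form used for quasinilpotence: the cycle is placed
  where the modulus of \<open>f\<close> is below \<open>e\<close>, and \<open>C\<close> does not
  depend on \<open>n\<close>.\<close>

lemma hol_calc_power_bound:
  assumes U: "open U" "cspectrum T \<subseteq> U" and f: "f holomorphic_on U"
    and small: "\<And>z. z \<in> cspectrum T \<Longrightarrow> cmod (f z) < e" and e: "e > 0"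
  obtains C where "\<And>n. norm (hol_calc (\<lambda>z. f z ^ n) T) \<le> C * e ^ n"
proof -
  define V where "V = U \<inter> f -` ball 0 e"
  have V: "open V" "cspectrum T \<subseteq> V" "V \<subseteq> U"
    unfolding V_def using U small
    by (auto intro!: continuous_open_preimage holomorphic_on_imp_continuous_on[OF f])
  have fV: "(\<lambda>z. f z ^ n) holomorphic_on V" for n
    by (intro holomorphic_intros holomorphic_on_subset[OF f V(3)])
  obtain \<Gamma> M L where \<Gamma>: "surrounds_within \<Gamma> (cspectrum T) V" and M: "compact M" "M \<subseteq> V - cspectrum T"
    and "\<And>\<gamma>. \<gamma> \<in> set \<Gamma> \<Longrightarrow> path_image \<gamma> \<subseteq> M" and L: "L \<ge> 0" "\<And>g B. continuous_on M g \<Longrightarrow> (\<And>z. z \<in> M \<Longrightarrow> cmod (g z) \<le> B) \<Longrightarrow> B \<ge> 0 \<Longrightarrow>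
      cmod (\<Sum>\<gamma>\<leftarrow>\<Gamma>. contour_integral \<gamma> g) \<le> L * B"
  proof (rule ex_surrounds_within[OF compact_cspectrum V(1,2)], goal_cases)
    case (1 \<Gamma> M L)
    show ?case by (rule 1(1)[OF 1(2-7)])
  qed
  have "continuous_on M (resolvent T)"
    using M by (intro continuous_on_subset[OF vec_analytic_on_imp_continuous_on[OF vec_analytic_resolvent]]) auto
  then have "bounded (resolvent T ` M)" by (intro compact_imp_bounded compact_continuous_image M)
  then obtain B where B: "\<And>z. z \<in> M \<Longrightarrow> norm (resolvent T z) \<le> B" "B > 0"
    by (auto simp: bounded_pos)
  have "norm (hol_calc (\<lambda>z. f z ^ n) T) \<le> (1 / (2 * pi) * (L * B)) * e ^ n" for n
  proof -
    obtain \<phi> :: "('a \<Rightarrow>\<^sub>C\<^sub>L 'a) \<Rightarrow>\<^sub>C\<^sub>L complex"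
      where \<phi>: "\<phi> (hol_calc (\<lambda>z. f z ^ n) T) = of_real (norm (hol_calc (\<lambda>z. f z ^ n) T))" "norm \<phi> \<le> 1"
      by (rule ex_norming_functional)
    have "cmod (\<Sum>\<gamma>\<leftarrow>\<Gamma>. contour_integral \<gamma> (\<lambda>z. f z ^ n * \<phi> (resolvent T z))) \<le> L * (e ^ n * B)"
    proof (rule L(2))
      have "(\<lambda>z. f z ^ n * \<phi> (resolvent T z)) holomorphic_on V - cspectrum T"
        by (rule functional_mult_holomorphic[OF fV])
      then show "continuous_on M (\<lambda>z. f z ^ n * \<phi> (resolvent T z))"
        by (rule continuous_on_subset[OF holomorphic_on_imp_continuous_on M(2)])
      show "cmod (f z ^ n * \<phi> (resolvent T z)) \<le> e ^ n * B" if z: "z \<in> M" for z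
      proof -
        have "cmod (f z) \<le> e" using M(2) z by (auto simp: V_def)
        moreover have "cmod (\<phi> (resolvent T z)) \<le> 1 * B"
          using B(1)[OF z] \<phi>(2) by (intro order_trans[OF norm_cblinfun_apply] mult_mono) auto
        ultimately show ?thesis
          unfolding norm_mult norm_power using e by (intro mult_mono power_mono) auto
      qed
    qed (use e B in auto)
    then have "1 / (2 * pi) * cmod (\<Sum>\<gamma>\<leftarrow>\<Gamma>. contour_integral \<gamma> (\<lambda>z. f z ^ n * \<phi> (resolvent T z))) \<le>
        1 / (2 * pi) * (L * (e ^ n * B))"
      by (intro mult_left_mono) auto
    moreover have "cmod (\<phi> (hol_calc (\<lambda>z. f z ^ n) T)) =
        1 / (2 * pi) * cmod (\<Sum>\<gamma>\<leftarrow>\<Gamma>. contour_integral \<gamma> (\<lambda>z. f z ^ n * \<phi> (resolvent T z)))"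
      unfolding hol_calc_eq_cycle_calc[OF \<Gamma> V(1,2) fV] cycle_calc_functional[OF \<Gamma> V(1) fV]
      by (simp add: norm_mult norm_divide)
    ultimately show ?thesis unfolding \<phi>(1) by (simp add: mult_ac)
  qed
  then show ?thesis by (rule that)
qed

end

section \<open>Weyl operators and factorizations\<close>

lemma index_le_compose:
  fixes A B :: "'a::complex_banach \<Rightarrow>\<^sub>C\<^sub>L 'a"
  assumes "A \<in> upper_semi_Fredholm" "B \<in> upper_semi_Fredholm" "nullity A \<le> defect A" "nullity B \<le> defect B"
  shows "nullity (A o\<^sub>C\<^sub>L B) \<le> defect (A o\<^sub>C\<^sub>L B)"
proof -
  have "nullity A < \<infinity>" "nullity B < \<infinity>" using assms by (auto simp: upper_semi_Fredholm_def)
  then show ?thesis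
    using index_compose[of A B] assms(3,4)
    by (cases "nullity A"; cases "nullity B"; cases "defect A"; cases "defect B";
        cases "nullity (A o\<^sub>C\<^sub>L B)"; cases "defect (A o\<^sub>C\<^sub>L B)") auto
qed

lemma index_ge_compose:
  fixes A B :: "'a::complex_banach \<Rightarrow>\<^sub>C\<^sub>L 'a"
  assumes "A \<in> upper_semi_Fredholm" "B \<in> upper_semi_Fredholm" "defect A \<le> nullity A" "defect B \<le> nullity B"
  shows "defect (A o\<^sub>C\<^sub>L B) \<le> nullity (A o\<^sub>C\<^sub>L B)"
proof -
  have "nullity A < \<infinity>" "nullity B < \<infinity>" using assms by (auto simp: upper_semi_Fredholm_def)
  then show ?thesis
    using index_compose[of A B] assms(3,4)
    by (cases "nullity A"; cases "nullity B"; cases "defect A"; cases "defect B";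
        cases "nullity (A o\<^sub>C\<^sub>L B)"; cases "defect (A o\<^sub>C\<^sub>L B)") auto
qed

text \<open>Two nonnegative indices whose sum is at most 0 both vanish; the nullities are finite,
  and with them the defects of the factors.\<close>

lemma index_squeeze:
  fixes A B :: "'a::complex_banach \<Rightarrow>\<^sub>C\<^sub>L 'a"
  assumes "A \<in> upper_semi_Fredholm" "B \<in> upper_semi_Fredholm" "defect A \<le> nullity A" "defect B \<le> nullity B"
    and "nullity (A o\<^sub>C\<^sub>L B) \<le> defect (A o\<^sub>C\<^sub>L B)"
  shows "nullity A \<le> defect A" "nullity B \<le> defect B"
proof -
  have "nullity A < \<infinity>" "nullity B < \<infinity>" "nullity (A o\<^sub>C\<^sub>L B) < \<infinity>"
    using assms upper_semi_Fredholm_compose[OF assms(1,2)] by (auto simp: upper_semi_Fredholm_def)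
  then show "nullity A \<le> defect A" "nullity B \<le> defect B"
    using index_compose[of A B] assms(3-)
    by (cases "nullity A"; cases "nullity B"; cases "defect A"; cases "defect B";
        cases "nullity (A o\<^sub>C\<^sub>L B)"; cases "defect (A o\<^sub>C\<^sub>L B)"; simp)+
qed

lemma invertible_Weyl:
  fixes A :: "'a::complex_banach \<Rightarrow>\<^sub>C\<^sub>L 'a"
  assumes "is_inverse_of S A"
  shows "A \<in> upper_semi_Fredholm" "nullity A = defect A"
proof -
  have bij: "bij A" by (rule is_inverse_of_imp_bij[OF assms])
  then have "null_space A = {0}"
    by (auto simp: null_space_def bij_def inj_def)
  then have n: "nullity A = 0"
    using reldim_le_card[of "{}" "{0}" "{0}"] complex_vector.subspace_single_0
    by (simp add: nullity_eq_reldim zero_enat_def[symmetric])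
  have r: "range A = UNIV" using bij by (simp add: bij_def)
  show "nullity A = defect A" using n defect_zero[OF r] by simp
  show "A \<in> upper_semi_Fredholm" by (simp add: upper_semi_Fredholm_def r n zero_enat_def)
qed

text \<open>The null space of \<open>1 - P\<close> is the range of \<open>P\<close>, and its range
  is the null space of \<open>P\<close>. As \<open>P\<close> identifies the quotient by its null
  space with its range, the index is 0.\<close>

lemma projection_Weyl:
  fixes P :: "'a::complex_banach \<Rightarrow>\<^sub>C\<^sub>L 'a"
  assumes P: "P o\<^sub>C\<^sub>L P = P" and fin: "cfinite_dim (range P)"
  shows "id_cblinfun - P \<in> upper_semi_Fredholm" "nullity (id_cblinfun - P) = defect (id_cblinfun - P)"
proof -
  have PP: "P (P x) = P x" for x using P by (metis cblinfun_compose_apply)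
  have n: "null_space (id_cblinfun - P) = range P"
    by (auto simp: null_space_def PP intro: range_eqI[of _ P])
  have r: "range (id_cblinfun - P) = null_space P"
  proof
    show "range (id_cblinfun - P) \<subseteq> null_space P" by (auto simp: null_space_def cblinfun_diff_right PP)
    show "null_space P \<subseteq> range (id_cblinfun - P)"
    proof
      fix x assume "x \<in> null_space P"
      then have "(id_cblinfun - P) x = x" by (simp add: null_space_def)
      then show "x \<in> range (id_cblinfun - P)" by (metis rangeI)
    qed
  qed
  have PN: "P ` null_space P = {0}" by (auto simp: null_space_def intro: image_eqI[of _ _ 0])
  have "nullity (id_cblinfun - P) = reldim (range P) {0}" by (simp add: nullity_eq_reldim n)
  also have "\<dots> = reldim UNIV (null_space P)"
    using reldim_image[OF subspace_null_space order_refl, of P UNIV] PN by simp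
  also have "\<dots> = defect (id_cblinfun - P)" unfolding defect_eq_reldim r ..
  finally show "nullity (id_cblinfun - P) = defect (id_cblinfun - P)" .
  have "nullity (id_cblinfun - P) < \<infinity>" unfolding nullity_finite_iff n by (rule fin)
  then show "id_cblinfun - P \<in> upper_semi_Fredholm"
    unfolding upper_semi_Fredholm_def mem_Collect_eq r using closed_null_space[of P] by blast
qed

section \<open>Products of shifts and factorization of functions of an operator\<close>

definition shifted_product ::
  "('a::complex_normed_vector \<Rightarrow>\<^sub>C\<^sub>L 'a) \<Rightarrow> complex list \<Rightarrow> ('a \<Rightarrow>\<^sub>C\<^sub>L 'a) \<Rightarrow> ('a \<Rightarrow>\<^sub>C\<^sub>L 'a)" where
  "shifted_product T ls W = foldr (\<lambda>l A. (T - l *\<^sub>C id_cblinfun) o\<^sub>C\<^sub>L A) ls W"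

lemma shifted_product_simps [simp]:
  "shifted_product T [] W = W"
  "shifted_product T (l # ls) W = (T - l *\<^sub>C id_cblinfun) o\<^sub>C\<^sub>L shifted_product T ls W"
  by (simp_all add: shifted_product_def)

lemma shifted_product_append:
  "shifted_product T (ls @ ms) W = shifted_product T ls (shifted_product T ms W)"
  by (simp add: shifted_product_def)

lemma shifted_product_compose:
  "shifted_product T ls W o\<^sub>C\<^sub>L E = shifted_product T ls (W o\<^sub>C\<^sub>L E)"
  by (induction ls) (simp_all add: cblinfun_compose_assoc)

lemma shifted_product_commute:
  assumes "W o\<^sub>C\<^sub>L (T - l *\<^sub>C id_cblinfun) = (T - l *\<^sub>C id_cblinfun) o\<^sub>C\<^sub>L W"
  shows "shifted_product T ls W o\<^sub>C\<^sub>L (T - l *\<^sub>C id_cblinfun) = (T - l *\<^sub>C id_cblinfun) o\<^sub>C\<^sub>L shifted_product T ls W"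
proof (induction ls)
  case (Cons m ls)
  have c: "(T - m *\<^sub>C id_cblinfun) o\<^sub>C\<^sub>L (T - l *\<^sub>C id_cblinfun) = (T - l *\<^sub>C id_cblinfun) o\<^sub>C\<^sub>L (T - m *\<^sub>C id_cblinfun)"
    by (rule cblinfun_eqI)
      (simp add: cblinfun_diff_right complex_vector.scale_right_diff_distrib scaleC_scaleC algebra_simps)
  show ?case by (simp add: cblinfun_compose_assoc Cons) (simp add: c flip: cblinfun_compose_assoc)
qed (use assms in simp)

lemma shifted_product_Fredholm:
  fixes T :: "'a::complex_banach \<Rightarrow>\<^sub>C\<^sub>L 'a"
  assumes "\<And>l. l \<in> set ls \<Longrightarrow> T - l *\<^sub>C id_cblinfun \<in> upper_semi_Fredholm" "W \<in> upper_semi_Fredholm"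
  shows "shifted_product T ls W \<in> upper_semi_Fredholm"
  using assms by (induction ls) (auto intro: upper_semi_Fredholm_compose)

lemma shifted_product_Weyl:
  fixes T :: "'a::complex_banach \<Rightarrow>\<^sub>C\<^sub>L 'a"
  assumes "\<And>l. l \<in> set ls \<Longrightarrow> T - l *\<^sub>C id_cblinfun \<in> upper_semi_Weyl" "W \<in> upper_semi_Weyl"
  shows "shifted_product T ls W \<in> upper_semi_Weyl"
  using assms
proof (induction ls)
  case (Cons l ls)
  then have "shifted_product T ls W \<in> upper_semi_Weyl" "T - l *\<^sub>C id_cblinfun \<in> upper_semi_Weyl" by auto
  then show ?case
    unfolding shifted_product_simps upper_semi_Weyl_iff
    by (auto intro: upper_semi_Fredholm_compose index_le_compose)
qed simp

text \<open>All factors commute with each shift, so any shift can be moved to the right end of the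
  product, where the property passes to it.\<close>

lemma shifted_product_Fredholm_factor:
  fixes T :: "'a::complex_banach \<Rightarrow>\<^sub>C\<^sub>L 'a"
  assumes "shifted_product T ls W \<in> upper_semi_Fredholm" "l \<in> set ls"
    and comm: "\<And>l. W o\<^sub>C\<^sub>L (T - l *\<^sub>C id_cblinfun) = (T - l *\<^sub>C id_cblinfun) o\<^sub>C\<^sub>L W"
  shows "T - l *\<^sub>C id_cblinfun \<in> upper_semi_Fredholm"
  using assms(1,2)
proof (induction ls)
  case (Cons m ls)
  have "shifted_product T ls W \<in> upper_semi_Fredholm"
    using Cons.prems(1) upper_semi_Fredholm_right_factor by fastforce
  moreover have "T - m *\<^sub>C id_cblinfun \<in> upper_semi_Fredholm"
    using Cons.prems(1) shifted_product_commute[OF comm, of ls m]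
      upper_semi_Fredholm_right_factor[of "shifted_product T ls W" "T - m *\<^sub>C id_cblinfun"] by simp
  ultimately show ?case using Cons by auto
qed simp

lemma shifted_product_index_squeeze:
  fixes T :: "'a::complex_banach \<Rightarrow>\<^sub>C\<^sub>L 'a"
  assumes "\<And>l. l \<in> set ls \<Longrightarrow> T - l *\<^sub>C id_cblinfun \<in> upper_semi_Fredholm \<and>
      defect (T - l *\<^sub>C id_cblinfun) \<le> nullity (T - l *\<^sub>C id_cblinfun)"
    and W: "W \<in> upper_semi_Fredholm" "defect W \<le> nullity W"
    and "nullity (shifted_product T ls W) \<le> defect (shifted_product T ls W)" "l \<in> set ls"
  shows "nullity (T - l *\<^sub>C id_cblinfun) \<le> defect (T - l *\<^sub>C id_cblinfun)"
  using assms(1,4,5)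
proof (induction ls)
  case (Cons m ls)
  have F: "shifted_product T ls W \<in> upper_semi_Fredholm"
    using Cons.prems(1) W by (intro shifted_product_Fredholm) auto
  have ge: "defect (shifted_product T ms W) \<le> nullity (shifted_product T ms W)" if "set ms \<subseteq> set ls" for ms
    using that
  proof (induction ms)
    case (Cons k ms)
    then show ?case
      using \<open>\<And>l. l \<in> set (m # ls) \<Longrightarrow> _\<close> W
      unfolding shifted_product_simps
      by (intro index_ge_compose shifted_product_Fredholm) auto
  qed (use W in simp)
  have m: "T - m *\<^sub>C id_cblinfun \<in> upper_semi_Fredholm"
      "defect (T - m *\<^sub>C id_cblinfun) \<le> nullity (T - m *\<^sub>C id_cblinfun)"
    using Cons.prems(1)[of m] by auto
  note sq = index_squeeze[OF m(1) F m(2) ge[OF order_refl] Cons.prems(2)[unfolded shifted_product_simps]]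
  show ?case
    using Cons.IH[OF _ sq(2)] Cons.prems(1,3) sq(1) by auto
qed simp

context
  fixes T :: "'a::complex_banach \<Rightarrow>\<^sub>C\<^sub>L 'a"
begin

lemma hol_calc_commute:
  assumes U: "open U" "cspectrum T \<subseteq> U" and f: "f holomorphic_on U" and g: "g holomorphic_on U"
  shows "hol_calc f T o\<^sub>C\<^sub>L hol_calc g T = hol_calc g T o\<^sub>C\<^sub>L hol_calc f T"
  using hol_calc_mult[OF U f g] hol_calc_mult[OF U g f] by (simp add: mult.commute)

lemma hol_calc_commute_shift:
  assumes U: "open U" "cspectrum T \<subseteq> U" and f: "f holomorphic_on U"
  shows "hol_calc f T o\<^sub>C\<^sub>L (T - l *\<^sub>C id_cblinfun) = (T - l *\<^sub>C id_cblinfun) o\<^sub>C\<^sub>L hol_calc f T"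
  using hol_calc_commute[OF U f, of "\<lambda>z. z - l"] by (simp add: hol_calc_linear holomorphic_on_diff)

lemma hol_calc_invertible:
  assumes U: "open U" "cspectrum T \<subseteq> U" and f: "f holomorphic_on U" and nz: "\<And>z. z \<in> cspectrum T \<Longrightarrow> f z \<noteq> 0"
  shows "\<exists>S. is_inverse_of S (hol_calc f T)"
proof -
  define V where "V = U \<inter> f -` (- {0})"
  have V: "open V" "cspectrum T \<subseteq> V"
    unfolding V_def using U nz by (auto intro!: continuous_open_preimage holomorphic_on_imp_continuous_on[OF f])
  have fV: "f holomorphic_on V" by (rule holomorphic_on_subset[OF f]) (auto simp: V_def)
  have gV: "(\<lambda>z. inverse (f z)) holomorphic_on V" using fV by (intro holomorphic_intros) (auto simp: V_def)
  have 1: "(\<lambda>z. f z * inverse (f z)) holomorphic_on V" by (intro holomorphic_intros fV gV)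
  have "hol_calc f T o\<^sub>C\<^sub>L hol_calc (\<lambda>z. inverse (f z)) T = hol_calc (\<lambda>z. f z * inverse (f z)) T"
    by (rule hol_calc_mult[OF V fV gV, symmetric])
  also have "\<dots> = hol_calc (\<lambda>_. 1) T"
    by (rule hol_calc_cong[OF V 1]) (auto simp: V_def)
  finally have "hol_calc f T o\<^sub>C\<^sub>L hol_calc (\<lambda>z. inverse (f z)) T = id_cblinfun" by (simp add: hol_calc_const)
  then show ?thesis
    using hol_calc_commute[OF V fV gV] unfolding is_inverse_of_def by metis
qed

lemma hol_calc_shift_power_mult:
  assumes U: "open U" "cspectrum T \<subseteq> U" and h: "h holomorphic_on U"
  shows "hol_calc (\<lambda>w. (w - l) ^ n * h w) T = shifted_product T (replicate n l) (hol_calc h T)"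
proof (induction n)
  case (Suc n)
  have "hol_calc (\<lambda>w. (w - l) ^ Suc n * h w) T = hol_calc (\<lambda>w. (w - l) * ((w - l) ^ n * h w)) T"
    by (simp add: mult.assoc)
  also have "\<dots> = hol_calc (\<lambda>w. w - l) T o\<^sub>C\<^sub>L hol_calc (\<lambda>w. (w - l) ^ n * h w) T"
    by (rule hol_calc_mult[OF U]) (intro holomorphic_intros h)+
  finally show ?case by (simp add: Suc hol_calc_linear)
qed simp

text \<open>Induction on the number of zeros in the spectrum, each divided out with its full
  multiplicity. Zeros off the spectrum stay in \<open>h\<close>, since invertibility of
  \<open>h(T)\<close> only concerns values on the spectrum.\<close>

lemma hol_calc_factorization:
  assumes U: "open U" "cspectrum T \<subseteq> U"
    and g: "g holomorphic_on U" "finite {z\<in>cspectrum T. g z = 0}"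
    "\<And>z. z \<in> cspectrum T \<Longrightarrow> g z = 0 \<Longrightarrow> \<not> (\<forall>\<^sub>F w in at z. g w = 0)"
  obtains ls h where "set ls = {z\<in>cspectrum T. g z = 0}" "h holomorphic_on U"
    "\<exists>S. is_inverse_of S (hol_calc h T)" "hol_calc g T = shifted_product T ls (hol_calc h T)"
proof -
  have "\<exists>ls h. set ls = {z\<in>cspectrum T. g z = 0} \<and> h holomorphic_on U \<and>
    (\<exists>S. is_inverse_of S (hol_calc h T)) \<and> hol_calc g T = shifted_product T ls (hol_calc h T)"
    using g
  proof (induction "card {z\<in>cspectrum T. g z = 0}" arbitrary: g rule: less_induct)
    case less
    show ?case
    proof (cases "{z\<in>cspectrum T. g z = 0} = {}")
      case True
      then show ?thesis
        using less.prems hol_calc_invertible[OF U less.prems(1)]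
        by (intro exI[of _ "[]"] exI[of _ g]) auto
    next
      case False
      then obtain l where l: "l \<in> cspectrum T" "g l = 0" by blast
      obtain r where r: "r > 0" "ball l r \<subseteq> U" using U l openE by blast
      have "\<not> g constant_on ball l r"
      proof
        assume "g constant_on ball l r"
        then have "g w = 0" if "w \<in> ball l r" for w
          using that l r(1) unfolding constant_on_def by (metis centre_in_ball)
        then have "\<forall>\<^sub>F w in at l. g w = 0"
          using r(1) by (auto simp: eventually_at dist_commute intro!: exI[of _ r])
        then show False using less.prems(3) l by blast
      qed
      then obtain h0 s n where s: "0 < n" "0 < s" "ball l s \<subseteq> ball l r" "h0 holomorphic_on ball l s"
        "\<And>w. w \<in> ball l s \<Longrightarrow> g w = (w - l) ^ n * h0 w" "\<And>w. w \<in> ball l s \<Longrightarrow> h0 w \<noteq> 0"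
        using holomorphic_factor_zero_nonconstant[of g "ball l r" l] less.prems(1) r l
        by (metis centre_in_ball connected_ball holomorphic_on_subset open_ball)
      \<comment> \<open>Near \<open>l\<close> the quotient is taken from the local factorization,
        elsewhere it is a division; the two agree on the punctured ball.\<close>
      define h where "h w = (if w \<in> ball l s then h0 w else g w / (w - l) ^ n)" for w
      have gh: "g w = (w - l) ^ n * h w" for w
        using s by (cases "w = l") (auto simp: h_def)
      have "h holomorphic_on ball l s \<union> (U - {l})"
        unfolding h_def
      proof (rule holomorphic_on_If_Un)
        show "(\<lambda>w. g w / (w - l) ^ n) holomorphic_on U - {l}"
          using less.prems(1) by (auto intro!: holomorphic_intros intro: holomorphic_on_subset)
        show "h0 w = g w / (w - l) ^ n" if "w \<in> ball l s" "w \<in> U - {l}" for w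
          using that s(5)[of w] by simp
      qed (use s U in \<open>auto simp: open_Diff\<close>)
      moreover have "ball l s \<union> (U - {l}) = U" using s r l U by auto
      ultimately have h: "h holomorphic_on U" by simp
      have hl: "h l \<noteq> 0" using s by (simp add: h_def)
      have Z: "{z\<in>cspectrum T. g z = 0} = insert l {z\<in>cspectrum T. h z = 0}"
        using gh l by auto
      have "\<exists>ls k. set ls = {z\<in>cspectrum T. h z = 0} \<and> k holomorphic_on U \<and>
          (\<exists>S. is_inverse_of S (hol_calc k T)) \<and> hol_calc h T = shifted_product T ls (hol_calc k T)"
      proof (rule less(1)[OF _ h])
        have "{z\<in>cspectrum T. h z = 0} \<subset> {z\<in>cspectrum T. g z = 0}" using Z hl by auto
        then show "card {z\<in>cspectrum T. h z = 0} < card {z\<in>cspectrum T. g z = 0}"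
          by (rule psubset_card_mono[OF less.prems(2)])
        show "finite {z\<in>cspectrum T. h z = 0}" using less.prems(2) Z by simp
        show "\<not> (\<forall>\<^sub>F w in at z. h w = 0)" if "z \<in> cspectrum T" "h z = 0" for z
        proof
          assume "\<forall>\<^sub>F w in at z. h w = 0"
          then have "\<forall>\<^sub>F w in at z. g w = 0" by eventually_elim (simp add: gh)
          then show False using less.prems(3)[OF that(1)] that(2) gh[of z] by simp
        qed
      qed
      then obtain ls k where ls: "set ls = {z\<in>cspectrum T. h z = 0}" "k holomorphic_on U"
          "\<exists>S. is_inverse_of S (hol_calc k T)" "hol_calc h T = shifted_product T ls (hol_calc k T)" by blast
      have "hol_calc g T = hol_calc (\<lambda>w. (w - l) ^ n * h w) T" by (simp add: gh[symmetric])
      also have "\<dots> = shifted_product T (replicate n l @ ls) (hol_calc k T)"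
        by (simp add: hol_calc_shift_power_mult[OF U h] ls(4) shifted_product_append)
      finally show ?thesis
        using ls s(1) Z by (intro exI[of _ "replicate n l @ ls"] exI[of _ k]) auto
    qed
  qed
  then show ?thesis using that by blast
qed

end

text \<open>\<open>E\<close> is a basis of the null space and \<open>q\<close> is dual to it. A
  small preimage \<open>w\<close> of \<open>A x\<close> differs from \<open>x\<close> by an element
  of the null space, whose coordinates are \<open>- q e w\<close> once all \<open>q e x\<close>
  vanish.\<close>

lemma Fredholm_bounded_below_mod_finite:
  fixes A :: "'a::complex_banach \<Rightarrow>\<^sub>C\<^sub>L 'a"
  assumes "A \<in> upper_semi_Fredholm"
  obtains E c and q :: "'a \<Rightarrow> 'a \<Rightarrow>\<^sub>C\<^sub>L complex" where "finite E" "c > 0"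
    "\<And>x. (\<And>e. e \<in> E \<Longrightarrow> q e x = 0) \<Longrightarrow> c * norm x \<le> norm (A x)"
proof -
  have cl: "closed (range A)" and fin: "nullity A < \<infinity>" using assms by (auto simp: upper_semi_Fredholm_def)
  then obtain m where m: "nullity A = enat m" by (cases "nullity A") auto
  obtain E where E: "finite E" "E \<subseteq> null_space A" "cindependent_mod {0} E" "card E = m"
    "null_space A \<subseteq> complex_vector.span (E \<union> {0})"
    by (rule ex_basis_mod[OF complex_vector.subspace_single_0 m[unfolded nullity_eq_reldim]])
  obtain q :: "'a \<Rightarrow> 'a \<Rightarrow>\<^sub>C\<^sub>L complex"
    where q: "\<And>b b'. b \<in> E \<Longrightarrow> b' \<in> E \<Longrightarrow> q b b' = (if b = b' then 1 else 0)"
    using ex_dual_family[OF complex_vector.subspace_single_0 closed_singleton E(1,3)] by metis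
  obtain C where C: "C > 0" "\<And>y. y \<in> range A \<Longrightarrow> \<exists>x. A x = y \<and> norm x \<le> C * norm y"
    using open_mapping[OF cl] by blast
  define L where "L = 1 + (\<Sum>e\<in>E. norm (q e) * norm e)"
  have L: "L > 0" by (simp add: L_def add_pos_nonneg sum_nonneg)
  have "norm x \<le> L * C * norm (A x)" if x: "\<And>e. e \<in> E \<Longrightarrow> q e x = 0" for x
  proof -
    obtain w where w: "A w = A x" "norm w \<le> C * norm (A x)" using C(2)[of "A x"] by blast
    define n where "n = x - w"
    have "n \<in> null_space A" using w(1) by (simp add: n_def null_space_def cblinfun_diff_right)
    then have "n \<in> complex_vector.span E" using E(5) by auto
    then obtain a where a: "n = (\<Sum>e\<in>E. a e *\<^sub>C e)" using E(1) by (auto simp: complex_vector.span_finite)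
    have ae: "a e = - q e w" if e: "e \<in> E" for e
    proof -
      have "q e n = (\<Sum>e'\<in>E. if e' = e then a e' else 0)"
        unfolding a cblinfun_sum_right using q[OF e] by (intro sum.cong) (auto simp: scaleC_complex_def)
      then have "q e n = a e" using E(1) e by simp
      then show ?thesis using x[OF e] by (simp add: n_def cblinfun_diff_right)
    qed
    have "norm n \<le> (\<Sum>e\<in>E. norm (q e) * norm w * norm e)"
      unfolding a
    proof (rule sum_norm_le)
      fix e assume e: "e \<in> E"
      show "norm (a e *\<^sub>C e) \<le> norm (q e) * norm w * norm e"
        unfolding norm_scaleC ae[OF e] norm_minus_cancel by (intro mult_right_mono norm_cblinfun_apply) auto
    qed
    also have "\<dots> = (\<Sum>e\<in>E. norm (q e) * norm e) * norm w"
      by (simp add: sum_distrib_left sum_distrib_right mult_ac)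
    finally have "norm x \<le> L * norm w"
      using norm_triangle_ineq[of n w] by (simp add: n_def L_def distrib_right)
    also have "\<dots> \<le> L * (C * norm (A x))" using w(2) L by (intro mult_left_mono) auto
    finally show ?thesis by (simp add: mult.assoc)
  qed
  then show ?thesis
    using that[of E "1 / (L * C)" q] E(1) L C(1) by (simp add: pos_divide_le_eq mult.commute)
qed

lemma funpow_cblinfun_sum: "(cblinfun_apply A ^^ k) (\<Sum>b\<in>B. c b *\<^sub>C b) = (\<Sum>b\<in>B. c b *\<^sub>C (cblinfun_apply A ^^ k) b)"
  for A :: "'a::complex_normed_vector \<Rightarrow>\<^sub>C\<^sub>L 'a"
  by (induction k) (simp_all add: cblinfun_sum_right)

text \<open>A semi-Fredholm operator is bounded below on the common kernel of finitely many functionals,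
  and so are its powers with the corresponding powers of the constant; on an infinite-dimensional
  space it cannot be quasinilpotent.\<close>

lemma Fredholm_quasinilpotent_imp_finite_dim:
  fixes A :: "'a::complex_banach \<Rightarrow>\<^sub>C\<^sub>L 'a"
  assumes A: "A \<in> upper_semi_Fredholm" and Y: "complex_vector.subspace Y"
    and small: "\<And>e. e > 0 \<Longrightarrow> \<exists>C. \<forall>n. \<forall>x\<in>Y. norm ((cblinfun_apply A ^^ n) x) \<le> C * e ^ n * norm x"
  shows "cfinite_dim Y"
proof (rule ccontr)
  assume "\<not> cfinite_dim Y"
  then have inf: "reldim Y {0} = \<infinity>" using ecdim_eq_reldim[OF Y] by (simp add: ecdim_def)
  obtain E c and q :: "'a \<Rightarrow> 'a \<Rightarrow>\<^sub>C\<^sub>L complex" where E: "finite E" and c: "c > 0"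
    and below: "\<And>x. (\<And>e. e \<in> E \<Longrightarrow> q e x = 0) \<Longrightarrow> c * norm x \<le> norm (A x)"
    using Fredholm_bounded_below_mod_finite[OF A] by blast
  \<comment> \<open>Half of the lower bound is used: comparing \<open>c ^ n\<close> with
    \<open>C * (c / 2) ^ n\<close> forces \<open>C\<close> to be at least every power of 2.\<close>
  obtain C where C: "\<And>n x. x \<in> Y \<Longrightarrow> norm ((cblinfun_apply A ^^ n) x) \<le> C * (c / 2) ^ n * norm x"
    using small[of "c / 2"] c by auto
  have "2 ^ n \<le> C" for n
  proof -
    \<comment> \<open>One index for each condition \<open>q e (A^k x) = 0\<close> with
      \<open>k < n\<close>. With one more independent vector than conditions some nonzero
      combination satisfies them all, and the lower bound applies to \<open>n\<close> steps in a
      row.\<close>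
    let ?I = "E \<times> {..<n}"
    obtain B where B: "finite B" "B \<subseteq> Y" "cindependent_mod {0} B" "card B = Suc (card ?I)"
      using inf le_reldim_iff[of "Suc (card ?I)" Y "{0}"] by auto
    have fin: "finite ?I" "card ?I < card B" using E B by auto
    obtain a where a: "\<exists>b\<in>B. a b \<noteq> 0"
      "\<And>i. i \<in> ?I \<Longrightarrow> (\<Sum>b\<in>B. (case i of (e, k) \<Rightarrow> q e ((cblinfun_apply A ^^ k) b)) * a b) = 0"
    proof (rule underdetermined_system[OF fin(1) B(1) fin(2),
          of "\<lambda>i b. case i of (e, k) \<Rightarrow> q e ((cblinfun_apply A ^^ k) b)"], goal_cases)
      case (1 a)
      show ?case by (rule 1(1)[OF 1(2,3)])
    qed
    define x where "x = (\<Sum>b\<in>B. a b *\<^sub>C b)"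
    have xY: "x \<in> Y" unfolding x_def using B Y
      by (intro complex_vector.subspace_sum complex_vector.subspace_scale) auto
    have x0: "x \<noteq> 0" using cindependent_mod_0D[OF B(3,1), of a] a(1) by (auto simp: x_def)
    have q0: "q e ((cblinfun_apply A ^^ k) x) = 0" if "e \<in> E" "k < n" for e k
      using a(2)[of "(e, k)"] that
      by (simp add: x_def funpow_cblinfun_sum cblinfun_sum_right scaleC_complex_def mult.commute)
    have "c ^ k * norm x \<le> norm ((cblinfun_apply A ^^ k) x)" if "k \<le> n" for k
      using that
    proof (induction k)
      case (Suc k)
      then have "c * (c ^ k * norm x) \<le> c * norm ((cblinfun_apply A ^^ k) x)" using c by (intro mult_left_mono) auto
      also have "\<dots> \<le> norm (A ((cblinfun_apply A ^^ k) x))" using q0 Suc.prems by (intro below) auto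
      finally show ?case by (simp add: mult_ac)
    qed simp
    from order_trans[OF this[OF order_refl] C[OF xY]]
    have "c ^ n \<le> C * (c / 2) ^ n" using x0 by simp
    then show ?thesis using c by (simp add: power_divide field_simps)
  qed
  moreover obtain n where "C < 2 ^ n" using real_arch_pow[of 2 C] by auto
  ultimately show False by (meson not_less)
qed

section \<open>Values attained near the spectrum\<close>

lemma finite_compact_isolated:
  fixes K :: "'a::metric_space set"
  assumes "compact K" "\<And>x. x \<in> K \<Longrightarrow> \<not> x islimpt K"
  shows "finite K"
  using assms compact_eq_Bolzano_Weierstrass[of K] by blast

text \<open>The frontier is finite by compactness. The plane without a finite set is connected, so a
  nonempty interior would leave no room for the complement of \<open>K\<close>, and \<open>K\<close>
  would be unbounded.\<close>

lemma finite_of_isolated_frontier: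
  fixes K :: "complex set"
  assumes K: "compact K" and iso: "\<And>x. x \<in> frontier K \<Longrightarrow> \<not> x islimpt K"
  shows "finite K"
proof -
  have cl: "closed K" using K by (rule compact_imp_closed)
  have sub: "frontier K \<subseteq> K" using cl by (rule frontier_subset_closed)
  have fin: "finite (frontier K)"
  proof (rule finite_compact_isolated)
    show "compact (frontier K)"
      using K sub by (metis compact_eq_bounded_closed bounded_subset frontier_closed)
    show "\<not> x islimpt frontier K" if "x \<in> frontier K" for x
      using iso[OF that] islimpt_subset[OF _ sub] by blast
  qed
  have "interior K = {}"
  proof (rule ccontr)
    assume ne: "interior K \<noteq> {}"
    have conn: "connected (UNIV - frontier K)"
      by (rule connected_open_delete_finite) (use fin in auto)
    have "UNIV - frontier K = interior K \<union> (- K)" using cl by (auto simp: frontier_def)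
    then have "interior K \<inter> (UNIV - frontier K) = {} \<or> (- K) \<inter> (UNIV - frontier K) = {}"
      using connectedD[OF conn, of "interior K" "- K"] cl interior_subset[of K] by (auto simp: open_Compl)
    moreover have "interior K \<subseteq> UNIV - frontier K" by (auto simp: frontier_def)
    moreover have "- K \<subseteq> UNIV - frontier K" using sub by auto
    ultimately have "K = UNIV" using ne by auto
    then show False using compact_imp_bounded[OF K] by simp
  qed
  then have "frontier K = K" using cl by (simp add: frontier_def)
  then show ?thesis using fin by simp
qed

lemma eventually_nonzero_of_not_eventually_zero:
  fixes g :: "complex \<Rightarrow> complex"
  assumes U: "open U" "z \<in> U" and g: "g holomorphic_on U" and nz: "\<not> (\<forall>\<^sub>F w in at z. g w = 0)"
  shows "\<forall>\<^sub>F w in at z. g w \<noteq> 0"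
proof -
  obtain r where r: "r > 0" "ball z r \<subseteq> U" using U openE by blast
  have gr: "g holomorphic_on ball z r" by (rule holomorphic_on_subset[OF g r(2)])
  show ?thesis
  proof (cases "g z = 0")
    case True
    have "\<exists>w\<in>ball z r. g w \<noteq> 0"
    proof (rule ccontr)
      assume "\<not> ?thesis"
      then have "\<forall>\<^sub>F w in at z. g w = 0"
        using r(1) by (auto simp: eventually_at dist_commute intro!: exI[of _ r])
      then show False using nz by blast
    qed
    then obtain w where w: "w \<in> ball z r" "g w \<noteq> 0" by blast
    have zb: "z \<in> ball z r" using r by simp
    obtain s where s: "0 < s" "\<And>w. w \<in> ball z s - {z} \<Longrightarrow> g w \<noteq> 0"
      by (rule isolated_zeros[OF gr open_ball connected_ball zb True w]) blast
    then show ?thesis by (auto simp: eventually_at dist_commute intro!: exI[of _ s])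
  next
    case False
    show ?thesis by (rule tendsto_imp_eventually_ne[OF holomorphic_on_ball_tendsto[OF gr r(1)] False])
  qed
qed

lemma finite_zeros_compact:
  fixes g :: "complex \<Rightarrow> complex"
  assumes U: "open U" "K \<subseteq> U" and K: "compact K" and g: "g holomorphic_on U"
    and nz: "\<And>z. z \<in> K \<Longrightarrow> g z = 0 \<Longrightarrow> \<not> (\<forall>\<^sub>F w in at z. g w = 0)"
  shows "finite {z\<in>K. g z = 0}"
proof (rule finite_compact_isolated)
  have "closedin (top_of_set K) (K \<inter> g -` {0})"
    using g U by (intro continuous_closedin_preimage)
      (auto intro: continuous_on_subset holomorphic_on_imp_continuous_on)
  then have "compact (K \<inter> g -` {0})" using K by (metis closedin_compact)
  then show "compact {z\<in>K. g z = 0}" by (simp add: Int_def vimage_def)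
  fix z assume z: "z \<in> {z\<in>K. g z = 0}"
  then have "\<forall>\<^sub>F w in at z. g w \<noteq> 0"
    using U nz by (intro eventually_nonzero_of_not_eventually_zero[OF U(1) _ g]) auto
  then have "\<forall>\<^sub>F w in at z. w \<notin> {z\<in>K. g z = 0}" by eventually_elim auto
  then show "\<not> z islimpt {z\<in>K. g z = 0}" by (simp add: islimpt_iff_eventually)
qed

text \<open>\<open>Z\<close> is the interior of the level set. By the identity theorem a ball in
  \<open>U\<close> that meets \<open>Z\<close> lies in \<open>Z\<close>; hence \<open>U - Z\<close>
  is open too, and holomorphic functions can be defined separately on the two parts.\<close>

lemma locally_constant_part:
  fixes f :: "complex \<Rightarrow> complex"
  assumes U: "open U" and f: "f holomorphic_on U"
  obtains Z where "open Z" "Z \<subseteq> U" "open (U - Z)" "\<And>z. z \<in> Z \<Longrightarrow> f z = \<mu>"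
    "\<And>z. z \<in> U - Z \<Longrightarrow> \<not> (\<forall>\<^sub>F w in at z. f w = \<mu>)"
proof -
  define Z where "Z = interior {z\<in>U. f z = \<mu>}"
  have Z: "open Z" "Z \<subseteq> U" "\<And>z. z \<in> Z \<Longrightarrow> f z = \<mu>"
    using interior_subset[of "{z\<in>U. f z = \<mu>}"] by (auto simp: Z_def)
  have in_Z: "z \<in> Z" if "r > 0" "ball z r \<subseteq> U" "\<And>w. w \<in> ball z r \<Longrightarrow> f w = \<mu>" for z r
    unfolding Z_def using that by (intro interiorI[of "ball z r"]) auto
  have "\<exists>e>0. ball z e \<subseteq> U - Z" if z: "z \<in> U - Z" for z
  proof -
    obtain r where r: "r > 0" "ball z r \<subseteq> U" using U z openE by blast
    have "ball z r \<inter> Z = {}"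
    proof (rule ccontr)
      assume ne: "ball z r \<inter> Z \<noteq> {}"
      have "f w = \<mu>" if "w \<in> ball z r" for w
      proof (rule analytic_continuation_open[of "ball z r \<inter> Z" "ball z r" f "\<lambda>_. \<mu>"])
        show "f holomorphic_on ball z r" by (rule holomorphic_on_subset[OF f r(2)])
      qed (use ne Z that in auto)
      then have "z \<in> Z" using r by (intro in_Z)
      then show False using z by blast
    qed
    then show ?thesis using r by blast
  qed
  then have op: "open (U - Z)" by (simp add: open_contains_ball)
  have "\<not> (\<forall>\<^sub>F w in at z. f w = \<mu>)" if z: "z \<in> U - Z" for z
  proof
    assume ev: "\<forall>\<^sub>F w in at z. f w = \<mu>"
    have "isCont f z" using f U z
      by (metis DiffD1 continuous_on_eq_continuous_at holomorphic_on_imp_continuous_on)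
    then have "f \<midarrow>z\<rightarrow> f z" by (simp add: isCont_def)
    moreover have "f \<midarrow>z\<rightarrow> \<mu>" using ev by (rule tendsto_eventually)
    ultimately have fz: "f z = \<mu>" using LIM_unique by blast
    obtain d where d: "d > 0" "\<And>w. w \<noteq> z \<Longrightarrow> dist w z < d \<Longrightarrow> f w = \<mu>"
      using ev by (auto simp: eventually_at)
    obtain r where r: "r > 0" "ball z r \<subseteq> U" using U z openE by blast
    have "z \<in> Z"
    proof (rule in_Z[of "min d r"])
      show "f w = \<mu>" if "w \<in> ball z (min d r)" for w
        using that d(2)[of w] fz by (cases "w = z") (auto simp: dist_commute)
    qed (use d r in auto)
    then show False using z by blast
  qed
  then show ?thesis using that Z op by blast
qed

section \<open>The spectral mapping theorem\<close>

lemma finite_dim_spectral_projection: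
  fixes T :: "'a::complex_banach \<Rightarrow>\<^sub>C\<^sub>L 'a"
  assumes U: "open U" "cspectrum T \<subseteq> U" and Z: "open Z" "Z \<subseteq> U" "open (U - Z)"
    and F: "\<And>l. l \<in> cspectrum T \<inter> Z \<Longrightarrow> T - l *\<^sub>C id_cblinfun \<in> upper_semi_Fredholm"
  shows "cfinite_dim (range (hol_calc (\<lambda>w. if w \<in> Z then 1 else 0) T))"
proof -
  let ?K = "cspectrum T"
  let ?K1 = "?K \<inter> Z"
  define e where "e w = (if w \<in> Z then 1 else 0 :: complex)" for w
  have eU: "e holomorphic_on U"
  proof -
    have "(\<lambda>w. if w \<in> Z then 1 else 0 :: complex) holomorphic_on Z \<union> (U - Z)"
      using Z by (intro holomorphic_on_If_Un) auto
    moreover have "Z \<union> (U - Z) = U" using Z(2) by blast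
    ultimately show ?thesis by (simp add: e_def[abs_def])
  qed
  have K1: "compact ?K1"
  proof -
    have "?K1 = ?K \<inter> - (U - Z)" using U(2) by blast
    then show ?thesis using compact_Int_closed[OF compact_cspectrum closed_Compl[OF Z(3)]] by simp
  qed
  have fin: "finite ?K1"
  proof (rule finite_of_isolated_frontier[OF K1])
    fix l assume l: "l \<in> frontier ?K1"
    then have lK: "l \<in> ?K1" using frontier_subset_closed[OF compact_imp_closed[OF K1]] by blast
    \<comment> \<open>\<open>Z\<close> is open, so an interior point of the spectrum that lies in
      \<open>Z\<close> would be interior to the intersection.\<close>
    have "l \<notin> interior ?K"
      using l lK Z(1) by (auto simp: frontier_def interior_open)
    then have "l \<in> frontier ?K" using lK by (auto simp: frontier_def intro: subsetD[OF closure_subset])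
    then obtain r where r: "r > 0" "ball l r \<inter> ?K \<subseteq> {l}"
      using frontier_cspectrum_imp_isolated[OF F[OF lK]] by blast
    show "\<not> l islimpt ?K1"
    proof
      assume "l islimpt ?K1"
      then obtain w where "w \<in> ?K1" "w \<noteq> l" "dist w l < r" using r(1) unfolding islimpt_approachable by blast
      then show False using r(2) by (auto simp: dist_commute)
    qed
  qed
  \<comment> \<open>The polynomial with a simple zero at each spectral point in \<open>Z\<close>.
    Times the indicator \<open>e\<close> it vanishes on the whole spectrum, which makes
    \<open>p(T)\<close> quasinilpotent on the range of the projection.\<close>
  define p where "p w = (\<Prod>l\<in>?K1. w - l)" for w
  have pU: "p holomorphic_on V" for V
    unfolding p_def by (intro holomorphic_intros)
  have p0: "p w = 0 \<longleftrightarrow> w \<in> ?K1" for w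
    using fin by (auto simp: p_def)
  have "\<forall>\<^sub>F w in at z. p w \<noteq> 0" for z
  proof -
    have "\<forall>\<^sub>F w in at z. \<forall>l\<in>?K1. w \<noteq> l"
      using fin by (subst eventually_ball_finite_distrib) (auto intro: eventually_neq_at_within)
    then show ?thesis by eventually_elim (use p0 in auto)
  qed
  then have "\<not> (\<forall>\<^sub>F w in at z. p w = 0)" for z
    using eventually_conj[of "\<lambda>w. p w = 0" "at z" "\<lambda>w. p w \<noteq> 0"] by (auto simp: eventually_False)
  moreover have "{z \<in> ?K. p z = 0} = ?K1" using p0 by auto
  ultimately obtain ls h where ls: "set ls = ?K1" "\<exists>S. is_inverse_of S (hol_calc h T)"
    "hol_calc p T = shifted_product T ls (hol_calc h T)"
    using hol_calc_factorization[OF U pU[of U]] fin by metis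
  define A where "A = hol_calc p T"
  have A: "A \<in> upper_semi_Fredholm"
    unfolding A_def ls(3) using F ls(1,2) invertible_Weyl(1) by (intro shifted_product_Fredholm) blast+
  define P where "P = hol_calc e T"
  have "P o\<^sub>C\<^sub>L P = hol_calc (\<lambda>w. e w * e w) T"
    unfolding P_def by (rule hol_calc_mult[OF U eU eU, symmetric])
  also have "(\<lambda>w. e w * e w) = e" by (auto simp: e_def)
  finally have PP: "P (P x) = P x" for x by (metis P_def cblinfun_compose_apply)
  have pe: "(\<lambda>w. p w * e w) holomorphic_on U" by (intro holomorphic_intros pU eU)
  have pen: "(\<lambda>w. (p w * e w) ^ n) holomorphic_on U" for n by (intro holomorphic_intros pU eU)
  \<comment> \<open>On vectors fixed by \<open>P\<close> the powers of \<open>A\<close> are given by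
    the calculus applied to powers of \<open>p e\<close>, to which the spectral radius estimate
    applies.\<close>
  have pow: "hol_calc (\<lambda>w. (p w * e w) ^ n) T x = (cblinfun_apply A ^^ n) x" if x: "P x = x" for x n
  proof (induction n)
    case 0
    then show ?case by (simp add: hol_calc_const)
  next
    case (Suc n)
    let ?y = "hol_calc (\<lambda>w. (p w * e w) ^ n) T x"
    have "P o\<^sub>C\<^sub>L hol_calc (\<lambda>w. (p w * e w) ^ n) T = hol_calc (\<lambda>w. (p w * e w) ^ n) T o\<^sub>C\<^sub>L P"
      unfolding P_def by (rule hol_calc_commute[OF U eU pen])
    then have "P ?y = hol_calc (\<lambda>w. (p w * e w) ^ n) T (P x)" by (simp only: cblinfun_compose_apply[symmetric])
    then have Py: "P ?y = ?y" using x by simp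
    have "hol_calc (\<lambda>w. (p w * e w) ^ Suc n) T = hol_calc (\<lambda>w. p w * e w) T o\<^sub>C\<^sub>L hol_calc (\<lambda>w. (p w * e w) ^ n) T"
      using hol_calc_mult[OF U pe pen[of n]] by simp
    also have "hol_calc (\<lambda>w. p w * e w) T = A o\<^sub>C\<^sub>L P"
      unfolding A_def P_def by (rule hol_calc_mult[OF U pU eU])
    finally have "hol_calc (\<lambda>w. (p w * e w) ^ Suc n) T x = A ?y" by (simp only: cblinfun_compose_apply Py)
    then show ?case by (simp only: Suc funpow.simps comp_apply)
  qed
  have "cfinite_dim (range P)"
  proof (rule Fredholm_quasinilpotent_imp_finite_dim[OF A subspace_range_cblinfun])
    fix d :: real assume d: "d > 0"
    have "cmod (p z * e z) < d" if "z \<in> ?K" for z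
      using that d p0[of z] by (auto simp: e_def)
    then obtain C where C: "\<And>n. norm (hol_calc (\<lambda>w. (p w * e w) ^ n) T) \<le> C * d ^ n"
      using hol_calc_power_bound[OF U pe] d by blast
    have "norm ((cblinfun_apply A ^^ n) x) \<le> C * d ^ n * norm x" if "x \<in> range P" for n x
    proof -
      have "P x = x" using that PP by auto
      then have "norm ((cblinfun_apply A ^^ n) x) = norm (hol_calc (\<lambda>w. (p w * e w) ^ n) T x)" by (simp add: pow)
      also have "\<dots> \<le> C * d ^ n * norm x"
        by (rule order_trans[OF norm_cblinfun_apply mult_right_mono[OF C]]) simp
      finally show ?thesis .
    qed
    then show "\<exists>C. \<forall>n. \<forall>x\<in>range P. norm ((cblinfun_apply A ^^ n) x) \<le> C * d ^ n * norm x" by blast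
  qed
  then show ?thesis by (simp add: P_def e_def[abs_def])
qed

text \<open>The spectral mapping theorem one value \<mu> at a time, in terms of the complements. The
  fibre of \<open>f\<close> is taken within the spectrum, since elsewhere \<open>T - l\<close> is
  invertible.\<close>

lemma hol_calc_Weyl_iff:
  fixes T :: "'a::complex_banach \<Rightarrow>\<^sub>C\<^sub>L 'a"
  assumes SVEP: "SVEP T \<or> SVEP (cadjoint T)"
    and U: "open U" "cspectrum T \<subseteq> U" and f: "f holomorphic_on U"
  shows "hol_calc f T - \<mu> *\<^sub>C id_cblinfun \<in> upper_semi_Weyl \<longleftrightarrow>
    (\<forall>l\<in>cspectrum T. f l = \<mu> \<longrightarrow> T - l *\<^sub>C id_cblinfun \<in> upper_semi_Weyl)"
proof -
  let ?K = "cspectrum T" and ?T = "\<lambda>l. T - l *\<^sub>C id_cblinfun"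
  let ?H = "hol_calc f T - \<mu> *\<^sub>C id_cblinfun"
  obtain Z where Z: "open Z" "Z \<subseteq> U" "open (U - Z)" and Z\<mu>: "\<And>z. z \<in> Z \<Longrightarrow> f z = \<mu>"
    and nZ: "\<And>z. z \<in> U - Z \<Longrightarrow> \<not> (\<forall>\<^sub>F w in at z. f w = \<mu>)"
    using locally_constant_part[OF U(1) f, of \<mu>] by blast
  have glue: "(\<lambda>w. if w \<in> Z then a else g w) holomorphic_on U" if "g holomorphic_on U" for a and g :: "complex \<Rightarrow> complex"
  proof -
    have "(\<lambda>w. if w \<in> Z then a else g w) holomorphic_on Z \<union> (U - Z)"
      using Z that by (intro holomorphic_on_If_Un) (auto intro: holomorphic_on_subset)
    moreover have "Z \<union> (U - Z) = U" using Z(2) by blast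
    ultimately show ?thesis by simp
  qed
  define e where "e w = (if w \<in> Z then 1 else 0 :: complex)" for w
  define e' where "e' w = (if w \<in> Z then 0 else 1 :: complex)" for w
  \<comment> \<open>Replacing \<open>f - \<mu>\<close> by 1 on \<open>Z\<close> leaves only isolated
    zeros; the zeros lost on \<open>Z\<close> are restored by the factor \<open>e'\<close>, that is,
    by \<open>E = 1 - P\<close>.\<close>
  define g where "g w = (if w \<in> Z then 1 else f w - \<mu>)" for w
  have eU: "e holomorphic_on U" and e'U: "e' holomorphic_on U" and gU: "g holomorphic_on U"
    unfolding e_def[abs_def] e'_def[abs_def] g_def[abs_def] by (intro glue holomorphic_intros f)+
  define P where "P = hol_calc e T"
  define E where "E = id_cblinfun - P"
  have E: "hol_calc e' T = E"
  proof -
    have "(\<lambda>w. e w + e' w) = (\<lambda>_. 1)" by (auto simp: e_def e'_def)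
    then have "P + hol_calc e' T = id_cblinfun"
      using hol_calc_add[OF U eU e'U] hol_calc_const[of 1 T] by (simp add: P_def)
    then show ?thesis by (simp add: E_def algebra_simps)
  qed
  have PP: "P o\<^sub>C\<^sub>L P = P"
  proof -
    have "(\<lambda>w. e w * e w) = e" by (auto simp: e_def)
    then show ?thesis using hol_calc_mult[OF U eU eU] by (simp add: P_def)
  qed
  have H: "?H = hol_calc g T o\<^sub>C\<^sub>L E"
  proof -
    have "?H = hol_calc (\<lambda>w. f w + (- \<mu>)) T"
      using hol_calc_add[OF U f, of "\<lambda>_. - \<mu>"] by (simp add: hol_calc_const complex_vector.scale_minus_left)
    also have "\<dots> = hol_calc (\<lambda>w. g w * e' w) T"
      by (rule hol_calc_cong[OF U]) (auto intro!: holomorphic_intros f simp: g_def e'_def Z\<mu>)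
    also have "\<dots> = hol_calc g T o\<^sub>C\<^sub>L E" using hol_calc_mult[OF U gU e'U] by (simp add: E)
    finally show ?thesis .
  qed
  have zeros: "{z\<in>?K. g z = 0} = {l\<in>?K. f l = \<mu> \<and> l \<notin> Z}" by (auto simp: g_def)
  have g_nz: "\<not> (\<forall>\<^sub>F w in at z. g w = 0)" if z: "z \<in> ?K" "g z = 0" for z
  proof
    assume "\<forall>\<^sub>F w in at z. g w = 0"
    moreover have zUZ: "z \<in> U - Z" using z U(2) by (auto simp: g_def split: if_splits)
    then have "\<forall>\<^sub>F w in at z. w \<in> U - Z" using eventually_at_in_open'[OF Z(3)] by blast
    ultimately have "\<forall>\<^sub>F w in at z. f w = \<mu>" by eventually_elim (auto simp: g_def)
    then show False using nZ[OF zUZ] by blast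
  qed
  obtain ls h where ls: "set ls = {l\<in>?K. f l = \<mu> \<and> l \<notin> Z}" and h: "h holomorphic_on U"
    and hinv: "\<exists>S. is_inverse_of S (hol_calc h T)" and gls: "hol_calc g T = shifted_product T ls (hol_calc h T)"
    using hol_calc_factorization[OF U gU finite_zeros_compact[OF U compact_cspectrum gU g_nz] g_nz] zeros by metis
  \<comment> \<open>An invertible operator times \<open>1 - P\<close>: semi-Fredholm of index 0 as
    soon as \<open>P\<close> has finite rank.\<close>
  define W where "W = hol_calc h T o\<^sub>C\<^sub>L E"
  have HW: "?H = shifted_product T ls W" by (simp add: H gls W_def shifted_product_compose)
  have W_comm: "W o\<^sub>C\<^sub>L ?T l = ?T l o\<^sub>C\<^sub>L W" for l
  proof -
    have "W = hol_calc (\<lambda>w. h w * e' w) T" using hol_calc_mult[OF U h e'U] by (simp add: W_def E)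
    then show ?thesis
      using hol_calc_commute_shift[OF U, of "\<lambda>w. h w * e' w" l] by (simp add: holomorphic_on_mult h e'U)
  qed
  have W_Weyl: "W \<in> upper_semi_Fredholm" "nullity W = defect W" and E_Weyl: "E \<in> upper_semi_Fredholm" "nullity E = defect E"
    if fin: "cfinite_dim (range P)"
  proof -
    obtain S where S: "is_inverse_of S (hol_calc h T)" using hinv by blast
    show E: "E \<in> upper_semi_Fredholm" "nullity E = defect E"
      unfolding E_def by (rule projection_Weyl[OF PP fin])+
    show "W \<in> upper_semi_Fredholm" unfolding W_def by (intro upper_semi_Fredholm_compose invertible_Weyl[OF S] E)
    show "nullity W = defect W"
      unfolding W_def using invertible_Weyl[OF S] E
      by (intro antisym index_le_compose index_ge_compose) auto
  qed
  show ?thesis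
  proof (intro iffI ballI impI)
    assume "\<forall>l\<in>?K. f l = \<mu> \<longrightarrow> ?T l \<in> upper_semi_Weyl"
    then have all: "\<And>l. l \<in> ?K \<Longrightarrow> f l = \<mu> \<Longrightarrow> ?T l \<in> upper_semi_Weyl" by blast
    have "cfinite_dim (range P)"
      unfolding P_def e_def[abs_def]
      by (rule finite_dim_spectral_projection[OF U Z]) (use all Z\<mu> in \<open>auto simp: upper_semi_Weyl_iff\<close>)
    then have "W \<in> upper_semi_Weyl" using W_Weyl by (simp add: upper_semi_Weyl_iff)
    then show "?H \<in> upper_semi_Weyl"
      unfolding HW using all ls by (intro shifted_product_Weyl) auto
  next
    assume Weyl: "?H \<in> upper_semi_Weyl"
    then have HF: "?H \<in> upper_semi_Fredholm" and Hle: "nullity ?H \<le> defect ?H" by (auto simp: upper_semi_Weyl_iff)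
    \<comment> \<open>In this direction the finite rank of \<open>P\<close> comes directly from the
      null space of \<open>f(T) - \<mu>\<close>, which contains the range of
      \<open>P\<close>.\<close>
    have "range P \<subseteq> null_space ?H"
    proof
      fix x assume "x \<in> range P"
      then have "P x = x" using PP by (metis cblinfun_compose_apply rangeE)
      then have "E x = 0" by (simp add: E_def)
      then show "x \<in> null_space ?H" unfolding H null_space_def by simp
    qed
    moreover have "cfinite_dim (null_space ?H)"
      using HF nullity_finite_iff by (auto simp: upper_semi_Fredholm_def)
    ultimately have fin: "cfinite_dim (range P)" unfolding cfinite_dim_def by blast
    fix l assume l: "l \<in> ?K" "f l = \<mu>"
    show "?T l \<in> upper_semi_Weyl"
    proof (cases "l \<in> Z")
      case True
      \<comment> \<open>\<open>w - l\<close> has no zero off \<open>Z\<close>, and on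
        \<open>Z\<close> it may be changed to 1 without affecting its product with
        \<open>e'\<close>; so \<open>(T - l) E\<close> equals an invertible operator times
        \<open>E\<close>.\<close>
      define k where "k w = (if w \<in> Z then 1 else w - l)" for w
      have kU: "k holomorphic_on U" unfolding k_def[abs_def] by (intro glue holomorphic_intros)
      obtain S where S: "is_inverse_of S (hol_calc k T)"
      proof -
        have "k z \<noteq> 0" for z using True by (auto simp: k_def)
        then show thesis using hol_calc_invertible[OF U kU] that by blast
      qed
      have "?T l o\<^sub>C\<^sub>L E = hol_calc (\<lambda>w. (w - l) * e' w) T"
        using hol_calc_mult[OF U _ e'U, of "\<lambda>w. w - l"] by (simp add: hol_calc_linear E holomorphic_on_diff)
      also have "(\<lambda>w. (w - l) * e' w) = (\<lambda>w. k w * e' w)" by (auto simp: k_def e'_def)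
      also have "hol_calc \<dots> T = hol_calc k T o\<^sub>C\<^sub>L E" using hol_calc_mult[OF U kU e'U] by (simp add: E)
      finally have TE: "?T l o\<^sub>C\<^sub>L E = hol_calc k T o\<^sub>C\<^sub>L E" .
      have comm: "E o\<^sub>C\<^sub>L ?T l = ?T l o\<^sub>C\<^sub>L E" using hol_calc_commute_shift[OF U e'U] by (simp add: E)
      have F: "E o\<^sub>C\<^sub>L ?T l \<in> upper_semi_Fredholm"
        unfolding comm TE by (intro upper_semi_Fredholm_compose invertible_Weyl[OF S] E_Weyl fin)
      have idx: "nullity (E o\<^sub>C\<^sub>L ?T l) = defect (E o\<^sub>C\<^sub>L ?T l)"
        unfolding comm TE using invertible_Weyl[OF S] E_Weyl[OF fin]
        by (intro antisym index_le_compose index_ge_compose) auto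
      have "?T l \<in> upper_semi_Fredholm" by (rule upper_semi_Fredholm_right_factor[OF F])
      \<comment> \<open>Additivity of the index: \<open>E\<close> and \<open>E (T - l)\<close> have
        index 0, hence so has \<open>T - l\<close>.\<close>
      moreover have "nullity (?T l) \<le> defect (?T l)"
      proof -
        have "nullity (E o\<^sub>C\<^sub>L ?T l) < \<infinity>" "nullity E < \<infinity>"
          using F E_Weyl(1)[OF fin] by (auto simp: upper_semi_Fredholm_def)
        then show ?thesis
          using index_compose[of E "?T l"] idx E_Weyl(2)[OF fin]
          by (cases "nullity (E o\<^sub>C\<^sub>L ?T l)"; cases "nullity E"; cases "nullity (?T l)"; cases "defect (?T l)") auto
      qed
      ultimately show ?thesis by (simp add: upper_semi_Weyl_iff)
    next
      case False
      have lls: "l \<in> set ls" using l False ls by blast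
      have fac: "?T m \<in> upper_semi_Fredholm" if "m \<in> set ls" for m
        using shifted_product_Fredholm_factor[OF HF[unfolded HW] that W_comm] .
      show ?thesis
        using SVEP
      proof
        assume "SVEP T"
        then show ?thesis
          using fac[OF lls] SVEP_imp_nullity_le_defect by (simp add: upper_semi_Weyl_iff)
      next
        assume S: "SVEP (cadjoint T)"
        \<comment> \<open>All factors have index at least 0 and their product has index at most 0,
          so none of the indices is positive.\<close>
        have "nullity (?T l) \<le> defect (?T l)"
          using fac SVEP_cadjoint_imp_defect_le_nullity[OF S] W_Weyl[OF fin] Hle[unfolded HW] lls
          by (intro shifted_product_index_squeeze[of ls T W l]) auto
        then show ?thesis using fac[OF lls] by (simp add: upper_semi_Weyl_iff)
      qed
    qed
  qed
qed

theorem theorem3p1: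
  fixes T :: "'a::complex_banach \<Rightarrow>\<^sub>C\<^sub>L 'a"
  assumes "\<not> cfinite_dim (UNIV :: 'a set)"
    and "SVEP T \<or> SVEP (cadjoint T)"
  shows "\<forall>f \<in> hol_near (cspectrum T). ea_spectrum (hol_calc f T) = f ` ea_spectrum T"
proof
  fix f assume "f \<in> hol_near (cspectrum T)"
  then obtain U where U: "open U" "cspectrum T \<subseteq> U" and f: "f holomorphic_on U" by (auto simp: hol_near_def)
  have "ea_spectrum T \<subseteq> cspectrum T"
  proof
    fix l assume l: "l \<in> ea_spectrum T"
    show "l \<in> cspectrum T"
    proof (rule ccontr)
      assume "l \<notin> cspectrum T"
      then obtain S where S: "is_inverse_of S (T - l *\<^sub>C id_cblinfun)" by (auto simp: cspectrum_def)
      then show False using l invertible_Weyl[OF S] by (simp add: ea_spectrum_def upper_semi_Weyl_iff)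
    qed
  qed
  \<comment> \<open>The negated equivalence produces a spectral point \<open>l\<close> with
    \<open>f l = \<mu>\<close> and \<open>T - l\<close> outside the class; by the inclusion just
    shown, restricting \<open>l\<close> to the spectrum loses no point of
    \<open>ea_spectrum T\<close>.\<close>
  then show "ea_spectrum (hol_calc f T) = f ` ea_spectrum T"
    using hol_calc_Weyl_iff[OF assms(2) U f] by (auto simp: ea_spectrum_def)
qed

end
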